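(* Let $R$ be a two-story region (see context) and fix a choice of ghost curves for $R$; for each tiling $t$ of $R$ let $P_t(q)\in\mathbb{Z}[q,q^{-1}]$ be the associated polynomial. (i) If $P^{(1)}_t$ and $P^{(2)}_t$ denote the polynomials obtained from two different choices of ghost curves for $R$, then there is an integer $k$ such that $P^{(1)}_t(q)=q^kP^{(2)}_t(q)$ for every tiling $t$ of $R$. (ii) If $t_0$ and $t_1$ are tilings of $R$ lying in the same flip connected component, then $P_{t_0}=P_{t_1}$. (iii) If $R$ is a duplex region and $t_0,t_1$ are tilings of $R$, then $P_{t_0}=P_{t_1}$ if and only if there exists a two-floored box $B$ containing $R$ such that the embeddings of $t_0$ and $t_1$ in $B$ lie in the same flip connected component (of tilings of $B$). (iv) If $R$ is a duplex region, $t_0,t_1$ are tilings of $R$, and $P_{t_0}'(1)=P_{t_1}'(1)$, then there exists a box with four floors $B$ (containing $R$ in its top two floors) such that the embeddings of $t_0$ and $t_1$ in $B$ lie in the same flip connected component.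
   Context: Cubes: for $(x,y,z)\in\mathbb{Z}^3$ the cube $C(x,y,z)=(x,y,z)+[0,1]^3$ is white if $x+y+z$ is even and black otherwise. A region is a finite union of such cubes. A dimer is the union of two cubes sharing a face; it is an $x$-, $y$- or $z$-dimer according to the direction of adjacency. A tiling of a region is a set of dimers with pairwise disjoint interiors whose union is the region. A flip removes two dimers of a tiling whose union is a $2\times2\times1$ box (in any of the three orientations) and replaces them by the other pair of dimers tiling that box. The flip connected component of a tiling is the set of tilings reachable from it by finite sequences of flips. Two-story region: a region $R\subset\mathbb{R}^2\times[0,2]$ whose two floors $R\cap(\mathbb{R}^2\times[0,1])$ (floor 0, the top floor) and $R\cap(\mathbb{R}^2\times[1,2])$ (floor 1) are both nonempty, connected and simply connected. Let $D_0,D_1\subset\mathbb{R}^2$ be the projections of floor 0 and floor 1 (unions of unit squares $[x,x+1]\times[y,y+1]$, $x,y\in\mathbb{Z}$). $R$ is a duplex region if $D_0=D_1$, i.e. $R=D\times[0,2]$. Associated drawing: the unit square $[x,x+1]\times[y,y+1]$ is white if $x+y$ is even, black otherwise. For a tiling $t$ of $R$: each $z$-dimer $C(x,y,0)\cup C(x,y,1)$ gives a jewel at the square $[x,x+1]\times[y,y+1]$ (a square of $D_0\cap D_1$), colored with the color of that square. Each non-$z$ dimer is drawn as the oriented segment from the center of the projection of its white cube to the center of the projection of its black cube. These segments form pairwise disjoint oriented closed curves and paths; each path endpoint lies in a hole (a square of the symmetric difference $D_0\triangle D_1$), each hole is the endpoint of exactly one path, and whether a hole is an initial or terminal endpoint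 depends only on $R$. A choice of ghost curves is a fixed collection of oriented plane curves, each going from the center of a terminal hole to the center of an initial hole, each hole used exactly once, and each disjoint from the closures of all squares of $D_0\cap D_1$ (for duplex regions there are no holes and no ghost curves). Segments and ghost curves together form oriented closed curves. For a jewel $j$, $k_t(j)$ is the sum of the winding numbers (counterclockwise positive) of all these closed curves around the center of $j$, and $P_t(q)=\sum_{j\text{ black jewel}}q^{k_t(j)}-\sum_{j\text{ white jewel}}q^{k_t(j)}$. Two-floored box: $B=[a,a+L]\times[b,b+M]\times[0,2]$ with integer parameters; for a duplex $R=D\times[0,2]\subset B$ and a tiling $t$ of $R$, the embedding of $t$ in $B$ is $t$ together with the $z$-dimers $C(x,y,0)\cup C(x,y,1)$ for all unit squares of $[a,a+L]\times[b,b+M]$ not in $D$. Box with four floors: $B=[a,a+L]\times[b,b+M]\times[0,4]$ with $R\subset[a,a+L]\times[b,b+M]\times[0,2]$ (the top two floors); the embedding of $t$ in $B$ is $t$ together with the $z$-dimers $C(x,y,0)\cup C(x,y,1)$ for the squares of the rectangle not in $D$ and the $z$-dimers $C(x,y,2)\cup C(x,y,3)$ for all squares of the rectangle.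
   Formalization: Part (i) is proved under the added assumption that the union of the closed squares of D_0∩D_1 is connected (possibly empty); without it (i) is false, since ghost curves can wind around one component of D_0∩D_1 and not another. *)

theory Defs
  imports
    "HOL-Complex_Analysis.Complex_Analysis"
    "HOL-Library.Poly_Mapping"
    "HOL-Library.Disjoint_Sets"
begin

section \<open>Cubes, dimers, tilings and flips\<close>

text \<open>
  The triple \<open>(x, y, z)\<close> stands for the unit cube \<open>(x,y,z) + [0,1]^3\<close>, the pair \<open>(x, y)\<close> for the
  unit square \<open>[x,x+1] \<times> [y,y+1]\<close>.  A union of cubes is represented by the set of its cubes:
  a region is a finite set of triples and a dimer is a set of two triples.  Dimers have disjoint
  interiors iff they share no cube.
\<close>

type_synonym cube = "int \<times> int \<times> int"
type_synonym square = "int \<times> int"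

definition white_cube :: "cube \<Rightarrow> bool" where
  "white_cube = (\<lambda>(x, y, z). even (x + y + z))"

definition white_square :: "square \<Rightarrow> bool" where
  "white_square = (\<lambda>(x, y). even (x + y))"

definition x_dimer :: "cube set \<Rightarrow> bool" where
  "x_dimer d \<longleftrightarrow> (\<exists>x y z. d = {(x, y, z), (x + 1, y, z)})"

definition y_dimer :: "cube set \<Rightarrow> bool" where
  "y_dimer d \<longleftrightarrow> (\<exists>x y z. d = {(x, y, z), (x, y + 1, z)})"

definition z_dimer :: "cube set \<Rightarrow> bool" where
  "z_dimer d \<longleftrightarrow> (\<exists>x y z. d = {(x, y, z), (x, y, z + 1)})"

definition dimer :: "cube set \<Rightarrow> bool" where
  "dimer d \<longleftrightarrow> x_dimer d \<or> y_dimer d \<or> z_dimer d"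

definition tiling :: "cube set \<Rightarrow> cube set set \<Rightarrow> bool" where
  "tiling R t \<longleftrightarrow> (\<forall>d\<in>t. dimer d) \<and> partition_on R t"

text \<open>A \<open>2 \<times> 2 \<times> 1\<close> box in any of the three orientations.\<close>

definition slab :: "cube set \<Rightarrow> bool" where
  "slab Q \<longleftrightarrow> (\<exists>x y z. Q = {x, x + 1} \<times> {y, y + 1} \<times> {z} \<or>
                      Q = {x, x + 1} \<times> {y} \<times> {z, z + 1} \<or>
                      Q = {x} \<times> {y, y + 1} \<times> {z, z + 1})"

definition flip :: "cube set set \<Rightarrow> cube set set \<Rightarrow> bool" where
  "flip t t' \<longleftrightarrow> (\<exists>Q d1 d2 e1 e2.
     slab Q \<and> d1 \<in> t \<and> d2 \<in> t \<and> d1 \<union> d2 = Q \<and>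
     dimer e1 \<and> dimer e2 \<and> e1 \<union> e2 = Q \<and> {e1, e2} \<noteq> {d1, d2} \<and>
     t' = (t - {d1, d2}) \<union> {e1, e2})"

definition flip_component :: "cube set set \<Rightarrow> cube set set set" where
  "flip_component t = {t'. flip\<^sup>*\<^sup>* t t'}"


section \<open>Two-story regions\<close>

definition solid_cube :: "cube \<Rightarrow> (real \<times> real \<times> real) set" where
  "solid_cube = (\<lambda>(x, y, z). {of_int x .. of_int x + 1} \<times> {of_int y .. of_int y + 1}
                               \<times> {of_int z .. of_int z + 1})"

definition solid :: "cube set \<Rightarrow> (real \<times> real \<times> real) set" where
  "solid R = (\<Union>c\<in>R. solid_cube c)"

definition floor_of :: "cube set \<Rightarrow> int \<Rightarrow> cube set" where
  "floor_of R k = {(x, y, z) \<in> R. z = k}"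

definition shadow :: "cube set \<Rightarrow> int \<Rightarrow> square set" where
  "shadow R k = {(x, y). (x, y, k) \<in> R}"

definition two_story :: "cube set \<Rightarrow> bool" where
  "two_story R \<longleftrightarrow> finite R \<and> R = floor_of R 0 \<union> floor_of R 1 \<and>
     (\<forall>k\<in>{0, 1}. floor_of R k \<noteq> {} \<and> connected (solid (floor_of R k)) \<and>
                  simply_connected (solid (floor_of R k)))"

definition duplex :: "cube set \<Rightarrow> bool" where
  "duplex R \<longleftrightarrow> two_story R \<and> shadow R 0 = shadow R 1"

definition common :: "cube set \<Rightarrow> square set" where
  "common R = shadow R 0 \<inter> shadow R 1"

definition holes :: "cube set \<Rightarrow> square set" where
  "holes R = (shadow R 0 - shadow R 1) \<union> (shadow R 1 - shadow R 0)"

text \<open>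
  Segments run from white to black cubes, and the only cube over a hole is never covered by a
  \<open>z\<close>-dimer.  So in every tiling a path starts at the hole if that cube is white and ends there
  if it is black.
\<close>

definition initial_holes :: "cube set \<Rightarrow> square set" where
  "initial_holes R = {(x, y) \<in> holes R. \<exists>z. (x, y, z) \<in> R \<and> white_cube (x, y, z)}"

definition terminal_holes :: "cube set \<Rightarrow> square set" where
  "terminal_holes R = {(x, y) \<in> holes R. \<exists>z. (x, y, z) \<in> R \<and> \<not> white_cube (x, y, z)}"


section \<open>The associated drawing\<close>

definition plane_square :: "square \<Rightarrow> complex set" where
  "plane_square = (\<lambda>(x, y). cbox (Complex (of_int x) (of_int y))
                                 (Complex (of_int x + 1) (of_int y + 1)))"

definition center :: "square \<Rightarrow> complex" where
  "center = (\<lambda>(x, y). Complex (of_int x + 1/2) (of_int y + 1/2))"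

definition cube_center :: "cube \<Rightarrow> complex" where
  "cube_center = (\<lambda>(x, y, z). center (x, y))"

definition jewels :: "cube set set \<Rightarrow> square set" where
  "jewels t = {(x, y). {(x, y, 0), (x, y, 1)} \<in> t}"

definition segments :: "cube set set \<Rightarrow> (real \<Rightarrow> complex) set" where
  "segments t = {linepath (cube_center w) (cube_center b) | w b.
                   {w, b} \<in> t \<and> \<not> z_dimer {w, b} \<and> white_cube w \<and> \<not> white_cube b}"

definition ghost_curves :: "cube set \<Rightarrow> (real \<Rightarrow> complex) set \<Rightarrow> bool" where
  "ghost_curves R G \<longleftrightarrow>
     (\<forall>g\<in>G. path g \<and> (\<forall>s \<in> common R. path_image g \<inter> plane_square s = {})) \<and>
     bij_betw pathstart G (center ` terminal_holes R) \<and>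
     bij_betw pathfinish G (center ` initial_holes R)"

text \<open>
  \<open>closed_curves A cs\<close>: the curves in \<open>A\<close> are arranged, each used exactly once, into closed curves,
  each given as the list of its consecutive pieces.
\<close>

definition closed_chain :: "(real \<Rightarrow> complex) list \<Rightarrow> bool" where
  "closed_chain ps \<longleftrightarrow> ps \<noteq> [] \<and>
     (\<forall>i. Suc i < length ps \<longrightarrow> pathfinish (ps ! i) = pathstart (ps ! Suc i)) \<and>
     pathfinish (last ps) = pathstart (hd ps)"

definition closed_curves :: "(real \<Rightarrow> complex) set \<Rightarrow> (real \<Rightarrow> complex) list list \<Rightarrow> bool" where
  "closed_curves A cs \<longleftrightarrow>
     (\<forall>c \<in> set cs. closed_chain c) \<and> distinct (concat cs) \<and> set (concat cs) = A"

fun join_curves :: "(real \<Rightarrow> complex) list \<Rightarrow> real \<Rightarrow> complex" where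
  "join_curves [] = (\<lambda>_. 0)"
| "join_curves [p] = p"
| "join_curves (p # q # ps) = p +++ join_curves (q # ps)"

text \<open>
  No two pieces of a drawing with ghost curves start at the same point, so the arrangement is unique
  up to the order of the closed curves and the piece at which each of them begins.  The choice made
  by \<open>SOME\<close> does not affect the sum of the winding numbers.
\<close>

definition winding :: "(real \<Rightarrow> complex) set \<Rightarrow> cube set set \<Rightarrow> square \<Rightarrow> int" where
  "winding G t j =
     (THE k. of_int k = (\<Sum>c \<leftarrow> (SOME cs. closed_curves (segments t \<union> G) cs).
                            winding_number (join_curves c) (center j)))"


section \<open>Laurent polynomials and the invariant\<close>

text \<open>
  \<open>int \<Rightarrow>\<^sub>0 int\<close>, with its convolution product, is the ring of Laurent polynomials in \<open>q\<close> with
  integer coefficients; \<open>q_pow k\<close> is the monomial \<open>q^k\<close>.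
\<close>

type_synonym laurent = "int \<Rightarrow>\<^sub>0 int"

definition q_pow :: "int \<Rightarrow> laurent" where
  "q_pow k = Poly_Mapping.single k 1"

definition laurent_deriv :: "laurent \<Rightarrow> laurent" where
  "laurent_deriv p =
     (\<Sum>k \<in> Poly_Mapping.keys p. Poly_Mapping.single (k - 1) (k * Poly_Mapping.lookup p k))"

definition laurent_eval :: "laurent \<Rightarrow> real \<Rightarrow> real" where
  "laurent_eval p q = (\<Sum>k \<in> Poly_Mapping.keys p. of_int (Poly_Mapping.lookup p k) * q powi k)"

definition P :: "(real \<Rightarrow> complex) set \<Rightarrow> cube set set \<Rightarrow> laurent" where
  "P G t = (\<Sum>j \<in> {j \<in> jewels t. \<not> white_square j}. q_pow (winding G t j))
         - (\<Sum>j \<in> {j \<in> jewels t. white_square j}. q_pow (winding G t j))"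


section \<open>Boxes and embeddings\<close>

definition rectangle :: "int \<Rightarrow> int \<Rightarrow> int \<Rightarrow> int \<Rightarrow> square set" where
  "rectangle a b L M = {a ..< a + L} \<times> {b ..< b + M}"

definition box_cubes :: "int \<Rightarrow> int \<Rightarrow> int \<Rightarrow> int \<Rightarrow> int \<Rightarrow> cube set" where
  "box_cubes a b L M h = {a ..< a + L} \<times> {b ..< b + M} \<times> {0 ..< h}"

definition embed2 :: "cube set \<Rightarrow> int \<Rightarrow> int \<Rightarrow> int \<Rightarrow> int \<Rightarrow> cube set set \<Rightarrow> cube set set" where
  "embed2 R a b L M t =
     t \<union> {{(x, y, 0), (x, y, 1)} | x y. (x, y) \<in> rectangle a b L M - shadow R 0}"

definition embed4 :: "cube set \<Rightarrow> int \<Rightarrow> int \<Rightarrow> int \<Rightarrow> int \<Rightarrow> cube set set \<Rightarrow> cube set set" where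
  "embed4 R a b L M t =
     embed2 R a b L M t \<union> {{(x, y, 2), (x, y, 3)} | x y. (x, y) \<in> rectangle a b L M}"

end

theory Submission
  imports Defs "HOL-Combinatorics.Transposition" "HOL-Library.Multiset"
begin

text \<open>
  In a region with two floors every square carries at most one white and one black cube, so a tiling
  is a bijection \<open>\<sigma>\<close> from the squares with a white cube to those with a black cube that moves every
  square by at most one step; jewels are the fixed points and a flip composes \<open>\<sigma>\<close> with a
  transposition.  The winding number of the drawing is the sum of the winding numbers of its pieces.
  A flip of two dimers of one floor changes the drawing by a unit square, and a flip of two
  \<open>z\<close>-dimers by a segment run through in both directions while it removes two jewels of opposite colours and
  equal winding number; this gives (ii), and (i) follows by comparing the two families of ghost curves.

  For a duplex region \<open>\<sigma>\<close> is, up to cycles of length two, the flow along the level curves of a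
  height function on the faces of the square lattice, and the winding number at a jewel is the height there.
  Heights modulo the moves that a flip induces form an abelian group under stacking side by side.  It is
  generated by the pyramids, and the signed numbers of jewels at the nonzero levels, that is, the coefficients of
  \<open>P\<close>, distinguish their combinations.  This gives (iii).

  With two more floors a part of the tiling that is disjoint from the rest can be moved up, deformed there and moved
  down again.  Taking the peak off a pyramid in this way makes the class of the pyramid of height \<open>k\<close> equal to \<open>k\<close> times
  the class of the pyramid of height one, so that only the sum of the heights of the jewels, \<open>P'(1)\<close>, is left.
\<close>

subsection \<open>Height functions\<close>

text \<open>Counting signs by colour makes parity decisive: the moves can insert or delete rows and
  columns only two at a time, and a translation by one step negates a class. Hence the even shifts
  in the definition of the sum. The inverse of a class is its mirror image, because a function
  stacked on its mirror image is symmetric and can be folded away like a walk that turns back on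
  itself. The hardest point is to split off one pyramid. Cutting the corners of a nest in
  \<open>w\<close> gives \<open>w'\<close>, and \<open>w\<close> is folded against the mirror image
  of \<open>w'\<close>. Without the cut the two halves would annihilate; the cut shortens, at each
  level, a run of even length by one, and what cannot be folded away is exactly a pyramid. Level 0
  is left out of all counts, since infinitely many vertices lie on it. For a duplex region this does
  no harm: by simple connectedness the height vanishes at every square outside it, so that embedding
  adds jewels of level 0 only. All moves take place in the infinite plane; the box is chosen at the
  end, around the finitely many squares used.\<close>

text \<open>
  The vertices of the lattice are the squares of the drawing.  The face \<open>(x, y)\<close> has the vertices
  \<open>(x, y)\<close>, \<open>(x + 1, y)\<close>, \<open>(x + 1, y + 1)\<close> and \<open>(x, y + 1)\<close>, and \<open>vertex_ok\<close> takes the heights of the four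
  faces around a vertex in cyclic order.  Its last condition excludes two level curves that meet at the vertex.
\<close>

definition vertex_ok :: "int \<Rightarrow> int \<Rightarrow> int \<Rightarrow> int \<Rightarrow> bool" where
  "vertex_ok a b c d \<longleftrightarrow> \<bar>a - b\<bar> \<le> 1 \<and> \<bar>b - c\<bar> \<le> 1 \<and> \<bar>c - d\<bar> \<le> 1 \<and> \<bar>d - a\<bar> \<le> 1 \<and>
     \<bar>a - c\<bar> \<le> 1 \<and> \<bar>b - d\<bar> \<le> 1 \<and> \<not> (a = c \<and> b = d \<and> a \<noteq> b)"

definition valid :: "(int \<times> int \<Rightarrow> int) \<Rightarrow> bool" where
  "valid w \<longleftrightarrow> (\<forall>x y. vertex_ok (w (x, y)) (w (x - 1, y)) (w (x - 1, y - 1)) (w (x, y - 1)))"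

definition height_fun :: "(int \<times> int \<Rightarrow> int) \<Rightarrow> bool" where
  "height_fun w \<longleftrightarrow> finite {f. w f \<noteq> 0} \<and> valid w"

text \<open>The trace of a flip on the heights. If two opposite neighbours of a face agree, then,
  once two-cycles have been inserted where necessary, the arrows run along two opposite sides of the
  face, and a flip moves the face to the height of these neighbours; see \<open>liftable_up\<close>.
  That the result is valid again is \<open>valid_set\<close>.\<close>

definition height_step :: "(int \<times> int \<Rightarrow> int) \<Rightarrow> (int \<times> int \<Rightarrow> int) \<Rightarrow> bool" where
  "height_step w w' \<longleftrightarrow> height_fun w \<and> (\<exists>x y a. w' = w((x, y) := a) \<and>
     (w (x - 1, y) = a \<and> w (x + 1, y) = a \<or> w (x, y - 1) = a \<and> w (x, y + 1) = a))"

text \<open>The closure alone relates every function to itself, valid or not. With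
  \<open>height_fun\<close> on both sides the relation is a partial equivalence, reflexive exactly
  on the height functions, and the quotient type is formed from it.\<close>

definition height_eq :: "(int \<times> int \<Rightarrow> int) \<Rightarrow> (int \<times> int \<Rightarrow> int) \<Rightarrow> bool" (infix "\<simeq>" 50) where
  "w \<simeq> w' \<longleftrightarrow> height_fun w \<and> height_fun w' \<and> equivclp height_step w w'"

lemma validD: "valid w \<Longrightarrow> vertex_ok (w (x, y)) (w (x - 1, y)) (w (x - 1, y - 1)) (w (x, y - 1))"
  by (simp add: valid_def)

lemma vertex_ok_zero [simp]: "vertex_ok a a a a"
  by (simp add: vertex_ok_def)

lemma vertex_ok_rotate: "vertex_ok a b c d \<longleftrightarrow> vertex_ok b c d a"
  by (auto simp: vertex_ok_def abs_minus_commute)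

lemma vertex_ok_reflect: "vertex_ok a b c d \<longleftrightarrow> vertex_ok b a d c"
  by (auto simp: vertex_ok_def abs_minus_commute)

lemma vertex_ok_reverse: "vertex_ok a b c d \<longleftrightarrow> vertex_ok d c b a"
  by (auto simp: vertex_ok_def abs_minus_commute)

lemma vertex_ok_transpose: "vertex_ok a b c d \<longleftrightarrow> vertex_ok a d c b"
  by (auto simp: vertex_ok_def abs_minus_commute)

text \<open>Copying the height of a cyclic neighbour is harmless: the differences to the other faces
  were bounded for that neighbour already, and the forbidden pattern has no two equal consecutive
  heights.\<close>

lemma vertex_ok_set: "vertex_ok f b c d \<Longrightarrow> b = a \<or> d = a \<Longrightarrow> vertex_ok a b c d"
  by (elim disjE) (simp_all add: vertex_ok_def abs_minus_commute)

text \<open>Each of the four vertices of the face also lies on one of the two opposite neighbours,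
  so that \<open>vertex_ok_set\<close> applies at every one of them.\<close>

lemma valid_set:
  assumes w: "valid w"
    and a: "w (x - 1, y) = a \<and> w (x + 1, y) = a \<or> w (x, y - 1) = a \<and> w (x, y + 1) = a"
  shows "valid (w((x, y) := a))"
  unfolding valid_def
proof (intro allI)
  fix p q :: int
  let ?v = "w((x, y) := a)"
  have 1: "vertex_ok (w (x, y)) (w (x - 1, y)) (w (x - 1, y - 1)) (w (x, y - 1))"
    and 2: "vertex_ok (w (x + 1, y)) (w (x, y)) (w (x, y - 1)) (w (x + 1, y - 1))"
    and 3: "vertex_ok (w (x, y + 1)) (w (x - 1, y + 1)) (w (x - 1, y)) (w (x, y))"
    and 4: "vertex_ok (w (x + 1, y + 1)) (w (x, y + 1)) (w (x, y)) (w (x + 1, y))"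
    using validD[OF w, of x y] validD[OF w, of "x+1" y] validD[OF w, of x "y+1"] validD[OF w, of "x+1" "y+1"]
    by simp_all
  have n: "vertex_ok a (w (x - 1, y)) (w (x - 1, y - 1)) (w (x, y - 1))"
    "vertex_ok (w (x + 1, y)) a (w (x, y - 1)) (w (x + 1, y - 1))"
    "vertex_ok (w (x, y + 1)) (w (x - 1, y + 1)) (w (x - 1, y)) a"
    "vertex_ok (w (x + 1, y + 1)) (w (x, y + 1)) a (w (x + 1, y))"
  proof -
    show "vertex_ok a (w (x - 1, y)) (w (x - 1, y - 1)) (w (x, y - 1))"
      using vertex_ok_set[OF 1] a by blast
    show "vertex_ok (w (x + 1, y)) a (w (x, y - 1)) (w (x + 1, y - 1))"
      using vertex_ok_set[OF 2[unfolded vertex_ok_rotate[of "w (x + 1, y)"]]] a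
      unfolding vertex_ok_rotate[of "w (x + 1, y)"] by blast
    show "vertex_ok (w (x, y + 1)) (w (x - 1, y + 1)) (w (x - 1, y)) a"
      using vertex_ok_set[of "w (x, y)" "w (x, y + 1)"] 3 a vertex_ok_rotate by blast
    show "vertex_ok (w (x + 1, y + 1)) (w (x, y + 1)) a (w (x + 1, y))"
      using vertex_ok_set[of "w (x, y)" "w (x + 1, y)" "w (x + 1, y + 1)" "w (x, y + 1)"] 4 a
        vertex_ok_rotate by blast
  qed
  consider "p = x \<and> q = y" | "p = x + 1 \<and> q = y" | "p = x \<and> q = y + 1" | "p = x + 1 \<and> q = y + 1"
    | "\<not> ((p = x \<or> p = x + 1) \<and> (q = y \<or> q = y + 1))" by blast
  then show "vertex_ok (?v (p, q)) (?v (p - 1, q)) (?v (p - 1, q - 1)) (?v (p, q - 1))"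
    using n validD[OF w, of p q] by cases auto
qed

lemma height_fun_set:
  assumes "height_fun w"
    and "w (x - 1, y) = a \<and> w (x + 1, y) = a \<or> w (x, y - 1) = a \<and> w (x, y + 1) = a"
  shows "height_fun (w((x, y) := a))"
proof -
  have "{f. (w((x, y) := a)) f \<noteq> 0} \<subseteq> insert (x, y) {f. w f \<noteq> 0}" by auto
  then show ?thesis
    using assms valid_set unfolding height_fun_def by (metis finite_insert finite_subset)
qed

lemma height_step_fun: "height_step w w' \<Longrightarrow> height_fun w \<and> height_fun w'"
  using height_fun_set by (auto simp: height_step_def)

lemma height_eq_refl: "height_fun w \<Longrightarrow> w \<simeq> w"
  by (simp add: height_eq_def equivclp_def)

lemma height_eq_sym: "w \<simeq> w' \<Longrightarrow> w' \<simeq> w"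
  by (simp add: height_eq_def equivclp_sym)

lemma height_eq_trans: "w \<simeq> w' \<Longrightarrow> w' \<simeq> w'' \<Longrightarrow> w \<simeq> w''"
  by (meson height_eq_def equivclp_trans)

lemma height_eq_step: "height_step w w' \<Longrightarrow> w \<simeq> w'"
  by (simp add: height_eq_def height_step_fun r_into_equivclp)

lemma height_eq_induct [consumes 1, case_names refl step sym trans]:
  assumes eq: "w \<simeq> w'"
    and refl: "\<And>w. height_fun w \<Longrightarrow> Q w w"
    and step: "\<And>w w'. height_step w w' \<Longrightarrow> Q w w'"
    and sym: "\<And>w w'. height_fun w \<Longrightarrow> height_fun w' \<Longrightarrow> Q w w' \<Longrightarrow> Q w' w"
    and trans: "\<And>w w' w''. height_fun w \<Longrightarrow> height_fun w' \<Longrightarrow> height_fun w'' \<Longrightarrow> Q w w' \<Longrightarrow> Q w' w'' \<Longrightarrow> Q w w''"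
  shows "Q w w'"
proof -
  have e: "equivclp height_step w w'" and w: "height_fun w" using eq by (auto simp: height_eq_def)
  from e have "height_fun w' \<and> Q w w'"
  proof (induction rule: equivclp_induct)
    case base then show ?case using w refl by simp
  next
    case (step y z)
    then have "height_fun z" using height_step_fun by blast
    moreover have "Q y z" using step(2) assms(3) sym height_step_fun by blast
    ultimately show ?case using step trans w by blast
  qed
  then show ?thesis by simp
qed

text \<open>The cells where \<open>v\<close> and \<open>u\<close> differ can be changed one after the other,
  since they never serve as the pair of opposite neighbours of another such cell.\<close>

lemma height_eq_simultaneous:
  assumes v: "height_fun v" and fin: "finite {f. u f \<noteq> v f}"
    and nb: "\<And>x y. u (x, y) \<noteq> v (x, y) \<Longrightarrow>
       v (x - 1, y) = u (x, y) \<and> v (x + 1, y) = u (x, y) \<and>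
       u (x - 1, y) = u (x, y) \<and> u (x + 1, y) = u (x, y) \<or>
       v (x, y - 1) = u (x, y) \<and> v (x, y + 1) = u (x, y) \<and>
       u (x, y - 1) = u (x, y) \<and> u (x, y + 1) = u (x, y)"
  shows "height_fun u \<and> v \<simeq> u"
  using assms
proof (induction "card {f. u f \<noteq> v f}" arbitrary: v)
  case 0
  then have "u = v" by auto
  then show ?case using 0 height_eq_refl by simp
next
  case (Suc n)
  then obtain x y where xy: "u (x, y) \<noteq> v (x, y)"
    by (metis (mono_tags, lifting) card.empty empty_Collect_eq nat.distinct(1) surj_pair)
  let ?v = "v((x, y) := u (x, y))"
  have s: "height_step v ?v"
    using Suc.prems(1) Suc.prems(3)[OF xy] unfolding height_step_def by blast
  have set: "{f. u f \<noteq> ?v f} = {f. u f \<noteq> v f} - {(x, y)}" by auto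
  have "n = card {f. u f \<noteq> ?v f}"
    unfolding set using Suc.hyps(2) Suc.prems(2) xy by simp
  moreover have "finite {f. u f \<noteq> ?v f}" unfolding set using Suc.prems(2) by simp
  moreover have "?v (p - 1, q) = u (p, q) \<and> ?v (p + 1, q) = u (p, q) \<and>
       u (p - 1, q) = u (p, q) \<and> u (p + 1, q) = u (p, q) \<or>
       ?v (p, q - 1) = u (p, q) \<and> ?v (p, q + 1) = u (p, q) \<and>
       u (p, q - 1) = u (p, q) \<and> u (p, q + 1) = u (p, q)" if "u (p, q) \<noteq> ?v (p, q)" for p q
    using Suc.prems(3)[of p q] that by (smt (verit, best) fun_upd_apply)
  ultimately have "height_fun u \<and> ?v \<simeq> u"
    using Suc.hyps(1)[of ?v] s height_step_fun by blast
  then show ?case using s height_eq_step height_eq_trans by blast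
qed

section \<open>Translations, reflections, transposition and sign change of height functions\<close>

definition height_shift :: "int \<Rightarrow> int \<Rightarrow> (int \<times> int \<Rightarrow> int) \<Rightarrow> int \<times> int \<Rightarrow> int" where
  "height_shift a b w = (\<lambda>(x, y). w (x - a, y - b))"

definition height_mirror :: "int \<Rightarrow> (int \<times> int \<Rightarrow> int) \<Rightarrow> int \<times> int \<Rightarrow> int" where
  "height_mirror c w = (\<lambda>(x, y). w (x, c - y))"

definition height_swap :: "(int \<times> int \<Rightarrow> int) \<Rightarrow> int \<times> int \<Rightarrow> int" where
  "height_swap w = (\<lambda>(x, y). w (y, x))"

lemma height_shift_apply [simp]: "height_shift a b w (x, y) = w (x - a, y - b)"
  by (simp add: height_shift_def)

lemma height_mirror_apply [simp]: "height_mirror c w (x, y) = w (x, c - y)"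
  by (simp add: height_mirror_def)

lemma height_swap_apply [simp]: "height_swap w (x, y) = w (y, x)"
  by (simp add: height_swap_def)

lemma height_swap_swap [simp]: "height_swap (height_swap w) = w"
  by (auto simp: height_swap_def)

lemma finite_support_reindex:
  assumes "finite {f. w f \<noteq> (0 :: int)}" and "inj g" and "\<And>f. v f = w (g f)"
  shows "finite {f. v f \<noteq> 0}"
proof -
  have "{f. v f \<noteq> 0} = g -` {f. w f \<noteq> 0}" using assms(3) by auto
  then show ?thesis using finite_vimageI[OF assms(1,2)] by simp
qed

lemma height_fun_shift:
  assumes "height_fun w" shows "height_fun (height_shift a b w)"
proof -
  have "finite {f. height_shift a b w f \<noteq> 0}"
    by (rule finite_support_reindex[of w "\<lambda>(x, y). (x - a, y - b)"])
      (use assms in \<open>auto simp: height_fun_def inj_def\<close>)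
  moreover have "valid (height_shift a b w)"
    unfolding valid_def
  proof (intro allI)
    fix x y :: int
    show "vertex_ok (height_shift a b w (x, y)) (height_shift a b w (x - 1, y))
       (height_shift a b w (x - 1, y - 1)) (height_shift a b w (x, y - 1))"
      using validD[of w "x - a" "y - b"] assms by (simp add: height_fun_def algebra_simps)
  qed
  ultimately show ?thesis by (simp add: height_fun_def)
qed

lemma height_fun_mirror:
  assumes "height_fun w" shows "height_fun (height_mirror c w)"
proof -
  have "finite {f. height_mirror c w f \<noteq> 0}"
    by (rule finite_support_reindex[of w "\<lambda>(x, y). (x, c - y)"])
      (use assms in \<open>auto simp: height_fun_def inj_def\<close>)
  moreover have "valid (height_mirror c w)"
    unfolding valid_def
  proof (intro allI)
    fix x y :: int
    have "vertex_ok (w (x, c - y + 1)) (w (x - 1, c - y + 1)) (w (x - 1, c - y)) (w (x, c - y))"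
      using validD[of w x "c - y + 1"] assms by (simp add: height_fun_def)
    then have "vertex_ok (w (x, c - y)) (w (x - 1, c - y)) (w (x - 1, c - y + 1)) (w (x, c - y + 1))"
      using vertex_ok_reverse by blast
    then show "vertex_ok (height_mirror c w (x, y)) (height_mirror c w (x - 1, y))
       (height_mirror c w (x - 1, y - 1)) (height_mirror c w (x, y - 1))"
      by (simp add: algebra_simps)
  qed
  ultimately show ?thesis by (simp add: height_fun_def)
qed

lemma height_fun_swap:
  assumes "height_fun w" shows "height_fun (height_swap w)"
proof -
  have "finite {f. height_swap w f \<noteq> 0}"
    by (rule finite_support_reindex[of w "\<lambda>(x, y). (y, x)"])
      (use assms in \<open>auto simp: height_fun_def inj_def\<close>)
  moreover have "valid (height_swap w)"
    unfolding valid_def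
  proof (intro allI)
    fix x y :: int
    have "vertex_ok (w (y, x)) (w (y - 1, x)) (w (y - 1, x - 1)) (w (y, x - 1))"
      using validD[of w y x] assms by (simp add: height_fun_def)
    then have "vertex_ok (w (y, x)) (w (y, x - 1)) (w (y - 1, x - 1)) (w (y - 1, x))"
      using vertex_ok_transpose by blast
    then show "vertex_ok (height_swap w (x, y)) (height_swap w (x - 1, y))
       (height_swap w (x - 1, y - 1)) (height_swap w (x, y - 1))"
      by simp
  qed
  ultimately show ?thesis by (simp add: height_fun_def)
qed

lemma height_fun_uminus:
  assumes "height_fun w" shows "height_fun (\<lambda>f. - w f)"
  using assms by (simp add: height_fun_def valid_def vertex_ok_def abs_minus_commute)

lemma height_fun_zero [simp]: "height_fun (\<lambda>_. 0)"
  by (simp add: height_fun_def valid_def)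

lemma height_eq_map:
  assumes "w \<simeq> w'"
    and "\<And>w. height_fun w \<Longrightarrow> height_fun (F w)"
    and "\<And>w w'. height_step w w' \<Longrightarrow> height_step (F w) (F w')"
  shows "F w \<simeq> F w'"
  using assms(1)
  by (induction rule: height_eq_induct)
    (use assms height_eq_refl height_eq_step height_eq_sym height_eq_trans in blast)+

lemma height_eq_shift:
  assumes "w \<simeq> w'" shows "height_shift a b w \<simeq> height_shift a b w'"
proof (rule height_eq_map[OF assms])
  fix w w' assume "height_step w w'"
  then obtain x y c where h: "height_fun w" and w': "w' = w((x, y) := c)"
    and n: "w (x - 1, y) = c \<and> w (x + 1, y) = c \<or> w (x, y - 1) = c \<and> w (x, y + 1) = c"
    unfolding height_step_def by blast
  have "height_shift a b w' = (height_shift a b w)((x + a, y + b) := c)"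
    by (auto simp: w' fun_eq_iff)
  then show "height_step (height_shift a b w) (height_shift a b w')"
    unfolding height_step_def using n height_fun_shift[OF h]
    by (intro conjI exI[of _ "x + a"] exI[of _ "y + b"] exI[of _ c]) (auto simp: algebra_simps)
qed (rule height_fun_shift)

lemma height_eq_mirror:
  assumes "w \<simeq> w'" shows "height_mirror d w \<simeq> height_mirror d w'"
proof (rule height_eq_map[OF assms])
  fix w w' assume "height_step w w'"
  then obtain x y c where h: "height_fun w" and w': "w' = w((x, y) := c)"
    and n: "w (x - 1, y) = c \<and> w (x + 1, y) = c \<or> w (x, y - 1) = c \<and> w (x, y + 1) = c"
    unfolding height_step_def by blast
  have "height_mirror d w' = (height_mirror d w)((x, d - y) := c)"
    by (auto simp: w' fun_eq_iff)
  then show "height_step (height_mirror d w) (height_mirror d w')"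
    unfolding height_step_def using n height_fun_mirror[OF h]
    by (intro conjI exI[of _ x] exI[of _ "d - y"] exI[of _ c]) (auto simp: algebra_simps)
qed (rule height_fun_mirror)

lemma height_eq_swap:
  assumes "w \<simeq> w'" shows "height_swap w \<simeq> height_swap w'"
proof (rule height_eq_map[OF assms])
  fix w w' assume "height_step w w'"
  then obtain x y c where h: "height_fun w" and w': "w' = w((x, y) := c)"
    and n: "w (x - 1, y) = c \<and> w (x + 1, y) = c \<or> w (x, y - 1) = c \<and> w (x, y + 1) = c"
    unfolding height_step_def by blast
  have "height_swap w' = (height_swap w)((y, x) := c)"
    by (auto simp: w' fun_eq_iff)
  then show "height_step (height_swap w) (height_swap w')"
    unfolding height_step_def using n height_fun_swap[OF h]
    by (intro conjI exI[of _ y] exI[of _ x] exI[of _ c]) auto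
qed (rule height_fun_swap)

lemma height_eq_uminus:
  assumes "w \<simeq> w'" shows "(\<lambda>f. - w f) \<simeq> (\<lambda>f. - w' f)"
proof (rule height_eq_map[OF assms])
  fix w w' assume "height_step w w'"
  then obtain x y c where h: "height_fun w" and w': "w' = w((x, y) := c)"
    and n: "w (x - 1, y) = c \<and> w (x + 1, y) = c \<or> w (x, y - 1) = c \<and> w (x, y + 1) = c"
    unfolding height_step_def by blast
  have "(\<lambda>f. - w' f) = (\<lambda>f. - w f)((x, y) := - c)"
    by (auto simp: w' fun_eq_iff)
  then show "height_step (\<lambda>f. - w f) (\<lambda>f. - w' f)"
    unfolding height_step_def using n height_fun_uminus[OF h]
    by (intro conjI exI[of _ x] exI[of _ y] exI[of _ "- c"]) auto
qed (rule height_fun_uminus)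

subsection \<open>Walks along the columns\<close>

lemma valid_columns:
  assumes "valid w" and "\<bar>p - q\<bar> \<le> (1 :: int)"
  shows "vertex_ok (w (p, y)) (w (q, y)) (w (q, y - 1)) (w (p, y - 1))"
proof -
  consider "q = p" | "q = p - 1" | "p = q - 1" using assms(2) by linarith
  then show ?thesis
  proof cases
    case 1
    then show ?thesis using validD[OF assms(1), of p y]
      by (auto simp: vertex_ok_def abs_minus_commute)
  next
    case 2
    then show ?thesis using validD[OF assms(1), of p y] by simp
  next
    case 3
    then show ?thesis using validD[OF assms(1), of q y] vertex_ok_reflect by simp
  qed
qed

text \<open>Above the row \<open>c\<close> the new function reads off the columns of
  \<open>w\<close> along a walk. Neighbouring columns of it are equal or neighbouring columns of
  \<open>w\<close>, which gives validity, and \<open>proper\<close> keeps the support finite. Where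
  the walks differ, both of them stand at \<open>\<phi> x\<close> just before and just after
  \<open>x\<close>, so every cell of the column changes by a horizontal step.\<close>

lemma walk_homotopy:
  assumes w: "height_fun w" and c: "\<And>x. w (x, c) = 0"
    and lip: "\<And>x. \<bar>\<psi> x - \<psi> (x - 1)\<bar> \<le> (1 :: int)"
    and proper: "\<And>p. finite {x. \<psi> x = p}"
    and fin: "finite {x. \<phi> x \<noteq> \<psi> x}"
    and nb: "\<And>x. \<phi> x \<noteq> \<psi> x \<Longrightarrow>
       \<psi> (x - 1) = \<phi> x \<and> \<psi> (x + 1) = \<phi> x \<and> \<phi> (x - 1) = \<phi> x \<and> \<phi> (x + 1) = \<phi> x"
  shows "(\<lambda>(x, y). if y > c then w (\<psi> x, y) else w (x, y)) \<simeq>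
         (\<lambda>(x, y). if y > c then w (\<phi> x, y) else w (x, y))" (is "?v \<simeq> ?u")
proof -
  let ?S = "{f. w f \<noteq> 0}"
  have S: "finite ?S" and val: "valid w" using w by (auto simp: height_fun_def)
  have "{f. ?v f \<noteq> 0} \<subseteq> ?S \<union> (\<Union>(p, q) \<in> ?S. {x. \<psi> x = p} \<times> {q})"
    by (auto split: if_splits)
  then have f: "finite {f. ?v f \<noteq> 0}"
    by (rule finite_subset) (use S proper in auto)
  have "valid ?v"
    unfolding valid_def
  proof (intro allI)
    fix x y :: int
    show "vertex_ok (?v (x, y)) (?v (x - 1, y)) (?v (x - 1, y - 1)) (?v (x, y - 1))"
    proof (cases "y > c")
      case True
      \<comment> \<open>For \<open>y = c + 1\<close> the lower row is the row \<open>c\<close>,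
        which vanishes however its columns are rearranged.\<close>
      then have "?v (z, y - 1) = w (\<psi> z, y - 1)" for z
        using c by (cases "y = c + 1") auto
      then show ?thesis using True valid_columns[OF val lip, of x y] by simp
    next
      case False
      then show ?thesis using validD[OF val, of x y] by simp
    qed
  qed
  then have v: "height_fun ?v" using f by (simp add: height_fun_def)
  have "{f. ?u f \<noteq> ?v f} \<subseteq> {x. \<phi> x \<noteq> \<psi> x} \<times> snd ` ?S"
  proof
    fix f assume "f \<in> {f. ?u f \<noteq> ?v f}"
    moreover obtain x y where "f = (x, y)" by fastforce
    ultimately have "w (\<phi> x, y) \<noteq> w (\<psi> x, y)" by (auto split: if_splits)
    then have "\<phi> x \<noteq> \<psi> x" "(\<phi> x, y) \<in> ?S \<or> (\<psi> x, y) \<in> ?S" by auto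
    then show "f \<in> {x. \<phi> x \<noteq> \<psi> x} \<times> snd ` ?S" using \<open>f = (x, y)\<close> by force
  qed
  then have "finite {f. ?u f \<noteq> ?v f}"
    by (rule finite_subset) (use S fin in auto)
  then show ?thesis
  proof (intro conjunct2[OF height_eq_simultaneous[OF v, of ?u]])
    fix x y assume "?u (x, y) \<noteq> ?v (x, y)"
    then have "\<phi> x \<noteq> \<psi> x" "y > c" by (auto split: if_splits)
    then show "?v (x - 1, y) = ?u (x, y) \<and> ?v (x + 1, y) = ?u (x, y) \<and>
       ?u (x - 1, y) = ?u (x, y) \<and> ?u (x + 1, y) = ?u (x, y) \<or>
       ?v (x, y - 1) = ?u (x, y) \<and> ?v (x, y + 1) = ?u (x, y) \<and>
       ?u (x, y - 1) = ?u (x, y) \<and> ?u (x, y + 1) = ?u (x, y)"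
      using nb[of x] by simp
  qed
qed

text \<open>The walk visits the column \<open>d\<close> three times and is then two columns behind.
  A single repetition would not do: it could be used to shift by one column, and that reverses the
  signs of the vertices in \<open>level_count\<close>.\<close>

definition insert_columns :: "int \<Rightarrow> int \<Rightarrow> (int \<times> int \<Rightarrow> int) \<Rightarrow> int \<times> int \<Rightarrow> int" where
  "insert_columns c d w = (\<lambda>(x, y). if y > c
     then w (if x \<le> d then x else if x \<le> d + 2 then d else x - 2, y) else w (x, y))"

text \<open>On the places \<open>d\<close> to \<open>d + 3\<close> the two walks are d, d, d, d+1
  and d, d+1, d+1, d+1. Each differs at one place from the zigzag d, d+1, d, d+1, which is
  \<open>\<psi>\<close>.\<close>

lemma insert_columns_Suc:
  assumes w: "height_fun w" and c: "\<And>x. w (x, c) = 0"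
  shows "insert_columns c d w \<simeq> insert_columns c (d + 1) w"
proof -
  define \<psi> where "\<psi> x = (if x = d + 1 then d + 1 else if x \<le> d then x else if x = d + 2 then d else x - 2)" for x
  define \<phi> where "\<phi> e x = (if x \<le> e then x else if x \<le> e + 2 then e else x - 2)" for e x :: int
  have ne1: "x = d + 1" if "\<phi> d x \<noteq> \<psi> x" for x
  proof (rule ccontr)
    assume "x \<noteq> d + 1"
    then consider "x \<le> d" | "x = d + 2" | "x > d + 2" by linarith
    then show False using that by cases (simp_all add: \<phi>_def \<psi>_def)
  qed
  have ne2: "x = d + 2" if "\<phi> (d + 1) x \<noteq> \<psi> x" for x
  proof (rule ccontr)
    assume "x \<noteq> d + 2"
    then consider "x \<le> d" | "x = d + 1" | "x = d + 3" | "x > d + 3" by linarith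
    then show False using that by cases (simp_all add: \<phi>_def \<psi>_def)
  qed
  have fin1: "finite {x. \<phi> d x \<noteq> \<psi> x}"
    by (rule finite_subset[of _ "{d + 1}"]) (use ne1 in auto)
  have fin2: "finite {x. \<phi> (d + 1) x \<noteq> \<psi> x}"
    by (rule finite_subset[of _ "{d + 2}"]) (use ne2 in auto)
  have fin: "finite {x. \<psi> x = p}" for p
    by (rule finite_subset[of _ "{p, p + 2, d + 1, d + 2}"]) (auto simp: \<psi>_def split: if_splits)
  have lip: "\<bar>\<psi> x - \<psi> (x - 1)\<bar> \<le> 1" for x
  proof -
    consider "x \<le> d" | "x = d + 1" | "x = d + 2" | "x = d + 3" | "x > d + 3" by linarith
    then show ?thesis by cases (simp_all add: \<psi>_def)
  qed
  have ins: "insert_columns c e w = (\<lambda>(x, y). if y > c then w (\<phi> e x, y) else w (x, y))" for e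
    unfolding insert_columns_def \<phi>_def ..
  have "(\<lambda>(x, y). if y > c then w (\<psi> x, y) else w (x, y)) \<simeq> insert_columns c d w"
    unfolding ins by (rule walk_homotopy[OF w c lip fin fin1]) (drule ne1, simp add: \<phi>_def \<psi>_def)
  moreover have "(\<lambda>(x, y). if y > c then w (\<psi> x, y) else w (x, y)) \<simeq> insert_columns c (d + 1) w"
    unfolding ins by (rule walk_homotopy[OF w c lip fin fin2]) (drule ne2, simp add: \<phi>_def \<psi>_def)
  ultimately show ?thesis using height_eq_sym height_eq_trans by blast
qed

lemma insert_columns_eq:
  assumes w: "height_fun w" and c: "\<And>x. w (x, c) = 0"
  shows "insert_columns c d w \<simeq> insert_columns c e w"
proof -
  have "insert_columns c d w \<simeq> insert_columns c (d + int n) w" for d n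
  proof (induction n)
    case 0
    then show ?case using insert_columns_Suc[OF w c, of d]
      by (simp add: height_eq_def equivclp_def)
  next
    case (Suc n)
    then show ?case using insert_columns_Suc[OF w c, of "d + int n"] height_eq_trans
      by (metis add.assoc of_nat_Suc add.commute)
  qed
  from this[of d "nat (e - d)"] this[of e "nat (d - e)"] show ?thesis
    using height_eq_sym by (cases "d \<le> e") auto
qed

lemma height_fun_bounds:
  assumes "height_fun w"
  obtains N where "N > 0" "\<And>x y. w (x, y) \<noteq> 0 \<Longrightarrow> \<bar>x\<bar> < N \<and> \<bar>y\<bar> < N"
proof -
  let ?A = "(\<lambda>(x, y). max \<bar>x\<bar> \<bar>y\<bar>) ` {f. w f \<noteq> 0}"
  have "finite ?A" using assms by (simp add: height_fun_def)
  then have *: "a \<le> Max (insert 0 ?A)" if "a \<in> ?A" for a using that by auto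
  show ?thesis
  proof (rule that[of "Max (insert 0 ?A) + 1"])
    show "0 < Max (insert 0 ?A) + 1" using \<open>finite ?A\<close> by (simp add: Max_ge_iff add_nonneg_pos)
    fix x y assume "w (x, y) \<noteq> 0"
    then have "max \<bar>x\<bar> \<bar>y\<bar> \<in> ?A" by force
    then show "\<bar>x\<bar> < Max (insert 0 ?A) + 1 \<and> \<bar>y\<bar> < Max (insert 0 ?A) + 1" using * by fastforce
  qed
qed

lemma insert_columns_id:
  assumes w: "height_fun w" and c: "\<And>x. w (x, c) = 0"
  shows "insert_columns c d w \<simeq> w"
proof -
  obtain N where N: "\<And>x y. w (x, y) \<noteq> 0 \<Longrightarrow> \<bar>x\<bar> < N \<and> \<bar>y\<bar> < N" "N > 0"
    using height_fun_bounds[OF w] by metis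
  have z: "w (x, y) = 0" if "x \<ge> N" for x y using N(1)[of x y] that by fastforce
  have "insert_columns c N w = w"
    by (auto simp: insert_columns_def fun_eq_iff z)
  then show ?thesis using insert_columns_eq[OF w c, of d N] by simp
qed

text \<open>To the right of the support the two extra columns change nothing, to its left they push
  everything above the row \<open>c\<close> to the right by two; \<open>insert_columns_eq\<close>
  connects the two positions.\<close>

lemma half_plane_shift2:
  assumes w: "height_fun w" and c: "\<And>x. w (x, c) = 0"
  shows "(\<lambda>(x, y). if y > c then w (x - 2, y) else w (x, y)) \<simeq> w"
proof -
  obtain N where N: "\<And>x y. w (x, y) \<noteq> 0 \<Longrightarrow> \<bar>x\<bar> < N \<and> \<bar>y\<bar> < N" "N > 0"
    using height_fun_bounds[OF w] by metis
  have z: "w (x, y) = 0" if "x \<le> - N" for x y using N(1)[of x y] that by fastforce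
  have "insert_columns c (- N) w = (\<lambda>(x, y). if y > c then w (x - 2, y) else w (x, y))"
    by (auto simp: insert_columns_def fun_eq_iff z)
  then show ?thesis using insert_columns_id[OF w c, of "- N"] by simp
qed

lemma half_plane_shift_nat:
  assumes w: "height_fun w" and c: "\<And>x. w (x, c) = 0"
  shows "(\<lambda>(x, y). if y > c then w (x - 2 * int n, y) else w (x, y)) \<simeq> w"
proof (induction n)
  case 0
  have "(\<lambda>(x, y). if y > c then w (x - 2 * int 0, y) else w (x, y)) = w" by (auto simp: fun_eq_iff)
  then show ?case using height_eq_refl[OF w] by simp
next
  case (Suc n)
  let ?w = "\<lambda>n. (\<lambda>(x, y). if y > c then w (x - 2 * int n, y) else w (x, y))"
  have "height_fun (?w n)" using Suc by (simp add: height_eq_def)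
  then have "(\<lambda>(x, y). if y > c then ?w n (x - 2, y) else ?w n (x, y)) \<simeq> ?w n"
    using half_plane_shift2[of "?w n" c] c by simp
  moreover have "(\<lambda>(x, y). if y > c then ?w n (x - 2, y) else ?w n (x, y)) = ?w (Suc n)"
    by (auto simp: fun_eq_iff algebra_simps)
  ultimately show ?case using Suc height_eq_trans by simp
qed

lemma height_fun_far_zero:
  assumes "height_fun w"
  obtains c where "\<And>x y. y \<le> c \<Longrightarrow> w (x, y) = 0"
proof -
  obtain N where "\<And>x y. w (x, y) \<noteq> 0 \<Longrightarrow> \<bar>x\<bar> < N \<and> \<bar>y\<bar> < N"
    using height_fun_bounds[OF assms] by metis
  then have "\<And>x y. y \<le> - N \<Longrightarrow> w (x, y) = 0" by fastforce
  then show ?thesis using that by blast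
qed

text \<open>By symmetry \<open>u\<close> is read off along the walk \<open>\<phi> 0\<close>, which
  comes from the left, turns round at the column \<open>c\<close> and goes back. The turning point
  can be retracted: \<open>\<phi> n\<close> waits at \<open>c - n\<close> before it turns, and the
  zigzag \<open>\<psi> n\<close> between \<open>c - n\<close> and \<open>c - n - 1\<close> links it
  to \<open>\<phi> (Suc n)\<close>. In the end the walk turns before it reaches the support.\<close>

lemma fold_columns:
  assumes u: "height_fun u" and sym: "\<And>x y. u (2 * c - x, y) = u (x, y)"
  shows "u \<simeq> (\<lambda>_. 0)"
proof -
  obtain c0 where c0: "\<And>x y. y \<le> c0 \<Longrightarrow> u (x, y) = 0" using height_fun_far_zero[OF u] by metis
  define \<phi> where "\<phi> n x = c - max (int n) \<bar>x - c\<bar>" for n x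
  define \<psi> where "\<psi> n x = (if \<bar>x - c\<bar> \<le> int n
     then (if even (x - c - int n) then c - int n else c - int n - 1) else c - \<bar>x - c\<bar>)" for n x
  let ?W = "\<lambda>\<phi>. \<lambda>(x, y). if y > c0 then u (\<phi> x, y) else u (x, y)"
  \<comment> \<open>At both ends of the waiting interval the zigzag stands at \<open>c - n\<close>,
    where it meets the outer arms.\<close>
  have rim: "even (x - c - int n)" if "\<bar>x - c\<bar> = int n" for x n
  proof -
    have "x - c - int n = 0 \<or> x - c - int n = - 2 * int n" using that by linarith
    then show ?thesis by (metis even_mult_iff even_zero even_minus even_numeral)
  qed
  have lip: "\<bar>\<psi> n x - \<psi> n (x - 1)\<bar> \<le> 1" for n x
    by (auto simp: \<psi>_def)
  have proper: "finite {x. \<psi> n x = p}" for n p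
    by (rule finite_subset[of _ "{c - int n..c + int n} \<union> {c - (c - p), c + (c - p)}"])
      (auto simp: \<psi>_def split: if_splits)
  have ne1: "\<bar>x - c\<bar> < int n \<and> odd (x - c - int n)" if "\<phi> n x \<noteq> \<psi> n x" for n x
  proof (cases "\<bar>x - c\<bar> \<le> int n")
    case True
    then have "odd (x - c - int n)" using that by (auto simp: \<phi>_def \<psi>_def max_def split: if_splits)
    then show ?thesis using True rim[of x n] by linarith
  next
    case False
    then show ?thesis using that by (simp add: \<phi>_def \<psi>_def)
  qed
  have ne2: "\<bar>x - c\<bar> \<le> int n \<and> even (x - c - int n)" if "\<phi> (Suc n) x \<noteq> \<psi> n x" for n x
    using that by (cases "\<bar>x - c\<bar> \<le> int n") (auto simp: \<phi>_def \<psi>_def max_def split: if_splits)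
  have val1: "\<psi> n x = c - int n" if "\<bar>x - c\<bar> \<le> int n" "even (x - c - int n)" for n x
    using that by (simp add: \<psi>_def)
  have val2: "\<psi> n x = c - int n - 1" if "\<bar>x - c\<bar> \<le> int n + 1" "odd (x - c - int n)" for n x
    using that by (auto simp: \<psi>_def)
  have fin: "finite {x. \<phi> n x \<noteq> \<psi> n x}" "finite {x. \<phi> (Suc n) x \<noteq> \<psi> n x}" for n
    by (rule finite_subset[of _ "{c - int n..c + int n}"]; use ne1 ne2 in fastforce)+
  have 1: "?W (\<psi> n) \<simeq> ?W (\<phi> n)" for n
  proof (rule walk_homotopy[OF u c0[OF order_refl] lip proper fin(1)])
    fix x assume "\<phi> n x \<noteq> \<psi> n x"
    then have *: "\<bar>x - c\<bar> < int n" "odd (x - c - int n)" using ne1 by auto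
    have "\<bar>x - 1 - c\<bar> \<le> int n" "\<bar>x + 1 - c\<bar> \<le> int n" using *(1) by linarith+
    moreover have "even (x - 1 - c - int n)" "even (x + 1 - c - int n)" using *(2) by presburger+
    ultimately show "\<psi> n (x - 1) = \<phi> n x \<and> \<psi> n (x + 1) = \<phi> n x \<and> \<phi> n (x - 1) = \<phi> n x \<and> \<phi> n (x + 1) = \<phi> n x"
      using * by (simp add: val1 \<phi>_def)
  qed
  have 2: "?W (\<psi> n) \<simeq> ?W (\<phi> (Suc n))" for n
  proof (rule walk_homotopy[OF u c0[OF order_refl] lip proper fin(2)])
    fix x assume "\<phi> (Suc n) x \<noteq> \<psi> n x"
    then have *: "\<bar>x - c\<bar> \<le> int n" "even (x - c - int n)" using ne2 by auto
    have "\<bar>x - 1 - c\<bar> \<le> int n + 1" "\<bar>x + 1 - c\<bar> \<le> int n + 1" using *(1) by linarith+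
    moreover have "odd (x - 1 - c - int n)" "odd (x + 1 - c - int n)" using *(2) by presburger+
    ultimately show "\<psi> n (x - 1) = \<phi> (Suc n) x \<and> \<psi> n (x + 1) = \<phi> (Suc n) x \<and>
        \<phi> (Suc n) (x - 1) = \<phi> (Suc n) x \<and> \<phi> (Suc n) (x + 1) = \<phi> (Suc n) x"
      using * by (simp add: val2 \<phi>_def)
  qed
  have fold: "?W (\<phi> 0) \<simeq> ?W (\<phi> n)" for n
  proof (induction n)
    case 0
    show ?case using 1[of 0] height_eq_sym height_eq_trans by blast
  next
    case (Suc n)
    then show ?case using 1[of n] 2[of n] height_eq_sym height_eq_trans by blast
  qed
  have W0: "?W (\<phi> 0) = u"
  proof (intro ext, clarify)
    fix x y
    have "\<phi> 0 x = x \<or> \<phi> 0 x = 2 * c - x" by (auto simp: \<phi>_def)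
    then have "u (\<phi> 0 x, y) = u (x, y)" using sym[of x y] by (elim disjE) simp_all
    then show "(if y > c0 then u (\<phi> 0 x, y) else u (x, y)) = u (x, y)" by simp
  qed
  obtain n where n: "?W (\<phi> n) = (\<lambda>_. 0)"
  proof -
    obtain N where N: "\<And>x y. u (x, y) \<noteq> 0 \<Longrightarrow> \<bar>x\<bar> < N \<and> \<bar>y\<bar> < N" "N > 0"
      using height_fun_bounds[OF u] by metis
    have "u (p, y) = 0" if "p \<le> - N" for p y using N(1)[of p y] that by fastforce
    then have "?W (\<phi> (nat (N + \<bar>c\<bar>))) = (\<lambda>_. 0)"
      using c0 by (intro ext) (auto simp: \<phi>_def)
    then show ?thesis using that by blast
  qed
  show ?thesis using fold[of n] unfolding n W0 .
qed

lemma fold_rows: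
  assumes u: "height_fun u" and sym: "\<And>x y. u (x, 2 * c - y) = u (x, y)"
  shows "u \<simeq> (\<lambda>_. 0)"
proof -
  have "height_swap u \<simeq> (\<lambda>_. 0)"
    by (rule fold_columns[OF height_fun_swap[OF u], of c]) (simp add: sym)
  moreover have "height_swap (\<lambda>_. 0) = (\<lambda>_. 0)" by (auto simp: fun_eq_iff)
  ultimately show ?thesis using height_eq_swap by fastforce
qed

text \<open>After transposition the threshold of \<open>insert_columns\<close> is put before the
  support, so that the repetition affects whole rows.\<close>

lemma insert_rows:
  assumes w: "height_fun w"
  shows "(\<lambda>(x, y). w (x, if y \<le> d then y else if y \<le> d + 2 then d else y - 2)) \<simeq> w"
proof -
  have h: "height_fun (height_swap w)" by (rule height_fun_swap[OF w])
  obtain c where c: "\<And>x y. y \<le> c \<Longrightarrow> height_swap w (x, y) = 0" using height_fun_far_zero[OF h] by metis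
  have "height_swap (insert_columns c d (height_swap w)) \<simeq> w"
    using height_eq_swap[OF insert_columns_id[OF h, of c d]] c by simp
  moreover have "height_swap (insert_columns c d (height_swap w)) =
      (\<lambda>(x, y). w (x, if y \<le> d then y else if y \<le> d + 2 then d else y - 2))"
    using c unfolding height_swap_def insert_columns_def by (auto simp: fun_eq_iff)
  ultimately show ?thesis by simp
qed

lemma half_plane_shift_rows:
  assumes w: "height_fun w" and c: "\<And>y. w (c, y) = 0"
  shows "(\<lambda>(x, y). if x > c then w (x, y - 2 * int n) else w (x, y)) \<simeq> w"
proof -
  have "height_swap (\<lambda>(x, y). if y > c then height_swap w (x - 2 * int n, y) else height_swap w (x, y)) \<simeq> w"
    using height_eq_swap[OF half_plane_shift_nat[OF height_fun_swap[OF w], of c n]] c by simp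
  moreover have "height_swap (\<lambda>(x, y). if y > c then height_swap w (x - 2 * int n, y) else height_swap w (x, y)) =
      (\<lambda>(x, y). if x > c then w (x, y - 2 * int n) else w (x, y))"
    unfolding height_swap_def by (auto simp: fun_eq_iff)
  ultimately show ?thesis by simp
qed

lemma height_eq_shift_x:
  assumes w: "height_fun w" shows "height_shift (2 * int n) 0 w \<simeq> w"
proof -
  obtain c where c: "\<And>x y. y \<le> c \<Longrightarrow> w (x, y) = 0" using height_fun_far_zero[OF w] by metis
  have "(\<lambda>(x, y). if y > c then w (x - 2 * int n, y) else w (x, y)) = height_shift (2 * int n) 0 w"
    using c by (auto simp: fun_eq_iff)
  then show ?thesis using half_plane_shift_nat[OF w c[OF order_refl], of n] by simp
qed

lemma height_eq_even_shift:
  assumes w: "height_fun w" and "even a" "even b"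
  shows "height_shift a b w \<simeq> w"
proof -
  have x: "height_shift a 0 w \<simeq> w" if "height_fun w" "even a" for w a
  proof -
    obtain k where k: "a = 2 * k" using \<open>even a\<close> by blast
    show ?thesis
    proof (cases "k \<ge> 0")
      case True
      then show ?thesis using height_eq_shift_x[OF that(1), of "nat k"] k by simp
    next
      case False
      have e: "height_shift (2 * int (nat (- k))) 0 (height_shift a 0 w) = w"
        using False k by (auto simp: fun_eq_iff)
      show ?thesis
        using height_eq_shift_x[OF height_fun_shift[OF that(1)], of "nat (- k)" a 0] height_eq_sym
        unfolding e by blast
    qed
  qed
  have y: "height_shift 0 b w \<simeq> w" if "height_fun w" "even b" for w b
  proof -
    have "height_swap (height_shift b 0 (height_swap w)) = height_shift 0 b w"
      by (auto simp: fun_eq_iff)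
    then show ?thesis
      using height_eq_swap[OF x[OF height_fun_swap[OF that(1)] that(2)]] by simp
  qed
  have "height_shift a b w = height_shift a 0 (height_shift 0 b w)" by (auto simp: fun_eq_iff)
  then show ?thesis using x[OF height_fun_shift[OF w] assms(2), of 0 b] y[OF w assms(3)] height_eq_trans by metis
qed

section \<open>Stacking one height function above another\<close>

definition height_add :: "(int \<times> int \<Rightarrow> int) \<Rightarrow> (int \<times> int \<Rightarrow> int) \<Rightarrow> int \<times> int \<Rightarrow> int" where
  "height_add u v = (\<lambda>f. u f + v f)"

definition zero_from :: "int \<Rightarrow> (int \<times> int \<Rightarrow> int) \<Rightarrow> bool" where
  "zero_from c u \<longleftrightarrow> (\<forall>x y. y \<ge> c \<longrightarrow> u (x, y) = 0)"

definition zero_upto :: "int \<Rightarrow> (int \<times> int \<Rightarrow> int) \<Rightarrow> bool" where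
  "zero_upto c u \<longleftrightarrow> (\<forall>x y. y \<le> c \<longrightarrow> u (x, y) = 0)"

lemma height_add_apply [simp]: "height_add u v f = u f + v f"
  by (simp add: height_add_def)

lemma height_fun_add:
  assumes u: "height_fun u" and v: "height_fun v" and "zero_from c u" "zero_upto c v"
  shows "height_fun (height_add u v)"
proof -
  have "finite ({f. u f \<noteq> 0} \<union> {f. v f \<noteq> 0})" using u v by (simp add: height_fun_def)
  then have "finite {f. height_add u v f \<noteq> 0}" by (rule rev_finite_subset) auto
  moreover have "valid (height_add u v)"
    unfolding valid_def
  proof (intro allI)
    fix x y
    show "vertex_ok (height_add u v (x, y)) (height_add u v (x - 1, y))
       (height_add u v (x - 1, y - 1)) (height_add u v (x, y - 1))"
    proof (cases "y \<le> c")
      case True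
      then show ?thesis using assms validD[of u x y] by (simp add: height_fun_def zero_upto_def)
    next
      case False
      then show ?thesis using assms validD[of v x y] by (simp add: height_fun_def zero_from_def)
    qed
  qed
  ultimately show ?thesis by (simp add: height_fun_def)
qed

lemma height_fun_zero_from:
  assumes "height_fun w" obtains N where "N > 0" "\<And>c. c \<ge> N \<Longrightarrow> zero_from c w" "\<And>c. c \<le> - N \<Longrightarrow> zero_upto c w"
proof -
  obtain N where N: "N > 0" "\<And>x y. w (x, y) \<noteq> 0 \<Longrightarrow> \<bar>x\<bar> < N \<and> \<bar>y\<bar> < N"
    using height_fun_bounds[OF assms] by metis
  show ?thesis
  proof (rule that[OF N(1)])
    fix c assume "c \<ge> N"
    then show "zero_from c w" unfolding zero_from_def using N(2) by fastforce
  next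
    fix c assume "c \<le> - N"
    then show "zero_upto c w" unfolding zero_upto_def using N(2) by fastforce
  qed
qed

text \<open>The intermediate functions of a chain of steps may reach higher than both of its ends.
  The bound \<open>N\<close> lies above all of them and above all cells changed, so that
  \<open>v\<close> does not notice the steps.\<close>

lemma height_eq_add_left:
  assumes "u \<simeq> u'"
  shows "\<exists>N. \<forall>c v. c \<ge> N \<longrightarrow> height_fun v \<longrightarrow> zero_upto c v \<longrightarrow> height_add u v \<simeq> height_add u' v"
  using assms
proof (induction rule: height_eq_induct)
  case (refl w)
  then obtain N where "\<And>c. c \<ge> N \<Longrightarrow> zero_from c w" using height_fun_zero_from by metis
  then show ?case using height_eq_refl height_fun_add refl by blast
next
  case (step w w')
  then obtain x y a where h: "height_fun w" and w': "w' = w((x, y) := a)"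
    and n: "w (x - 1, y) = a \<and> w (x + 1, y) = a \<or> w (x, y - 1) = a \<and> w (x, y + 1) = a"
    unfolding height_step_def by blast
  obtain N where N: "\<And>c. c \<ge> N \<Longrightarrow> zero_from c w" using height_fun_zero_from[OF h] by metis
  show ?case
  proof (intro exI allI impI)
    fix c v assume c: "c \<ge> max N (y + 1)" and v: "height_fun v" "zero_upto c v"
    have "height_add w' v = (height_add w v)((x, y) := a)"
      using c v(2) by (auto simp: fun_eq_iff w' zero_upto_def)
    moreover have "height_fun (height_add w v)" using height_fun_add[OF h v(1) N v(2)] c by simp
    moreover have "height_add w v (p, q) = w (p, q)" if "q \<le> y + 1" for p q
      using that c v(2) by (simp add: zero_upto_def)
    ultimately have "height_step (height_add w v) (height_add w' v)"
      unfolding height_step_def using n by (intro conjI exI[of _ x] exI[of _ y] exI[of _ a]) auto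
    then show "height_add w v \<simeq> height_add w' v" by (rule height_eq_step)
  qed
next
  case (sym w w')
  then show ?case using height_eq_sym by blast
next
  case (trans w w' w'')
  then obtain N M where N: "\<And>c v. c \<ge> N \<Longrightarrow> height_fun v \<Longrightarrow> zero_upto c v \<Longrightarrow> height_add w v \<simeq> height_add w' v"
    and M: "\<And>c v. c \<ge> M \<Longrightarrow> height_fun v \<Longrightarrow> zero_upto c v \<Longrightarrow> height_add w' v \<simeq> height_add w'' v" by blast
  show ?case
  proof (intro exI allI impI)
    fix c v assume "c \<ge> max N M" "height_fun v" "zero_upto c v"
    then show "height_add w v \<simeq> height_add w'' v"
      using height_eq_trans[OF N[of c v] M[of c v]] by simp
  qed
qed

lemma height_eq_add_right:
  assumes "v \<simeq> v'"
  shows "\<exists>N. \<forall>c u. c \<le> N \<longrightarrow> height_fun u \<longrightarrow> zero_from c u \<longrightarrow> height_add u v \<simeq> height_add u v'"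
proof -
  have add: "height_mirror 0 (height_add (height_mirror 0 v) (height_mirror 0 u)) = height_add u v" for u v
    by (auto simp: fun_eq_iff)
  obtain N where N: "\<And>c u. c \<ge> N \<Longrightarrow> height_fun u \<Longrightarrow> zero_upto c u \<Longrightarrow>
      height_add (height_mirror 0 v) u \<simeq> height_add (height_mirror 0 v') u"
    using height_eq_add_left[OF height_eq_mirror[OF assms, of 0]] by blast
  have "height_add u v \<simeq> height_add u v'" if "c \<le> - N" "height_fun u" "zero_from c u" for c u
  proof -
    have "zero_upto (- c) (height_mirror 0 u)" using that(3) by (simp add: zero_upto_def zero_from_def)
    then show ?thesis using height_eq_mirror[OF N[OF _ height_fun_mirror[OF that(2)]], of "- c" 0 0] that(1)
      by (simp add: add)
  qed
  then show ?thesis by blast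
qed

text \<open>Both summands vanish on the row \<open>c\<close>. Repeating it twice with
  \<open>insert_rows\<close> therefore only lifts the upper summand by two.\<close>

lemma height_add_gap:
  assumes u: "height_fun u" and v: "height_fun v" and z: "zero_from c u" "zero_upto c v"
  shows "height_add u (height_shift 0 (2 * int n) v) \<simeq> height_add u v"
proof (induction n)
  case 0
  have "height_shift 0 (2 * int 0) v = v" by (auto simp: fun_eq_iff)
  then show ?case using height_eq_refl[OF height_fun_add[OF u v z]] by (simp only:)
next
  case (Suc n)
  let ?v = "\<lambda>n. height_shift 0 (2 * int n) v"
  let ?w = "height_add u (?v n)"
  have z': "zero_upto c (?v n)" using z(2) by (simp add: zero_upto_def)
  have "(\<lambda>(x, y). ?w (x, if y \<le> c then y else if y \<le> c + 2 then c else y - 2)) = height_add u (?v (Suc n))"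
  proof (intro ext, clarify)
    fix x y
    have "y - 2 - 2 * int n = y - 2 * int (Suc n)" by simp
    then show "?w (x, if y \<le> c then y else if y \<le> c + 2 then c else y - 2) = height_add u (?v (Suc n)) (x, y)"
      using z unfolding zero_from_def zero_upto_def height_add_apply height_shift_apply
      by (cases "y \<le> c"; cases "y \<le> c + 2") (simp_all add: diff_diff_eq)
  qed
  then have "height_add u (?v (Suc n)) \<simeq> ?w"
    using insert_rows[OF height_fun_add[OF u height_fun_shift[OF v] z(1) z'], of c] by (simp only:)
  then show ?case using Suc height_eq_trans by blast
qed

subsection \<open>The group of classes\<close>

definition height_bound :: "(int \<times> int \<Rightarrow> int) \<Rightarrow> int" where
  "height_bound w = (SOME N. N > 0 \<and> (\<forall>c \<ge> N. zero_from c w) \<and> (\<forall>c \<le> - N. zero_upto c w))"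

lemma height_bound:
  assumes "height_fun w"
  shows "height_bound w > 0" "c \<ge> height_bound w \<Longrightarrow> zero_from c w" "c \<le> - height_bound w \<Longrightarrow> zero_upto c w"
proof -
  have "\<exists>N. N > 0 \<and> (\<forall>c \<ge> N. zero_from c w) \<and> (\<forall>c \<le> - N. zero_upto c w)"
    using height_fun_zero_from[OF assms] by metis
  then have "height_bound w > 0 \<and> (\<forall>c \<ge> height_bound w. zero_from c w) \<and> (\<forall>c \<le> - height_bound w. zero_upto c w)"
    unfolding height_bound_def by (rule someI_ex)
  then show "height_bound w > 0" "c \<ge> height_bound w \<Longrightarrow> zero_from c w"
    "c \<le> - height_bound w \<Longrightarrow> zero_upto c w" by blast+
qed

text \<open>The shift is even, so it does not change the class of \<open>v\<close>, and it is large
  enough to put the support of \<open>v\<close> above that of \<open>u\<close>.\<close>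

definition height_stack :: "(int \<times> int \<Rightarrow> int) \<Rightarrow> (int \<times> int \<Rightarrow> int) \<Rightarrow> int \<times> int \<Rightarrow> int" where
  "height_stack u v = height_add u (height_shift 0 (2 * (height_bound u + height_bound v)) v)"

lemma zero_upto_shift: "zero_upto c w \<Longrightarrow> zero_upto (c + n) (height_shift m n w)"
  by (auto simp: zero_upto_def)

lemma zero_from_shift: "zero_from c w \<Longrightarrow> zero_from (c + n) (height_shift m n w)"
  by (auto simp: zero_from_def)

lemma zero_upto_mono: "zero_upto c w \<Longrightarrow> d \<le> c \<Longrightarrow> zero_upto d w"
  by (auto simp: zero_upto_def)

lemma zero_from_mono: "zero_from c w \<Longrightarrow> c \<le> d \<Longrightarrow> zero_from d w"
  by (auto simp: zero_from_def)

lemma height_shift_shift: "height_shift a b (height_shift c d w) = height_shift (a + c) (b + d) w"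
  by (auto simp: fun_eq_iff algebra_simps)

lemma height_stack_separate:
  assumes u: "height_fun u" and v: "height_fun v" and "n \<ge> height_bound u + height_bound v"
  shows "zero_from (height_bound u) u" "zero_upto (height_bound u) (height_shift 0 (2 * n) v)"
proof -
  show "zero_from (height_bound u) u" using height_bound[OF u] by blast
  have "zero_upto (- height_bound v + 2 * n) (height_shift 0 (2 * n) v)"
    by (rule zero_upto_shift[OF height_bound(3)[OF v order_refl]])
  then show "zero_upto (height_bound u) (height_shift 0 (2 * n) v)"
    by (rule zero_upto_mono) (use assms(3) height_bound(1)[OF u] height_bound(1)[OF v] in linarith)
qed

lemma height_stack_eq:
  assumes u: "height_fun u" and v: "height_fun v" and "n \<ge> height_bound u + height_bound v"
  shows "height_stack u v \<simeq> height_add u (height_shift 0 (2 * n) v)"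
proof -
  let ?k = "height_bound u + height_bound v"
  have "height_add u (height_shift 0 (2 * int (nat (n - ?k))) (height_shift 0 (2 * ?k) v)) \<simeq> height_stack u v"
    unfolding height_stack_def
    by (rule height_add_gap[OF u height_fun_shift[OF v] height_stack_separate[OF u v order_refl]])
  moreover have "height_shift 0 (2 * int (nat (n - ?k))) (height_shift 0 (2 * ?k) v) = height_shift 0 (2 * n) v"
    using assms(3) by (simp add: height_shift_shift algebra_simps)
  ultimately show ?thesis using height_eq_sym[of _ "height_stack u v"] by metis
qed

lemma height_stack_add:
  assumes u: "height_fun u" and v: "height_fun v" and z: "zero_from c u" "zero_upto c v"
  shows "height_stack u v \<simeq> height_add u v"
proof -
  let ?k = "height_bound u + height_bound v"
  have k: "int (nat ?k) = ?k" using height_bound(1)[OF u] height_bound(1)[OF v] by simp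
  have "height_add u (height_shift 0 (2 * ?k) v) \<simeq> height_add u v"
    using height_add_gap[OF u v z, of "nat ?k"] unfolding k .
  then show ?thesis
    using height_stack_eq[OF u v order_refl] height_eq_trans by blast
qed

text \<open>The gap can be widened at will by \<open>height_stack_eq\<close>. One \<open>n\<close>
  beyond the thresholds of both \<open>height_eq_add_left\<close> and
  \<open>height_eq_add_right\<close> leaves room to replace the lower summand and then the upper
  one.\<close>

lemma height_stack_cong:
  assumes u: "u \<simeq> u'" and v: "v \<simeq> v'"
  shows "height_stack u v \<simeq> height_stack u' v'"
proof -
  have h: "height_fun u" "height_fun u'" "height_fun v" "height_fun v'"
    using u v by (auto simp: height_eq_def)
  obtain N where N: "\<And>c v. c \<ge> N \<Longrightarrow> height_fun v \<Longrightarrow> zero_upto c v \<Longrightarrow> height_add u v \<simeq> height_add u' v"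
    using height_eq_add_left[OF u] by blast
  obtain M where M: "\<And>c u. c \<le> M \<Longrightarrow> height_fun u \<Longrightarrow> zero_from c u \<Longrightarrow> height_add u v \<simeq> height_add u v'"
    using height_eq_add_right[OF v] by blast
  obtain p where p: "N \<le> p" "- M \<le> p" "0 \<le> p"
    by (rule that[of "max 0 (max N (- M))"]) auto
  define n where "n = p + height_bound u + height_bound v + height_bound u' + height_bound v'"
  note pos = height_bound(1)[OF h(1)] height_bound(1)[OF h(2)] height_bound(1)[OF h(3)] height_bound(1)[OF h(4)]
  have 1: "height_add u (height_shift 0 (2 * n) v) \<simeq> height_add u' (height_shift 0 (2 * n) v)"
  proof (rule N[OF _ height_fun_shift[OF h(3)]])
    show "zero_upto (- height_bound v + 2 * n) (height_shift 0 (2 * n) v)"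
      by (rule zero_upto_shift[OF height_bound(3)[OF h(3) order_refl]])
    show "N \<le> - height_bound v + 2 * n" unfolding n_def using pos p by simp
  qed
  have 2: "height_add u' (height_shift 0 (2 * n) v) \<simeq> height_add u' (height_shift 0 (2 * n) v')"
  proof -
    \<comment> \<open>The bound for the steps from \<open>v\<close> to \<open>v'\<close> is known at
      their original place; so \<open>u'\<close> is shifted down instead of \<open>v\<close> up, and
      the sum is shifted back as a whole.\<close>
    have e: "height_add u' (height_shift 0 (2 * n) v) = height_shift 0 (2 * n) (height_add (height_shift 0 (- 2 * n) u') v)" for v
      by (auto simp: fun_eq_iff)
    have "zero_from (height_bound u' - 2 * n) (height_shift 0 (- 2 * n) u')"
      using zero_from_shift[OF height_bound(2)[OF h(2) order_refl], of "- 2 * n" 0] by simp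
    then show ?thesis unfolding e
      by (intro height_eq_shift M[OF _ height_fun_shift[OF h(2)]]) (use pos p in \<open>auto simp: n_def\<close>)
  qed
  have 3: "height_stack u v \<simeq> height_add u (height_shift 0 (2 * n) v)"
    by (rule height_stack_eq) (use h pos p in \<open>auto simp: n_def\<close>)
  have 4: "height_stack u' v' \<simeq> height_add u' (height_shift 0 (2 * n) v')"
    by (rule height_stack_eq) (use h pos p in \<open>auto simp: n_def\<close>)
  show ?thesis
    by (rule height_eq_trans[OF 3 height_eq_trans[OF 1 height_eq_trans[OF 2 height_eq_sym[OF 4]]]])
qed

\<comment> \<open>The classes and their group structure\<close>
quotient_type height_class = "int \<times> int \<Rightarrow> int" / partial: height_eq
  morphisms rep_height_class height_class
proof (rule part_equivpI)
  show "\<exists>w. w \<simeq> w" using height_eq_refl height_fun_zero by blast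
  show "symp height_eq" by (rule sympI) (rule height_eq_sym)
  show "transp height_eq" by (rule transpI) (rule height_eq_trans)
qed

lemma height_class_eq_iff:
  assumes "height_fun u" "height_fun v"
  shows "height_class u = height_class v \<longleftrightarrow> u \<simeq> v"
  using Quotient_height_class assms height_eq_refl unfolding Quotient_def by metis

lemma height_class_cases:
  obtains w where "height_fun w" "g = height_class w"
proof -
  have "rep_height_class g \<simeq> rep_height_class g" "height_class (rep_height_class g) = g"
    using Quotient_height_class unfolding Quotient_def by metis+
  then show ?thesis using that unfolding height_eq_def by metis
qed

instantiation height_class :: "{zero, plus, uminus, minus}"
begin

lift_definition zero_height_class :: height_class is "\<lambda>_. 0"
  by (rule height_eq_refl[OF height_fun_zero])

lift_definition plus_height_class :: "height_class \<Rightarrow> height_class \<Rightarrow> height_class" is height_stack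
  by (rule height_stack_cong)

text \<open>The inverse is the mirror image and not the function with negated heights: the latter
  gives a different automorphism, \<open>class_neg\<close>, which exchanges \<open>gen k\<close> and
  \<open>gen (- k)\<close>.\<close>

lift_definition uminus_height_class :: "height_class \<Rightarrow> height_class" is "height_mirror 0"
  by (rule height_eq_mirror)

definition minus_height_class :: "height_class \<Rightarrow> height_class \<Rightarrow> height_class" where
  "minus_height_class g h = g + - h"

instance ..

end

lemma height_class_eqI: "u \<simeq> v \<Longrightarrow> height_class u = height_class v"
  using height_class_eq_iff by (auto simp: height_eq_def)

lemma height_class_add:
  assumes u: "height_fun u" and v: "height_fun v" and z: "zero_from c u" "zero_upto c v"
  shows "height_class (height_add u v) = height_class u + height_class v"
proof -
  have "height_class u + height_class v = height_class (height_stack u v)"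
    by (rule plus_height_class.abs_eq[OF height_eq_refl[OF u] height_eq_refl[OF v]])
  then show ?thesis using height_class_eqI[OF height_stack_add[OF u v z]] by simp
qed

lemma height_class_uminus:
  "height_fun u \<Longrightarrow> - height_class u = height_class (height_mirror 0 u)"
  by (rule uminus_height_class.abs_eq[OF height_eq_refl])

lemma height_class_zero: "0 = height_class (\<lambda>_. 0)"
  by (rule zero_height_class.abs_eq)

lemma height_class_shift:
  assumes "height_fun w" "even a" "even b"
  shows "height_class (height_shift a b w) = height_class w"
  using height_class_eqI[OF height_eq_even_shift[OF assms]] .

lemma height_class_rep_far:
  obtains w where "height_fun w" "g = height_class w" "zero_upto c w" "\<And>x y. x \<le> c \<Longrightarrow> w (x, y) = 0"
proof -
  obtain w where w: "height_fun w" "g = height_class w" by (rule height_class_cases)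
  obtain N where N: "N > 0" "\<And>x y. w (x, y) \<noteq> 0 \<Longrightarrow> \<bar>x\<bar> < N \<and> \<bar>y\<bar> < N"
    using height_fun_bounds[OF w(1)] by metis
  let ?a = "2 * (\<bar>c\<bar> + N)"
  let ?w = "height_shift ?a ?a w"
  have far: "w (x, y) = 0" if "x \<le> - N \<or> y \<le> - N" for x y using N(2)[of x y] that by fastforce
  show ?thesis
  proof (rule that[of ?w])
    show "height_fun ?w" by (rule height_fun_shift[OF w(1)])
    show "g = height_class ?w" using height_class_shift[OF w(1), of ?a ?a] w(2) by simp
    show "zero_upto c ?w" using N(1) by (auto simp: zero_upto_def intro!: far)
    show "?w (x, y) = 0" if "x \<le> c" for x y using N(1) that by (auto intro!: far)
  qed
qed

lemma height_class_rep_above: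
  obtains w where "height_fun w" "g = height_class w" "zero_upto c w"
  using height_class_rep_far by metis

lemma height_add_zero: "height_add u (\<lambda>_. 0) = u" "height_add (\<lambda>_. 0) u = u"
  by (auto simp: fun_eq_iff)

lemma height_add_assoc: "height_add (height_add u v) w = height_add u (height_add v w)"
  by (auto simp: fun_eq_iff)

lemma height_add_commute: "height_add u v = height_add v u"
  by (auto simp: fun_eq_iff)

lemma height_class_add_assoc: "(g + h) + k = g + (h + k :: height_class)"
proof -
  obtain u where u: "height_fun u" "g = height_class u" by (rule height_class_cases)
  obtain c where c: "zero_from c u" using height_fun_zero_from[OF u(1)] by blast
  obtain v where v: "height_fun v" "h = height_class v" "zero_upto c v" by (rule height_class_rep_above)
  obtain d' where d': "\<And>d. d \<ge> d' \<Longrightarrow> zero_from d v" using height_fun_zero_from[OF v(1)] by blast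
  define d where "d = max c d'"
  have d: "zero_from d v" "zero_from d u" "c \<le> d"
    using d' c by (auto simp: d_def intro: zero_from_mono)
  obtain w where w: "height_fun w" "k = height_class w" "zero_upto d w" by (rule height_class_rep_above)
  have uv: "height_fun (height_add u v)" "zero_from d (height_add u v)"
    using height_fun_add[OF u(1) v(1) c v(3)] d by (auto simp: zero_from_def)
  have vw: "height_fun (height_add v w)" "zero_upto c (height_add v w)"
    using height_fun_add[OF v(1) w(1) d(1) w(3)] v(3) w(3) d(3) by (auto simp: zero_upto_def)
  have "(g + h) + k = height_class (height_add (height_add u v) w)"
    using height_class_add[OF uv(1) w(1) uv(2) w(3)] height_class_add[OF u(1) v(1) c v(3)] u(2) v(2) w(2) by simp
  moreover have "g + (h + k) = height_class (height_add u (height_add v w))"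
    using height_class_add[OF u(1) vw(1) c vw(2)] height_class_add[OF v(1) w(1) d(1) w(3)] u(2) v(2) w(2) by simp
  ultimately show ?thesis by (simp add: height_add_assoc)
qed

lemma height_fun_add_columns:
  assumes u: "height_fun u" and v: "height_fun v"
    and "\<And>x y. x \<ge> c \<Longrightarrow> u (x, y) = 0" "\<And>x y. x \<le> c \<Longrightarrow> v (x, y) = 0"
  shows "height_fun (height_add u v)"
proof -
  have "height_fun (height_add (height_swap u) (height_swap v))"
    using height_fun_add[OF height_fun_swap[OF u] height_fun_swap[OF v], of c] assms(3,4)
    by (simp add: zero_from_def zero_upto_def)
  moreover have "height_swap (height_add (height_swap u) (height_swap v)) = height_add u v"
    by (auto simp: fun_eq_iff)
  ultimately show ?thesis using height_fun_swap by metis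
qed

text \<open>Commutativity: slide \<open>v\<close>, stacked above \<open>u\<close>, to the right until it is clear of \<open>u\<close>,
  and then down until it is below \<open>u\<close>.\<close>

lemma height_class_add_commute: "g + h = h + (g :: height_class)"
proof -
  obtain u where u: "height_fun u" "g = height_class u" by (rule height_class_cases)
  obtain N where N: "N > 0" "\<And>x y. u (x, y) \<noteq> 0 \<Longrightarrow> \<bar>x\<bar> < N \<and> \<bar>y\<bar> < N"
    using height_fun_bounds[OF u(1)] by metis
  have u0: "u (x, y) = 0" if "x \<ge> N \<or> y \<ge> N \<or> y \<le> - N" for x y using N(2)[of x y] that by fastforce
  obtain v where v: "height_fun v" "h = height_class v" "zero_upto N v" "\<And>x y. x \<le> N \<Longrightarrow> v (x, y) = 0"
    using height_class_rep_far[of h N] by blast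
  obtain M where M: "\<And>x y. v (x, y) \<noteq> 0 \<Longrightarrow> \<bar>x\<bar> < M \<and> \<bar>y\<bar> < M" "M > 0"
    using height_fun_bounds[OF v(1)] by metis
  define n where "n = nat (N + M)"
  have n: "int n = N + M" using N(1) M(2) by (simp add: n_def)
  let ?v = "height_shift 0 (- 2 * int n) v"
  have v0: "?v (x, y) = 0" if "y \<ge> - N" for x y
  proof -
    have "\<not> \<bar>y + 2 * int n\<bar> < M" using that n N(1) M(2) by simp
    then show ?thesis using M(1)[of x "y + 2 * int n"] by auto
  qed
  have hv: "height_fun ?v" by (rule height_fun_shift[OF v(1)])
  have "g + h = height_class (height_add u v)"
    using height_class_add[OF u(1) v(1) _ v(3)] u0 u(2) v(2) by (simp add: zero_from_def)
  also have "height_add u v \<simeq> height_add ?v u"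
  proof -
    let ?w = "height_add u ?v"
    have w: "height_fun ?w"
      by (rule height_fun_add_columns[OF u(1) hv, of N]) (use u0 v(4) in auto)
    have "(\<lambda>(x, y). if x > N then ?w (x, y - 2 * int n) else ?w (x, y)) \<simeq> ?w"
      by (rule half_plane_shift_rows[OF w]) (use u0 v(4) in auto)
    moreover have "(\<lambda>(x, y). if x > N then ?w (x, y - 2 * int n) else ?w (x, y)) = height_add u v"
      using u0 v(4) by (auto simp: fun_eq_iff)
    ultimately show ?thesis by (simp add: height_add_commute)
  qed
  then have "height_class (height_add u v) = height_class (height_add ?v u)" by (rule height_class_eqI)
  also have "\<dots> = height_class ?v + height_class u"
    by (rule height_class_add[OF hv u(1), of "- N"]) (use u0 v0 in \<open>auto simp: zero_from_def zero_upto_def\<close>)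
  also have "\<dots> = h + g" using height_class_shift[OF v(1), of 0 "- 2 * int n"] u(2) v(2) by simp
  finally show ?thesis .
qed

text \<open>Reflect \<open>u\<close> in a row \<open>N\<close> above its support. The sum of
  \<open>u\<close> and its reflection is symmetric about that row and collapses by
  \<open>fold_rows\<close>. The reflection in \<open>N\<close> differs from that in row 0 by the
  even shift \<open>2 * N\<close>.\<close>

lemma height_class_right_inverse: "g + - g = (0 :: height_class)"
proof -
  obtain u where u: "height_fun u" "g = height_class u" by (rule height_class_cases)
  obtain N where N: "\<And>c. c \<ge> N \<Longrightarrow> zero_from c u" "N > 0" using height_fun_zero_from[OF u(1)] by metis
  have z: "zero_upto N (height_mirror (2 * N) u)" using N(1)[of N] by (auto simp: zero_from_def zero_upto_def)
  have hm: "height_fun (height_mirror (2 * N) u)" by (rule height_fun_mirror[OF u(1)])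
  have "height_mirror (2 * N) u = height_shift 0 (2 * N) (height_mirror 0 u)" by (auto simp: fun_eq_iff)
  then have "- g = height_class (height_mirror (2 * N) u)"
    using height_class_uminus[OF u(1)] height_class_shift[OF height_fun_mirror[OF u(1)], of 0 "2 * N" 0] u(2) by simp
  then have "g + - g = height_class (height_add u (height_mirror (2 * N) u))"
    using height_class_add[OF u(1) hm N(1) z] u(2) by simp
  also have "\<dots> = 0" unfolding height_class_zero
    by (rule height_class_eqI[OF fold_rows[OF height_fun_add[OF u(1) hm N(1)[OF order_refl] z], of N]])
      (simp add: add.commute)
  finally show ?thesis .
qed

instance height_class :: ab_group_add
proof
  fix g h k :: height_class
  show "g + h + k = g + (h + k)" by (rule height_class_add_assoc)
  show "g + h = h + g" by (rule height_class_add_commute)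
  have "0 + g = g" for g :: height_class
  proof -
    obtain u where u: "height_fun u" "g = height_class u" by (rule height_class_cases)
    obtain c where "zero_upto c u" using height_fun_zero_from[OF u(1)] by blast
    then show ?thesis
      using height_class_add[OF height_fun_zero u(1), of c] u(2)
      by (simp add: height_class_zero height_add_zero zero_from_def)
  qed
  then show "0 + g = g" .
  show "- g + g = 0" using height_class_right_inverse height_class_add_commute by simp
  show "g - h = g + - h" by (simp add: minus_height_class_def)
qed

section \<open>Signed numbers of the vertices at each level\<close>

definition square_sign :: "int \<times> int \<Rightarrow> int" where
  "square_sign = (\<lambda>(x, y). if even (x + y) then - 1 else 1)"

definition level_set :: "int \<Rightarrow> (int \<times> int \<Rightarrow> int) \<Rightarrow> (int \<times> int) set" where
  "level_set m w = {(x, y). w (x, y) = m \<and> w (x - 1, y) = m \<and> w (x - 1, y - 1) = m \<and> w (x, y - 1) = m}"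

text \<open>The level set of 0 is infinite, hence the default value 0 there. The sign is that of a
  jewel in \<open>P\<close>: minus for white squares.\<close>

definition level_count :: "int \<Rightarrow> (int \<times> int \<Rightarrow> int) \<Rightarrow> int" where
  "level_count m w = (if m = 0 then 0 else \<Sum>v\<in>level_set m w. square_sign v)"

lemma finite_level_set:
  assumes "height_fun w" "m \<noteq> 0" shows "finite (level_set m w)"
  by (rule finite_subset[of _ "{f. w f \<noteq> 0}"]) (use assms in \<open>auto simp: height_fun_def level_set_def\<close>)

lemma level_count_swap: "level_count m (height_swap w) = level_count m w"
proof -
  have "(\<Sum>v\<in>level_set m (height_swap w). square_sign v) = (\<Sum>v\<in>level_set m w. square_sign v)"
    by (rule sum.reindex_bij_witness[of _ prod.swap prod.swap])
      (auto simp: level_set_def square_sign_def add.commute)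
  then show ?thesis by (simp add: level_count_def)
qed

text \<open>Here \<open>f\<close> differs from \<open>a\<close> by one. If \<open>c\<close> equals
  \<open>f\<close>, this is the forbidden pattern; if it lies on the other side of \<open>a\<close>,
  it differs from \<open>f\<close> by two.\<close>

lemma vertex_ok_corner: "vertex_ok f a c a \<Longrightarrow> f \<noteq> a \<Longrightarrow> c = a"
  by (auto simp: vertex_ok_def)

text \<open>Before the change every vertex of the face meets the two heights \<open>w (x, y)\<close>
  and \<open>a\<close>. Afterwards the two lower vertices enter the level set of \<open>a\<close>
  together, namely when the face below has height \<open>a\<close>
  (\<open>vertex_ok_corner\<close>), and likewise the two upper ones. Adjacent vertices have
  opposite signs, so nothing is gained.\<close>

lemma level_count_set:
  assumes w: "height_fun w" and f: "w (x, y) \<noteq> a" and n: "w (x - 1, y) = a" "w (x + 1, y) = a"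
  shows "level_count m (w((x, y) := a)) = level_count m w"
proof (cases "m = 0")
  case False
  let ?w = "w((x, y) := a)"
  let ?C = "{(x, y), (x + 1, y), (x, y + 1), (x + 1, y + 1)}"
  let ?S = "level_set m w" and ?S' = "level_set m ?w"
  have v: "valid w" using w by (simp add: height_fun_def)
  have fin: "finite ?S" "finite ?S'"
    using finite_level_set[OF w False] finite_level_set[OF height_fun_set[OF w] False] n by auto
  have ok: "vertex_ok (w (x, y)) a (w (x - 1, y - 1)) (w (x, y - 1))"
    "vertex_ok (w (x, y)) (w (x, y - 1)) (w (x + 1, y - 1)) a"
    "vertex_ok (w (x, y)) (w (x, y + 1)) (w (x - 1, y + 1)) a"
    "vertex_ok (w (x, y)) a (w (x + 1, y + 1)) (w (x, y + 1))"
    using validD[OF v, of x y] vertex_ok_rotate[THEN iffD1, OF validD[OF v, of "x + 1" y]]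
      vertex_ok_rotate[THEN iffD2, OF validD[OF v, of x "y + 1"]]
      vertex_ok_rotate[THEN iffD2, OF vertex_ok_rotate[THEN iffD2, OF validD[OF v, of "x + 1" "y + 1"]]] n
    by simp_all
  have out: "?S \<inter> ?C = {}" using f n by (auto simp: level_set_def)
  have off: "?S - ?C = ?S' - ?C" by (auto simp: level_set_def)
  have bottom: "(x, y) \<in> ?S' \<longleftrightarrow> (x + 1, y) \<in> ?S'"
    using n ok(1,2) vertex_ok_corner f vertex_ok_transpose by (auto simp: level_set_def)
  have top: "(x, y + 1) \<in> ?S' \<longleftrightarrow> (x + 1, y + 1) \<in> ?S'"
    using n ok(3,4) vertex_ok_corner f vertex_ok_transpose by (auto simp: level_set_def)
  have "(\<Sum>v\<in>?S'. square_sign v) = (\<Sum>v\<in>?S' - ?C. square_sign v) + (\<Sum>v\<in>?C \<inter> ?S'. square_sign v)"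
    using sum.Int_Diff[OF fin(2), of square_sign ?C] by (simp add: add.commute Int_commute)
  also have "(\<Sum>v\<in>?C \<inter> ?S'. square_sign v) = (\<Sum>v\<in>?C. if v \<in> ?S' then square_sign v else 0)"
    by (rule sum.inter_restrict) simp
  also have "\<dots> = 0" using bottom top by (simp add: square_sign_def)
  also have "?S' - ?C = ?S" using off out by blast
  finally show ?thesis using False unfolding level_count_def by presburger
qed (simp add: level_count_def)

lemma level_count_eq: "w \<simeq> w' \<Longrightarrow> level_count m w = level_count m w'"
proof (induction rule: height_eq_induct)
  case (step w w')
  then obtain x y a where h: "height_fun w" and w': "w' = w((x, y) := a)"
    and n: "w (x - 1, y) = a \<and> w (x + 1, y) = a \<or> w (x, y - 1) = a \<and> w (x, y + 1) = a"
    unfolding height_step_def by blast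
  show ?case
  proof (cases "w (x, y) = a")
    case True
    then have "w' = w" by (auto simp: w')
    then show ?thesis by simp
  next
    case False
    from n show ?thesis
    proof
      assume "w (x - 1, y) = a \<and> w (x + 1, y) = a"
      then show ?thesis unfolding w' by (intro level_count_set[OF h False, symmetric]) auto
    next
      assume "w (x, y - 1) = a \<and> w (x, y + 1) = a"
      then have "level_count m ((height_swap w)((y, x) := a)) = level_count m (height_swap w)"
        by (intro level_count_set[OF height_fun_swap[OF h]]) (use False \<open>w (x, y - 1) = a \<and> _\<close> in auto)
      moreover have "(height_swap w)((y, x) := a) = height_swap w'" by (auto simp: w' fun_eq_iff)
      ultimately show ?thesis by (simp add: level_count_swap)
    qed
  qed
qed auto

lemma level_count_add:
  assumes u: "height_fun u" and v: "height_fun v" and z: "zero_from c u" "zero_upto c v"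
  shows "level_count m (height_add u v) = level_count m u + level_count m v"
proof (cases "m = 0")
  case False
  have "(x, y) \<in> level_set m (height_add u v) \<longleftrightarrow> (x, y) \<in> level_set m u \<union> level_set m v" for x y
    using z False by (cases "y \<le> c") (auto simp: level_set_def zero_from_def zero_upto_def)
  then have "level_set m (height_add u v) = level_set m u \<union> level_set m v" by auto
  moreover have "level_set m u \<inter> level_set m v = {}"
  proof -
    have "(x, y) \<notin> level_set m u \<or> (x, y) \<notin> level_set m v" for x y
      using z False by (cases "y \<le> c") (auto simp: level_set_def zero_from_def zero_upto_def)
    then show ?thesis by auto
  qed
  ultimately show ?thesis
    using finite_level_set[OF u False] finite_level_set[OF v False]
    by (simp add: level_count_def sum.union_disjoint)
qed (simp add: level_count_def)

lift_definition class_count :: "int \<Rightarrow> height_class \<Rightarrow> int" is level_count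
  by (rule level_count_eq)

lemma class_count_class: "height_fun w \<Longrightarrow> class_count m (height_class w) = level_count m w"
  by (rule class_count.abs_eq[OF height_eq_refl])

lemma class_count_add: "class_count m (g + h) = class_count m g + class_count m h"
proof -
  obtain u where u: "height_fun u" "g = height_class u" by (rule height_class_cases)
  obtain c where c: "zero_from c u" using height_fun_zero_from[OF u(1)] by blast
  obtain v where v: "height_fun v" "h = height_class v" "zero_upto c v" by (rule height_class_rep_above)
  have "g + h = height_class (height_add u v)" using height_class_add[OF u(1) v(1) c v(3)] u(2) v(2) by simp
  then show ?thesis
    using level_count_add[OF u(1) v(1) c v(3)] u v height_fun_add[OF u(1) v(1) c v(3)]
    by (simp add: class_count_class)
qed

lemma class_count_zero: "class_count m 0 = 0"
  using class_count_add[of m 0 0] by simp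

lemma class_count_uminus: "class_count m (- g) = - class_count m g"
  using class_count_add[of m g "- g"] by (simp add: class_count_zero)

lemma class_count_diff: "class_count m (g - h) = class_count m g - class_count m h"
  using class_count_add[of m g "- h"] by (simp add: class_count_uminus)

subsection \<open>Pyramids\<close>

text \<open>The faces \<open>p - 1\<close> and \<open>p\<close> on either side of the vertex
  \<open>p\<close> both have index 0. So a pyramid is centred at a vertex, and its top is the block
  of the four faces around that vertex; for negative \<open>k\<close> it is a pit.\<close>

definition ring_index :: "int \<Rightarrow> int \<Rightarrow> int" where
  "ring_index p x = (if x \<ge> p then x - p else p - 1 - x)"

definition pyramid :: "int \<Rightarrow> int \<Rightarrow> int \<Rightarrow> int \<times> int \<Rightarrow> int" where
  "pyramid k p q = (\<lambda>(x, y). sgn k * max 0 (\<bar>k\<bar> - max (ring_index p x) (ring_index q y)))"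

text \<open>Such a map cannot create the forbidden pattern: if it shows up among the images, then
  \<open>a\<close> and \<open>c\<close> both differ from \<open>b\<close> and from \<open>d\<close>,
  and four integers with pairwise distance at most one then satisfy \<open>a = c\<close> and
  \<open>b = d\<close>.\<close>

lemma vertex_ok_lipschitz:
  assumes "vertex_ok a b c d" and "\<And>x y. x \<le> y \<Longrightarrow> g x \<le> g y \<and> g y - g x \<le> y - x"
  shows "vertex_ok (g a) (g b) (g c) (g d :: int)"
proof -
  have l: "\<bar>g x - g y\<bar> \<le> \<bar>x - y\<bar>" for x y
    using assms(2)[of x y] assms(2)[of y x] by (cases "x \<le> y") auto
  have le: "\<bar>a - b\<bar> \<le> 1" "\<bar>b - c\<bar> \<le> 1" "\<bar>c - d\<bar> \<le> 1" "\<bar>d - a\<bar> \<le> 1" "\<bar>a - c\<bar> \<le> 1" "\<bar>b - d\<bar> \<le> 1"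
    and s: "\<not> (a = c \<and> b = d \<and> a \<noteq> b)"
    using assms(1) by (auto simp: vertex_ok_def)
  have "\<not> (g a = g c \<and> g b = g d \<and> g a \<noteq> g b)"
  proof
    assume "g a = g c \<and> g b = g d \<and> g a \<noteq> g b"
    then have "a \<noteq> b" "c \<noteq> b" "a \<noteq> d" "c \<noteq> d" by auto
    then have "a = c" "b = d" using le by linarith+
    then show False using s \<open>a \<noteq> b\<close> by simp
  qed
  moreover have "\<bar>g a - g b\<bar> \<le> 1" "\<bar>g b - g c\<bar> \<le> 1" "\<bar>g c - g d\<bar> \<le> 1" "\<bar>g d - g a\<bar> \<le> 1"
    "\<bar>g a - g c\<bar> \<le> 1" "\<bar>g b - g d\<bar> \<le> 1"
    using l[of a b] l[of b c] l[of c d] l[of d a] l[of a c] l[of b d] le by linarith+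
  ultimately show ?thesis by (simp add: vertex_ok_def)
qed

lemma vertex_ok_max:
  assumes "\<bar>a - a'\<bar> \<le> 1" "\<bar>b - b'\<bar> \<le> (1 :: int)"
  shows "vertex_ok (max a b) (max a' b) (max a' b') (max a b')"
proof -
  have "a' = a \<or> a' = a + 1 \<or> a' = a - 1" "b' = b \<or> b' = b + 1 \<or> b' = b - 1"
    "a \<le> b - 2 \<or> a = b - 1 \<or> a = b \<or> a = b + 1 \<or> a \<ge> b + 2"
    using assms by linarith+
  then show ?thesis by (elim disjE) (simp_all add: vertex_ok_def max_def)
qed

lemma ring_index_lipschitz: "\<bar>ring_index p x - ring_index p (x - 1)\<bar> \<le> 1"
  by (simp add: ring_index_def)

lemma vertex_ok_uminus: "vertex_ok (- a) (- b) (- c) (- d) \<longleftrightarrow> vertex_ok a b c d"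
proof -
  have "- x - - y = - (x - y)" for x y :: int by simp
  then show ?thesis by (simp only: vertex_ok_def neg_equal_iff_equal abs_minus_cancel)
qed

lemma height_fun_pyramid: "height_fun (pyramid k p q)"
proof -
  have "{f. pyramid k p q f \<noteq> 0} \<subseteq> {p - \<bar>k\<bar>..p + \<bar>k\<bar>} \<times> {q - \<bar>k\<bar>..q + \<bar>k\<bar>}"
    by (auto simp: pyramid_def ring_index_def split: if_splits)
  then have "finite {f. pyramid k p q f \<noteq> 0}" by (rule finite_subset) simp
  moreover have "valid (pyramid k p q)"
    unfolding valid_def
  proof (intro allI)
    fix x y
    let ?r = "\<lambda>x y. max (ring_index p x) (ring_index q y)"
    have "vertex_ok (?r x y) (?r (x - 1) y) (?r (x - 1) (y - 1)) (?r x (y - 1))"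
      by (rule vertex_ok_max) (rule ring_index_lipschitz)+
    then have "vertex_ok (- ?r x y) (- ?r (x - 1) y) (- ?r (x - 1) (y - 1)) (- ?r x (y - 1))"
      by (simp only: vertex_ok_uminus)
    moreover have "max 0 (\<bar>k\<bar> + s) \<le> max 0 (\<bar>k\<bar> + t) \<and> max 0 (\<bar>k\<bar> + t) - max 0 (\<bar>k\<bar> + s) \<le> t - s"
      if "s \<le> t" for s t :: int
      using that by linarith
    ultimately have *: "vertex_ok (max 0 (\<bar>k\<bar> - ?r x y)) (max 0 (\<bar>k\<bar> - ?r (x - 1) y))
      (max 0 (\<bar>k\<bar> - ?r (x - 1) (y - 1))) (max 0 (\<bar>k\<bar> - ?r x (y - 1)))"
      using vertex_ok_lipschitz[where g = "\<lambda>t. max 0 (\<bar>k\<bar> + t)"] by fastforce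
    consider "k = 0" | "k > 0" | "k < 0" by linarith
    then show "vertex_ok (pyramid k p q (x, y)) (pyramid k p q (x - 1, y))
      (pyramid k p q (x - 1, y - 1)) (pyramid k p q (x, y - 1))"
      by cases (use * vertex_ok_uminus in \<open>simp_all add: pyramid_def\<close>)
  qed
  ultimately show ?thesis by (simp add: height_fun_def)
qed

lemma pyramid_uminus: "(\<lambda>f. - pyramid k p q f) = pyramid (- k) p q"
  by (auto simp: pyramid_def fun_eq_iff)

lemma pyramid_shift: "height_shift a b (pyramid k p q) = pyramid k (p + a) (q + b)"
  by (auto simp: pyramid_def ring_index_def fun_eq_iff algebra_simps)

lemma pyramid_mirror: "height_mirror 0 (pyramid k p q) = pyramid k p (1 - q)"
  by (auto simp: pyramid_def ring_index_def fun_eq_iff)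

lemma pyramid_swap: "height_swap (pyramid k p q) = pyramid k q p"
  by (auto simp: pyramid_def fun_eq_iff max.commute)

subsection \<open>Extracting a pyramid at a corner\<close>

text \<open>
  The outer corners of \<open>k\<close> nested curves lie on a diagonal, with free vertices at both of its ends:
  \<open>(0, 1)\<close> at level \<open>0\<close> and \<open>(- k, k + 1)\<close> at level \<open>k\<close>.  Passing from \<open>w\<close> to \<open>w'\<close>
  cuts off the \<open>k\<close> corners.
\<close>

locale corner_nest =
  fixes w w' :: "int \<times> int \<Rightarrow> int" and k :: int
  assumes w: "height_fun w" and w': "height_fun w'" and k: "k > 0"
    and cut: "\<And>x y. w' (x, y) = w (x, y) - (if 1 \<le> y \<and> y \<le> k \<and> x = - y then 1 else 0)"
    and below: "\<And>x y. y \<le> 0 \<Longrightarrow> w (x, y) = 0"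
    and trapezoid: "\<And>x y. 0 \<le> y \<Longrightarrow> y \<le> k \<Longrightarrow> - 2 * k + y - 1 \<le> x \<Longrightarrow> x \<le> - y \<Longrightarrow> w (x, y) = y"
    and edge: "\<And>y. 0 \<le> y \<Longrightarrow> y \<le> k \<Longrightarrow> w (- y, y + 1) = y"
begin

lemma w'_eq: "\<not> (1 \<le> y \<and> y \<le> k \<and> x = - y) \<Longrightarrow> w' (x, y) = w (x, y)"
  by (simp add: cut)

lemma ok: "vertex_ok (w (x, y)) (w (x - 1, y)) (w (x - 1, y - 1)) (w (x, y - 1))"
  using validD w by (simp add: height_fun_def)

lemma ok': "vertex_ok (w' (x, y)) (w' (x - 1, y)) (w' (x - 1, y - 1)) (w' (x, y - 1))"
  using validD w' by (simp add: height_fun_def)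

lemma ok'_reverse: "vertex_ok (w' (x, y - 1)) (w' (x - 1, y - 1)) (w' (x - 1, y)) (w' (x, y))"
  using ok' vertex_ok_reverse by blast

text \<open>For large \<open>c\<close> this is \<open>w\<close> stacked with a mirror image of
  \<open>w'\<close>, hence a representative of the difference of the two classes
  (\<open>class_diff\<close>). Since \<open>w\<close> and \<open>w'\<close> agree above the row
  \<open>k\<close>, the mirror can be lowered to the row \<open>k + 1\<close>.\<close>

definition fold_at :: "int \<Rightarrow> int \<times> int \<Rightarrow> int" where
  "fold_at c = (\<lambda>(x, y). if y \<le> c then w (x, y) else w' (x, 2 * c - y))"

lemma height_fun_fold_at:
  assumes "c \<ge> k + 1" shows "height_fun (fold_at c)"
proof -
  have "{f. fold_at c f \<noteq> 0} \<subseteq> {f. w f \<noteq> 0} \<union> {f. height_mirror (2 * c) w' f \<noteq> 0}"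
    by (auto simp: fold_at_def split: if_splits)
  then have "finite {f. fold_at c f \<noteq> 0}"
    by (rule finite_subset) (use w height_fun_mirror[OF w'] in \<open>auto simp: height_fun_def\<close>)
  moreover have "valid (fold_at c)"
    unfolding valid_def
  proof (intro allI)
    fix x y
    have w'c: "w' (x, c) = w (x, c)" for x using assms by (simp add: w'_eq)
    show "vertex_ok (fold_at c (x, y)) (fold_at c (x - 1, y)) (fold_at c (x - 1, y - 1)) (fold_at c (x, y - 1))"
    proof (cases "y \<le> c")
      case True
      then show ?thesis using ok by (simp add: fold_at_def)
    next
      case False
      have "fold_at c (x, y - 1) = w' (x, 2 * c - y + 1)" for x
      proof -
        have "w' (x, 2 * c - (y - 1)) = w' (x, 2 * c - y + 1)" by (rule arg_cong[where f = w']) simp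
        then show ?thesis using False w'c by (cases "y = c + 1") (auto simp: fold_at_def)
      qed
      then show ?thesis using False ok'_reverse[of x "2 * c - y + 1"] by (simp add: fold_at_def)
    qed
  qed
  ultimately show ?thesis by (simp add: height_fun_def)
qed

text \<open>With the mirror in the row \<open>c + 1\<close>, the rows \<open>c\<close> and
  \<open>c + 2\<close> are both equal to row \<open>c\<close> of \<open>w\<close>. Vertical steps
  give the row between them the same values, and the three equal rows are reduced to one by
  \<open>insert_rows\<close>.\<close>

lemma fold_at_Suc:
  assumes "c \<ge> k + 1" shows "fold_at (c + 1) \<simeq> fold_at c"
proof -
  let ?u = "\<lambda>(x, y). fold_at c (x, if y \<le> c then y else if y \<le> c + 2 then c else y - 2)"
  let ?v = "fold_at (c + 1)"
  have w'c: "w' (x, c) = w (x, c)" for x using assms by (simp add: w'_eq)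
  have u: "?u (x, y) = (if y = c + 1 then w (x, c) else ?v (x, y))" for x y
  proof -
    consider "y \<le> c" | "y = c + 1" | "y = c + 2" | "y > c + 2" by linarith
    then show ?thesis by cases (simp_all add: fold_at_def w'c algebra_simps)
  qed
  have hv: "height_fun ?v" using height_fun_fold_at[of "c + 1"] assms by simp
  have "{f. ?u f \<noteq> ?v f} \<subseteq> fst ` {f. w f \<noteq> 0} \<times> {c + 1}"
  proof
    fix f assume "f \<in> {f. ?u f \<noteq> ?v f}"
    moreover obtain x y where f: "f = (x, y)" by fastforce
    ultimately have "?u (x, y) \<noteq> ?v (x, y)" by simp
    then have "y = c + 1" "w (x, c) \<noteq> w (x, c + 1)" unfolding u by (auto simp: fold_at_def split: if_splits)
    moreover have "w (x, c) \<noteq> 0 \<or> w (x, c + 1) \<noteq> 0" using calculation by auto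
    then have "x \<in> fst ` {f. w f \<noteq> 0}" by (metis (mono_tags) fst_conv image_eqI mem_Collect_eq)
    ultimately show "f \<in> fst ` {f. w f \<noteq> 0} \<times> {c + 1}" unfolding f by simp
  qed
  then have "finite {f. ?u f \<noteq> ?v f}"
    by (rule finite_subset) (use w in \<open>simp add: height_fun_def\<close>)
  then have "?v \<simeq> ?u"
  proof (rule conjunct2[OF height_eq_simultaneous[OF hv]])
    fix x y assume "?u (x, y) \<noteq> ?v (x, y)"
    then have y: "y = c + 1" unfolding u by (auto split: if_splits)
    have vals: "?u (x, c + 1) = w (x, c)" "?u (x, c + 1 - 1) = w (x, c)" "?u (x, c + 1 + 1) = w (x, c)"
      "?v (x, c + 1 - 1) = w (x, c)" "?v (x, c + 1 + 1) = w (x, c)"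
      unfolding u by (simp_all add: fold_at_def w'c)
    then show "?v (x - 1, y) = ?u (x, y) \<and> ?v (x + 1, y) = ?u (x, y) \<and>
       ?u (x - 1, y) = ?u (x, y) \<and> ?u (x + 1, y) = ?u (x, y) \<or>
       ?v (x, y - 1) = ?u (x, y) \<and> ?v (x, y + 1) = ?u (x, y) \<and>
       ?u (x, y - 1) = ?u (x, y) \<and> ?u (x, y + 1) = ?u (x, y)"
      unfolding y by (simp only: vals simp_thms)
  qed
  then show ?thesis using insert_rows[OF height_fun_fold_at[OF assms], of c] height_eq_trans by blast
qed

lemma fold_at_eq: "fold_at (k + 1 + int n) \<simeq> fold_at (k + 1)"
proof (induction n)
  case 0
  show ?case using height_eq_refl[OF height_fun_fold_at[of "k + 1"]] by simp
next
  case (Suc n)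
  have "fold_at (k + 1 + int n + 1) \<simeq> fold_at (k + 1 + int n)" by (rule fold_at_Suc) simp
  from height_eq_trans[OF this Suc] show ?case by (simp add: algebra_simps)
qed

lemma class_diff: "height_class w - height_class w' = height_class (fold_at (k + 1))"
proof -
  obtain N where N: "\<And>c. c \<ge> N \<Longrightarrow> zero_from c w" using height_fun_zero_from[OF w] by metis
  obtain N' where N': "\<And>c. c \<ge> N' \<Longrightarrow> zero_from c w'" using height_fun_zero_from[OF w'] by metis
  define n where "n = nat (\<bar>N\<bar> + \<bar>N'\<bar>)"
  define c where "c = k + 1 + int n"
  have "c \<ge> N" "c \<ge> N'" using k by (auto simp: c_def n_def)
  then have z: "zero_from c w" "zero_from c w'" using N N' by auto
  have zu: "zero_upto c (height_mirror (2 * c) w')" using z(2) by (simp add: zero_upto_def zero_from_def)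
  have hm: "height_fun (height_mirror (2 * c) w')" by (rule height_fun_mirror[OF w'])
  have "height_mirror (2 * c) w' = height_shift 0 (2 * c) (height_mirror 0 w')" by (auto simp: fun_eq_iff)
  then have "height_class (height_mirror (2 * c) w') = - height_class w'"
    using height_class_uminus[OF w'] height_class_shift[OF height_fun_mirror[OF w'], of 0 "2 * c" 0] by simp
  then have "height_class w - height_class w' = height_class (height_add w (height_mirror (2 * c) w'))"
    using height_class_add[OF w hm z(1) zu] by simp
  also have "height_add w (height_mirror (2 * c) w') = fold_at c"
  proof (intro ext, clarify)
    fix x y
    show "height_add w (height_mirror (2 * c) w') (x, y) = fold_at c (x, y)"
      using z by (cases "y = c") (auto simp: fold_at_def zero_from_def)
  qed
  also have "height_class (fold_at c) = height_class (fold_at (k + 1))"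
    unfolding c_def by (rule height_class_eqI[OF fold_at_eq])
  finally show ?thesis .
qed

abbreviation pyr :: "int \<times> int \<Rightarrow> int" where
  "pyr \<equiv> pyramid k (- k) (k + 1)"

text \<open>The levels above \<open>j - 1\<close> have been reduced to those of the pyramid.\<close>

definition stage :: "int \<Rightarrow> int \<times> int \<Rightarrow> int" where
  "stage j = (\<lambda>(x, y). if y < j then w (x, y)
     else if y > 2 * k + 2 - j then w' (x, 2 * k + 2 - y)
     else if - 2 * k + j - 1 \<le> x \<and> x \<le> - j then max (j - 1) (pyr (x, y))
     else w (x, j - 1))"

text \<open>The row \<open>k + 1\<close> lies between row \<open>k\<close> of \<open>w\<close> and
  the reflected row \<open>k\<close> of \<open>w'\<close>. These agree except at the cut corner, in
  the column \<open>- k\<close>, and there rows \<open>k\<close> and \<open>k + 1\<close> of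
  \<open>w\<close> already have the same height \<open>k\<close>.\<close>

lemma stage_first: "fold_at (k + 1) \<simeq> stage (k + 1)"
proof -
  let ?v = "fold_at (k + 1)" and ?u = "stage (k + 1)"
  have u: "?u (x, y) = (if y = k + 1 then w (x, k) else ?v (x, y))" for x y
    by (auto simp: stage_def fold_at_def)
  have hv: "height_fun ?v" by (rule height_fun_fold_at) simp
  have "{f. ?u f \<noteq> ?v f} \<subseteq> fst ` {f. w f \<noteq> 0} \<times> {k + 1}"
  proof
    fix f assume "f \<in> {f. ?u f \<noteq> ?v f}"
    moreover obtain x y where f: "f = (x, y)" by fastforce
    ultimately have "?u (x, y) \<noteq> ?v (x, y)" by simp
    then have "y = k + 1" "w (x, k) \<noteq> w (x, k + 1)" unfolding u by (auto simp: fold_at_def split: if_splits)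
    moreover have "w (x, k) \<noteq> 0 \<or> w (x, k + 1) \<noteq> 0" using calculation by auto
    then have "x \<in> fst ` {f. w f \<noteq> 0}" by (metis (mono_tags) fst_conv image_eqI mem_Collect_eq)
    ultimately show "f \<in> fst ` {f. w f \<noteq> 0} \<times> {k + 1}" unfolding f by simp
  qed
  then have "finite {f. ?u f \<noteq> ?v f}"
    by (rule finite_subset) (use w in \<open>simp add: height_fun_def\<close>)
  then show ?thesis
  proof (rule conjunct2[OF height_eq_simultaneous[OF hv]])
    fix x y assume ne: "?u (x, y) \<noteq> ?v (x, y)"
    then have y: "y = k + 1" unfolding u by (auto split: if_splits)
    have "x \<noteq> - k"
    proof
      assume "x = - k"
      then show False using ne y trapezoid[of k "- k"] edge[of k] k by (simp add: u fold_at_def)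
    qed
    then have w'x: "w' (x, k) = w (x, k)" by (simp add: w'_eq)
    have vals: "?u (x, k + 1) = w (x, k)" "?u (x, k + 1 - 1) = w (x, k)" "?u (x, k + 1 + 1) = w (x, k)"
      "?v (x, k + 1 - 1) = w (x, k)" "?v (x, k + 1 + 1) = w (x, k)"
      unfolding u by (simp_all add: fold_at_def w'x)
    then show "?v (x - 1, y) = ?u (x, y) \<and> ?v (x + 1, y) = ?u (x, y) \<and>
       ?u (x - 1, y) = ?u (x, y) \<and> ?u (x + 1, y) = ?u (x, y) \<or>
       ?v (x, y - 1) = ?u (x, y) \<and> ?v (x, y + 1) = ?u (x, y) \<and>
       ?u (x, y - 1) = ?u (x, y) \<and> ?u (x, y + 1) = ?u (x, y)"
      unfolding y by (simp only: vals simp_thms)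
  qed
qed

lemma stage_last: "stage 1 = pyr"
proof (intro ext, clarify)
  fix x y
  have w'0: "w' (x, q) = 0" if "q \<le> 0" for q using that below by (simp add: w'_eq)
  have far: "pyr (x, y) = 0" if "y < 1 \<or> y > 2 * k + 1 \<or> x < - 2 * k \<or> x > - 1"
    using that k by (auto simp: pyramid_def ring_index_def)
  have nn: "pyr (x, y) \<ge> 0" using k by (simp add: pyramid_def)
  consider "y < 1" | "y > 2 * k + 1" | "1 \<le> y" "y \<le> 2 * k + 1" "- 2 * k \<le> x" "x \<le> - 1"
    | "1 \<le> y" "y \<le> 2 * k + 1" "x < - 2 * k \<or> x > - 1" by linarith
  then show "stage 1 (x, y) = pyr (x, y)"
  proof cases
    case 1
    then show ?thesis using far below by (simp add: stage_def)
  next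
    case 2
    then show ?thesis using far w'0 k by (simp add: stage_def)
  next
    case 3
    then show ?thesis using nn by (simp add: stage_def)
  next
    case 4
    then show ?thesis using far below by (auto simp: stage_def)
  qed
qed

lemma finite_difference:
  fixes u v :: "int \<times> int \<Rightarrow> int"
  assumes "finite {f. u f \<noteq> 0}" "finite {f. v f \<noteq> 0}" shows "finite {f. u f \<noteq> v f}"
  by (rule finite_subset[of _ "{f. u f \<noteq> 0} \<union> {f. v f \<noteq> 0}"]) (use assms in auto)

lemma finite_patch:
  assumes "\<And>x y. y < j \<Longrightarrow> u (x, y) = w (x, y)"
    and "\<And>x y. y > t \<Longrightarrow> u (x, y) = w' (x, 2 * k + 2 - y)"
    and "\<And>x y. x < a \<or> x > b \<Longrightarrow> j \<le> y \<Longrightarrow> y \<le> t \<Longrightarrow> u (x, y) = w (x, j) \<or> u (x, y) = w (x, j - 1)"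
  shows "finite {f. u f \<noteq> (0 :: int)}"
proof -
  have "{f. u f \<noteq> 0} \<subseteq> {f. w f \<noteq> 0} \<union> {f. height_mirror (2 * k + 2) w' f \<noteq> 0} \<union>
      (fst ` {f. w f \<noteq> 0} \<union> {a..b}) \<times> {j..t}"
  proof
    fix f assume "f \<in> {f. u f \<noteq> 0}"
    moreover obtain x y where f: "f = (x, y)" by fastforce
    ultimately have u: "u (x, y) \<noteq> 0" by simp
    consider "y < j" | "y > t" | "j \<le> y" "y \<le> t" "a \<le> x" "x \<le> b" | "j \<le> y" "y \<le> t" "x < a \<or> x > b" by linarith
    then show "f \<in> {f. w f \<noteq> 0} \<union> {f. height_mirror (2 * k + 2) w' f \<noteq> 0} \<union>
      (fst ` {f. w f \<noteq> 0} \<union> {a..b}) \<times> {j..t}"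
    proof cases
      case 4
      then have "w (x, j) \<noteq> 0 \<or> w (x, j - 1) \<noteq> 0" using assms(3)[of x y] u by auto
      then have "x \<in> fst ` {f. w f \<noteq> 0}" by (metis (mono_tags) fst_conv image_eqI mem_Collect_eq)
      then show ?thesis using 4 f by simp
    qed (use u assms(1,2)[of y x] f in auto)
  qed
  then show ?thesis
    by (rule finite_subset) (use w height_fun_mirror[OF w'] in \<open>auto simp: height_fun_def\<close>)
qed

context
  fixes j :: int
  assumes j: "1 \<le> j" "j \<le> k"
begin

abbreviation left :: int where "left \<equiv> - 2 * k + j - 1"
abbreviation top :: int where "top \<equiv> 2 * k + 2 - j"

lemma left_less: "left < - j"
  using j by simp

lemma row_j: "left \<le> x \<Longrightarrow> x \<le> - j \<Longrightarrow> w (x, j) = j"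
  using trapezoid j by simp

lemma row_below: "left - 1 \<le> x \<Longrightarrow> x \<le> - j + 1 \<Longrightarrow> w (x, j - 1) = j - 1"
  using trapezoid[of "j - 1" x] j by simp

lemma right_of_corner: "w (- j + 1, j) = j - 1"
  using edge[of "j - 1"] j by simp

lemma left_of_row: "w (left - 1, j) = j \<or> w (left - 1, j) = j - 1"
  using ok[of left j] row_j[of left] row_below[of left] row_below[of "left - 1"] j
  by (auto simp: vertex_ok_def)

lemma row_j': "w' (x, j) = w (x, j) - (if x = - j then 1 else 0)"
  using j by (simp add: cut)

lemma row_below': "x \<noteq> - j + 1 \<Longrightarrow> w' (x, j - 1) = w (x, j - 1)"
  using j by (auto simp: cut)

lemma pyr_rim:
  assumes "left \<le> x" "x \<le> - j" "j \<le> y" "y < top"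
  shows "pyr (x, y) \<ge> j" "x = left \<or> x = - j \<or> y = j \<or> y = top - 1 \<Longrightarrow> pyr (x, y) = j"
  using assms j k by (auto simp: pyramid_def ring_index_def)

lemma pyr_above:
  assumes "y \<ge> top" shows "pyr (x, y) \<le> j - 1"
  using assms j k by (auto simp: pyramid_def ring_index_def)

lemma ok_pyr: "vertex_ok (pyr (x, y)) (pyr (x - 1, y)) (pyr (x - 1, y - 1)) (pyr (x, y - 1))"
  using validD height_fun_pyramid by (auto simp: height_fun_def)

text \<open>From \<open>stage (j + 1)\<close> to \<open>stage j\<close>, the rows \<open>j\<close>
  to \<open>top\<close> beside the pyramid change from row \<open>j\<close> of \<open>w\<close> to
  row \<open>j - 1\<close>, and the part of the row \<open>top\<close> over the pyramid drops from
  \<open>j\<close> to \<open>j - 1\<close>. Adjacent cells change, so detours are needed: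
  \<open>zigzag_rows\<close> alternates the two rows, \<open>zigzag_top\<close> the two heights, and
  \<open>half_stage\<close> lies between. As \<open>top - j\<close> is even, the outermost
  alternating rows both carry row \<open>j\<close>. In the row \<open>top\<close> the cut corner at
  \<open>- j\<close> is already at \<open>j - 1\<close>; this leaves a run of odd length from
  \<open>left\<close> to \<open>- j - 1\<close>, which can alternate so that it starts and ends with
  \<open>j\<close>.\<close>

definition zigzag_rows :: "int \<times> int \<Rightarrow> int" where
  "zigzag_rows = (\<lambda>(x, y). if y < j then w (x, y) else if y > top then w' (x, 2 * k + 2 - y)
     else if left \<le> x \<and> x \<le> - j then (if y < top then pyr (x, y) else if x = - j then j - 1 else j)
     else if even (y - j) then w (x, j) else w (x, j - 1))"

definition half_stage :: "int \<times> int \<Rightarrow> int" where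
  "half_stage = (\<lambda>(x, y). if y < j then w (x, y) else if y > top then w' (x, 2 * k + 2 - y)
     else if left \<le> x \<and> x \<le> - j then (if y < top then pyr (x, y) else if x = - j then j - 1 else j)
     else w (x, j - 1))"

definition zigzag_top :: "int \<times> int \<Rightarrow> int" where
  "zigzag_top = (\<lambda>(x, y). if y < j then w (x, y) else if y > top then w' (x, 2 * k + 2 - y)
     else if left \<le> x \<and> x \<le> - j then (if y < top then pyr (x, y) else if even (x + j) then j - 1 else j)
     else w (x, j - 1))"

lemma ok_bottom: "vertex_ok (w (x, j)) (w (x - 1, j)) (w (x - 1, j - 1)) (w (x, j - 1))"
  by (rule ok)

lemma ok_bottom': "vertex_ok (w (x, j - 1)) (w (x - 1, j - 1)) (w (x - 1, j)) (w (x, j))"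
  using ok vertex_ok_reverse by blast

lemma ok_row: "vertex_ok (w (x, i)) (w (x - 1, i)) (w (x - 1, i)) (w (x, i))"
  using ok[of x i] by (simp add: vertex_ok_def abs_minus_commute)

text \<open>Beside the pyramid the rows \<open>j - 1\<close> and \<open>j\<close> of
  \<open>w\<close> alternate, so each vertex there looks like one of \<open>w\<close> between these
  rows, upright or upside down.\<close>

lemma valid_zigzag_rows: "valid zigzag_rows"
  unfolding valid_def
proof (intro allI)
  fix x y
  let ?B = zigzag_rows
  have bottom: "?B (x, j) = w (x, j)" for x
    using pyr_rim(2)[of x j] row_j[of x] j by (auto simp: zigzag_rows_def)
  have last: "?B (x, top) = w' (x, j)" for x
    using row_j[of x] row_j'[of x] j by (auto simp: zigzag_rows_def)
  have up: "?B (x, y) = w' (x, 2 * k + 2 - y)" if "y \<ge> top" for x y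
    using that last[of x] j by (cases "y = top") (auto simp: zigzag_rows_def)
  have low: "?B (x, y) = w (x, y)" if "y \<le> j" for x y
    using that bottom[of x] by (cases "y = j") (auto simp: zigzag_rows_def)
  consider "y \<le> j" | "y > top" | "j < y" "y \<le> top" by linarith
  then show "vertex_ok (?B (x, y)) (?B (x - 1, y)) (?B (x - 1, y - 1)) (?B (x, y - 1))"
  proof cases
    case 1
    then show ?thesis using ok low by simp
  next
    case 2
    have "w' (z, 2 * k + 2 - (y - 1)) = w' (z, 2 * k + 3 - y)"
      "w' (z, 2 * k + 2 - y) = w' (z, 2 * k + 3 - y - 1)" for z
      by (rule arg_cong[where f = w'], simp)+
    then show ?thesis using 2 ok'_reverse[of x "2 * k + 3 - y"] up by simp
  next
    case 3
    have out: "?B (z, y) = (if even (y - j) then w (z, j) else w (z, j - 1))"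
      "?B (z, y - 1) = (if even (y - j) then w (z, j - 1) else w (z, j))" if "z < left \<or> z > - j" for z
      using that 3 by (auto simp: zigzag_rows_def)
    have ins: "?B (z, y - 1) = pyr (z, y - 1)"
      "?B (z, y) = (if y < top then pyr (z, y) else if z = - j then j - 1 else j)" if "left \<le> z" "z \<le> - j" for z
      using that 3 by (auto simp: zigzag_rows_def)
    have l: "?B (left, y) = j" "?B (left, y - 1) = j"
      using ins[of left] pyr_rim(2)[of left y] pyr_rim(2)[of left "y - 1"] 3 j left_less by auto
    have r: "?B (- j, y) = (if y < top then j else j - 1)" "?B (- j, y - 1) = j"
      using ins[of "- j"] pyr_rim(2)[of "- j" y] pyr_rim(2)[of "- j" "y - 1"] 3 j left_less by auto
    have rr: "?B (- j + 1, y) = j - 1" "?B (- j + 1, y - 1) = j - 1"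
      using out[of "- j + 1"] right_of_corner row_below[of "- j + 1"] j by auto
    have ll: "?B (left - 1, y) = j \<and> ?B (left - 1, y - 1) = j - 1 \<or>
        ?B (left - 1, y) = j - 1 \<and> ?B (left - 1, y - 1) = j \<or>
        ?B (left - 1, y) = j - 1 \<and> ?B (left - 1, y - 1) = j - 1"
      using out[of "left - 1"] left_of_row row_below[of "left - 1"] j by (cases "even (y - j)") auto
    consider "x < left \<or> x - 1 > - j" | "x = left" | "x = - j + 1" | "left < x" "x \<le> - j" "y < top"
      | "left < x" "x \<le> - j" "y = top" using 3 by linarith
    then show ?thesis
    proof cases
      case 1
      then show ?thesis using out[of x] out[of "x - 1"] ok_bottom[of x] ok_bottom'[of x] by auto
    next
      case 2
      then show ?thesis using l ll by (elim disjE) (simp_all add: vertex_ok_def)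
    next
      case 3
      then show ?thesis using r rr by (simp add: vertex_ok_def)
    next
      case 4
      then show ?thesis using ins[of x] ins[of "x - 1"] ok_pyr[of x y] by simp
    next
      case 5
      have "?B (x, y - 1) = j" "?B (x - 1, y - 1) = j" "?B (x - 1, y) = j" "?B (x, y) = j \<or> ?B (x, y) = j - 1"
        using ins[of x] ins[of "x - 1"] pyr_rim(2)[of x "y - 1"] pyr_rim(2)[of "x - 1" "y - 1"] 5 3 j by auto
      then show ?thesis by (elim disjE) (simp_all add: vertex_ok_def)
    qed
  qed
qed

lemma valid_zigzag_top: "valid zigzag_top"
  unfolding valid_def
proof (intro allI)
  fix x y
  let ?B = zigzag_top
  have up: "?B (x, y) = w' (x, 2 * k + 2 - y)" if "y > top" for x y
    using that j by (auto simp: zigzag_top_def)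
  have low: "?B (x, y) = w (x, y)" if "y < j" for x y
    using that by (auto simp: zigzag_top_def)
  have out: "?B (z, y) = w (z, j - 1)" if "z < left \<or> z > - j" "j \<le> y" "y \<le> top" for z y
    using that by (auto simp: zigzag_top_def)
  have ins: "?B (z, y) = pyr (z, y)" if "left \<le> z" "z \<le> - j" "j \<le> y" "y < top" for z y
    using that by (auto simp: zigzag_top_def)
  have inst: "?B (z, top) = j \<or> ?B (z, top) = j - 1" if "left \<le> z" "z \<le> - j" for z
    using that j by (auto simp: zigzag_top_def)
  have rt: "?B (- j, top) = j - 1"
    using j by (auto simp: zigzag_top_def)
  have side: "?B (left - 1, y) = j - 1" "?B (- j + 1, y) = j - 1" if "j \<le> y" "y \<le> top" for y
    using out[of "left - 1" y] out[of "- j + 1" y] row_below[of "left - 1"] row_below[of "- j + 1"] that j by auto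
  have rim: "?B (left, y) = j" "?B (- j, y) = j" if "j \<le> y" "y < top" for y
    using ins[of left y] ins[of "- j" y] pyr_rim(2)[of left y] pyr_rim(2)[of "- j" y] that j left_less by auto
  have base: "?B (z, j) = j" if "left \<le> z" "z \<le> - j" for z
    using ins[of z j] pyr_rim(2)[of z j] that j by auto
  have roof: "?B (z, top - 1) = j" if "left \<le> z" "z \<le> - j" for z
    using ins[of z "top - 1"] pyr_rim(2)[of z "top - 1"] that j by auto
  consider "y < j" | "y > top + 1" | "y = j" | "y = top + 1" | "y = top" | "j < y" "y < top" by linarith
  then show "vertex_ok (?B (x, y)) (?B (x - 1, y)) (?B (x - 1, y - 1)) (?B (x, y - 1))"
  proof cases
    case 1
    then show ?thesis using ok low by simp
  next
    case 2
    have "w' (z, 2 * k + 2 - (y - 1)) = w' (z, 2 * k + 3 - y)"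
      "w' (z, 2 * k + 2 - y) = w' (z, 2 * k + 3 - y - 1)" for z
      by (rule arg_cong[where f = w'], simp)+
    then show ?thesis using 2 ok'_reverse[of x "2 * k + 3 - y"] up by simp
  next
    case 3
    have b: "?B (z, y - 1) = w (z, j - 1)" for z using 3 low by simp
    consider "x < left \<or> x - 1 > - j" | "x = left" | "x = - j + 1" | "left < x" "x \<le> - j" by linarith
    then show ?thesis
    proof cases
      case 1
      then have "?B (x, y) = w (x, j - 1)" "?B (x - 1, y) = w (x - 1, j - 1)"
        using 3 out[of x j] out[of "x - 1" j] j by auto
      then show ?thesis using b ok_row by simp
    next
      case 2
      then show ?thesis using 3 b side(1)[of j] rim(1)[of j] row_below[of left] row_below[of "left - 1"] j
        by (simp add: vertex_ok_def)
    next
      case 3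
      then show ?thesis using \<open>y = j\<close> b side(2)[of j] rim(2)[of j] row_below[of "- j"] row_below[of "- j + 1"] j
        by (simp add: vertex_ok_def)
    next
      case 4
      then show ?thesis using 3 b base[of x] base[of "x - 1"] row_below[of x] row_below[of "x - 1"] j
        by (simp add: vertex_ok_def)
    qed
  next
    case 4
    have y: "2 * k + 2 - y = j - 1" "y - 1 = top" using 4 by auto
    have a: "?B (z, y) = w' (z, j - 1)" for z using up[of y z] 4 by (simp add: y(1))
    have a': "?B (z, y - 1) = ?B (z, top)" for z by (simp only: y(2))
    consider "x < left \<or> x > - j + 2" | "x = - j + 2" | "x = left" | "x = - j + 1" | "left < x" "x \<le> - j" by linarith
    then show ?thesis
    proof cases
      case 1
      then have "?B (x, top) = w (x, j - 1)" "?B (x - 1, top) = w (x - 1, j - 1)"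
        using out[of x top] out[of "x - 1" top] j by auto
      moreover have "w' (x, j - 1) = w (x, j - 1)" "w' (x - 1, j - 1) = w (x - 1, j - 1)"
        using 1 row_below'[of x] row_below'[of "x - 1"] j k by auto
      ultimately show ?thesis unfolding a a' using ok_row[of x "j - 1"] by simp
    next
      case 2
      have "w' (- j + 1, j - 1) = (if j = 1 then 0 else j - 2)"
        using row_below[of "- j + 1"] j k by (auto simp: cut)
      moreover have "w (- j + 2, j - 1) = (if j = 1 then 0 else j - 2)"
        using below[of 0 1] edge[of "j - 2"] j by auto
      moreover have "w' (- j + 2, j - 1) = w (- j + 2, j - 1)" using row_below'[of "- j + 2"] by simp
      moreover have "?B (- j + 2, top) = w (- j + 2, j - 1)" "?B (- j + 1, top) = j - 1"
        using out[of "- j + 2" top] side(2)[of top] j by auto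
      ultimately show ?thesis unfolding a a' 2 by (simp add: vertex_ok_def)
    next
      case 3
      have "w' (left, j - 1) = j - 1" "w' (left - 1, j - 1) = j - 1"
        using row_below[of left] row_below[of "left - 1"] row_below'[of left] row_below'[of "left - 1"] j by auto
      then show ?thesis unfolding a a' 3 using side(1)[of top] inst[of left] j by (auto simp: vertex_ok_def)
    next
      case 4
      have "w' (- j + 1, j - 1) = (if j = 1 then 0 else j - 2)" "w' (- j, j - 1) = j - 1"
        using row_below[of "- j + 1"] row_below[of "- j"] row_below'[of "- j"] j k by (auto simp: cut)
      then show ?thesis unfolding a a' 4 using side(2)[of top] rt j by (simp add: vertex_ok_def)
    next
      case 5
      have "w' (x, j - 1) = j - 1" "w' (x - 1, j - 1) = j - 1"
        using 5 row_below[of x] row_below[of "x - 1"] row_below'[of x] row_below'[of "x - 1"] j by auto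
      then show ?thesis unfolding a a' using 5 inst[of x] inst[of "x - 1"] j by (auto simp: vertex_ok_def)
    qed
  next
    case 5
    consider "x < left \<or> x - 1 > - j" | "x = left" | "x = - j + 1" | "left < x" "x \<le> - j" by linarith
    then show ?thesis
    proof cases
      case 1
      then have "?B (x, y) = w (x, j - 1)" "?B (x - 1, y) = w (x - 1, j - 1)"
          "?B (x, y - 1) = w (x, j - 1)" "?B (x - 1, y - 1) = w (x - 1, j - 1)"
        using 5 out[of x] out[of "x - 1"] j by auto
      then show ?thesis using ok_row by simp
    next
      case 2
      then show ?thesis using 5 side(1)[of top] side(1)[of "top - 1"] rim(1)[of "top - 1"] inst[of left] j
        by (auto simp: vertex_ok_def)
    next
      case 3
      then show ?thesis using 5 side(2)[of top] side(2)[of "top - 1"] rim(2)[of "top - 1"] rt j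
        by (simp add: vertex_ok_def)
    next
      case 4
      then show ?thesis using 5 roof[of x] roof[of "x - 1"] inst[of x] inst[of "x - 1"] j
        by (auto simp: vertex_ok_def)
    qed
  next
    case 6
    consider "x < left \<or> x - 1 > - j" | "x = left" | "x = - j + 1" | "left < x" "x \<le> - j" by linarith
    then show ?thesis
    proof cases
      case 1
      then have "?B (x, y) = w (x, j - 1)" "?B (x - 1, y) = w (x - 1, j - 1)"
          "?B (x, y - 1) = w (x, j - 1)" "?B (x - 1, y - 1) = w (x - 1, j - 1)"
        using 6 out[of x] out[of "x - 1"] j by auto
      then show ?thesis using ok_row by simp
    next
      case 2
      then show ?thesis using 6 side(1)[of y] side(1)[of "y - 1"] rim(1)[of "y - 1"] rim(1)[of y] j
        by (simp add: vertex_ok_def)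
    next
      case 3
      then show ?thesis using 6 side(2)[of y] side(2)[of "y - 1"] rim(2)[of "y - 1"] rim(2)[of y] j
        by (simp add: vertex_ok_def)
    next
      case 4
      then show ?thesis using 6 ins[of x y] ins[of "x - 1" y] ins[of x "y - 1"] ins[of "x - 1" "y - 1"] ok_pyr[of x y] j
        by simp
    qed
  qed
qed

lemma stage_Suc_eq:
  "stage (j + 1) (x, y) = (if y < j then w (x, y) else if y > top then w' (x, 2 * k + 2 - y)
     else if left \<le> x \<and> x \<le> - j then (if y < top then pyr (x, y) else if x = - j then j - 1 else j)
     else w (x, j))"
proof -
  have s: "stage (j + 1) (x, y) = (if y \<le> j then w (x, y) else if y \<ge> top then w' (x, 2 * k + 2 - y)
     else if left < x \<and> x < - j then max j (pyr (x, y)) else w (x, j))"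
    using j by (auto simp: stage_def)
  consider "y < j" | "y > top" | "y = j" | "y = top" | "j < y" "y < top" by linarith
  then show ?thesis
  proof cases
    case 3
    then show ?thesis using s row_j[of x] pyr_rim(2)[of x j] j by auto
  next
    case 4
    then show ?thesis using s row_j[of x] row_j'[of x] j by auto
  next
    case 5
    consider "left < x \<and> x < - j" | "x = left" | "x = - j" | "x < left \<or> x > - j" by linarith
    then show ?thesis
      using s 5 pyr_rim[of x y] row_j[of x] left_less by cases auto
  qed (use s j in auto)
qed

lemma stage_eq:
  "stage j (x, y) = (if y < j then w (x, y) else if y > top then w' (x, 2 * k + 2 - y)
     else if left \<le> x \<and> x \<le> - j then (if y < top then pyr (x, y) else j - 1)
     else w (x, j - 1))"
  using pyr_rim(1)[of x y] pyr_above[of y x] by (auto simp: stage_def)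

lemma finite_zigzag_rows: "finite {f. zigzag_rows f \<noteq> 0}"
  by (rule finite_patch[of j _ top left "- j"]) (use j in \<open>auto simp: zigzag_rows_def\<close>)

lemma finite_zigzag_top: "finite {f. zigzag_top f \<noteq> 0}"
  by (rule finite_patch[of j _ top left "- j"]) (use j in \<open>auto simp: zigzag_top_def\<close>)

lemma finite_half_stage: "finite {f. half_stage f \<noteq> 0}"
  by (rule finite_patch[of j _ top left "- j"]) (use j in \<open>auto simp: half_stage_def\<close>)

lemma finite_stage_Suc: "finite {f. stage (j + 1) f \<noteq> 0}"
  by (rule finite_patch[of j _ top left "- j"]) (use j in \<open>auto simp: stage_Suc_eq\<close>)

lemma finite_stage: "finite {f. stage j f \<noteq> 0}"
  by (rule finite_patch[of j _ top left "- j"]) (use j in \<open>auto simp: stage_eq\<close>)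

lemma zigzag_rows_stage_Suc: "zigzag_rows \<simeq> stage (j + 1)"
proof (rule conjunct2[OF height_eq_simultaneous])
  show "height_fun zigzag_rows" using valid_zigzag_rows finite_zigzag_rows by (simp add: height_fun_def)
  show "finite {f. stage (j + 1) f \<noteq> zigzag_rows f}" by (rule finite_difference[OF finite_stage_Suc finite_zigzag_rows])
  fix x y assume ne: "stage (j + 1) (x, y) \<noteq> zigzag_rows (x, y)"
  have y: "j \<le> y" "y \<le> top" and x: "x < left \<or> x > - j" and o: "odd (y - j)"
    using ne unfolding stage_Suc_eq by (auto simp: zigzag_rows_def split: if_splits)
  have "even (top - j)" by simp
  then have "y \<noteq> j" "y \<noteq> top" using o by auto
  then have "j < y" "y < top" using y by auto
  then show "zigzag_rows (x - 1, y) = stage (j + 1) (x, y) \<and> zigzag_rows (x + 1, y) = stage (j + 1) (x, y) \<and>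
       stage (j + 1) (x - 1, y) = stage (j + 1) (x, y) \<and> stage (j + 1) (x + 1, y) = stage (j + 1) (x, y) \<or>
       zigzag_rows (x, y - 1) = stage (j + 1) (x, y) \<and> zigzag_rows (x, y + 1) = stage (j + 1) (x, y) \<and>
       stage (j + 1) (x, y - 1) = stage (j + 1) (x, y) \<and> stage (j + 1) (x, y + 1) = stage (j + 1) (x, y)"
    using x o unfolding stage_Suc_eq by (intro disjI2) (auto simp: zigzag_rows_def)
qed

lemma zigzag_rows_half_stage: "zigzag_rows \<simeq> half_stage"
proof (rule conjunct2[OF height_eq_simultaneous])
  show "height_fun zigzag_rows" using valid_zigzag_rows finite_zigzag_rows by (simp add: height_fun_def)
  show "finite {f. half_stage f \<noteq> zigzag_rows f}" by (rule finite_difference[OF finite_half_stage finite_zigzag_rows])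
  fix x y assume ne: "half_stage (x, y) \<noteq> zigzag_rows (x, y)"
  have y: "j \<le> y" "y \<le> top" and x: "x < left \<or> x > - j" and e: "even (y - j)" and nw: "w (x, j) \<noteq> w (x, j - 1)"
    using ne by (auto simp: zigzag_rows_def half_stage_def split: if_splits)
  \<comment> \<open>In the column of the next lower corner, row \<open>j - 1\<close> of
    \<open>w'\<close> may be lower than that of \<open>w\<close>. That column is not affected, since
    rows \<open>j\<close> and \<open>j - 1\<close> of \<open>w\<close> agree in it.\<close>
  have "x \<noteq> - j + 1" using nw right_of_corner row_below[of "- j + 1"] j by auto
  then have r: "w' (x, j - 1) = w (x, j - 1)" by (rule row_below')
  have "2 * k + 2 - (top + 1) = j - 1" by simp
  then have t: "zigzag_rows (x, top + 1) = w (x, j - 1)" "half_stage (x, top + 1) = w (x, j - 1)"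
    using r j by (simp_all add: zigzag_rows_def half_stage_def)
  have u: "zigzag_rows (x, y + 1) = w (x, j - 1)" "half_stage (x, y + 1) = w (x, j - 1)"
    using x y e t by (cases "y = top"; auto simp: zigzag_rows_def half_stage_def)+
  have d: "zigzag_rows (x, y - 1) = w (x, j - 1)" "half_stage (x, y - 1) = w (x, j - 1)"
    using x y e by (cases "y = j"; auto simp: zigzag_rows_def half_stage_def)+
  have "half_stage (x, y) = w (x, j - 1)" using x y by (auto simp: half_stage_def)
  then show "zigzag_rows (x - 1, y) = half_stage (x, y) \<and> zigzag_rows (x + 1, y) = half_stage (x, y) \<and>
       half_stage (x - 1, y) = half_stage (x, y) \<and> half_stage (x + 1, y) = half_stage (x, y) \<or>
       zigzag_rows (x, y - 1) = half_stage (x, y) \<and> zigzag_rows (x, y + 1) = half_stage (x, y) \<and>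
       half_stage (x, y - 1) = half_stage (x, y) \<and> half_stage (x, y + 1) = half_stage (x, y)"
    using u d by simp
qed

lemma zigzag_top_half_stage: "zigzag_top \<simeq> half_stage"
proof (rule conjunct2[OF height_eq_simultaneous])
  show "height_fun zigzag_top" using valid_zigzag_top finite_zigzag_top by (simp add: height_fun_def)
  show "finite {f. half_stage f \<noteq> zigzag_top f}" by (rule finite_difference[OF finite_half_stage finite_zigzag_top])
  fix x y assume ne: "half_stage (x, y) \<noteq> zigzag_top (x, y)"
  have y: "y = top" and x: "left \<le> x" "x < - j" and e: "even (x + j)"
    using ne by (auto simp: zigzag_top_def half_stage_def split: if_splits)
  have "odd (left + j)" by simp
  then have "x \<noteq> left" using e by auto
  moreover have "x + 1 \<noteq> - j"
  proof
    assume "x + 1 = - j"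
    then have "x + j = - 1" by simp
    then show False using e by simp
  qed
  ultimately have "x \<noteq> left" "x + 1 \<noteq> - j" by auto
  then have "left \<le> x - 1" "x + 1 < - j" using x by auto
  then show "zigzag_top (x - 1, y) = half_stage (x, y) \<and> zigzag_top (x + 1, y) = half_stage (x, y) \<and>
       half_stage (x - 1, y) = half_stage (x, y) \<and> half_stage (x + 1, y) = half_stage (x, y) \<or>
       zigzag_top (x, y - 1) = half_stage (x, y) \<and> zigzag_top (x, y + 1) = half_stage (x, y) \<and>
       half_stage (x, y - 1) = half_stage (x, y) \<and> half_stage (x, y + 1) = half_stage (x, y)"
    using e y j by (intro disjI1) (auto simp: zigzag_top_def half_stage_def)
qed

lemma zigzag_top_stage: "zigzag_top \<simeq> stage j"
proof (rule conjunct2[OF height_eq_simultaneous])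
  show "height_fun zigzag_top" using valid_zigzag_top finite_zigzag_top by (simp add: height_fun_def)
  show "finite {f. stage j f \<noteq> zigzag_top f}" by (rule finite_difference[OF finite_stage finite_zigzag_top])
  fix x y assume ne: "stage j (x, y) \<noteq> zigzag_top (x, y)"
  have y: "y = top" and x: "left \<le> x" "x \<le> - j" and o: "odd (x + j)"
    using ne unfolding stage_eq by (auto simp: zigzag_top_def split: if_splits)
  have "x \<noteq> - j" using o by auto
  then have "x < - j" using x by simp
  then have r: "zigzag_top (x + 1, y) = j - 1" "stage j (x + 1, y) = j - 1"
    using x y o j unfolding stage_eq by (auto simp: zigzag_top_def)
  have l: "zigzag_top (x - 1, y) = j - 1" "stage j (x - 1, y) = j - 1"
    using x y o j row_below[of "left - 1"] unfolding stage_eq by (cases "x = left"; auto simp: zigzag_top_def)+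
  have "stage j (x, y) = j - 1" using x y j unfolding stage_eq by auto
  then show "zigzag_top (x - 1, y) = stage j (x, y) \<and> zigzag_top (x + 1, y) = stage j (x, y) \<and>
       stage j (x - 1, y) = stage j (x, y) \<and> stage j (x + 1, y) = stage j (x, y) \<or>
       zigzag_top (x, y - 1) = stage j (x, y) \<and> zigzag_top (x, y + 1) = stage j (x, y) \<and>
       stage j (x, y - 1) = stage j (x, y) \<and> stage j (x, y + 1) = stage j (x, y)"
    using l r by simp
qed

lemma stage_step: "stage (j + 1) \<simeq> stage j"
  by (rule height_eq_trans[OF height_eq_sym[OF zigzag_rows_stage_Suc]
        height_eq_trans[OF zigzag_rows_half_stage height_eq_trans[OF height_eq_sym[OF zigzag_top_half_stage] zigzag_top_stage]]])

end

lemma stage_down: "int n \<le> k \<Longrightarrow> stage (k + 1) \<simeq> stage (k + 1 - int n)"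
proof (induction n)
  case 0
  have "height_fun (stage (k + 1))" using stage_first by (simp add: height_eq_def)
  then show ?case using height_eq_refl by simp
next
  case (Suc n)
  have "stage (k + 1 - int (Suc n) + 1) \<simeq> stage (k + 1 - int (Suc n))"
    by (rule stage_step) (use Suc.prems in auto)
  moreover have "k + 1 - int (Suc n) + 1 = k + 1 - int n" by simp
  ultimately have "stage (k + 1 - int n) \<simeq> stage (k + 1 - int (Suc n))" by (simp only:)
  moreover have "stage (k + 1) \<simeq> stage (k + 1 - int n)" by (rule Suc.IH) (use Suc.prems in simp)
  ultimately show ?case using height_eq_trans by blast
qed

theorem extraction: "height_class w = height_class w' + height_class (pyramid k (- k) (k + 1))"
proof -
  have "stage (k + 1) \<simeq> pyr"
    using stage_down[of "nat k"] k stage_last by simp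
  then have "fold_at (k + 1) \<simeq> pyr" using stage_first height_eq_trans by blast
  then have "height_class w - height_class w' = height_class pyr"
    using class_diff height_class_eqI by simp
  then show ?thesis by (simp add: algebra_simps)
qed

end

subsection \<open>Symmetries of the group of classes\<close>

lift_definition class_shift :: "int \<Rightarrow> int \<Rightarrow> height_class \<Rightarrow> height_class" is height_shift
  by (rule height_eq_shift)

lift_definition class_swap :: "height_class \<Rightarrow> height_class" is height_swap
  by (rule height_eq_swap)

lift_definition class_neg :: "height_class \<Rightarrow> height_class" is "\<lambda>w f. - w f"
  by (rule height_eq_uminus)

lemma class_shift_class: "height_fun w \<Longrightarrow> class_shift a b (height_class w) = height_class (height_shift a b w)"
  by (rule class_shift.abs_eq[OF height_eq_refl])

lemma class_swap_class: "height_fun w \<Longrightarrow> class_swap (height_class w) = height_class (height_swap w)"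
  by (rule class_swap.abs_eq[OF height_eq_refl])

lemma class_neg_class: "height_fun w \<Longrightarrow> class_neg (height_class w) = height_class (\<lambda>f. - w f)"
  by (rule class_neg.abs_eq[OF height_eq_refl])

lemma height_class_rep_pair:
  obtains u v c where "height_fun u" "height_fun v" "g = height_class u" "h = height_class v"
    "zero_from c u" "zero_upto c v" "g + h = height_class (height_add u v)"
proof -
  obtain u where u: "height_fun u" "g = height_class u" by (rule height_class_cases)
  obtain c where c: "zero_from c u" using height_fun_zero_from[OF u(1)] by blast
  obtain v where v: "height_fun v" "h = height_class v" "zero_upto c v" by (rule height_class_rep_above)
  show ?thesis
    using that[OF u(1) v(1) u(2) v(2) c v(3)] height_class_add[OF u(1) v(1) c v(3)] u(2) v(2) by simp
qed

lemma class_shift_add: "class_shift a b (g + h) = class_shift a b g + class_shift a b h"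
proof -
  obtain u v c where *: "height_fun u" "height_fun v" "g = height_class u" "h = height_class v"
    "zero_from c u" "zero_upto c v" "g + h = height_class (height_add u v)"
    by (rule height_class_rep_pair)
  have "height_shift a b (height_add u v) = height_add (height_shift a b u) (height_shift a b v)"
    by (auto simp: fun_eq_iff)
  then have "class_shift a b (g + h) = height_class (height_add (height_shift a b u) (height_shift a b v))"
    by (simp only: *(7) class_shift_class[OF height_fun_add[OF *(1,2,5,6)]])
  also have "\<dots> = height_class (height_shift a b u) + height_class (height_shift a b v)"
    by (rule height_class_add[OF height_fun_shift[OF *(1)] height_fun_shift[OF *(2)]
        zero_from_shift[OF *(5)] zero_upto_shift[OF *(6)]])
  finally show ?thesis by (simp only: *(3,4) class_shift_class[OF *(1)] class_shift_class[OF *(2)])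
qed

lemma class_neg_add: "class_neg (g + h) = class_neg g + class_neg h"
proof -
  obtain u v c where *: "height_fun u" "height_fun v" "g = height_class u" "h = height_class v"
    "zero_from c u" "zero_upto c v" "g + h = height_class (height_add u v)"
    by (rule height_class_rep_pair)
  have "(\<lambda>f. - height_add u v f) = height_add (\<lambda>f. - u f) (\<lambda>f. - v f)"
    by (auto simp: fun_eq_iff)
  then have "class_neg (g + h) = height_class (height_add (\<lambda>f. - u f) (\<lambda>f. - v f))"
    by (simp only: *(7) class_neg_class[OF height_fun_add[OF *(1,2,5,6)]])
  also have "\<dots> = height_class (\<lambda>f. - u f) + height_class (\<lambda>f. - v f)"
    by (rule height_class_add[OF height_fun_uminus[OF *(1)] height_fun_uminus[OF *(2)], of c])
      (use *(5,6) in \<open>auto simp: zero_from_def zero_upto_def\<close>)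
  finally show ?thesis by (simp only: *(3,4) class_neg_class[OF *(1)] class_neg_class[OF *(2)])
qed

text \<open>The right summand slides up until it is above the left one, so placing functions side by
  side gives the same sum as stacking them. This is what makes \<open>class_swap\<close>
  additive.\<close>

lemma height_class_add_columns:
  assumes u: "height_fun u" and v: "height_fun v"
    and z: "\<And>x y. x \<ge> c \<Longrightarrow> u (x, y) = 0" "\<And>x y. x \<le> c \<Longrightarrow> v (x, y) = 0"
  shows "height_class (height_add u v) = height_class u + height_class v"
proof -
  obtain N where N: "zero_from N u" "N > 0" using height_fun_zero_from[OF u] by (metis order_refl)
  obtain M where M: "zero_upto (- M) v" "M > 0" using height_fun_zero_from[OF v] by (metis order_refl)
  define n where "n = nat (N + M)"
  have w: "height_fun (height_add u v)" by (rule height_fun_add_columns[OF u v z])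
  let ?v = "height_shift 0 (2 * int n) v"
  have "(\<lambda>(x, y). if x > c then height_add u v (x, y - 2 * int n) else height_add u v (x, y)) = height_add u ?v"
    using z by (auto simp: fun_eq_iff)
  then have "height_add u ?v \<simeq> height_add u v"
    using half_plane_shift_rows[OF w, of c n] z by simp
  then have "height_class (height_add u v) = height_class (height_add u ?v)"
    using height_class_eqI by simp
  also have "\<dots> = height_class u + height_class ?v"
    by (rule height_class_add[OF u height_fun_shift[OF v] N(1)])
      (rule zero_upto_mono[OF zero_upto_shift[OF M(1)]], use N M in \<open>simp add: n_def\<close>)
  finally show ?thesis using height_class_shift[OF v, of 0 "2 * int n"] by simp
qed

lemma class_swap_add: "class_swap (g + h) = class_swap g + class_swap h"
proof -
  obtain u v c where *: "height_fun u" "height_fun v" "g = height_class u" "h = height_class v"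
    "zero_from c u" "zero_upto c v" "g + h = height_class (height_add u v)"
    by (rule height_class_rep_pair)
  have "height_swap (height_add u v) = height_add (height_swap u) (height_swap v)"
    by (auto simp: fun_eq_iff)
  then have "class_swap (g + h) = height_class (height_add (height_swap u) (height_swap v))"
    by (simp only: *(7) class_swap_class[OF height_fun_add[OF *(1,2,5,6)]])
  also have "\<dots> = height_class (height_swap u) + height_class (height_swap v)"
    by (rule height_class_add_columns[OF height_fun_swap[OF *(1)] height_fun_swap[OF *(2)], of c])
      (use *(5,6) in \<open>auto simp: zero_from_def zero_upto_def\<close>)
  finally show ?thesis by (simp only: *(3,4) class_swap_class[OF *(1)] class_swap_class[OF *(2)])
qed

lemma additive_uminus:
  fixes F :: "height_class \<Rightarrow> height_class"
  assumes "\<And>g h. F (g + h) = F g + F h"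
  shows "F 0 = 0" "F (- g) = - F g"
proof -
  show F0: "F 0 = 0" using assms[of 0 0] by simp
  have "F g + F (- g) = 0" using assms[of g "- g"] F0 by simp
  then show "F (- g) = - F g" by (simp add: eq_neg_iff_add_eq_0 add.commute)
qed

subsection \<open>The classes of the pyramids\<close>

text \<open>The centre \<open>(1, 0)\<close> is a black square, so that the one vertex on top counts
  as \<open>+1\<close> in \<open>class_count_gen\<close>.\<close>

definition gen :: "int \<Rightarrow> height_class" where
  "gen k = height_class (pyramid k 1 0)"

lemma pyramid_class_mirror: "height_class (pyramid k p (1 - q)) = - height_class (pyramid k p q)"
  using height_class_uminus[OF height_fun_pyramid, of k p q] by (simp add: pyramid_mirror)

lemma pyramid_class_mirror_x: "height_class (pyramid k (1 - p) q) = - height_class (pyramid k p q)"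
proof -
  have "class_swap (height_class (pyramid k q (1 - p))) = height_class (pyramid k (1 - p) q)"
    by (simp add: class_swap_class height_fun_pyramid pyramid_swap)
  moreover have "class_swap (height_class (pyramid k q p)) = height_class (pyramid k p q)"
    by (simp add: class_swap_class height_fun_pyramid pyramid_swap)
  ultimately show ?thesis
    using additive_uminus(2)[OF class_swap_add] by (metis pyramid_class_mirror)
qed

lemma pyramid_class_even_shift:
  "even a \<Longrightarrow> even b \<Longrightarrow> height_class (pyramid k (p + a) (q + b)) = height_class (pyramid k p q)"
  using height_class_shift[OF height_fun_pyramid, of a b k p q] by (simp add: pyramid_shift)

text \<open>Even translations keep the class, so only the parities of \<open>p\<close> and
  \<open>q\<close> matter; the reflections taking \<open>p\<close> to \<open>1 - p\<close> or
  \<open>q\<close> to \<open>1 - q\<close> change one parity each and negate the class.\<close>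

lemma pyramid_class: "height_class (pyramid k p q) = (if even (p + q) then - gen k else gen k)"
proof -
  define p' where "p' = p mod 2"
  define q' where "q' = q mod 2"
  have 1: "height_class (pyramid k p q) = height_class (pyramid k p' q')"
  proof -
    have "p = p' + 2 * (p div 2)" "q = q' + 2 * (q div 2)" by (simp_all add: p'_def q'_def)
    then show ?thesis using pyramid_class_even_shift[of "2 * (p div 2)" "2 * (q div 2)" k p' q'] by simp
  qed
  have 2: "even (p + q) \<longleftrightarrow> p' = q'" unfolding p'_def q'_def by presburger
  have "p' = 0 \<or> p' = 1" "q' = 0 \<or> q' = 1" by (auto simp: p'_def q'_def)
  then show ?thesis unfolding 1 2
    using pyramid_class_mirror[of k 1 0] pyramid_class_mirror_x[of k 1 0] pyramid_class_mirror[of k 0 0]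
    by (auto simp: gen_def)
qed

lemma gen_zero: "gen 0 = 0"
proof -
  have "pyramid 0 1 0 = (\<lambda>_. 0)" by (auto simp: pyramid_def)
  then show ?thesis by (simp add: gen_def height_class_zero)
qed

lemma class_neg_gen: "class_neg (gen k) = gen (- k)"
  by (simp add: gen_def class_neg_class height_fun_pyramid pyramid_uminus)

lemma class_shift_gen: "class_shift a b (gen k) = gen k \<or> class_shift a b (gen k) = - gen k"
  by (simp add: gen_def class_shift_class height_fun_pyramid pyramid_shift)
    (simp add: pyramid_class gen_def[symmetric])

text \<open>Between \<open>x - 1\<close> and \<open>x\<close> the ring index changes unless
  \<open>x = p\<close>, and then it is 0 on both sides; the same holds for \<open>y\<close> and
  \<open>q\<close>. So the maximum of the two indices is the same in all four faces around a vertex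
  only at the centre.\<close>

lemma level_set_pyramid: "m \<noteq> 0 \<Longrightarrow> level_set m (pyramid k p q) = (if m = k then {(p, q)} else {})"
proof -
  assume m: "m \<noteq> 0"
  have "x = p \<and> y = q" if "(x, y) \<in> level_set m (pyramid k p q)" for x y
  proof (rule ccontr)
    assume n: "\<not> (x = p \<and> y = q)"
    define r where "r = max (ring_index p x) (ring_index q y)"
    have v: "pyramid k p q (x, y) = m" "pyramid k p q (x - 1, y) = m" "pyramid k p q (x - 1, y - 1) = m"
      "pyramid k p q (x, y - 1) = m"
      using that by (auto simp: level_set_def)
    have eq: "max (ring_index p x) (ring_index q y) = r" "max (ring_index p (x - 1)) (ring_index q y) = r"
      "max (ring_index p (x - 1)) (ring_index q (y - 1)) = r" "max (ring_index p x) (ring_index q (y - 1)) = r"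
    proof -
      have R: "R = \<bar>k\<bar> - \<bar>m\<bar>" if "sgn k * max 0 (\<bar>k\<bar> - R) = m" for R
      proof -
        consider "k > 0" | "k = 0" | "k < 0" by linarith
        then show ?thesis using that m by cases (simp_all add: max_def split: if_splits)
      qed
      note v' = v[unfolded pyramid_def prod.case]
      have r: "r = \<bar>k\<bar> - \<bar>m\<bar>" unfolding r_def by (rule R[OF v'(1)])
      show "max (ring_index p x) (ring_index q y) = r" "max (ring_index p (x - 1)) (ring_index q y) = r"
        "max (ring_index p (x - 1)) (ring_index q (y - 1)) = r" "max (ring_index p x) (ring_index q (y - 1)) = r"
        unfolding r by (rule R[OF v'(1)], rule R[OF v'(2)], rule R[OF v'(3)], rule R[OF v'(4)])
    qed
    have nn: "ring_index p x \<ge> 0" "ring_index p (x - 1) \<ge> 0" "ring_index q y \<ge> 0" "ring_index q (y - 1) \<ge> 0"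
      by (auto simp: ring_index_def)
    have "ring_index p x \<noteq> ring_index p (x - 1) \<or> ring_index q y \<noteq> ring_index q (y - 1)"
      "ring_index p x = ring_index p (x - 1) \<Longrightarrow> ring_index p x = 0"
      "ring_index q y = ring_index q (y - 1) \<Longrightarrow> ring_index q y = 0"
      using n by (auto simp: ring_index_def split: if_splits)
    then show False using eq nn by linarith
  qed
  moreover have "(p, q) \<in> level_set m (pyramid k p q) \<longleftrightarrow> m = k" using m
    by (auto simp: level_set_def pyramid_def ring_index_def sgn_if)
  ultimately show ?thesis by auto
qed

lemma class_count_gen: "m \<noteq> 0 \<Longrightarrow> class_count m (gen k) = (if m = k then 1 else 0)"
  by (simp add: gen_def class_count_class height_fun_pyramid level_count_def level_set_pyramid square_sign_def)

text \<open>An integral combination of generators, coded by the multisets of the indices with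
  positive and with negative sign. The index 0 may occur, as \<open>gen 0 = 0\<close>.\<close>

definition represented :: "height_class \<Rightarrow> bool" where
  "represented g \<longleftrightarrow> (\<exists>A B. g = (\<Sum>k\<in>#A. gen k) - (\<Sum>k\<in>#B. gen k))"

lemma represented_zero: "represented 0"
  unfolding represented_def by (intro exI[of _ "{#}"]) simp

lemma represented_gen: "represented (gen k)"
  unfolding represented_def by (rule exI[of _ "{#k#}"], rule exI[of _ "{#}"]) simp

lemma represented_uminus:
  assumes "represented g" shows "represented (- g)"
proof -
  obtain A B where "g = (\<Sum>k\<in>#A. gen k) - (\<Sum>k\<in>#B. gen k)" using assms by (auto simp: represented_def)
  then have "- g = (\<Sum>k\<in>#B. gen k) - (\<Sum>k\<in>#A. gen k)" by simp
  then show ?thesis unfolding represented_def by blast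
qed

lemma represented_add:
  assumes "represented g" "represented h" shows "represented (g + h)"
proof -
  obtain A B C D where "g = (\<Sum>k\<in>#A. gen k) - (\<Sum>k\<in>#B. gen k)" "h = (\<Sum>k\<in>#C. gen k) - (\<Sum>k\<in>#D. gen k)"
    using assms by (auto simp: represented_def)
  then have "g + h = (\<Sum>k\<in>#A + C. gen k) - (\<Sum>k\<in>#B + D. gen k)" by simp
  then show ?thesis unfolding represented_def by blast
qed

lemma represented_sum:
  assumes "\<And>g h. F (g + h) = F g + F h" "\<And>k. represented (F (gen k))" "represented g"
  shows "represented (F g)"
proof -
  obtain A B where g: "g = (\<Sum>k\<in>#A. gen k) - (\<Sum>k\<in>#B. gen k)" using assms(3) by (auto simp: represented_def)
  have S: "represented (F (\<Sum>k\<in>#A. gen k))" for A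
    by (induction A) (use assms(1,2) additive_uminus(1)[of F] represented_add represented_zero in auto)
  have "F g = F (\<Sum>k\<in>#A. gen k) + - F (\<Sum>k\<in>#B. gen k)"
    using assms(1)[of "\<Sum>k\<in>#A. gen k" "- (\<Sum>k\<in>#B. gen k)"] additive_uminus(2)[of F] assms(1) g by simp
  then show ?thesis using represented_add[OF S represented_uminus[OF S]] by simp
qed

lemma class_count_sum: "m \<noteq> 0 \<Longrightarrow> class_count m (\<Sum>k\<in>#A. gen k) = int (count A m)"
  by (induction A) (simp_all add: class_count_zero class_count_add class_count_gen)

lemma gen_sum_filter: "(\<Sum>k\<in>#A. gen k) = (\<Sum>k\<in>#filter_mset (\<lambda>k. k \<noteq> 0) A. gen k)"
  by (induction A) (auto simp: gen_zero)

text \<open>The counts recover the difference of the multiplicities of every index except 0, and the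
  index 0 contributes nothing to the sums.\<close>

lemma represented_eq_zero:
  assumes "represented g" and "\<And>m. m \<noteq> 0 \<Longrightarrow> class_count m g = 0" shows "g = 0"
proof -
  obtain A B where g: "g = (\<Sum>k\<in>#A. gen k) - (\<Sum>k\<in>#B. gen k)" using assms(1) by (auto simp: represented_def)
  have "count A m = count B m" if "m \<noteq> 0" for m
    using assms(2)[OF that] that by (simp add: g class_count_diff class_count_sum)
  then have "filter_mset (\<lambda>k. k \<noteq> 0) A = filter_mset (\<lambda>k. k \<noteq> 0) B"
    by (intro multiset_eqI) simp
  then show ?thesis unfolding g by (metis gen_sum_filter diff_self)
qed

subsection \<open>The pyramids generate\<close>

definition cut_corners :: "int \<Rightarrow> (int \<times> int \<Rightarrow> int) \<Rightarrow> int \<times> int \<Rightarrow> int" where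
  "cut_corners k w = (\<lambda>(x, y). w (x, y) - (if 1 \<le> y \<and> y \<le> k \<and> x = - y then 1 else 0))"

text \<open>The vertices affected lie on three adjacent diagonals and are checked one diagonal at a
  time. At the upper end of the middle one, \<open>apex\<close> gives the last face around
  \<open>(- k, k + 1)\<close> the height \<open>k\<close>; after the cut only one of the four is
  lower.\<close>

lemma height_fun_cut_corners:
  assumes w: "height_fun w" and k: "k > 0"
    and below: "\<And>x y. y \<le> 0 \<Longrightarrow> w (x, y) = 0"
    and trapezoid: "\<And>x y. 0 \<le> y \<Longrightarrow> y \<le> k \<Longrightarrow> - 2 * k + y - 1 \<le> x \<Longrightarrow> x \<le> - y \<Longrightarrow> w (x, y) = y"
    and edge: "\<And>y. 0 \<le> y \<Longrightarrow> y \<le> k \<Longrightarrow> w (- y, y + 1) = y"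
    and apex: "w (- k - 1, k + 1) = k"
  shows "height_fun (cut_corners k w)"
proof -
  let ?w = "cut_corners k w"
  have same: "?w (x, y) = w (x, y)" if "\<not> (1 \<le> y \<and> y \<le> k \<and> x = - y)" for x y
    using that by (simp add: cut_corners_def)
  have diag: "?w (- y, y) = y - 1" if "1 \<le> y" "y \<le> k" for y
    using that trapezoid[of y "- y"] by (simp add: cut_corners_def)
  have "{f. ?w f \<noteq> 0} \<subseteq> {f. w f \<noteq> 0} \<union> (\<lambda>y. (- y, y)) ` {1..k}"
    by (auto simp: cut_corners_def split: if_splits)
  then have "finite {f. ?w f \<noteq> 0}"
    by (rule finite_subset) (use w in \<open>simp add: height_fun_def\<close>)
  moreover have "valid ?w"
    unfolding valid_def
  proof (intro allI)
    fix x y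
    have ok: "vertex_ok (w (x, y)) (w (x - 1, y)) (w (x - 1, y - 1)) (w (x, y - 1))"
      using validD w by (simp add: height_fun_def)
    consider "x + y = 0" "1 \<le> y" "y \<le> k" | "x + y = 2" "1 \<le> y - 1" "y - 1 \<le> k"
      | "x + y = 1" "y = 1" | "x + y = 1" "2 \<le> y" "y \<le> k" | "x + y = 1" "y = k + 1"
      | "\<not> (x + y = 0 \<and> 1 \<le> y \<and> y \<le> k)" "\<not> (x + y = 2 \<and> 1 \<le> y - 1 \<and> y - 1 \<le> k)"
        "\<not> (x + y = 1 \<and> 1 \<le> y \<and> y \<le> k + 1)" by linarith
    then show "vertex_ok (?w (x, y)) (?w (x - 1, y)) (?w (x - 1, y - 1)) (?w (x, y - 1))"
    proof cases
      case 1
      have x: "x = - y" using 1 by simp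
      have "?w (- y, y) = y - 1" using diag[of y] 1 by simp
      moreover have "?w (- y - 1, y) = y" "?w (- y - 1, y - 1) = y - 1" "?w (- y, y - 1) = y - 1"
        using same[where x = "- y - 1" and y = y] same[where x = "- y - 1" and y = "y - 1"] same[where x = "- y" and y = "y - 1"]
          trapezoid[of y "- y - 1"] trapezoid[of "y - 1" "- y - 1"] trapezoid[of "y - 1" "- y"] 1 by auto
      ultimately show ?thesis unfolding x by (simp add: vertex_ok_def)
    next
      case 2
      define j where "j = y - 1"
      have xy: "x = - j + 1" "y = j + 1" using 2 by (auto simp: j_def)
      have j: "1 \<le> j" "j \<le> k" using 2 by (auto simp: j_def)
      have "w (- j, j + 1) = j" "w (- j + 1, j) = j - 1" "w (- j, j) = j"
        using edge[of j] edge[of "j - 1"] trapezoid[of j "- j"] j by auto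
      moreover have "?w (- j, j + 1) = w (- j, j + 1)" "?w (- j + 1, j) = w (- j + 1, j)"
        "?w (- j, j) = j - 1" "?w (- j + 1, j + 1) = w (- j + 1, j + 1)"
        using same[where x = "- j" and y = "j + 1"] same[where x = "- j + 1" and y = j] same[where x = "- j + 1" and y = "j + 1"] diag[of j] j by auto
      ultimately show ?thesis using ok unfolding xy by (auto simp: vertex_ok_def)
    next
      case 3
      have "?w (-1, 1) = 0" "w (0, 1) = 0" using diag[of 1] edge[of 0] k by auto
      then show ?thesis using 3 same[where x = 0 and y = 1] same[where x = "-1" and y = 0] same[where x = 0 and y = 0] below[of 0] by (auto simp: vertex_ok_def)
    next
      case 4
      have x: "x = - y + 1" using 4 by simp
      have "?w (- y + 1, y) = y - 1" "?w (- y, y) = y - 1" "?w (- y, y - 1) = y - 1" "?w (- y + 1, y - 1) = y - 2"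
        using edge[of "y - 1"] same[where x = "- y + 1" and y = y] diag[of y] diag[of "y - 1"] same[where x = "- y" and y = "y - 1"]
          trapezoid[of "y - 1" "- y"] 4 by auto
      then show ?thesis unfolding x by (simp add: vertex_ok_def)
    next
      case 5
      have "?w (- k, k + 1) = k" "?w (- k - 1, k + 1) = k" "?w (- k - 1, k) = k" "?w (- k, k) = k - 1"
        using edge[of k] apex trapezoid[of k "- k - 1"] diag[of k] k
          same[where x = "- k" and y = "k + 1"] same[where x = "- k - 1" and y = "k + 1"] same[where x = "- k - 1" and y = k] by auto
      moreover have "x = - k" "y = k + 1" using 5 by auto
      ultimately show ?thesis by (simp add: vertex_ok_def)
    next
      case 6
      then show ?thesis
        using ok same[where x = x and y = y] same[where x = "x - 1" and y = y] same[where x = "x - 1" and y = "y - 1"] same[where x = x and y = "y - 1"] by auto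
    qed
  qed
  ultimately show ?thesis by (simp add: height_fun_def)
qed

text \<open>The measure for the induction in \<open>represented_height_class\<close>: both lowering
  a cell and cutting a nest decrease it.\<close>

definition height_mass :: "(int \<times> int \<Rightarrow> int) \<Rightarrow> int" where
  "height_mass w = (\<Sum>f | w f \<noteq> 0. \<bar>w f\<bar>)"

lemma height_mass_less:
  assumes "finite {f. w f \<noteq> 0}" and le: "\<And>f. \<bar>w' f\<bar> \<le> \<bar>w f\<bar>" and "\<bar>w' f\<bar> < \<bar>w f\<bar>"
  shows "height_mass w' < height_mass w"
proof -
  have "w f = 0 \<Longrightarrow> w' f = 0" for f using le[of f] by simp
  then have "height_mass w' = (\<Sum>f | w f \<noteq> 0. \<bar>w' f\<bar>)"
    unfolding height_mass_def by (intro sum.mono_neutral_left) (use assms(1) in auto)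
  also have "\<dots> < height_mass w" unfolding height_mass_def
  proof (rule sum_strict_mono_ex1)
    have "w f \<noteq> 0" using assms(3) by auto
    then show "\<exists>f\<in>{f. w f \<noteq> 0}. \<bar>w' f\<bar> < \<bar>w f\<bar>" using assms(3) by blast
  qed (use assms in auto)
  finally show ?thesis .
qed

lemma height_mass_shift: "height_mass (height_shift a b w) = height_mass w"
  unfolding height_mass_def
  by (rule sum.reindex_bij_witness[of _ "\<lambda>(x, y). (x + a, y + b)" "\<lambda>(x, y). (x - a, y - b)"]) auto

lemma height_mass_uminus: "height_mass (\<lambda>f. - w f) = height_mass w"
  by (simp add: height_mass_def)

lemma height_mass_nonneg: "height_mass w \<ge> 0"
  by (simp add: height_mass_def sum_nonneg)

definition shrinkable :: "(int \<times> int \<Rightarrow> int) \<Rightarrow> bool" where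
  "shrinkable w \<longleftrightarrow> (\<exists>x y a. (w (x - 1, y) = a \<and> w (x + 1, y) = a \<or> w (x, y - 1) = a \<and> w (x, y + 1) = a) \<and>
     \<bar>a\<bar> < \<bar>w (x, y)\<bar>)"

text \<open>
  Start from a maximal run of cells at level \<open>m\<close> that lies flat on level \<open>m - 1\<close>.  If no single cell
  can be lowered, then the cells above the run are at level \<open>m\<close> or \<open>m + 1\<close>, with \<open>m\<close> at both
  ends, so that next to its right end there is a free vertex or another such run.
\<close>

lemma nest_exists:
  assumes w: "height_fun w" and irr: "\<not> shrinkable w"
    and m: "m \<ge> 1" and ab: "a \<le> b"
    and base: "\<And>x. a - 1 \<le> x \<Longrightarrow> x \<le> b + 1 \<Longrightarrow> w (x, y - 1) = m - 1"
    and run: "\<And>x. a \<le> x \<Longrightarrow> x \<le> b \<Longrightarrow> w (x, y) = m"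
    and ends: "w (a - 1, y) = m - 1" "w (b + 1, y) = m - 1"
  shows "\<exists>n \<ge> 0. (\<forall>i x. 0 \<le> i \<longrightarrow> i \<le> n \<longrightarrow> b - i - 2 * (n - i) - 1 \<le> x \<longrightarrow> x \<le> b - i \<longrightarrow> w (x, y + i) = m + i) \<and>
     (\<forall>i. 0 \<le> i \<longrightarrow> i \<le> n \<longrightarrow> w (b - i, y + i + 1) = m + i) \<and> w (b - n - 1, y + n + 1) = m + n"
proof -
  have val: "valid w" using w by (simp add: height_fun_def)
  obtain M where M: "\<And>f. w f \<le> M"
  proof -
    have "finite (w ` {f. w f \<noteq> 0})" using w by (simp add: height_fun_def)
    then have "w f \<le> Max (insert 0 (w ` {f. w f \<noteq> 0}))" for f
      by (cases "w f = 0") (auto intro!: Max_ge)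
    then show ?thesis using that by blast
  qed
  show ?thesis using m ab base run ends
  proof (induction "nat (M + 1 - m)" arbitrary: m y a b rule: less_induct)
    case (less m y a b)
    have hor: "\<not> (w (x - 1, y) = l \<and> w (x + 1, y) = l) \<or> \<bar>l\<bar> \<ge> \<bar>w (x, y)\<bar>"
      and ver: "\<not> (w (x, y - 1) = l \<and> w (x, y + 1) = l) \<or> \<bar>l\<bar> \<ge> \<bar>w (x, y)\<bar>" for x y l
    proof -
      have *: "\<not> ((w (x - 1, y) = l \<and> w (x + 1, y) = l \<or> w (x, y - 1) = l \<and> w (x, y + 1) = l) \<and>
          \<bar>l\<bar> < \<bar>w (x, y)\<bar>)"
        using irr unfolding shrinkable_def by blast
      show "\<not> (w (x - 1, y) = l \<and> w (x + 1, y) = l) \<or> \<bar>l\<bar> \<ge> \<bar>w (x, y)\<bar>" using * by linarith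
      show "\<not> (w (x, y - 1) = l \<and> w (x, y + 1) = l) \<or> \<bar>l\<bar> \<ge> \<bar>w (x, y)\<bar>" using * by linarith
    qed
    let ?T = "\<lambda>x. w (x, y + 1)"
    have Tm: "?T x = m \<or> ?T x = m + 1" if "a \<le> x" "x \<le> b" for x
    proof -
      have "\<bar>?T x - m\<bar> \<le> 1"
        using validD[OF val, of x "y + 1"] less.prems(4)[OF that] by (auto simp: vertex_ok_def)
      moreover have "?T x \<noteq> m - 1"
        using ver[of x y "m - 1"] less.prems(1) less.prems(3)[of x] less.prems(4)[OF that] that by auto
      ultimately show ?thesis by linarith
    qed
    \<comment> \<open>The cell \<open>(b, y + 1)\<close> meets \<open>(b + 1, y)\<close>, which has
      height \<open>m - 1\<close>, at a vertex, so \<open>m + 1\<close> is excluded.\<close>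
    have Tb: "?T b = m"
      using validD[OF val, of "b + 1" "y + 1"] less.prems(2,6) less.prems(4)[of b] Tm[of b]
      by (auto simp: vertex_ok_def)
    have Ta: "?T a = m"
      using validD[OF val, of a "y + 1"] less.prems(2,5) less.prems(4)[of a] Tm[of a]
      by (auto simp: vertex_ok_def)
    \<comment> \<open>A run of a single cell lies between two cells of height \<open>m - 1\<close>
      and could be lowered.\<close>
    have "a \<noteq> b"
      using hor[of a y "m - 1"] less.prems(1,5,6) less.prems(4)[of a] by auto
    then have "a < b" using less.prems(2) by simp
    consider "?T (b - 1) = m" | "?T (b - 1) = m + 1" using Tm[of "b - 1"] \<open>a < b\<close> by auto
    then show ?case
    proof cases
      case 1
      show ?thesis
        by (rule exI[of _ 0]) (use 1 Tb less.prems(4) \<open>a < b\<close> in \<open>auto intro!: less.prems(4)\<close>)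
    next
      case 2
      \<comment> \<open>Its maximum \<open>c\<close> is the last place before \<open>b\<close> at
        which the upper row has height \<open>m\<close>. The cells \<open>c + 1\<close> to
        \<open>b - 1\<close> of that row are then a run one level higher with all properties of the
        first.\<close>
      define S where "S = {x. a \<le> x \<and> x < b \<and> ?T x = m}"
      have fS: "finite S" unfolding S_def by (rule finite_subset[of _ "{a..b}"]) auto
      have "a \<in> S" using Ta \<open>a < b\<close> by (simp add: S_def)
      define c where "c = Max S"
      have c: "c \<in> S" "\<And>x. x \<in> S \<Longrightarrow> x \<le> c" using fS \<open>a \<in> S\<close> by (auto simp: c_def intro: Max_in)
      have "c \<noteq> b - 1" using c(1) 2 by (auto simp: S_def)
      then have cb: "a \<le> c" "c < b - 1" "?T c = m" using c(1) by (auto simp: S_def)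
      have T: "?T x = m + 1" if "c + 1 \<le> x" "x \<le> b - 1" for x
        using c(2)[of x] Tm[of x] that cb by (auto simp: S_def)
      have "m + 1 \<le> M" using M[of "(b - 1, y + 1)"] 2 by simp
      then have dec: "nat (M + 1 - (m + 1)) < nat (M + 1 - m)" by simp
      have "\<exists>n \<ge> 0. (\<forall>i x. 0 \<le> i \<longrightarrow> i \<le> n \<longrightarrow> (b - 1) - i - 2 * (n - i) - 1 \<le> x \<longrightarrow> x \<le> (b - 1) - i \<longrightarrow> w (x, y + 1 + i) = m + 1 + i) \<and>
         (\<forall>i. 0 \<le> i \<longrightarrow> i \<le> n \<longrightarrow> w ((b - 1) - i, y + 1 + i + 1) = m + 1 + i) \<and> w ((b - 1) - n - 1, y + 1 + n + 1) = m + 1 + n"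
        by (rule less.hyps[OF dec, of "c + 1" "b - 1" "y + 1"])
          (use less.prems(1,4) cb T Tb in auto)
      then obtain n where n: "n \<ge> 0"
        "\<And>i x. 0 \<le> i \<Longrightarrow> i \<le> n \<Longrightarrow> (b - 1) - i - 2 * (n - i) - 1 \<le> x \<Longrightarrow> x \<le> (b - 1) - i \<Longrightarrow> w (x, y + 1 + i) = m + 1 + i"
        "\<And>i. 0 \<le> i \<Longrightarrow> i \<le> n \<Longrightarrow> w ((b - 1) - i, y + 1 + i + 1) = m + 1 + i"
        "w ((b - 1) - n - 1, y + 1 + n + 1) = m + 1 + n" by blast
      \<comment> \<open>At \<open>c\<close> the upper row has height \<open>m\<close>, so
        \<open>c\<close> is outside the trapezoid found there, whose lowest row has height
        \<open>m + 1\<close>. Hence the run from \<open>a\<close> to \<open>b\<close> is long enough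
        for a trapezoid with one row more.\<close>
      have "c < b - 2 - 2 * n"
        using n(2)[of 0 c] n(1) cb by fastforce
      then have ac: "a \<le> b - 2 * (n + 1) - 1" using cb by simp
      show ?thesis
      proof (rule exI[of _ "n + 1"], intro conjI allI impI)
        show "0 \<le> n + 1" using n(1) by simp
        show "w (b - (n + 1) - 1, y + (n + 1) + 1) = m + (n + 1)"
          using n(4) by (simp add: algebra_simps)
        fix i assume i: "0 \<le> i" "i \<le> n + 1"
        show "w (b - i, y + i + 1) = m + i"
          using n(3)[of "i - 1"] i Tb by (cases "i = 0") (auto simp: algebra_simps)
        fix x assume x: "b - i - 2 * (n + 1 - i) - 1 \<le> x" "x \<le> b - i"
        show "w (x, y + i) = m + i"
        proof (cases "i = 0")
          case True
          then show ?thesis using less.prems(4)[of x] x ac by simp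
        next
          case False
          then show ?thesis using n(2)[of "i - 1" x] i x by (auto simp: algebra_simps)
        qed
      qed
    qed
  qed
qed

lemma represented_class_shift: "represented g \<Longrightarrow> represented (class_shift a b g)"
  by (rule represented_sum[OF class_shift_add])
    (use class_shift_gen represented_gen represented_uminus in metis)

lemma represented_class_neg: "represented g \<Longrightarrow> represented (class_neg g)"
  by (rule represented_sum[OF class_neg_add]) (simp_all add: class_neg_gen represented_gen)

lemma represented_pyramid: "represented (height_class (pyramid k p q))"
  by (simp add: pyramid_class represented_gen represented_uminus)

text \<open>The maximal run through \<open>(x0, y0)\<close> in the lowest occupied row lies flat on
  zeros, so \<open>nest_exists\<close> finds a nest over its right end. Extracting a pyramid there
  leaves a function of smaller mass. The translations to and from the standard position may be odd,
  but they only change the signs of generators.\<close>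

lemma smaller_if_bottom_one:
  assumes w: "height_fun w" and irr: "\<not> shrinkable w"
    and bottom: "\<And>x y. y < y0 \<Longrightarrow> w (x, y) = 0" and one: "w (x0, y0) = 1"
  shows "\<exists>w'. height_fun w' \<and> height_mass w' < height_mass w \<and>
    (represented (height_class w') \<longrightarrow> represented (height_class w))"
proof -
  have val: "valid w" using w by (simp add: height_fun_def)
  have fin: "finite {f. w f \<noteq> 0}" using w by (simp add: height_fun_def)
  obtain N where N: "N > 0" "\<And>x y. w (x, y) \<noteq> 0 \<Longrightarrow> \<bar>x\<bar> < N \<and> \<bar>y\<bar> < N"
    using height_fun_bounds[OF w] by metis
  have x0: "\<bar>x0\<bar> < N" using N(2)[of x0 y0] one by simp
  have zN: "w (x, y0) = 0" if "\<bar>x\<bar> \<ge> N" for x using N(2)[of x y0] that by fastforce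
  have nbr: "w (x + 1, y0) \<in> {0, 1}" "w (x - 1, y0) \<in> {0, 1}" if "w (x, y0) = 1" for x
    using validD[OF val, of "x + 1" y0] validD[OF val, of x y0] bottom[of "y0 - 1"] that
    by (auto simp: vertex_ok_def)
  define S where "S = {x. x0 \<le> x \<and> (\<forall>z. x0 \<le> z \<longrightarrow> z \<le> x \<longrightarrow> w (z, y0) = 1)}"
  have "S \<subseteq> {x0..N}"
  proof
    fix x assume "x \<in> S"
    then show "x \<in> {x0..N}" using zN[of N] x0 unfolding S_def by (cases "x \<le> N") auto
  qed
  then have fS: "finite S" by (rule finite_subset) simp
  have "x0 \<in> S" using one by (auto simp: S_def)
  define b where "b = Max S"
  have b: "b \<in> S" "\<And>x. x \<in> S \<Longrightarrow> x \<le> b" using fS \<open>x0 \<in> S\<close> by (auto simp: b_def intro: Max_in)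
  have wb: "w (b + 1, y0) = 0"
  proof (rule ccontr)
    assume "w (b + 1, y0) \<noteq> 0"
    then have "w (b + 1, y0) = 1" using nbr(1)[of b] b(1) by (auto simp: S_def)
    moreover have "w (z, y0) = 1" if "x0 \<le> z" "z \<le> b" for z using b(1) that unfolding S_def by blast
    ultimately have "w (z, y0) = 1" if "x0 \<le> z" "z \<le> b + 1" for z using that by (cases "z = b + 1") auto
    then have "b + 1 \<in> S" using b(1) unfolding S_def by simp
    then show False using b(2)[of "b + 1"] by simp
  qed
  define S' where "S' = {x. x \<le> x0 \<and> (\<forall>z. x \<le> z \<longrightarrow> z \<le> x0 \<longrightarrow> w (z, y0) = 1)}"
  have "S' \<subseteq> {- N..x0}"
  proof
    fix x assume "x \<in> S'"
    then show "x \<in> {- N..x0}" using zN[of "- N"] x0 unfolding S'_def by (cases "- N \<le> x") auto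
  qed
  then have fS': "finite S'" by (rule finite_subset) simp
  have "x0 \<in> S'" using one by (auto simp: S'_def)
  define a where "a = Min S'"
  have a: "a \<in> S'" "\<And>x. x \<in> S' \<Longrightarrow> a \<le> x" using fS' \<open>x0 \<in> S'\<close> by (auto simp: a_def intro: Min_in)
  have wa: "w (a - 1, y0) = 0"
  proof (rule ccontr)
    assume "w (a - 1, y0) \<noteq> 0"
    then have "w (a - 1, y0) = 1" using nbr(2)[of a] a(1) by (auto simp: S'_def)
    moreover have "w (z, y0) = 1" if "a \<le> z" "z \<le> x0" for z using a(1) that unfolding S'_def by blast
    ultimately have "w (z, y0) = 1" if "a - 1 \<le> z" "z \<le> x0" for z using that by (cases "z = a - 1") auto
    then have "a - 1 \<in> S'" using a(1) unfolding S'_def by simp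
    then show False using a(2)[of "a - 1"] by simp
  qed
  have run: "w (x, y0) = 1" if "a \<le> x" "x \<le> b" for x
    using a(1) b(1) that unfolding S_def S'_def by (cases "x \<le> x0") auto
  have ab: "a \<le> b" using a(1) b(1) by (simp add: S_def S'_def)
  obtain n where n: "n \<ge> 0"
    "\<And>i x. 0 \<le> i \<Longrightarrow> i \<le> n \<Longrightarrow> b - i - 2 * (n - i) - 1 \<le> x \<Longrightarrow> x \<le> b - i \<Longrightarrow> w (x, y0 + i) = 1 + i"
    "\<And>i. 0 \<le> i \<Longrightarrow> i \<le> n \<Longrightarrow> w (b - i, y0 + i + 1) = 1 + i" "w (b - n - 1, y0 + n + 1) = 1 + n"
    using nest_exists[OF w irr, of 1 a b y0] ab bottom run wa wb by auto
  define k where "k = n + 1"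
  \<comment> \<open>This takes the last cell \<open>(b, y0)\<close> of the run to the first corner
    \<open>(-1, 1)\<close>.\<close>
  let ?u = "height_shift (- b - 1) (1 - y0) w"
  have u: "?u (x, y) = w (x + b + 1, y + y0 - 1)" for x y by (simp add: algebra_simps)
  have hu: "height_fun ?u" by (rule height_fun_shift[OF w])
  have k: "k > 0" using n(1) by (simp add: k_def)
  have below: "?u (x, y) = 0" if "y \<le> 0" for x y using bottom[of "y + y0 - 1"] that unfolding u by simp
  have trapezoid: "?u (x, y) = y" if "0 \<le> y" "y \<le> k" "- 2 * k + y - 1 \<le> x" "x \<le> - y" for x y
  proof (cases "y = 0")
    case False
    then show ?thesis using n(2)[of "y - 1" "x + b + 1"] that unfolding u k_def by (simp add: algebra_simps)
  next
    case True
    show ?thesis unfolding True by (rule below) simp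
  qed
  have edge: "?u (- y, y + 1) = y" if "0 \<le> y" "y \<le> k" for y
  proof (cases "y = 0")
    case True
    then show ?thesis using wb unfolding u by (simp add: algebra_simps)
  next
    case False
    then show ?thesis using n(3)[of "y - 1"] that unfolding u k_def by (simp add: algebra_simps)
  qed
  have apex: "?u (- k - 1, k + 1) = k" using n(4) unfolding u k_def by (simp add: algebra_simps)
  have hu': "height_fun (cut_corners k ?u)"
    by (rule height_fun_cut_corners[OF hu k below trapezoid edge apex])
  interpret corner_nest ?u "cut_corners k ?u" k
  proof unfold_locales
    show "cut_corners k ?u (x, y) = ?u (x, y) - (if 1 \<le> y \<and> y \<le> k \<and> x = - y then 1 else 0)" for x y
      by (simp add: cut_corners_def)
  qed ((rule hu hu' k | erule below | (rule trapezoid; assumption) | (rule edge; assumption))+)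
  let ?w' = "height_shift (b + 1) (y0 - 1) (cut_corners k ?u)"
  have undo: "height_shift (b + 1) (y0 - 1) ?u = w" by (auto simp: fun_eq_iff)
  have "class_shift (b + 1) (y0 - 1) (height_class ?u) =
      class_shift (b + 1) (y0 - 1) (height_class (cut_corners k ?u)) +
      class_shift (b + 1) (y0 - 1) (height_class (pyramid k (- k) (k + 1)))"
    using extraction class_shift_add by simp
  then have cls: "height_class w = height_class ?w' + class_shift (b + 1) (y0 - 1) (height_class (pyramid k (- k) (k + 1)))"
    by (simp add: class_shift_class hu hu' undo)
  have "height_mass (cut_corners k ?u) < height_mass ?u"
  proof (rule height_mass_less[of _ _ "(-1, 1)"])
    show "finite {f. ?u f \<noteq> 0}" using hu by (simp add: height_fun_def)
    have "?u (- y, y) = y" if "1 \<le> y" "y \<le> k" for y using trapezoid[of y "- y"] that by simp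
    then show "\<bar>cut_corners k ?u f\<bar> \<le> \<bar>?u f\<bar>" for f
      by (cases f) (auto simp: cut_corners_def simp del: height_shift_apply)
    show "\<bar>cut_corners k ?u (-1, 1)\<bar> < \<bar>?u (-1, 1)\<bar>"
      using trapezoid[of 1 "-1"] k by (simp add: cut_corners_def del: height_shift_apply)
  qed
  then have "height_mass ?w' < height_mass w" by (simp add: height_mass_shift)
  moreover have "height_fun ?w'" by (rule height_fun_shift[OF hu'])
  moreover have "represented (height_class ?w') \<longrightarrow> represented (height_class w)"
    using cls represented_add represented_class_shift represented_pyramid by simp
  ultimately show ?thesis by blast
qed

text \<open>Induction on the mass. If a cell can be lowered, this keeps the class. Otherwise the
  lowest nonzero row contains a value 1 or -1; the first case is
  \<open>smaller_if_bottom_one\<close>, and the second reduces to it by changing all signs.\<close>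

lemma represented_height_class: "height_fun w \<Longrightarrow> represented (height_class w)"
proof (induction "nat (height_mass w)" arbitrary: w rule: less_induct)
  case (less w)
  have val: "valid w" using less.prems by (simp add: height_fun_def)
  have IH: "represented (height_class v)" if "height_fun v" "height_mass v < height_mass w" for v
    using less.hyps[of v] that height_mass_nonneg[of v] by simp
  show ?case
  proof (cases "shrinkable w")
    case True
    then obtain x y c where c: "w (x - 1, y) = c \<and> w (x + 1, y) = c \<or> w (x, y - 1) = c \<and> w (x, y + 1) = c"
      and l: "\<bar>c\<bar> < \<bar>w (x, y)\<bar>" unfolding shrinkable_def by blast
    let ?v = "w((x, y) := c)"
    have s: "height_step w ?v" using c less.prems unfolding height_step_def by blast
    have "height_mass ?v < height_mass w"
      by (rule height_mass_less[of _ _ "(x, y)"]) (use less.prems l in \<open>auto simp: height_fun_def\<close>)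
    then have "represented (height_class ?v)" using IH height_step_fun[OF s] by blast
    then show ?thesis using height_class_eqI[OF height_eq_step[OF s]] by simp
  next
    case False
    show ?thesis
    proof (cases "w = (\<lambda>_. 0)")
      case True
      then show ?thesis using represented_zero by (simp add: height_class_zero)
    next
      case ne: False
      let ?Y = "snd ` {f. w f \<noteq> 0}"
      have fY: "finite ?Y" using less.prems by (simp add: height_fun_def)
      have neY: "?Y \<noteq> {}" using ne by auto
      define y0 where "y0 = Min ?Y"
      have bottom: "w (x, y) = 0" if "y < y0" for x y
      proof (rule ccontr)
        assume "w (x, y) \<noteq> 0"
        then have "y \<in> ?Y" by force
        from Min_le[OF fY this] show False using that unfolding y0_def by linarith
      qed
      have "y0 \<in> ?Y" using Min_in[OF fY neY] by (simp add: y0_def)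
      then obtain x0 where x0: "w (x0, y0) \<noteq> 0" by auto
      have "\<bar>w (x0, y0)\<bar> \<le> 1"
        using validD[OF val, of x0 y0] bottom[of "y0 - 1"] by (auto simp: vertex_ok_def)
      then consider "w (x0, y0) = 1" | "w (x0, y0) = - 1" using x0 by linarith
      then show ?thesis
      proof cases
        case 1
        then show ?thesis using smaller_if_bottom_one[OF less.prems False bottom] IH by blast
      next
        case 2
        have nm: "height_fun (\<lambda>f. - w f)" by (rule height_fun_uminus[OF less.prems])
        have "\<not> shrinkable (\<lambda>f. - w f)"
        proof
          assume "shrinkable (\<lambda>f. - w f)"
          then obtain x y c where c: "- w (x - 1, y) = c \<and> - w (x + 1, y) = c \<or> - w (x, y - 1) = c \<and> - w (x, y + 1) = c"
            and l: "\<bar>c\<bar> < \<bar>- w (x, y)\<bar>" unfolding shrinkable_def by blast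
          have "w (x - 1, y) = - c \<and> w (x + 1, y) = - c \<or> w (x, y - 1) = - c \<and> w (x, y + 1) = - c"
            using c by linarith
          moreover have "\<bar>- c\<bar> < \<bar>w (x, y)\<bar>" using l by simp
          ultimately have "shrinkable w" unfolding shrinkable_def by blast
          then show False using False by simp
        qed
        then have "represented (height_class (\<lambda>f. - w f))"
          using smaller_if_bottom_one[OF nm, of y0 x0] bottom 2 IH by (auto simp: height_mass_uminus)
        from represented_class_neg[OF this] show ?thesis by (simp add: class_neg_class nm)
      qed
    qed
  qed
qed

theorem height_class_eq_if_counts:
  assumes "\<And>m. m \<noteq> 0 \<Longrightarrow> class_count m g = class_count m h" shows "g = h"
proof -
  obtain w where "height_fun w" "g - h = height_class w" by (rule height_class_cases)
  then have "represented (g - h)" using represented_height_class by simp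
  then have "g - h = 0" by (rule represented_eq_zero) (use assms in \<open>simp add: class_count_diff\<close>)
  then show ?thesis by simp
qed

lemma height_eq_if_counts:
  assumes "height_fun w" "height_fun w'" "\<And>m. m \<noteq> 0 \<Longrightarrow> level_count m w = level_count m w'"
  shows "w \<simeq> w'"
  using height_class_eq_if_counts[of "height_class w" "height_class w'"] assms
  by (simp add: class_count_class height_class_eq_iff)

subsection \<open>Permutations with displacement at most one\<close>

definition near :: "int \<times> int \<Rightarrow> int \<times> int \<Rightarrow> bool" where
  "near = (\<lambda>(x, y) (x', y'). \<bar>x - x'\<bar> + \<bar>y - y'\<bar> \<le> 1)"

definition short_perm :: "(int \<times> int \<Rightarrow> int \<times> int) \<Rightarrow> bool" where
  "short_perm \<sigma> \<longleftrightarrow> bij \<sigma> \<and> finite {v. \<sigma> v \<noteq> v} \<and> (\<forall>v. near v (\<sigma> v))"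

definition perm_step :: "(int \<times> int \<Rightarrow> int \<times> int) \<Rightarrow> (int \<times> int \<Rightarrow> int \<times> int) \<Rightarrow> bool" where
  "perm_step \<sigma> \<tau> \<longleftrightarrow> short_perm \<sigma> \<and> short_perm \<tau> \<and> (\<exists>u v. u \<noteq> v \<and> \<tau> = \<sigma> \<circ> Transposition.transpose u v)"

text \<open>The net flow along an edge. A cycle of length two has none, so the heights do not see
  it.\<close>

definition perm_flow :: "(int \<times> int \<Rightarrow> int \<times> int) \<Rightarrow> int \<times> int \<Rightarrow> int \<times> int \<Rightarrow> int" where
  "perm_flow \<sigma> p q = of_bool (\<sigma> p = q) - of_bool (\<sigma> q = p)"

text \<open>The cycles of \<open>\<sigma>\<close> run counterclockwise around the higher levels.\<close>

definition height_of :: "(int \<times> int \<Rightarrow> int \<times> int) \<Rightarrow> (int \<times> int \<Rightarrow> int) \<Rightarrow> bool" where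
  "height_of \<sigma> w \<longleftrightarrow> short_perm \<sigma> \<and> finite {f. w f \<noteq> 0} \<and>
     (\<forall>x y. w (x, y) - w (x, y - 1) = perm_flow \<sigma> (x, y) (x + 1, y)) \<and>
     (\<forall>x y. w (x - 1, y) - w (x, y) = perm_flow \<sigma> (x, y) (x, y + 1))"

lemma near_cases:
  assumes "near (x, y) p"
  shows "p = (x, y) \<or> p = (x + 1, y) \<or> p = (x, y + 1) \<or> p = (x - 1, y) \<or> p = (x, y - 1)"
proof -
  obtain a b where p: "p = (a, b)" by fastforce
  have *: "\<bar>x - a\<bar> + \<bar>y - b\<bar> \<le> 1" using assms by (simp add: near_def p)
  then have "x = a \<or> y = b" by linarith
  then show ?thesis
  proof
    assume "x = a"
    then have "b = y \<or> b = y + 1 \<or> b = y - 1" using * by linarith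
    then show ?thesis using \<open>x = a\<close> p by auto
  next
    assume "y = b"
    then have "a = x \<or> a = x + 1 \<or> a = x - 1" using * by linarith
    then show ?thesis using \<open>y = b\<close> p by auto
  qed
qed

lemma near_sym: "near p q \<longleftrightarrow> near q p"
  by (cases p, cases q) (simp add: near_def abs_minus_commute)

lemma perm_flow_antisym: "perm_flow \<sigma> q p = - perm_flow \<sigma> p q"
  by (simp add: perm_flow_def)

lemma short_perm_id: "short_perm id"
  by (simp add: short_perm_def near_def case_prod_unfold)

lemma short_perm_near: "short_perm \<sigma> \<Longrightarrow> near v (\<sigma> v)"
  unfolding short_perm_def by blast

lemma short_perm_transpose:
  assumes "short_perm \<sigma>" "near u (\<sigma> v)" "near v (\<sigma> u)"
  shows "short_perm (\<sigma> \<circ> Transposition.transpose u v)"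
proof -
  have "bij (\<sigma> \<circ> Transposition.transpose u v)" using assms(1) by (simp add: short_perm_def bij_comp)
  moreover have "{p. (\<sigma> \<circ> Transposition.transpose u v) p \<noteq> p} \<subseteq> {p. \<sigma> p \<noteq> p} \<union> {u, v}"
    by (auto simp: Transposition.transpose_def split: if_splits)
  then have "finite {p. (\<sigma> \<circ> Transposition.transpose u v) p \<noteq> p}"
    by (rule finite_subset) (use assms(1) in \<open>simp add: short_perm_def\<close>)
  moreover have "near p ((\<sigma> \<circ> Transposition.transpose u v) p)" for p
    using assms(2,3) short_perm_near[OF assms(1), of p] by (simp add: Transposition.transpose_def)
  ultimately show ?thesis unfolding short_perm_def by blast
qed

lemma perm_step_sym: "perm_step \<sigma> \<tau> \<Longrightarrow> perm_step \<tau> \<sigma>"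
proof -
  assume a: "perm_step \<sigma> \<tau>"
  then obtain u v where uv: "u \<noteq> v" "\<tau> = \<sigma> \<circ> Transposition.transpose u v" unfolding perm_step_def by blast
  then have "\<sigma> = \<tau> \<circ> Transposition.transpose u v" by (intro ext) simp
  then show ?thesis using a uv(1) unfolding perm_step_def by blast
qed

lemma perm_steps_sym: "perm_step\<^sup>*\<^sup>* \<sigma> \<tau> \<Longrightarrow> perm_step\<^sup>*\<^sup>* \<tau> \<sigma>"
  by (induction rule: rtranclp_induct) (auto intro: converse_rtranclp_into_rtranclp perm_step_sym)

lemma inj_short_perm: "short_perm \<sigma> \<Longrightarrow> \<sigma> p = \<sigma> q \<Longrightarrow> p = q"
  unfolding short_perm_def bij_def by (blast dest: injD)

lemma short_perm_out:
  assumes "short_perm \<sigma>"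
  shows "\<sigma> (x, y) = (x, y) \<or> \<sigma> (x, y) = (x + 1, y) \<or> \<sigma> (x, y) = (x, y + 1) \<or>
    \<sigma> (x, y) = (x - 1, y) \<or> \<sigma> (x, y) = (x, y - 1)"
  using near_cases[OF short_perm_near[OF assms, of "(x, y)"]] .

lemma short_perm_in:
  assumes "short_perm \<sigma>"
  shows "\<sigma> (x, y) = (x, y) \<or> \<sigma> (x + 1, y) = (x, y) \<or> \<sigma> (x, y + 1) = (x, y) \<or>
    \<sigma> (x - 1, y) = (x, y) \<or> \<sigma> (x, y - 1) = (x, y)"
proof -
  obtain p where p: "\<sigma> p = (x, y)" using assms by (metis short_perm_def bij_pointE)
  then have "near p (x, y)" using short_perm_near[OF assms, of p] by simp
  then have "near (x, y) p" by (simp add: near_sym)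
  from near_cases[OF this] show ?thesis using p by auto
qed

lemma perm_flow_fixed: "short_perm \<sigma> \<Longrightarrow> \<sigma> p = p \<Longrightarrow> p \<noteq> q \<Longrightarrow> perm_flow \<sigma> p q = 0 \<and> perm_flow \<sigma> q p = 0"
  using inj_short_perm[of \<sigma> q p] by (auto simp: perm_flow_def)

lemma perm_flow_values:
  assumes s: "short_perm \<sigma>"
  obtains (fixed) "\<sigma> (x, y) = (x, y)" "perm_flow \<sigma> (x, y) (x + 1, y) = 0" "perm_flow \<sigma> (x, y) (x, y + 1) = 0"
      "perm_flow \<sigma> (x, y) (x - 1, y) = 0" "perm_flow \<sigma> (x, y) (x, y - 1) = 0"
  | (moved) oE oN oW oS iE iN iW iS :: int where
      "perm_flow \<sigma> (x, y) (x + 1, y) = oE - iE" "perm_flow \<sigma> (x, y) (x, y + 1) = oN - iN"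
      "perm_flow \<sigma> (x, y) (x - 1, y) = oW - iW" "perm_flow \<sigma> (x, y) (x, y - 1) = oS - iS"
      "(oE, oN, oW, oS) \<in> {(1, 0, 0, 0), (0, 1, 0, 0), (0, 0, 1, 0), (0, 0, 0, 1)}"
      "(iE, iN, iW, iS) \<in> {(1, 0, 0, 0), (0, 1, 0, 0), (0, 0, 1, 0), (0, 0, 0, 1)}"
proof (cases "\<sigma> (x, y) = (x, y)")
  case True
  then show ?thesis using perm_flow_fixed[OF s True] by (intro fixed) simp_all
next
  case False
  have i: "(of_bool (\<sigma> (x + 1, y) = (x, y)), of_bool (\<sigma> (x, y + 1) = (x, y)),
      of_bool (\<sigma> (x - 1, y) = (x, y)), of_bool (\<sigma> (x, y - 1) = (x, y)))
      \<in> {(1, 0, 0, 0), (0, 1, 0, 0), (0, 0, 1, 0), (0, 0, 0, 1 :: int)}"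
  proof -
    have inj: "p \<noteq> q \<Longrightarrow> \<not> (\<sigma> p = (x, y) \<and> \<sigma> q = (x, y))" for p q
      using inj_short_perm[OF s, of p q] by auto
    from short_perm_in[OF s, of x y] False
    consider "\<sigma> (x + 1, y) = (x, y)" | "\<sigma> (x, y + 1) = (x, y)" | "\<sigma> (x - 1, y) = (x, y)" | "\<sigma> (x, y - 1) = (x, y)"
      by blast
    then show ?thesis
      by cases (use inj[of "(x + 1, y)" "(x, y + 1)"] inj[of "(x + 1, y)" "(x - 1, y)"] inj[of "(x + 1, y)" "(x, y - 1)"]
          inj[of "(x, y + 1)" "(x - 1, y)"] inj[of "(x, y + 1)" "(x, y - 1)"] inj[of "(x - 1, y)" "(x, y - 1)"] in simp_all)
  qed
  have "(of_bool (\<sigma> (x, y) = (x + 1, y)), of_bool (\<sigma> (x, y) = (x, y + 1)),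
      of_bool (\<sigma> (x, y) = (x - 1, y)), of_bool (\<sigma> (x, y) = (x, y - 1)))
      \<in> {(1, 0, 0, 0), (0, 1, 0, 0), (0, 0, 1, 0), (0, 0, 0, 1 :: int)}"
    using short_perm_out[OF s, of x y] False by (elim disjE) auto
  from moved[OF _ _ _ _ this i] show ?thesis by (simp add: perm_flow_def)
qed

lemma height_of_vertex:
  assumes "height_of \<sigma> w"
  shows "w (x, y) - w (x, y - 1) = perm_flow \<sigma> (x, y) (x + 1, y)"
    "w (x - 1, y) - w (x, y) = perm_flow \<sigma> (x, y) (x, y + 1)"
    "w (x - 1, y - 1) - w (x - 1, y) = perm_flow \<sigma> (x, y) (x - 1, y)"
    "w (x, y - 1) - w (x - 1, y - 1) = perm_flow \<sigma> (x, y) (x, y - 1)"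
proof -
  have h: "w (x, y) - w (x, y - 1) = perm_flow \<sigma> (x, y) (x + 1, y)"
    "w (x - 1, y) - w (x, y) = perm_flow \<sigma> (x, y) (x, y + 1)" for x y
    using assms unfolding height_of_def by blast+
  show "w (x, y) - w (x, y - 1) = perm_flow \<sigma> (x, y) (x + 1, y)"
    "w (x - 1, y) - w (x, y) = perm_flow \<sigma> (x, y) (x, y + 1)" by (rule h)+
  show "w (x - 1, y - 1) - w (x - 1, y) = perm_flow \<sigma> (x, y) (x - 1, y)"
    using h(1)[of "x - 1" y] perm_flow_antisym[of \<sigma> "(x, y)" "(x - 1, y)"] by simp
  show "w (x, y - 1) - w (x - 1, y - 1) = perm_flow \<sigma> (x, y) (x, y - 1)"
    using h(2)[of x "y - 1"] perm_flow_antisym[of \<sigma> "(x, y)" "(x, y - 1)"] by simp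
qed

text \<open>A moved vertex has one outgoing and one incoming arrow, so that on a tour around it the
  height goes up once and down once or, in a two-cycle, not at all. In particular two level curves
  never meet there.\<close>

lemma height_fun_height_of:
  assumes "height_of \<sigma> w" shows "height_fun w"
proof -
  have "valid w" unfolding valid_def
  proof (intro allI)
    fix x y
    note h = height_of_vertex[OF assms, of x y]
    have s: "short_perm \<sigma>" using assms by (simp add: height_of_def)
    show "vertex_ok (w (x, y)) (w (x - 1, y)) (w (x - 1, y - 1)) (w (x, y - 1))"
    proof (rule perm_flow_values[OF s, of x y])
      assume "perm_flow \<sigma> (x, y) (x + 1, y) = 0" "perm_flow \<sigma> (x, y) (x, y + 1) = 0"
        "perm_flow \<sigma> (x, y) (x - 1, y) = 0" "perm_flow \<sigma> (x, y) (x, y - 1) = 0"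
      then show ?thesis using h by (simp add: vertex_ok_def)
    next
      fix oE oN oW oS iE iN iW iS :: int
      assume f: "perm_flow \<sigma> (x, y) (x + 1, y) = oE - iE" "perm_flow \<sigma> (x, y) (x, y + 1) = oN - iN"
        "perm_flow \<sigma> (x, y) (x - 1, y) = oW - iW" "perm_flow \<sigma> (x, y) (x, y - 1) = oS - iS"
        and o: "(oE, oN, oW, oS) \<in> {(1, 0, 0, 0), (0, 1, 0, 0), (0, 0, 1, 0), (0, 0, 0, 1)}"
        and i: "(iE, iN, iW, iS) \<in> {(1, 0, 0, 0), (0, 1, 0, 0), (0, 0, 1, 0), (0, 0, 0, 1)}"
      have "w (x, y - 1) = w (x, y) - (oE - iE)" "w (x - 1, y) = w (x, y) + (oN - iN)"
        "w (x - 1, y - 1) = w (x, y) + (oN - iN) + (oW - iW)" using h f by linarith+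
      then show ?thesis using o i h(4) f(4)
        by (auto simp: vertex_ok_def)
    qed
  qed
  then show ?thesis using assms by (simp add: height_fun_def height_of_def)
qed

lemma short_perm_bounds:
  assumes "short_perm \<sigma>"
  obtains N where "N > 0" "\<And>x y. \<sigma> (x, y) \<noteq> (x, y) \<Longrightarrow> \<bar>x\<bar> < N \<and> \<bar>y\<bar> < N"
proof -
  let ?A = "insert 0 ((\<lambda>(x, y). max \<bar>x\<bar> \<bar>y\<bar>) ` {v. \<sigma> v \<noteq> v})"
  have fin: "finite ?A" using assms by (simp add: short_perm_def)
  show ?thesis
  proof (rule that[of "Max ?A + 1"])
    have "0 \<le> Max ?A" by (rule Max_ge[OF fin]) simp
    then show "0 < Max ?A + 1" by simp
    fix x y assume "\<sigma> (x, y) \<noteq> (x, y)"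
    then have "max \<bar>x\<bar> \<bar>y\<bar> \<in> ?A" by force
    then have "max \<bar>x\<bar> \<bar>y\<bar> \<le> Max ?A" using fin by (rule Max_ge[rotated])
    then show "\<bar>x\<bar> < Max ?A + 1 \<and> \<bar>y\<bar> < Max ?A + 1" by linarith
  qed
qed

lemma perm_flow_conservation:
  assumes "short_perm \<sigma>"
  shows "perm_flow \<sigma> (x, y) (x + 1, y) + perm_flow \<sigma> (x, y) (x, y + 1) +
    perm_flow \<sigma> (x, y) (x - 1, y) + perm_flow \<sigma> (x, y) (x, y - 1) = 0"
  by (rule perm_flow_values[OF assms, of x y]) auto

text \<open>The height of a face is the total upward flow to the right of it in its row, which
  settles the differences across vertical edges. Conservation of the flow at the vertices carries
  the equation for horizontal edges from column to column, starting on the right where everything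
  vanishes.\<close>

lemma height_of_exists:
  assumes s: "short_perm \<sigma>" obtains w where "height_of \<sigma> w"
proof -
  obtain N where N: "N > 0" "\<And>x y. \<sigma> (x, y) \<noteq> (x, y) \<Longrightarrow> \<bar>x\<bar> < N \<and> \<bar>y\<bar> < N"
    using short_perm_bounds[OF s] by metis
  let ?U = "\<lambda>x y. perm_flow \<sigma> (x, y) (x, y + 1)" and ?H = "\<lambda>x y. perm_flow \<sigma> (x, y) (x + 1, y)"
  have fixed: "\<sigma> (x, y) = (x, y)" if "\<bar>x\<bar> \<ge> N \<or> \<bar>y\<bar> \<ge> N" for x y using N(2)[of x y] that by fastforce
  have U0: "?U x y = 0" if "\<bar>x\<bar> \<ge> N \<or> \<bar>y\<bar> \<ge> N" for x y
    using perm_flow_fixed[OF s fixed[of x y]] that by simp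
  have H0: "?H x y = 0" if "\<bar>x\<bar> \<ge> N \<or> \<bar>y\<bar> \<ge> N" for x y
    using perm_flow_fixed[OF s fixed[of x y]] that by simp
  define w where "w = (\<lambda>(x, y). \<Sum>i\<in>{x<..N}. ?U i y)"
  have wN: "w (x, y) = 0" if "x \<ge> N" for x y using that by (simp add: w_def)
  have ver: "w (x - 1, y) - w (x, y) = ?U x y" for x y
  proof (cases "x \<le> N")
    case True
    then have "{x - 1<..N} = insert x {x<..N}" by auto
    then show ?thesis by (simp add: w_def)
  next
    case False
    then show ?thesis using wN[of "x - 1" y] wN[of x y] U0[of x y] N(1) by simp
  qed
  have hor: "w (x, y) - w (x, y - 1) = ?H x y" for x y
  proof (cases "x \<le> N")
    case True
    then show ?thesis
    proof (induction x rule: int_le_induct)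
      case base
      show ?case using wN[of N] H0[of N y] N(1) by simp
    next
      case (step x)
      have "perm_flow \<sigma> (x, y) (x - 1, y) = - ?H (x - 1) y" "perm_flow \<sigma> (x, y) (x, y - 1) = - ?U x (y - 1)"
        using perm_flow_antisym[of \<sigma> "(x, y)" "(x - 1, y)"] perm_flow_antisym[of \<sigma> "(x, y)" "(x, y - 1)"] by simp_all
      then show ?case
        using step.IH perm_flow_conservation[OF s, of x y] ver[of x y] ver[of x "y - 1"] by simp
    qed
  next
    case False
    then show ?thesis using wN[of x] H0[of x y] N(1) by simp
  qed
  have yN: "w (x, y) = 0" if "\<bar>y\<bar> \<ge> N" for x y using U0 that by (simp add: w_def)
  \<comment> \<open>To the left of the moved vertices the height is constant along each column, and
    it vanishes far below.\<close>
  have xN: "w (x, y) = 0" if "x \<le> - N" for x y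
  proof -
    have eq: "w (x, y) = w (x, y - 1)" for y using hor[of x y] H0[of x y] that N(1) by simp
    have "w (x, y) = w (x, y - int n)" for n
    proof (induction n)
      case (Suc n)
      then show ?case using eq[of "y - int n"] by (simp add: algebra_simps)
    qed simp
    from this[of "nat (y + N)"] show ?thesis using yN[of "y - int (nat (y + N))" x] yN[of y x] N(1)
      by (cases "y \<ge> - N") auto
  qed
  have "{f. w f \<noteq> 0} \<subseteq> {- N..N} \<times> {- N..N}"
  proof
    fix f assume "f \<in> {f. w f \<noteq> 0}"
    moreover obtain x y where f: "f = (x, y)" by fastforce
    ultimately have "w (x, y) \<noteq> 0" by simp
    then have "\<not> x \<ge> N" "\<not> x \<le> - N" "\<not> \<bar>y\<bar> \<ge> N" using wN xN yN by blast+
    then have "- N \<le> x" "x \<le> N" "- N \<le> y" "y \<le> N" by linarith+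
    then show "f \<in> {- N..N} \<times> {- N..N}" unfolding f by simp
  qed
  then have "finite {f. w f \<noteq> 0}" by (rule finite_subset) simp
  then have "height_of \<sigma> w" using s ver hor by (simp add: height_of_def)
  then show ?thesis by (rule that)
qed

text \<open>The permutation with heights \<open>w\<close> and no two-cycles: a vertex moves along
  the edge whose left-hand face is higher by one, and \<open>vertex_ok\<close> leaves at most one
  such edge.\<close>

definition flow_perm :: "(int \<times> int \<Rightarrow> int) \<Rightarrow> int \<times> int \<Rightarrow> int \<times> int" where
  "flow_perm w = (\<lambda>(x, y). if w (x, y) - w (x, y - 1) = 1 then (x + 1, y)
     else if w (x - 1, y) - w (x, y) = 1 then (x, y + 1)
     else if w (x - 1, y - 1) - w (x - 1, y) = 1 then (x - 1, y)
     else if w (x, y - 1) - w (x - 1, y - 1) = 1 then (x, y - 1) else (x, y))"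

lemma vertex_ok_differences:
  assumes "vertex_ok a b c d"
  shows "b = a - 1 \<or> b = a \<or> b = a + 1" "c = b - 1 \<or> c = b \<or> c = b + 1" "d = c - 1 \<or> d = c \<or> d = c + 1"
proof -
  have "\<bar>a - b\<bar> \<le> 1" "\<bar>b - c\<bar> \<le> 1" "\<bar>c - d\<bar> \<le> 1" using assms by (simp_all add: vertex_ok_def)
  then show "b = a - 1 \<or> b = a \<or> b = a + 1" "c = b - 1 \<or> c = b \<or> c = b + 1" "d = c - 1 \<or> d = c \<or> d = c + 1"
    by linarith+
qed

lemma select_iff:
  fixes x y :: int and A B C D :: bool
  defines "p \<equiv> (if A then (x + 1, y) else if B then (x, y + 1) else if C then (x - 1, y) else if D then (x, y - 1) else (x, y))"
  assumes "\<not> (A \<and> B)" "\<not> (A \<and> C)" "\<not> (A \<and> D)" "\<not> (B \<and> C)" "\<not> (B \<and> D)" "\<not> (C \<and> D)"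
  shows "p = (x + 1, y) \<longleftrightarrow> A" "p = (x, y + 1) \<longleftrightarrow> B" "p = (x - 1, y) \<longleftrightarrow> C" "p = (x, y - 1) \<longleftrightarrow> D"
    "p = (x, y) \<longleftrightarrow> \<not> A \<and> \<not> B \<and> \<not> C \<and> \<not> D"
  using assms(2-) unfolding p_def by (simp_all split: if_splits)
lemma vertex_ok_out:
  assumes "vertex_ok a b c d"
  shows "\<not> (a - d = 1 \<and> b - a = 1)" "\<not> (a - d = 1 \<and> c - b = 1)" "\<not> (a - d = 1 \<and> d - c = 1)" "\<not> (b - a = 1 \<and> c - b = 1)" "\<not> (b - a = 1 \<and> d - c = 1)" "\<not> (c - b = 1 \<and> d - c = 1)"
  using vertex_ok_differences[OF assms] assms by (elim disjE; simp add: vertex_ok_def)+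

lemma vertex_ok_in:
  assumes "vertex_ok a b c d"
  shows "\<not> (a - d = - 1 \<and> b - a = - 1)" "\<not> (a - d = - 1 \<and> c - b = - 1)" "\<not> (a - d = - 1 \<and> d - c = - 1)" "\<not> (b - a = - 1 \<and> c - b = - 1)" "\<not> (b - a = - 1 \<and> d - c = - 1)" "\<not> (c - b = - 1 \<and> d - c = - 1)"
  using vertex_ok_differences[OF assms] assms by (elim disjE; simp add: vertex_ok_def)+

lemma vertex_ok_moving:
  assumes "vertex_ok a b c d"
  shows "a - d = 1 \<or> b - a = 1 \<or> c - b = 1 \<or> d - c = 1 \<or> (a = b \<and> b = c \<and> c = d)"
    "a - d = - 1 \<or> b - a = - 1 \<or> c - b = - 1 \<or> d - c = - 1 \<or> (a = b \<and> b = c \<and> c = d)"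
  using vertex_ok_differences[OF assms] assms by (elim disjE; simp add: vertex_ok_def)+

context
  fixes w :: "int \<times> int \<Rightarrow> int"
  assumes w: "height_fun w"
begin

lemma vok: "vertex_ok (w (x, y)) (w (x - 1, y)) (w (x - 1, y - 1)) (w (x, y - 1))"
  using w validD by (simp add: height_fun_def)

lemma flow_perm_iff:
  "flow_perm w (x, y) = (x + 1, y) \<longleftrightarrow> w (x, y) - w (x, y - 1) = 1"
  "flow_perm w (x, y) = (x, y + 1) \<longleftrightarrow> w (x - 1, y) - w (x, y) = 1"
  "flow_perm w (x, y) = (x - 1, y) \<longleftrightarrow> w (x - 1, y - 1) - w (x - 1, y) = 1"
  "flow_perm w (x, y) = (x, y - 1) \<longleftrightarrow> w (x, y - 1) - w (x - 1, y - 1) = 1"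
  "flow_perm w (x, y) = (x, y) \<longleftrightarrow> w (x, y) = w (x - 1, y) \<and> w (x - 1, y) = w (x - 1, y - 1) \<and> w (x - 1, y - 1) = w (x, y - 1)"
proof -
  have "flow_perm w (x, y) = (if w (x, y) - w (x, y - 1) = 1 then (x + 1, y)
     else if w (x - 1, y) - w (x, y) = 1 then (x, y + 1)
     else if w (x - 1, y - 1) - w (x - 1, y) = 1 then (x - 1, y)
     else if w (x, y - 1) - w (x - 1, y - 1) = 1 then (x, y - 1) else (x, y))"
    unfolding flow_perm_def prod.case ..
  note * = select_iff[OF vertex_ok_out[OF vok[of x y]], of x y, folded this]
  show "flow_perm w (x, y) = (x + 1, y) \<longleftrightarrow> w (x, y) - w (x, y - 1) = 1" by (rule *(1))
  show "flow_perm w (x, y) = (x, y + 1) \<longleftrightarrow> w (x - 1, y) - w (x, y) = 1" by (rule *(2))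
  show "flow_perm w (x, y) = (x - 1, y) \<longleftrightarrow> w (x - 1, y - 1) - w (x - 1, y) = 1" by (rule *(3))
  show "flow_perm w (x, y) = (x, y - 1) \<longleftrightarrow> w (x, y - 1) - w (x - 1, y - 1) = 1" by (rule *(4))
  show "flow_perm w (x, y) = (x, y) \<longleftrightarrow> w (x, y) = w (x - 1, y) \<and> w (x - 1, y) = w (x - 1, y - 1) \<and> w (x - 1, y - 1) = w (x, y - 1)"
    unfolding *(5) using vertex_ok_moving(1)[OF vok[of x y]] by auto
qed

lemma flow_perm_in:
  "flow_perm w (x + 1, y) = (x, y) \<longleftrightarrow> w (x, y) - w (x, y - 1) = - 1"
  "flow_perm w (x, y + 1) = (x, y) \<longleftrightarrow> w (x - 1, y) - w (x, y) = - 1"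
  "flow_perm w (x - 1, y) = (x, y) \<longleftrightarrow> w (x - 1, y - 1) - w (x - 1, y) = - 1"
  "flow_perm w (x, y - 1) = (x, y) \<longleftrightarrow> w (x, y - 1) - w (x - 1, y - 1) = - 1"
  using flow_perm_iff(3)[of "x + 1" y] flow_perm_iff(4)[of x "y + 1"] flow_perm_iff(1)[of "x - 1" y]
    flow_perm_iff(2)[of x "y - 1"] by auto

lemma near_flow_perm: "near v (flow_perm w v)"
  by (cases v) (simp add: flow_perm_def near_def)

lemma flow_perm_ex1: "\<exists>!p. flow_perm w p = (x, y)"
proof -
  note i = vertex_ok_in[OF vok[of x y]]
  have uniq: "p = (x, y) \<or> p = (x + 1, y) \<or> p = (x, y + 1) \<or> p = (x - 1, y) \<or> p = (x, y - 1)"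
    if "flow_perm w p = (x, y)" for p
    using near_cases[of x y p] near_flow_perm[of p] near_sym that by metis
  from vertex_ok_moving(2)[OF vok[of x y]]
  consider "w (x, y) - w (x, y - 1) = - 1" | "w (x - 1, y) - w (x, y) = - 1"
    | "w (x - 1, y - 1) - w (x - 1, y) = - 1" | "w (x, y - 1) - w (x - 1, y - 1) = - 1"
    | "w (x, y) = w (x - 1, y)" "w (x - 1, y) = w (x - 1, y - 1)" "w (x - 1, y - 1) = w (x, y - 1)" by blast
  then show ?thesis
  proof cases
    case 1
    show ?thesis
    proof (rule ex1I[of _ "(x + 1, y)"])
      show "flow_perm w (x + 1, y) = (x, y)" using 1 by (simp add: flow_perm_in flow_perm_iff(5))
      show "p = (x + 1, y)" if "flow_perm w p = (x, y)" for p
        using uniq[OF that] that i 1 by (elim disjE) (simp_all add: flow_perm_in flow_perm_iff(5))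
    qed
  next
    case 2
    show ?thesis
    proof (rule ex1I[of _ "(x, y + 1)"])
      show "flow_perm w (x, y + 1) = (x, y)" using 2 by (simp add: flow_perm_in flow_perm_iff(5))
      show "p = (x, y + 1)" if "flow_perm w p = (x, y)" for p
        using uniq[OF that] that i 2 by (elim disjE) (simp_all add: flow_perm_in flow_perm_iff(5))
    qed
  next
    case 3
    show ?thesis
    proof (rule ex1I[of _ "(x - 1, y)"])
      show "flow_perm w (x - 1, y) = (x, y)" using 3 by (simp add: flow_perm_in flow_perm_iff(5))
      show "p = (x - 1, y)" if "flow_perm w p = (x, y)" for p
        using uniq[OF that] that i 3 by (elim disjE) (simp_all add: flow_perm_in flow_perm_iff(5))
    qed
  next
    case 4
    show ?thesis
    proof (rule ex1I[of _ "(x, y - 1)"])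
      show "flow_perm w (x, y - 1) = (x, y)" using 4 by (simp add: flow_perm_in flow_perm_iff(5))
      show "p = (x, y - 1)" if "flow_perm w p = (x, y)" for p
        using uniq[OF that] that i 4 by (elim disjE) (simp_all add: flow_perm_in flow_perm_iff(5))
    qed
  next
    case 5
    show ?thesis
    proof (rule ex1I[of _ "(x, y)"])
      show "flow_perm w (x, y) = (x, y)" using 5 by (simp add: flow_perm_in flow_perm_iff(5))
      show "p = (x, y)" if "flow_perm w p = (x, y)" for p
        using uniq[OF that] that i 5 by (elim disjE) (simp_all add: flow_perm_in flow_perm_iff(5))
    qed
  qed
qed

lemma short_perm_flow_perm: "short_perm (flow_perm w)"
proof -
  have "bij (flow_perm w)" unfolding bij_iff using flow_perm_ex1 by auto
  moreover have "{v. flow_perm w v \<noteq> v} \<subseteq> (\<Union>(x, y) \<in> {f. w f \<noteq> 0}. {(x, y), (x + 1, y), (x + 1, y + 1), (x, y + 1)})"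
  proof
    fix v assume "v \<in> {v. flow_perm w v \<noteq> v}"
    moreover obtain x y where v: "v = (x, y)" by fastforce
    ultimately have "\<not> (w (x, y) = w (x - 1, y) \<and> w (x - 1, y) = w (x - 1, y - 1) \<and> w (x - 1, y - 1) = w (x, y - 1))"
      using flow_perm_iff(5) by auto
    then have "w (x, y) \<noteq> 0 \<or> w (x - 1, y) \<noteq> 0 \<or> w (x - 1, y - 1) \<noteq> 0 \<or> w (x, y - 1) \<noteq> 0" by auto
    then show "v \<in> (\<Union>(x, y) \<in> {f. w f \<noteq> 0}. {(x, y), (x + 1, y), (x + 1, y + 1), (x, y + 1)})"
      unfolding v by force
  qed
  then have "finite {v. flow_perm w v \<noteq> v}"
    by (rule finite_subset) (use w in \<open>auto simp: height_fun_def\<close>)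
  ultimately show ?thesis by (simp add: short_perm_def near_flow_perm)
qed

lemma height_of_flow_perm: "height_of (flow_perm w) w"
proof -
  have d: "d = of_bool (d = 1) - of_bool (d = - 1)" if "\<bar>d\<bar> \<le> 1" for d :: int
  proof -
    have "d = 0 \<or> d = 1 \<or> d = - 1" using that by linarith
    then show ?thesis by auto
  qed
  have "w (x, y) - w (x, y - 1) = perm_flow (flow_perm w) (x, y) (x + 1, y)" for x y
    unfolding perm_flow_def flow_perm_iff flow_perm_in
    by (rule d) (use vok[of x y] in \<open>auto simp: vertex_ok_def\<close>)
  moreover have "w (x - 1, y) - w (x, y) = perm_flow (flow_perm w) (x, y) (x, y + 1)" for x y
    unfolding perm_flow_def flow_perm_iff flow_perm_in
    by (rule d) (use vok[of x y] in \<open>auto simp: vertex_ok_def\<close>)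
  ultimately show ?thesis using short_perm_flow_perm w by (simp add: height_of_def height_fun_def)
qed

end

section \<open>Two-cycles and permutations with equal heights\<close>

lemma height_of_cong_flow:
  assumes "height_of \<sigma> w" "short_perm \<tau>" "\<And>p q. p \<noteq> q \<Longrightarrow> perm_flow \<tau> p q = perm_flow \<sigma> p q"
  shows "height_of \<tau> w"
  using assms by (simp add: height_of_def)

lemma two_cycle_insert:
  assumes h: "height_of \<sigma> w" and f: "\<sigma> u = u" "\<sigma> v = v" "near u v" "u \<noteq> v"
  shows "height_of (\<sigma> \<circ> Transposition.transpose u v) w" "perm_step \<sigma> (\<sigma> \<circ> Transposition.transpose u v)"
proof -
  have s: "short_perm \<sigma>" using h by (simp add: height_of_def)
  have t: "short_perm (\<sigma> \<circ> Transposition.transpose u v)"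
    by (rule short_perm_transpose[OF s]) (use f near_sym in auto)
  show "perm_step \<sigma> (\<sigma> \<circ> Transposition.transpose u v)" using s t f(4) unfolding perm_step_def by blast
  have iff: "\<sigma> p = u \<longleftrightarrow> p = u" "\<sigma> p = v \<longleftrightarrow> p = v" for p
    using inj_short_perm[OF s, of p u] inj_short_perm[OF s, of p v] f by auto
  have "perm_flow (\<sigma> \<circ> Transposition.transpose u v) p q = perm_flow \<sigma> p q" if "p \<noteq> q" for p q
    using that f(3-) by (cases "p = u"; cases "p = v"; cases "q = u"; cases "q = v")
      (simp_all add: perm_flow_def Transposition.transpose_def iff f(1,2))
  then show "height_of (\<sigma> \<circ> Transposition.transpose u v) w" using height_of_cong_flow[OF h t] by simp
qed

lemma two_cycle_remove:
  assumes h: "height_of \<sigma> w" and f: "\<sigma> u = v" "\<sigma> v = u" "u \<noteq> v"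
  shows "height_of (\<sigma> \<circ> Transposition.transpose u v) w" "perm_step \<sigma> (\<sigma> \<circ> Transposition.transpose u v)"
proof -
  have s: "short_perm \<sigma>" using h by (simp add: height_of_def)
  have t: "short_perm (\<sigma> \<circ> Transposition.transpose u v)"
    by (rule short_perm_transpose[OF s]) (use f in \<open>auto simp: near_def\<close>)
  show "perm_step \<sigma> (\<sigma> \<circ> Transposition.transpose u v)" using s t f(3) unfolding perm_step_def by blast
  have iff: "\<sigma> p = u \<longleftrightarrow> p = v" "\<sigma> p = v \<longleftrightarrow> p = u" for p
    using inj_short_perm[OF s, of p v] inj_short_perm[OF s, of p u] f by auto
  have "perm_flow (\<sigma> \<circ> Transposition.transpose u v) p q = perm_flow \<sigma> p q" if "p \<noteq> q" for p q
    using that f(3-) by (cases "p = u"; cases "p = v"; cases "q = u"; cases "q = v")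
      (simp_all add: perm_flow_def Transposition.transpose_def iff f(1,2))
  then show "height_of (\<sigma> \<circ> Transposition.transpose u v) w" using height_of_cong_flow[OF h t] by simp
qed

lemma two_cycle_if_not_flow:
  assumes h: "height_of \<sigma> w" and n: "\<sigma> v \<noteq> flow_perm w v"
  shows "\<sigma> (\<sigma> v) = v" "\<sigma> v \<noteq> v" "flow_perm w v = v"
proof -
  have s: "short_perm \<sigma>" using h by (simp add: height_of_def)
  have w: "height_fun w" by (rule height_fun_height_of[OF h])
  obtain x y where v: "v = (x, y)" by fastforce
  note hv = height_of_vertex[OF h, of x y]
  have out: "\<sigma> (x, y) = q \<Longrightarrow> q \<noteq> (x, y) \<Longrightarrow> \<sigma> q \<noteq> (x, y) \<Longrightarrow> perm_flow \<sigma> (x, y) q = 1" for q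
    by (simp add: perm_flow_def)
  have "\<sigma> (\<sigma> v) = v \<and> \<sigma> v \<noteq> v"
  proof (rule ccontr)
    assume c: "\<not> (\<sigma> (\<sigma> v) = v \<and> \<sigma> v \<noteq> v)"
    show False
    proof (cases "\<sigma> v = v")
      case True
      have "flow_perm w v = v"
        using perm_flow_fixed[OF s True] hv flow_perm_iff(5)[OF w, of x y] unfolding v by simp
      then show False using n True by simp
    next
      case False
      then have "\<sigma> (\<sigma> (x, y)) \<noteq> (x, y)" "\<sigma> (x, y) \<noteq> (x, y)" using c v by auto
      then have "flow_perm w (x, y) = \<sigma> (x, y)"
        using short_perm_out[OF s, of x y] out hv flow_perm_iff[OF w, of x y] by (elim disjE) auto
      then show False using n v by simp
    qed
  qed
  then show c: "\<sigma> (\<sigma> v) = v" "\<sigma> v \<noteq> v" by auto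
  have "perm_flow \<sigma> v q = 0" if "v \<noteq> q" for q
  proof -
    have "\<sigma> q = v \<longleftrightarrow> \<sigma> v = q" using inj_short_perm[OF s, of q "\<sigma> v"] c by auto
    then show ?thesis by (simp add: perm_flow_def)
  qed
  then show "flow_perm w v = v" using hv flow_perm_iff(5)[OF w, of x y] unfolding v by simp
qed

text \<open>Wherever \<open>\<sigma>\<close> differs from \<open>flow_perm w\<close> it has a
  two-cycle. Dissolving it is a step that keeps the heights and reduces the number of
  differences.\<close>

lemma perm_steps_flow_perm: "height_of \<sigma> w \<Longrightarrow> perm_step\<^sup>*\<^sup>* \<sigma> (flow_perm w)"
proof (induction "card {v. \<sigma> v \<noteq> flow_perm w v}" arbitrary: \<sigma> rule: less_induct)
  case (less \<sigma>)
  show ?case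
  proof (cases "\<sigma> = flow_perm w")
    case False
    then obtain v where v: "\<sigma> v \<noteq> flow_perm w v" by (meson ext)
    note t = two_cycle_if_not_flow[OF less.prems v]
    let ?u = "\<sigma> v" and ?\<tau> = "\<sigma> \<circ> Transposition.transpose v (\<sigma> v)"
    have "\<sigma> ?u \<noteq> flow_perm w ?u"
    proof
      assume "\<sigma> ?u = flow_perm w ?u"
      then have "flow_perm w ?u = flow_perm w v" using t by simp
      then show False using inj_short_perm[OF short_perm_flow_perm[OF height_fun_height_of[OF less.prems]]] t(2) by blast
    qed
    note u = two_cycle_if_not_flow(3)[OF less.prems this]
    have h: "height_of ?\<tau> w" "perm_step \<sigma> ?\<tau>"
      using two_cycle_remove[OF less.prems, of v ?u] t by auto
    have sub: "{z. ?\<tau> z \<noteq> flow_perm w z} \<subseteq> {z. \<sigma> z \<noteq> flow_perm w z} - {v}"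
      using t u by (auto simp: Transposition.transpose_def split: if_splits)
    have "{z. \<sigma> z \<noteq> flow_perm w z} \<subseteq> {z. \<sigma> z \<noteq> z} \<union> {z. flow_perm w z \<noteq> z}" by auto
    then have fin: "finite {z. \<sigma> z \<noteq> flow_perm w z}"
      by (rule finite_subset) (use less.prems short_perm_flow_perm[OF height_fun_height_of[OF less.prems]]
          in \<open>simp add: height_of_def short_perm_def\<close>)
    have "card {z. ?\<tau> z \<noteq> flow_perm w z} < card {z. \<sigma> z \<noteq> flow_perm w z}"
      by (rule psubset_card_mono[OF fin]) (use sub v in blast)
    then have "perm_step\<^sup>*\<^sup>* ?\<tau> (flow_perm w)" by (rule less.hyps) (rule h(1))
    with h(2) show ?thesis by (rule converse_rtranclp_into_rtranclp)
  qed simp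
qed

lemma perm_steps_same_height:
  assumes "height_of \<sigma> w" "height_of \<tau> w" shows "perm_step\<^sup>*\<^sup>* \<sigma> \<tau>"
  using perm_steps_flow_perm[OF assms(1)] perm_steps_sym[OF perm_steps_flow_perm[OF assms(2)]] by simp

text \<open>The two arrows run clockwise along the bottom and the top of the face. Exchanging their
  targets makes them run counterclockwise along its left and right sides, and so raises the face by
  one. \<open>height_of_turn_diagonal\<close> is the same with the two pairs of sides
  exchanged.\<close>

lemma height_of_turn_antidiagonal:
  assumes h: "height_of \<rho> w" and r: "\<rho> (x + 1, y) = (x, y)" "\<rho> (x, y + 1) = (x + 1, y + 1)"
  shows "height_of (\<rho> \<circ> Transposition.transpose (x + 1, y) (x, y + 1)) (w((x, y) := w (x, y) + 1))"
    "perm_step \<rho> (\<rho> \<circ> Transposition.transpose (x + 1, y) (x, y + 1))"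
proof -
  let ?\<tau> = "\<rho> \<circ> Transposition.transpose (x + 1, y) (x, y + 1)" and ?w = "w((x, y) := w (x, y) + 1)"
  have s: "short_perm \<rho>" using h by (simp add: height_of_def)
  have t: "short_perm ?\<tau>"
    by (rule short_perm_transpose[OF s]) (simp_all add: r near_def)
  show "perm_step \<rho> ?\<tau>" unfolding perm_step_def
    by (intro conjI exI[of _ "(x + 1, y)"] exI[of _ "(x, y + 1)"] s t) simp_all
  have other: "?\<tau> p = \<rho> p" if "p \<noteq> (x + 1, y)" "p \<noteq> (x, y + 1)" for p
    using that by (simp add: Transposition.transpose_def)
  have new: "?\<tau> (x + 1, y) = (x + 1, y + 1)" "?\<tau> (x, y + 1) = (x, y)" using r by simp_all
  have fin: "finite {f. ?w f \<noteq> 0}"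
    by (rule finite_subset[of _ "insert (x, y) {f. w f \<noteq> 0}"]) (use h in \<open>auto simp: height_of_def\<close>)
  have hor: "?w (p, q) - ?w (p, q - 1) = perm_flow ?\<tau> (p, q) (p + 1, q)" for p q
  proof -
    have "w (p, q) - w (p, q - 1) = perm_flow \<rho> (p, q) (p + 1, q)" by (rule height_of_vertex(1)[OF h])
    moreover have "perm_flow ?\<tau> (p, q) (p + 1, q) = perm_flow \<rho> (p, q) (p + 1, q) +
        (if p = x \<and> q = y then 1 else if p = x \<and> q = y + 1 then - 1 else 0)"
      using other[of "(p, q)"] other[of "(p + 1, q)"] new r by (auto simp: perm_flow_def Transposition.transpose_def)
    ultimately show ?thesis by auto
  qed
  have ver: "?w (p - 1, q) - ?w (p, q) = perm_flow ?\<tau> (p, q) (p, q + 1)" for p q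
  proof -
    have "w (p - 1, q) - w (p, q) = perm_flow \<rho> (p, q) (p, q + 1)" by (rule height_of_vertex(2)[OF h])
    moreover have "perm_flow ?\<tau> (p, q) (p, q + 1) = perm_flow \<rho> (p, q) (p, q + 1) +
        (if p = x \<and> q = y then - 1 else if p = x + 1 \<and> q = y then 1 else 0)"
      using other[of "(p, q)"] other[of "(p, q + 1)"] new r by (auto simp: perm_flow_def Transposition.transpose_def)
    ultimately show ?thesis by auto
  qed
  show "height_of ?\<tau> ?w" using t fin hor ver unfolding height_of_def by blast
qed

lemma height_of_turn_diagonal:
  assumes h: "height_of \<rho> w" and r: "\<rho> (x, y) = (x, y + 1)" "\<rho> (x + 1, y + 1) = (x + 1, y)"
  shows "height_of (\<rho> \<circ> Transposition.transpose (x, y) (x + 1, y + 1)) (w((x, y) := w (x, y) + 1))"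
    "perm_step \<rho> (\<rho> \<circ> Transposition.transpose (x, y) (x + 1, y + 1))"
proof -
  let ?\<tau> = "\<rho> \<circ> Transposition.transpose (x, y) (x + 1, y + 1)" and ?w = "w((x, y) := w (x, y) + 1)"
  have s: "short_perm \<rho>" using h by (simp add: height_of_def)
  have t: "short_perm ?\<tau>"
    by (rule short_perm_transpose[OF s]) (simp_all add: r near_def)
  show "perm_step \<rho> ?\<tau>" unfolding perm_step_def
    by (intro conjI exI[of _ "(x, y)"] exI[of _ "(x + 1, y + 1)"] s t) simp_all
  have other: "?\<tau> p = \<rho> p" if "p \<noteq> (x, y)" "p \<noteq> (x + 1, y + 1)" for p
    using that by (simp add: Transposition.transpose_def)
  have new: "?\<tau> (x, y) = (x + 1, y)" "?\<tau> (x + 1, y + 1) = (x, y + 1)" using r by simp_all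
  have fin: "finite {f. ?w f \<noteq> 0}"
    by (rule finite_subset[of _ "insert (x, y) {f. w f \<noteq> 0}"]) (use h in \<open>auto simp: height_of_def\<close>)
  have hor: "?w (p, q) - ?w (p, q - 1) = perm_flow ?\<tau> (p, q) (p + 1, q)" for p q
  proof -
    have "w (p, q) - w (p, q - 1) = perm_flow \<rho> (p, q) (p + 1, q)" by (rule height_of_vertex(1)[OF h])
    moreover have "perm_flow ?\<tau> (p, q) (p + 1, q) = perm_flow \<rho> (p, q) (p + 1, q) +
        (if p = x \<and> q = y then 1 else if p = x \<and> q = y + 1 then - 1 else 0)"
      using other[of "(p, q)"] other[of "(p + 1, q)"] new r by (auto simp: perm_flow_def Transposition.transpose_def)
    ultimately show ?thesis by auto
  qed
  have ver: "?w (p - 1, q) - ?w (p, q) = perm_flow ?\<tau> (p, q) (p, q + 1)" for p q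
  proof -
    have "w (p - 1, q) - w (p, q) = perm_flow \<rho> (p, q) (p, q + 1)" by (rule height_of_vertex(2)[OF h])
    moreover have "perm_flow ?\<tau> (p, q) (p, q + 1) = perm_flow \<rho> (p, q) (p, q + 1) +
        (if p = x \<and> q = y then - 1 else if p = x + 1 \<and> q = y then 1 else 0)"
      using other[of "(p, q)"] other[of "(p, q + 1)"] new r by (auto simp: perm_flow_def Transposition.transpose_def)
    ultimately show ?thesis by auto
  qed
  show "height_of ?\<tau> ?w" using t fin hor ver unfolding height_of_def by blast
qed

section \<open>Lifting the moves of heights to permutations\<close>

definition liftable :: "(int \<times> int \<Rightarrow> int) \<Rightarrow> (int \<times> int \<Rightarrow> int) \<Rightarrow> bool" where
  "liftable w w' \<longleftrightarrow> (\<exists>\<sigma> \<tau>. height_of \<sigma> w \<and> height_of \<tau> w' \<and> perm_step\<^sup>*\<^sup>* \<sigma> \<tau>)"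

lemma liftable_sym: "liftable w w' \<Longrightarrow> liftable w' w"
  unfolding liftable_def using perm_steps_sym by blast

lemma liftableI: "height_of \<sigma> w \<Longrightarrow> height_of \<tau> w' \<Longrightarrow> perm_step \<sigma> \<tau> \<Longrightarrow> liftable w w'"
  unfolding liftable_def by blast

text \<open>Supplies an arrow from \<open>v\<close> to \<open>u\<close> without changing the
  heights: either it is there, or both vertices are fixed and a two-cycle provides it.\<close>

lemma two_cycle_on_edge:
  assumes h: "height_of \<sigma> w" and n: "near u v" "u \<noteq> v"
    and e: "\<sigma> v = u \<or> \<sigma> u = u \<and> \<sigma> v = v"
  obtains \<tau> where "height_of \<tau> w" "\<tau> v = u" "\<And>p. p \<noteq> u \<Longrightarrow> p \<noteq> v \<Longrightarrow> \<tau> p = \<sigma> p"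
proof (cases "\<sigma> v = u")
  case True
  then show ?thesis using that[OF h] by blast
next
  case False
  then have "\<sigma> u = u" "\<sigma> v = v" using e by auto
  then show ?thesis
    using that[of "\<sigma> \<circ> Transposition.transpose u v"] two_cycle_insert(1)[OF h _ _ n] by (simp add: Transposition.transpose_def)
qed

text \<open>If two opposite neighbours of the face are at \<open>m + 1\<close>, the arrows along the
  sides they share with it already run as a turn requires. If instead they are at \<open>m\<close>,
  the other two sides are used: each carries such an arrow when the neighbour across it is at
  \<open>m + 1\<close>, and gets one from a two-cycle when that neighbour is at
  \<open>m\<close>.\<close>

lemma liftable_up:
  assumes w: "height_fun w" and w': "height_fun w'" and w'_def: "w' = w((x, y) := w (x, y) + 1)"
    and n: "w (x - 1, y) = w (x + 1, y) \<and> \<bar>w (x - 1, y) - w (x, y)\<bar> \<le> 1 \<and> w (x - 1, y) \<ge> w (x, y) \<or>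
            w (x, y - 1) = w (x, y + 1) \<and> \<bar>w (x, y - 1) - w (x, y)\<bar> \<le> 1 \<and> w (x, y - 1) \<ge> w (x, y)"
  shows "liftable w w'"
proof -
  define m where "m = w (x, y)"
  have h: "height_of (flow_perm w) w" by (rule height_of_flow_perm[OF w])
  note iff = flow_perm_iff[OF w]
  have 1: "vertex_ok (m + 1) (w (x - 1, y)) (w (x - 1, y - 1)) (w (x, y - 1))"
    "vertex_ok (w (x + 1, y)) (m + 1) (w (x, y - 1)) (w (x + 1, y - 1))"
    "vertex_ok (w (x, y + 1)) (w (x - 1, y + 1)) (w (x - 1, y)) (m + 1)"
    "vertex_ok (w (x + 1, y + 1)) (w (x, y + 1)) (m + 1) (w (x + 1, y))"
    using vok[OF w', of x y] vok[OF w', of "x + 1" y] vok[OF w', of x "y + 1"] vok[OF w', of "x + 1" "y + 1"]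
    by (simp_all add: w'_def m_def)
  have 0: "vertex_ok m (w (x - 1, y)) (w (x - 1, y - 1)) (w (x, y - 1))"
    "vertex_ok (w (x + 1, y + 1)) (w (x, y + 1)) m (w (x + 1, y))"
    using vok[OF w, of x y] vok[OF w, of "x + 1" "y + 1"] by (simp_all add: m_def)
  have nb: "w (x - 1, y) = m \<or> w (x - 1, y) = m + 1" "w (x + 1, y) = m \<or> w (x + 1, y) = m + 1"
    "w (x, y - 1) = m \<or> w (x, y - 1) = m + 1" "w (x, y + 1) = m \<or> w (x, y + 1) = m + 1"
  proof -
    have "\<bar>m - w (x - 1, y)\<bar> \<le> 1" "\<bar>m - w (x, y - 1)\<bar> \<le> 1" "\<bar>m - w (x + 1, y)\<bar> \<le> 1" "\<bar>m - w (x, y + 1)\<bar> \<le> 1"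
      "\<bar>m + 1 - w (x - 1, y)\<bar> \<le> 1" "\<bar>m + 1 - w (x, y - 1)\<bar> \<le> 1" "\<bar>m + 1 - w (x + 1, y)\<bar> \<le> 1" "\<bar>m + 1 - w (x, y + 1)\<bar> \<le> 1"
      using 0 1(1,4) by (simp_all add: vertex_ok_def abs_minus_commute)
    then show "w (x - 1, y) = m \<or> w (x - 1, y) = m + 1" "w (x + 1, y) = m \<or> w (x + 1, y) = m + 1"
      "w (x, y - 1) = m \<or> w (x, y - 1) = m + 1" "w (x, y + 1) = m \<or> w (x, y + 1) = m + 1"
      by linarith+
  qed
  \<comment> \<open>Validity of the raised function forces a face between two neighbours of height
    \<open>m\<close> to have height \<open>m\<close> as well. So both ends of a side without flow
    are fixed, and a two-cycle can be inserted there.\<close>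
  have corner: "w (x - 1, y) = m \<Longrightarrow> w (x, y - 1) = m \<Longrightarrow> w (x - 1, y - 1) = m"
    "w (x + 1, y) = m \<Longrightarrow> w (x, y - 1) = m \<Longrightarrow> w (x + 1, y - 1) = m"
    "w (x - 1, y) = m \<Longrightarrow> w (x, y + 1) = m \<Longrightarrow> w (x - 1, y + 1) = m"
    "w (x + 1, y) = m \<Longrightarrow> w (x, y + 1) = m \<Longrightarrow> w (x + 1, y + 1) = m"
    using vertex_ok_corner[of "m + 1" m "w (x - 1, y - 1)"] vertex_ok_corner[of "m + 1" m "w (x + 1, y - 1)"]
      vertex_ok_corner[of "m + 1" m "w (x - 1, y + 1)"] vertex_ok_corner[of "m + 1" m "w (x + 1, y + 1)"]
      1(1) vertex_ok_rotate[THEN iffD1, OF 1(2)] vertex_ok_rotate[THEN iffD2, OF 1(3)]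
      vertex_ok_rotate[THEN iffD1, OF vertex_ok_rotate[THEN iffD1, OF 1(4)]] by simp_all
  consider "w (x - 1, y) = m + 1" "w (x + 1, y) = m + 1" | "w (x, y - 1) = m + 1" "w (x, y + 1) = m + 1"
    | "w (x - 1, y) = m" "w (x + 1, y) = m" | "w (x, y - 1) = m" "w (x, y + 1) = m"
    using n nb unfolding m_def[symmetric] by linarith
  then show ?thesis
  proof cases
    case 1
    then have "flow_perm w (x, y) = (x, y + 1)" "flow_perm w (x + 1, y + 1) = (x + 1, y)"
      using iff(2)[of x y] iff(4)[of "x + 1" "y + 1"] by (auto simp: m_def)
    from height_of_turn_diagonal[OF h this] show ?thesis unfolding w'_def using liftableI[OF h] by blast
  next
    case 2
    then have "flow_perm w (x + 1, y) = (x, y)" "flow_perm w (x, y + 1) = (x + 1, y + 1)"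
      using iff(3)[of "x + 1" y] iff(1)[of x "y + 1"] by (auto simp: m_def)
    from height_of_turn_antidiagonal[OF h this] show ?thesis unfolding w'_def using liftableI[OF h] by blast
  next
    case 3
    have b: "flow_perm w (x + 1, y) = (x, y) \<or> flow_perm w (x, y) = (x, y) \<and> flow_perm w (x + 1, y) = (x + 1, y)"
      using nb(3)
    proof
      assume "w (x, y - 1) = m"
      then show ?thesis using 3 corner(1,2) iff(5)[of x y] iff(5)[of "x + 1" y] by (auto simp: m_def)
    next
      assume "w (x, y - 1) = m + 1"
      then show ?thesis using iff(3)[of "x + 1" y] by (auto simp: m_def)
    qed
    have t: "flow_perm w (x, y + 1) = (x + 1, y + 1) \<or>
        flow_perm w (x + 1, y + 1) = (x + 1, y + 1) \<and> flow_perm w (x, y + 1) = (x, y + 1)"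
      using nb(4)
    proof
      assume "w (x, y + 1) = m"
      then show ?thesis using 3 corner(3,4) iff(5)[of x "y + 1"] iff(5)[of "x + 1" "y + 1"] by (auto simp: m_def)
    next
      assume "w (x, y + 1) = m + 1"
      then show ?thesis using iff(1)[of x "y + 1"] by (auto simp: m_def)
    qed
    obtain \<tau> where \<tau>: "height_of \<tau> w" "\<tau> (x + 1, y) = (x, y)" "\<And>p. p \<noteq> (x, y) \<Longrightarrow> p \<noteq> (x + 1, y) \<Longrightarrow> \<tau> p = flow_perm w p"
      by (rule two_cycle_on_edge[OF h _ _ b]) (auto simp: near_def)
    have "\<tau> (x, y + 1) = (x + 1, y + 1) \<or> \<tau> (x + 1, y + 1) = (x + 1, y + 1) \<and> \<tau> (x, y + 1) = (x, y + 1)"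
      using t \<tau>(3)[of "(x, y + 1)"] \<tau>(3)[of "(x + 1, y + 1)"] by simp
    then obtain \<rho> where \<rho>: "height_of \<rho> w" "\<rho> (x, y + 1) = (x + 1, y + 1)"
        "\<And>p. p \<noteq> (x + 1, y + 1) \<Longrightarrow> p \<noteq> (x, y + 1) \<Longrightarrow> \<rho> p = \<tau> p"
      by (rule two_cycle_on_edge[OF \<tau>(1), rotated 2]) (auto simp: near_def)
    have "\<rho> (x + 1, y) = (x, y)" using \<rho>(3)[of "(x + 1, y)"] \<tau>(2) by simp
    from height_of_turn_antidiagonal[OF \<rho>(1) this \<rho>(2)] show ?thesis
      unfolding w'_def using liftableI[OF \<rho>(1)] by blast
  next
    case 4
    have b: "flow_perm w (x, y) = (x, y + 1) \<or> flow_perm w (x, y + 1) = (x, y + 1) \<and> flow_perm w (x, y) = (x, y)"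
      using nb(1)
    proof
      assume "w (x - 1, y) = m"
      then show ?thesis using 4 corner(1,3) iff(5)[of x y] iff(5)[of x "y + 1"] by (auto simp: m_def)
    next
      assume "w (x - 1, y) = m + 1"
      then show ?thesis using iff(2)[of x y] by (auto simp: m_def)
    qed
    have t: "flow_perm w (x + 1, y + 1) = (x + 1, y) \<or>
        flow_perm w (x + 1, y) = (x + 1, y) \<and> flow_perm w (x + 1, y + 1) = (x + 1, y + 1)"
      using nb(2)
    proof
      assume "w (x + 1, y) = m"
      then show ?thesis using 4 corner(2,4) iff(5)[of "x + 1" y] iff(5)[of "x + 1" "y + 1"] by (auto simp: m_def)
    next
      assume "w (x + 1, y) = m + 1"
      then show ?thesis using iff(4)[of "x + 1" "y + 1"] by (auto simp: m_def)
    qed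
    obtain \<tau> where \<tau>: "height_of \<tau> w" "\<tau> (x, y) = (x, y + 1)" "\<And>p. p \<noteq> (x, y + 1) \<Longrightarrow> p \<noteq> (x, y) \<Longrightarrow> \<tau> p = flow_perm w p"
      by (rule two_cycle_on_edge[OF h _ _ b]) (auto simp: near_def)
    have "\<tau> (x + 1, y + 1) = (x + 1, y) \<or> \<tau> (x + 1, y) = (x + 1, y) \<and> \<tau> (x + 1, y + 1) = (x + 1, y + 1)"
      using t \<tau>(3)[of "(x + 1, y)"] \<tau>(3)[of "(x + 1, y + 1)"] by simp
    then obtain \<rho> where \<rho>: "height_of \<rho> w" "\<rho> (x + 1, y + 1) = (x + 1, y)"
        "\<And>p. p \<noteq> (x + 1, y) \<Longrightarrow> p \<noteq> (x + 1, y + 1) \<Longrightarrow> \<rho> p = \<tau> p"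
      by (rule two_cycle_on_edge[OF \<tau>(1), rotated 2]) (auto simp: near_def)
    have "\<rho> (x, y) = (x, y + 1)" using \<rho>(3)[of "(x, y)"] \<tau>(2) by simp
    from height_of_turn_diagonal[OF \<rho>(1) this \<rho>(2)] show ?thesis
      unfolding w'_def using liftableI[OF \<rho>(1)] by blast
  qed
qed

lemma liftable_step:
  assumes "height_step w w'" shows "liftable w w'"
proof -
  obtain x y a where w': "w' = w((x, y) := a)"
    and n: "w (x - 1, y) = a \<and> w (x + 1, y) = a \<or> w (x, y - 1) = a \<and> w (x, y + 1) = a"
    using assms unfolding height_step_def by blast
  have h: "height_fun w" "height_fun w'" using height_step_fun[OF assms] by auto
  have "\<bar>a - w (x, y)\<bar> \<le> 1"
    using n vok[OF h(1), of x y] by (auto simp: vertex_ok_def)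
  then consider "w (x, y) = a" | "a = w (x, y) + 1" | "w (x, y) = a + 1" by linarith
  then show ?thesis
  proof cases
    case 1
    then have "w' = w" by (auto simp: w')
    then show ?thesis using height_of_flow_perm[OF h(1)] unfolding liftable_def by blast
  next
    case 2
    show ?thesis by (rule liftable_up[OF h, of x y]) (use 2 n w' in auto)
  next
    case 3
    have "w = w'((x, y) := w' (x, y) + 1)" using 3 by (auto simp: w')
    then have "liftable w' w"
      by (rule liftable_up[OF h(2,1)]) (use n in \<open>auto simp: w'\<close>)
    then show ?thesis by (rule liftable_sym)
  qed
qed

lemma perm_steps_liftable:
  assumes "liftable w w'" "height_of \<sigma> w" "height_of \<tau> w'" shows "perm_step\<^sup>*\<^sup>* \<sigma> \<tau>"
proof -
  obtain \<sigma>' \<tau>' where "height_of \<sigma>' w" "height_of \<tau>' w'" "perm_step\<^sup>*\<^sup>* \<sigma>' \<tau>'"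
    using assms(1) unfolding liftable_def by blast
  then show ?thesis using perm_steps_same_height assms(2,3) by (meson rtranclp_trans)
qed

lemma liftable_height_eq: "w \<simeq> w' \<Longrightarrow> liftable w w'"
proof (induction rule: height_eq_induct)
  case (refl w)
  then show ?case using height_of_flow_perm unfolding liftable_def by blast
next
  case (trans w w' w'')
  have h: "height_of (flow_perm w) w" "height_of (flow_perm w') w'" "height_of (flow_perm w'') w''"
    using trans height_of_flow_perm by blast+
  have "perm_step\<^sup>*\<^sup>* (flow_perm w) (flow_perm w'')"
    using perm_steps_liftable[OF trans(4) h(1,2)] perm_steps_liftable[OF trans(5) h(2,3)] by simp
  then show ?case using h unfolding liftable_def by blast
qed (auto intro: liftable_step liftable_sym)

theorem perm_steps_height_eq:
  "w \<simeq> w' \<Longrightarrow> height_of \<sigma> w \<Longrightarrow> height_of \<tau> w' \<Longrightarrow> perm_step\<^sup>*\<^sup>* \<sigma> \<tau>"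
  using perm_steps_liftable liftable_height_eq by blast

lemma height_of_add:
  assumes s: "height_of \<sigma> w" and t: "height_of \<tau> u" and d: "\<And>v. \<sigma> v = v \<or> \<tau> v = v"
  shows "height_of (\<sigma> \<circ> \<tau>) (\<lambda>f. w f + u f)"
proof -
  have ss: "short_perm \<sigma>" and tt: "short_perm \<tau>" using s t by (auto simp: height_of_def)
  \<comment> \<open>The image of a vertex moved by \<open>\<tau>\<close> is moved by
    \<open>\<tau>\<close> too, hence fixed by \<open>\<sigma>\<close>.\<close>
  have \<tau>\<tau>: "\<tau> p \<noteq> p \<Longrightarrow> \<sigma> (\<tau> p) = \<tau> p" for p
    using d[of "\<tau> p"] inj_short_perm[OF tt, of "\<tau> p" p] by auto
  have c: "(\<sigma> \<circ> \<tau>) p = (if \<tau> p = p then \<sigma> p else \<tau> p)" for p using \<tau>\<tau>[of p] by simp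
  have "bij (\<sigma> \<circ> \<tau>)" using ss tt by (simp add: short_perm_def bij_comp)
  moreover have "finite {v. (\<sigma> \<circ> \<tau>) v \<noteq> v}"
    by (rule finite_subset[of _ "{v. \<sigma> v \<noteq> v} \<union> {v. \<tau> v \<noteq> v}"]) (use ss tt in \<open>auto simp: short_perm_def\<close>)
  moreover have "near v ((\<sigma> \<circ> \<tau>) v)" for v using short_perm_near[OF ss, of v] short_perm_near[OF tt, of v] unfolding c by simp
  ultimately have st: "short_perm (\<sigma> \<circ> \<tau>)" unfolding short_perm_def by blast
  have o: "of_bool ((\<sigma> \<circ> \<tau>) p = q) = (of_bool (\<sigma> p = q) + of_bool (\<tau> p = q) :: int)" if "p \<noteq> q" for p q
    using that d[of p] unfolding c by auto
  have "perm_flow (\<sigma> \<circ> \<tau>) p q = perm_flow \<sigma> p q + perm_flow \<tau> p q" if "p \<noteq> q" for p q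
    using o[OF that] o[of q p] that unfolding perm_flow_def by simp
  moreover have "finite {f. w f + u f \<noteq> 0}"
    by (rule finite_subset[of _ "{f. w f \<noteq> 0} \<union> {f. u f \<noteq> 0}"]) (use s t in \<open>auto simp: height_of_def\<close>)
  moreover have "w (x, y) + u (x, y) - (w (x, y - 1) + u (x, y - 1)) =
      perm_flow \<sigma> (x, y) (x + 1, y) + perm_flow \<tau> (x, y) (x + 1, y)" for x y
    using height_of_vertex(1)[OF s, of x y] height_of_vertex(1)[OF t, of x y] by linarith
  moreover have "w (x - 1, y) + u (x - 1, y) - (w (x, y) + u (x, y)) =
      perm_flow \<sigma> (x, y) (x, y + 1) + perm_flow \<tau> (x, y) (x, y + 1)" for x y
    using height_of_vertex(2)[OF s, of x y] height_of_vertex(2)[OF t, of x y] by linarith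
  ultimately show ?thesis using st unfolding height_of_def by simp
qed

subsection \<open>Tilings of two floors as matchings\<close>

text \<open>Here \<open>k\<close> is the number of a pair of floors: \<open>2 * k\<close> and \<open>2 * k + 1\<close>.\<close>

definition white_over :: "int \<Rightarrow> square \<Rightarrow> cube" where
  "white_over k = (\<lambda>(x, y). (x, y, 2 * k + (if even (x + y) then 0 else 1)))"

definition black_over :: "int \<Rightarrow> square \<Rightarrow> cube" where
  "black_over k = (\<lambda>(x, y). (x, y, 2 * k + (if even (x + y) then 1 else 0)))"

definition match_dimer :: "int \<Rightarrow> (square \<Rightarrow> square) \<Rightarrow> square \<Rightarrow> cube set" where
  "match_dimer k \<sigma> v = {white_over k v, black_over k (\<sigma> v)}"

definition match_tiling :: "int \<Rightarrow> square set \<Rightarrow> (square \<Rightarrow> square) \<Rightarrow> cube set set" where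
  "match_tiling k A \<sigma> = match_dimer k \<sigma> ` A"

definition matching :: "square set \<Rightarrow> square set \<Rightarrow> (square \<Rightarrow> square) \<Rightarrow> bool" where
  "matching A B \<sigma> \<longleftrightarrow> bij_betw \<sigma> A B \<and> (\<forall>v\<in>A. near v (\<sigma> v))"

lemma white_cube_white_over: "white_cube (white_over k v)"
  by (cases v) (simp add: white_cube_def white_over_def)

lemma white_cube_black_over: "\<not> white_cube (black_over k v)"
  by (cases v) (simp add: white_cube_def black_over_def)

lemma white_over_ne_black_over: "white_over k v \<noteq> black_over l u"
  using white_cube_white_over white_cube_black_over by metis

lemma white_over_eq_iff: "white_over k u = white_over k v \<longleftrightarrow> u = v"
  by (cases u, cases v) (auto simp: white_over_def)

lemma black_over_eq_iff: "black_over k u = black_over k v \<longleftrightarrow> u = v"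
  by (cases u, cases v) (auto simp: black_over_def)

lemma white_black_pair_eq_iff:
  "{white_over k v, black_over l u} = {white_over k v', black_over l u'} \<longleftrightarrow> v = v' \<and> u = u'"
  using white_over_ne_black_over[of k v l u'] white_over_ne_black_over[of k v' l u]
  by (auto simp: doubleton_eq_iff white_over_eq_iff black_over_eq_iff)

lemma dimer_colours:
  assumes "dimer d"
  obtains a b where "d = {a, b}" "white_cube a" "\<not> white_cube b"
proof -
  obtain x y z x' y' z' where d: "d = {(x, y, z), (x', y', z')}" and "x' + y' + z' = x + y + z + 1"
    using assms unfolding dimer_def x_dimer_def y_dimer_def z_dimer_def by fastforce
  then have "white_cube (x, y, z) \<longleftrightarrow> \<not> white_cube (x', y', z')"
    unfolding white_cube_def prod.case by presburger
  then show ?thesis using that[of "(x, y, z)" "(x', y', z')"] that[of "(x', y', z')" "(x, y, z)"] d by (auto simp: insert_commute)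
qed

lemma two_floor_white: "white_cube (x, y, z) \<Longrightarrow> z = 0 \<or> z = 1 \<Longrightarrow> (x, y, z) = white_over 0 (x, y)"
  by (auto simp: white_cube_def white_over_def)

lemma two_floor_black: "\<not> white_cube (x, y, z) \<Longrightarrow> z = 0 \<or> z = 1 \<Longrightarrow> (x, y, z) = black_over 0 (x, y)"
  by (auto simp: white_cube_def black_over_def)

lemma dimer_imp_near:
  assumes "dimer {white_over 0 v, black_over 0 u}" shows "near v u"
proof -
  obtain x y x' y' where vu: "v = (x, y)" "u = (x', y')" by fastforce
  show ?thesis
    using assms unfolding dimer_def x_dimer_def y_dimer_def z_dimer_def vu near_def
    by (auto simp: doubleton_eq_iff white_over_def black_over_def)
qed

lemma near_imp_dimer:
  assumes "near v u" shows "dimer {white_over k v, black_over k u}"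
proof -
  obtain x y where v: "v = (x, y)" by fastforce
  define z where "z = 2 * k + (if even (x + y) then 0 else 1)"
  have w: "white_over k v = (x, y, z)" by (simp add: v z_def white_over_def)
  from near_cases[OF assms[unfolded v]] show ?thesis
  proof (elim disjE)
    assume "u = (x, y)"
    then have "black_over k u = (if even (x + y) then (x, y, z + 1) else (x, y, z - 1))"
      by (simp add: black_over_def z_def)
    moreover have "{(x, y, z), (x, y, z - 1)} = {(x, y, z - 1), (x, y, z - 1 + 1)}" by auto
    ultimately show ?thesis unfolding w dimer_def z_dimer_def by (cases "even (x + y)") (simp, blast, metis)
  next
    assume "u = (x + 1, y)"
    then have "{white_over k v, black_over k u} = {(x, y, z), (x + 1, y, z)}" by (simp add: w black_over_def z_def)
    then show ?thesis unfolding dimer_def x_dimer_def by blast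
  next
    assume "u = (x, y + 1)"
    then have "{white_over k v, black_over k u} = {(x, y, z), (x, y + 1, z)}" by (simp add: w black_over_def z_def)
    then show ?thesis unfolding dimer_def y_dimer_def by blast
  next
    assume "u = (x - 1, y)"
    then have "{white_over k v, black_over k u} = {(x - 1, y, z), (x - 1 + 1, y, z)}" by (auto simp: w black_over_def z_def)
    then show ?thesis unfolding dimer_def x_dimer_def by blast
  next
    assume "u = (x, y - 1)"
    then have "{white_over k v, black_over k u} = {(x, y - 1, z), (x, y - 1 + 1, z)}" by (auto simp: w black_over_def z_def)
    then show ?thesis unfolding dimer_def y_dimer_def by blast
  qed
qed

lemma z_dimer_match: "z_dimer {white_over k v, black_over k u} \<longleftrightarrow> u = v"
proof
  show "z_dimer {white_over k v, black_over k u} \<Longrightarrow> u = v"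
    by (cases u, cases v) (auto simp: z_dimer_def white_over_def black_over_def doubleton_eq_iff)
  assume u: "u = v"
  obtain x y where v: "v = (x, y)" by fastforce
  have "{white_over k v, black_over k u} = {(x, y, 2 * k), (x, y, 2 * k + 1)}"
    unfolding u v by (auto simp: white_over_def black_over_def)
  then show "z_dimer {white_over k v, black_over k u}" unfolding z_dimer_def by blast
qed

definition white_squares :: "cube set \<Rightarrow> square set" where
  "white_squares R = {v. white_over 0 v \<in> R}"

definition black_squares :: "cube set \<Rightarrow> square set" where
  "black_squares R = {v. black_over 0 v \<in> R}"

definition two_floors :: "cube set \<Rightarrow> bool" where
  "two_floors R \<longleftrightarrow> finite R \<and> (\<forall>(x, y, z)\<in>R. z = 0 \<or> z = 1)"

lemma tiling_disjoint: "tiling R t \<Longrightarrow> d \<in> t \<Longrightarrow> e \<in> t \<Longrightarrow> c \<in> d \<Longrightarrow> c \<in> e \<Longrightarrow> d = e"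
  unfolding tiling_def partition_on_def disjoint_def by blast

lemma tiling_cover: "tiling R t \<Longrightarrow> c \<in> R \<Longrightarrow> \<exists>d\<in>t. c \<in> d"
  unfolding tiling_def partition_on_def by blast

lemma tiling_sub: "tiling R t \<Longrightarrow> d \<in> t \<Longrightarrow> d \<subseteq> R"
  unfolding tiling_def partition_on_def by blast

lemma tiling_dimer: "tiling R t \<Longrightarrow> d \<in> t \<Longrightarrow> dimer d"
  unfolding tiling_def by blast

lemma tiling_match_form:
  assumes R: "two_floors R" and t: "tiling R t" and d: "d \<in> t"
  obtains v u where "d = {white_over 0 v, black_over 0 u}" "v \<in> white_squares R" "u \<in> black_squares R"
proof -
  obtain a b where ab: "d = {a, b}" "white_cube a" "\<not> white_cube b"
    using dimer_colours[OF tiling_dimer[OF t d]] by metis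
  obtain x y z x' y' z' where a: "a = (x, y, z)" and b: "b = (x', y', z')" by (metis prod_cases3)
  have "a \<in> R" "b \<in> R" using tiling_sub[OF t d] ab by auto
  then have "z = 0 \<or> z = 1" "z' = 0 \<or> z' = 1" using R a b by (auto simp: two_floors_def)
  then have "a = white_over 0 (x, y)" "b = black_over 0 (x', y')"
    using ab a b two_floor_white two_floor_black by auto
  then show ?thesis using that ab \<open>a \<in> R\<close> \<open>b \<in> R\<close> by (auto simp: white_squares_def black_squares_def)
qed

lemma tiling_matching:
  assumes R: "two_floors R" and t: "tiling R t"
  obtains \<sigma> where "matching (white_squares R) (black_squares R) \<sigma>" "t = match_tiling 0 (white_squares R) \<sigma>"
proof -
  have ex: "\<exists>u. {white_over 0 v, black_over 0 u} \<in> t" if "v \<in> white_squares R" for v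
  proof -
    obtain d where d: "d \<in> t" "white_over 0 v \<in> d"
      using tiling_cover[OF t] \<open>v \<in> white_squares R\<close> unfolding white_squares_def by blast
    obtain v' u where vu: "d = {white_over 0 v', black_over 0 u}" by (rule tiling_match_form[OF R t d(1)])
    then have "v' = v" using d(2) white_over_ne_black_over by (auto simp: white_over_eq_iff)
    then show ?thesis using vu d(1) by blast
  qed
  define \<sigma> where "\<sigma> v = (SOME u. {white_over 0 v, black_over 0 u} \<in> t)" for v
  have \<sigma>: "match_dimer 0 \<sigma> v \<in> t" if "v \<in> white_squares R" for v
    unfolding \<sigma>_def match_dimer_def by (rule someI_ex[OF ex[OF that]])
  have uniq: "v = v' \<and> u = \<sigma> v'" if "{white_over 0 v, black_over 0 u} \<in> t" "v' \<in> white_squares R"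
      and touch: "v = v' \<or> u = \<sigma> v'" for v u v'
  proof -
    obtain c where "c \<in> {white_over 0 v, black_over 0 u}" "c \<in> match_dimer 0 \<sigma> v'"
      using touch unfolding match_dimer_def by blast
    then have "{white_over 0 v, black_over 0 u} = match_dimer 0 \<sigma> v'"
      by (rule tiling_disjoint[OF t that(1) \<sigma>[OF that(2)]])
    then show ?thesis by (simp add: match_dimer_def white_black_pair_eq_iff)
  qed
  have "bij_betw \<sigma> (white_squares R) (black_squares R)"
    unfolding bij_betw_def
  proof (intro conjI)
    show "inj_on \<sigma> (white_squares R)"
      by (rule inj_onI) (use uniq \<sigma> in \<open>unfold match_dimer_def, metis\<close>)
    show "\<sigma> ` white_squares R = black_squares R"
    proof (intro equalityI subsetI)
      fix u assume "u \<in> \<sigma> ` white_squares R"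
      then obtain v where "v \<in> white_squares R" "u = \<sigma> v" by blast
      then have "black_over 0 u \<in> R" using tiling_sub[OF t \<sigma>] by (auto simp: match_dimer_def)
      then show "u \<in> black_squares R" by (simp add: black_squares_def)
    next
      fix u assume "u \<in> black_squares R"
      then obtain d where d: "d \<in> t" "black_over 0 u \<in> d"
        using tiling_cover[OF t] unfolding black_squares_def by blast
      obtain v u' where vu: "d = {white_over 0 v, black_over 0 u'}" "v \<in> white_squares R"
        by (rule tiling_match_form[OF R t d(1)])
      then have "u' = u" using d(2) white_over_ne_black_over by (metis black_over_eq_iff empty_iff insert_iff)
      then have "u = \<sigma> v" using uniq[of v u v] vu d(1) by blast
      then show "u \<in> \<sigma> ` white_squares R" using vu(2) by blast
    qed
  qed
  moreover have "near v (\<sigma> v)" if "v \<in> white_squares R" for v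
    using dimer_imp_near tiling_dimer[OF t \<sigma>[OF that]] by (simp add: match_dimer_def)
  moreover have "t = match_tiling 0 (white_squares R) \<sigma>"
  proof (intro equalityI subsetI)
    fix d assume d: "d \<in> t"
    obtain v u where vu: "d = {white_over 0 v, black_over 0 u}" "v \<in> white_squares R"
      by (rule tiling_match_form[OF R t d])
    then have "u = \<sigma> v" using uniq[of v u v] d by blast
    then show "d \<in> match_tiling 0 (white_squares R) \<sigma>" using vu by (auto simp: match_tiling_def match_dimer_def)
  qed (use \<sigma> in \<open>auto simp: match_tiling_def\<close>)
  ultimately show ?thesis using that[of \<sigma>] unfolding matching_def by blast
qed

lemma inj_match_dimer: "inj (match_dimer k \<sigma>)"
  by (rule injI) (simp add: match_dimer_def white_black_pair_eq_iff)

lemma match_tiling_transpose: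
  assumes "u \<in> A" "v \<in> A"
  shows "match_tiling k A (\<sigma> \<circ> Transposition.transpose u v) =
    match_tiling k A \<sigma> - {match_dimer k \<sigma> u, match_dimer k \<sigma> v} \<union>
      {{white_over k u, black_over k (\<sigma> v)}, {white_over k v, black_over k (\<sigma> u)}}"
proof -
  let ?\<tau> = "\<sigma> \<circ> Transposition.transpose u v"
  have "match_tiling k A \<sigma> - {match_dimer k \<sigma> u, match_dimer k \<sigma> v} = match_dimer k \<sigma> ` (A - {u, v})"
    unfolding match_tiling_def using image_set_diff[OF inj_match_dimer, of k \<sigma> A "{u, v}"] by simp
  also have "\<dots> = match_dimer k ?\<tau> ` (A - {u, v})"
    by (rule image_cong) (auto simp: match_dimer_def Transposition.transpose_def)
  finally have 1: "match_tiling k A \<sigma> - {match_dimer k \<sigma> u, match_dimer k \<sigma> v} = match_dimer k ?\<tau> ` (A - {u, v})" .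
  have 2: "{{white_over k u, black_over k (\<sigma> v)}, {white_over k v, black_over k (\<sigma> u)}} = match_dimer k ?\<tau> ` {u, v}"
    by (simp add: match_dimer_def)
  have "A = (A - {u, v}) \<union> {u, v}" using assms by blast
  then have "match_tiling k A ?\<tau> = match_dimer k ?\<tau> ` (A - {u, v}) \<union> match_dimer k ?\<tau> ` {u, v}"
    unfolding match_tiling_def by (metis image_Un)
  then show ?thesis using 1 2 by simp
qed

lemma slab_card: "slab Q \<Longrightarrow> card Q = 4"
proof -
  assume "slab Q"
  moreover have "card ({x, x + 1} \<times> {y, y + 1} \<times> {z}) = 4" "card ({x, x + 1} \<times> {y} \<times> {z, z + 1}) = 4"
    "card ({x} \<times> {y, y + 1} \<times> {z, z + 1}) = 4" for x y z :: int
    by (simp_all add: card_cartesian_product)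
  ultimately show ?thesis unfolding slab_def by metis
qed

lemma dimer_card: "dimer d \<Longrightarrow> card d = 2"
  unfolding dimer_def x_dimer_def y_dimer_def z_dimer_def by auto

lemma flip_tiling:
  assumes t: "tiling R t" and f: "flip t t'"
  shows "tiling R t'" "flip t' t"
proof -
  obtain Q d1 d2 e1 e2 where Q: "slab Q" and d: "d1 \<in> t" "d2 \<in> t" "d1 \<union> d2 = Q"
    and e: "dimer e1" "dimer e2" "e1 \<union> e2 = Q" and ne: "{e1, e2} \<noteq> {d1, d2}"
    and t': "t' = (t - {d1, d2}) \<union> {e1, e2}" using f unfolding flip_def by blast
  have fin: "finite e1" "finite e2" "finite d1" "finite d2"
    using dimer_card[OF e(1)] dimer_card[OF e(2)] dimer_card[OF tiling_dimer[OF t d(1)]]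
      dimer_card[OF tiling_dimer[OF t d(2)]] by (auto intro: card_ge_0_finite)
  \<comment> \<open>Two dimers that cover the four cubes of a slab are disjoint by counting.\<close>
  have "card (e1 \<union> e2) + card (e1 \<inter> e2) = 4"
    using card_Un_Int[OF fin(1,2)] dimer_card[OF e(1)] dimer_card[OF e(2)] by simp
  then have dis: "e1 \<inter> e2 = {}" using e(3) slab_card[OF Q] fin by simp
  have nonempty: "e1 \<noteq> {}" "e2 \<noteq> {}" "d1 \<noteq> {}" "d2 \<noteq> {}"
    using dimer_card[OF e(1)] dimer_card[OF e(2)] dimer_card[OF tiling_dimer[OF t d(1)]]
      dimer_card[OF tiling_dimer[OF t d(2)]] by auto
  have avoid: "s \<inter> Q = {}" if "s \<in> t - {d1, d2}" for s
    proof -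
    have "s \<inter> d1 = {}" "s \<inter> d2 = {}"
      using that d t unfolding tiling_def partition_on_def disjoint_def by auto
    then show ?thesis unfolding d(3)[symmetric] by auto
  qed
  have part: "\<Union>t = R" "{} \<notin> t" using t by (auto simp: tiling_def partition_on_def)
  have "\<Union>t' = R"
  proof -
    have "t = (t - {d1, d2}) \<union> {d1, d2}" using d by blast
    then have "\<Union>t = \<Union>(t - {d1, d2}) \<union> Q" unfolding d(3)[symmetric] by (metis Union_Un_distrib Union_insert Union_empty Un_empty_right)
    moreover have "\<Union>t' = \<Union>(t - {d1, d2}) \<union> Q" unfolding t' e(3)[symmetric] by (simp add: ac_simps)
    ultimately show ?thesis using part by simp
  qed
  moreover have "disjoint t'"
  proof (rule disjointI)
    fix a b assume ab: "a \<in> t'" "b \<in> t'" "a \<noteq> b"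
    from ab(1) have a: "a \<in> t - {d1, d2} \<or> a \<in> {e1, e2}" by (simp only: t' Un_iff)
    from ab(2) have b: "b \<in> t - {d1, d2} \<or> b \<in> {e1, e2}" by (simp only: t' Un_iff)
    show "a \<inter> b = {}"
    proof (cases "a \<in> t - {d1, d2}")
      case True
      then have aQ: "a \<inter> Q = {}" by (rule avoid)
      show ?thesis
      proof (cases "b \<in> t - {d1, d2}")
        case b': True
        show ?thesis using True b' ab(3) t unfolding tiling_def partition_on_def disjoint_def by simp
      next
        case False
        then have "b \<subseteq> Q" using b e(3) by auto
        then show ?thesis using aQ by auto
      qed
    next
      case False
      then have aQ: "a \<in> {e1, e2}" "a \<subseteq> Q" using a e(3) by auto
      show ?thesis
      proof (cases "b \<in> t - {d1, d2}")
        case True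
        then have "b \<inter> Q = {}" by (rule avoid)
        then show ?thesis using aQ by auto
      next
        case False
        then have "b \<in> {e1, e2}" using b by blast
        then show ?thesis using dis ab(3) aQ(1) by auto
      qed
    qed
  qed
  moreover have "{} \<notin> t'" using part nonempty t' by auto
  moreover have "\<forall>s\<in>t'. dimer s" using t e t' by (auto simp: tiling_def)
  ultimately show "tiling R t'" by (auto simp: tiling_def partition_on_def)
  have "e1 \<notin> t - {d1, d2}" "e2 \<notin> t - {d1, d2}" using avoid e(3) nonempty by auto
  then have "t' - {e1, e2} = t - {d1, d2}" using t' by auto
  then have tt: "t = (t' - {e1, e2}) \<union> {d1, d2}" using d by auto
  have et: "e1 \<in> t'" "e2 \<in> t'" using t' by auto
  show "flip t' t" unfolding flip_def
    by (rule exI[of _ Q], rule exI[of _ e1], rule exI[of _ e2], rule exI[of _ d1], rule exI[of _ d2])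
      (rule conjI[OF Q conjI[OF et(1) conjI[OF et(2) conjI[OF e(3) conjI[OF tiling_dimer[OF t d(1)]
        conjI[OF tiling_dimer[OF t d(2)] conjI[OF d(3) conjI[OF not_sym[OF ne] tt]]]]]]]])
qed

lemma flips_tiling:
  assumes "tiling R t" "flip\<^sup>*\<^sup>* t t'" shows "tiling R t'" "flip\<^sup>*\<^sup>* t' t"
proof -
  have "tiling R t' \<and> flip\<^sup>*\<^sup>* t' t" using assms(2)
  proof (induction rule: rtranclp_induct)
    case (step y z)
    then have "tiling R y" "flip\<^sup>*\<^sup>* y t" by simp_all
    then show ?case
      using flip_tiling[OF \<open>tiling R y\<close> step.hyps(2)] converse_rtranclp_into_rtranclp[of flip z y t] by simp
  qed (use assms(1) in simp)
  then show "tiling R t'" "flip\<^sup>*\<^sup>* t' t" by auto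
qed

text \<open>A slab made of two dimers has two white and two black cubes. There are only two ways to
  pair them, and the other one exchanges the images of the two white squares.\<close>

lemma flip_matching:
  assumes R: "two_floors R" and t: "tiling R t" and f: "flip t t'"
    and m: "matching (white_squares R) (black_squares R) \<sigma>" and t\<sigma>: "t = match_tiling 0 (white_squares R) \<sigma>"
  obtains u v where "u \<in> white_squares R" "v \<in> white_squares R" "u \<noteq> v" "near u (\<sigma> v)" "near v (\<sigma> u)"
    "t' = match_tiling 0 (white_squares R) (\<sigma> \<circ> Transposition.transpose u v)"
proof -
  let ?A = "white_squares R"
  obtain Q d1 d2 e1 e2 where Q: "slab Q" and d: "d1 \<in> t" "d2 \<in> t" "d1 \<union> d2 = Q"
    and e: "dimer e1" "dimer e2" "e1 \<union> e2 = Q" and ne: "{e1, e2} \<noteq> {d1, d2}"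
    and t': "t' = (t - {d1, d2}) \<union> {e1, e2}" using f unfolding flip_def by blast
  obtain u v where u: "u \<in> ?A" "d1 = match_dimer 0 \<sigma> u" and v: "v \<in> ?A" "d2 = match_dimer 0 \<sigma> v"
    using d t\<sigma> by (auto simp: match_tiling_def)
  have uv: "u \<noteq> v"
  proof
    assume "u = v"
    then have "Q = d1" using d(3) u v by simp
    then have "card Q = 2" using dimer_card[OF tiling_dimer[OF t d(1)]] by simp
    then show False using slab_card[OF Q] by simp
  qed
  have inj: "inj_on \<sigma> ?A" using m by (auto simp: matching_def bij_betw_def)
  then have \<sigma>uv: "\<sigma> u \<noteq> \<sigma> v" using uv u v by (auto dest: inj_onD)
  have Q4: "e1 \<union> e2 = {white_over 0 u, black_over 0 (\<sigma> u), white_over 0 v, black_over 0 (\<sigma> v)}"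
    using e(3) d(3) u v by (auto simp: match_dimer_def)
  obtain a1 b1 where e1: "e1 = {a1, b1}" "white_cube a1" "\<not> white_cube b1" by (rule dimer_colours[OF e(1)])
  obtain a2 b2 where e2: "e2 = {a2, b2}" "white_cube a2" "\<not> white_cube b2" by (rule dimer_colours[OF e(2)])
  have a: "{a1, a2} = {white_over 0 u, white_over 0 v}"
  proof -
    have "{a1, a2} = {c \<in> e1 \<union> e2. white_cube c}" using e1 e2 by auto
    also have "\<dots> = {white_over 0 u, white_over 0 v}"
      unfolding Q4 by (auto simp: white_cube_white_over white_cube_black_over)
    finally show ?thesis .
  qed
  have b: "{b1, b2} = {black_over 0 (\<sigma> u), black_over 0 (\<sigma> v)}"
  proof -
    have "{b1, b2} = {c \<in> e1 \<union> e2. \<not> white_cube c}" using e1 e2 by auto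
    also have "\<dots> = {black_over 0 (\<sigma> u), black_over 0 (\<sigma> v)}"
      unfolding Q4 by (auto simp: white_cube_white_over white_cube_black_over)
    finally show ?thesis .
  qed
  let ?f1 = "{white_over 0 u, black_over 0 (\<sigma> v)}" and ?f2 = "{white_over 0 v, black_over 0 (\<sigma> u)}"
  have ef: "{e1, e2} = {?f1, ?f2}"
    using a b ne unfolding e1 e2 u v match_dimer_def by (auto simp: doubleton_eq_iff insert_commute)
  then have "dimer ?f1" "dimer ?f2" using e(1,2) by (auto simp: doubleton_eq_iff)
  then have near: "near u (\<sigma> v)" "near v (\<sigma> u)" using dimer_imp_near by auto
  have "t' = match_tiling 0 ?A (\<sigma> \<circ> Transposition.transpose u v)"
    unfolding t' ef match_tiling_transpose[OF u(1) v(1)] t\<sigma> u(2) v(2) ..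
  then show ?thesis using that[OF u(1) v(1) uv near] by simp
qed

subsection \<open>Flips of matchings and slides between floors\<close>

definition cube_at :: "int \<Rightarrow> square \<Rightarrow> cube" where
  "cube_at z = (\<lambda>(x, y). (x, y, z))"

lemma cube_at_eq_iff: "cube_at z p = cube_at z' q \<longleftrightarrow> z = z' \<and> p = q"
  by (auto simp: cube_at_def split: prod.splits)

lemma white_over_cube_at: "white_over k v = cube_at (2 * k + (if white_square v then 0 else 1)) v"
  and black_over_cube_at: "black_over k v = cube_at (2 * k + (if white_square v then 1 else 0)) v"
  by (cases v, simp add: white_over_def black_over_def cube_at_def white_square_def)+

lemma column_pair: "{white_over k v, black_over k v} = {cube_at (2 * k) v, cube_at (2 * k + 1) v}"
  by (auto simp: white_over_cube_at black_over_cube_at)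

lemma near_neq_colour: "near u v \<Longrightarrow> u \<noteq> v \<Longrightarrow> white_square v \<longleftrightarrow> \<not> white_square u"
  by (cases u, cases v) (drule near_cases[of "fst u" "snd u", simplified], auto simp: white_square_def)

lemma flipI:
  assumes "slab (d1 \<union> d2)" "dimer e1" "dimer e2" "e1 \<union> e2 = d1 \<union> d2" "{e1, e2} \<noteq> {d1, d2}" "d1 \<notin> X" "d2 \<notin> X"
  shows "flip (X \<union> {d1, d2}) (X \<union> {e1, e2})"
  unfolding flip_def
proof (rule exI[of _ "d1 \<union> d2"], rule exI[of _ d1], rule exI[of _ d2], rule exI[of _ e1], rule exI[of _ e2], intro conjI)
  show "X \<union> {e1, e2} = X \<union> {d1, d2} - {d1, d2} \<union> {e1, e2}" using assms(6,7) by auto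
qed (use assms in auto)

lemma slab_columns:
  assumes "near p q" "p \<noteq> q"
  shows "slab {cube_at z p, cube_at (z + 1) p, cube_at z q, cube_at (z + 1) q}"
proof -
  obtain x y where p: "p = (x, y)" by fastforce
  have x: "slab {(x, y, z), (x, y, z + 1), (x + 1, y, z), (x + 1, y, z + 1)}" for x
  proof -
    have "{(x, y, z), (x, y, z + 1), (x + 1, y, z), (x + 1, y, z + 1)} = {x, x + 1} \<times> {y} \<times> {z, z + 1}" by auto
    then show ?thesis unfolding slab_def by blast
  qed
  have y: "slab {(x, y, z), (x, y, z + 1), (x, y + 1, z), (x, y + 1, z + 1)}" for y
  proof -
    have "{(x, y, z), (x, y, z + 1), (x, y + 1, z), (x, y + 1, z + 1)} = {x} \<times> {y, y + 1} \<times> {z, z + 1}" by auto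
    then show ?thesis unfolding slab_def by blast
  qed
  show ?thesis
    using near_cases[OF assms(1)[unfolded p]] assms(2) x[of x] x[of "x - 1"] y[of y] y[of "y - 1"]
    by (elim disjE) (simp_all add: p cube_at_def insert_commute)
qed

lemma dimer_column: "dimer {cube_at z p, cube_at (z + 1) p}"
  by (cases p) (auto simp: dimer_def z_dimer_def cube_at_def)

lemma dimer_level:
  assumes "near p q" "p \<noteq> q" shows "dimer {cube_at z p, cube_at z q}"
proof -
  obtain x y where p: "p = (x, y)" by fastforce
  have x: "dimer {(x, y, z), (x + 1, y, z)}" for x
    unfolding dimer_def x_dimer_def by blast
  have y: "dimer {(x, y, z), (x, y + 1, z)}" for y
    unfolding dimer_def y_dimer_def by blast
  show ?thesis
    using near_cases[OF assms(1)[unfolded p]] assms(2) x[of x] x[of "x - 1"] y[of y] y[of "y - 1"]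
    by (elim disjE) (simp_all add: p cube_at_def insert_commute)
qed

text \<open>The two shapes of a slab, seen from above: a pair of adjacent columns, or a unit square
  whose diagonals are coloured alike.\<close>

lemma near_square:
  assumes "near (x, y) a" "near (x, y) b" "near v a" "near v b" "a \<noteq> b" "v \<noteq> (x, y)"
  shows "near (x, y) v \<and> {a, b} = {(x, y), v} \<or>
    (\<exists>s t. s \<in> {1, -1} \<and> t \<in> {1, -1} \<and> v = (x + s, y + t) \<and> {a, b} = {(x + s, y), (x, y + t)})"
proof -
  obtain x' y' where v: "v = (x', y')" by fastforce
  have v1: "\<bar>x' - fst a\<bar> + \<bar>y' - snd a\<bar> \<le> 1" "\<bar>x' - fst b\<bar> + \<bar>y' - snd b\<bar> \<le> 1"
    using assms(3,4) by (simp_all add: v near_def case_prod_unfold)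
  show ?thesis
    using near_cases[OF assms(1)] near_cases[OF assms(2)] assms(5,6) v1
    by (elim disjE) (simp_all add: v near_def doubleton_eq_iff, presburger+)
qed

lemma slab_match:
  assumes "u \<noteq> v" "a \<noteq> b" "near u a" "near u b" "near v a" "near v b"
  shows "slab {white_over k u, black_over k a, white_over k v, black_over k b}"
proof -
  obtain x y where u: "u = (x, y)" by fastforce
  have base: "slab {(x, y, z), (x + 1, y, z), (x, y + 1, z), (x + 1, y + 1, z)}" for x y z
  proof -
    have "{(x, y, z), (x + 1, y, z), (x, y + 1, z), (x + 1, y + 1, z)} = {x, x + 1} \<times> {y, y + 1} \<times> {z}" by auto
    then show ?thesis unfolding slab_def by blast
  qed
  have corners: "slab {(x, y, z), (x + s, y, z), (x + s, y + t, z), (x, y + t, z)}"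
    if "s \<in> {1, -1}" "t \<in> {1, -1}" for s t z
    using that base[of x y z] base[of "x - 1" y z] base[of x "y - 1" z] base[of "x - 1" "y - 1" z]
    by (elim insertE emptyE) (simp_all add: insert_commute)
  from near_square[OF assms(3)[unfolded u] assms(4)[unfolded u] assms(5,6,2)] assms(1)
  consider "near (x, y) v" "{a, b} = {(x, y), v}"
    | s t where "s \<in> {1, -1}" "t \<in> {1, -1}" "v = (x + s, y + t)" "{a, b} = {(x + s, y), (x, y + t)}"
    using u by blast
  then show ?thesis
  proof cases
    case 1
    have "{white_over k u, black_over k a, white_over k v, black_over k b} =
        {white_over k u, white_over k v} \<union> black_over k ` {a, b}" by auto
    also have "\<dots> = {white_over k u, black_over k u} \<union> {white_over k v, black_over k v}"
      unfolding 1 u by auto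
    also have "\<dots> = {cube_at (2 * k) u, cube_at (2 * k + 1) u, cube_at (2 * k) v, cube_at (2 * k + 1) v}"
      unfolding column_pair by auto
    finally show ?thesis using slab_columns[of u v "2 * k"] 1 u assms(1) by simp
  next
    case 2
    define z where "z = 2 * k + (if even (x + y) then 0 else 1)"
    have "{white_over k u, black_over k a, white_over k v, black_over k b} =
        {white_over k u, white_over k v} \<union> black_over k ` {a, b}" by auto
    also have "\<dots> = {(x, y, z), (x + s, y, z), (x + s, y + t, z), (x, y + t, z)}"
    proof -
      have "white_over k u = (x, y, z)" by (simp add: u white_over_def z_def)
      moreover have "white_over k v = (x + s, y + t, z)" "black_over k (x + s, y) = (x + s, y, z)" "black_over k (x, y + t) = (x, y + t, z)"
        using 2(1,2) by (auto simp: 2(3) white_over_def black_over_def z_def)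
      ultimately show ?thesis unfolding 2(4) by auto
    qed
    finally show ?thesis using corners[OF 2(1,2)] by simp
  qed
qed

lemma flip_match_tiling:
  assumes A: "u \<in> A" "v \<in> A" and ne: "u \<noteq> v" "\<sigma> u \<noteq> \<sigma> v"
    and near: "near u (\<sigma> u)" "near v (\<sigma> v)" "near u (\<sigma> v)" "near v (\<sigma> u)"
    and X: "\<And>\<tau> p. match_dimer k \<tau> p \<notin> X"
  shows "flip (match_tiling k A \<sigma> \<union> X) (match_tiling k A (\<sigma> \<circ> Transposition.transpose u v) \<union> X)"
proof -
  let ?d1 = "match_dimer k \<sigma> u" and ?d2 = "match_dimer k \<sigma> v"
  let ?e1 = "{white_over k u, black_over k (\<sigma> v)}" and ?e2 = "{white_over k v, black_over k (\<sigma> u)}"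
  let ?Y = "match_tiling k A \<sigma> - {?d1, ?d2} \<union> X"
  have "flip (?Y \<union> {?d1, ?d2}) (?Y \<union> {?e1, ?e2})"
  proof (rule flipI)
    show "slab (?d1 \<union> ?d2)"
      using slab_match[OF ne(1,2) near(1,3,4,2), of k] by (simp add: match_dimer_def insert_commute)
    show "?e1 \<union> ?e2 = ?d1 \<union> ?d2" by (auto simp: match_dimer_def)
    show "{?e1, ?e2} \<noteq> {?d1, ?d2}"
      using ne by (simp add: match_dimer_def doubleton_eq_iff[of "{_, _}"] white_black_pair_eq_iff)
  qed (use near near_imp_dimer X in auto)
  moreover have "?Y \<union> {?d1, ?d2} = match_tiling k A \<sigma> \<union> X" using A by (auto simp: match_tiling_def)
  moreover have "?Y \<union> {?e1, ?e2} = match_tiling k A (\<sigma> \<circ> Transposition.transpose u v) \<union> X"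
    unfolding match_tiling_transpose[OF A] by auto
  ultimately show ?thesis by simp
qed

text \<open>Steps of permutations live in the whole plane. The set \<open>F\<close> collects the
  squares that are exchanged, so any set of squares containing \<open>F\<close> has room for the
  flips; \<open>X\<close> stands for the dimers on the other pair of floors.\<close>

lemma perm_steps_flips:
  assumes "perm_step\<^sup>*\<^sup>* \<sigma> \<tau>"
  shows "\<exists>F. finite F \<and> (\<forall>A X. F \<subseteq> A \<longrightarrow> (\<forall>\<tau> p. match_dimer k \<tau> p \<notin> X) \<longrightarrow>
       flip\<^sup>*\<^sup>* (match_tiling k A \<sigma> \<union> X) (match_tiling k A \<tau> \<union> X))"
  using assms
proof (induction rule: rtranclp_induct)
  case base
  show ?case by (rule exI[of _ "{}"]) simp
next
  case (step \<rho> \<tau>)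
  then obtain F where F: "finite F" "\<And>A X. F \<subseteq> A \<Longrightarrow> (\<And>\<tau> p. match_dimer k \<tau> p \<notin> X) \<Longrightarrow>
     flip\<^sup>*\<^sup>* (match_tiling k A \<sigma> \<union> X) (match_tiling k A \<rho> \<union> X)" by blast
  obtain u v where s: "short_perm \<rho>" "short_perm \<tau>" and uv: "u \<noteq> v" "\<tau> = \<rho> \<circ> Transposition.transpose u v"
    using step.hyps(2) unfolding perm_step_def by blast
  have near: "near u (\<rho> u)" "near v (\<rho> v)" "near u (\<rho> v)" "near v (\<rho> u)"
    using short_perm_near[OF s(1)] short_perm_near[OF s(2), of u] short_perm_near[OF s(2), of v]
    by (simp_all add: uv(2))
  have ne: "\<rho> u \<noteq> \<rho> v" using inj_short_perm[OF s(1)] uv(1) by blast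
  have "flip\<^sup>*\<^sup>* (match_tiling k A \<sigma> \<union> X) (match_tiling k A \<tau> \<union> X)"
    if "insert u (insert v F) \<subseteq> A" "\<And>\<tau> p. match_dimer k \<tau> p \<notin> X" for A X
  proof -
    have "F \<subseteq> A" "u \<in> A" "v \<in> A" using that(1) by auto
    then show ?thesis
      unfolding uv(2)
      by (intro rtranclp.rtrancl_into_rtrancl[OF F(2)[OF _ that(2)] flip_match_tiling[OF _ _ uv(1) ne near that(2)]])
  qed
  then show ?case using F(1) by (intro exI[of _ "insert u (insert v F)"] conjI allI impI) blast+
qed

text \<open>The first flip turns the two vertical dimers into horizontal ones, the second one turns the two lowest horizontal dimers up.\<close>

lemma slide_dimer:
  assumes pq: "near p q" "p \<noteq> q"
    and X: "\<And>d i r. d \<in> X \<Longrightarrow> i \<in> {z, z + 1, z + 2} \<Longrightarrow> r \<in> {p, q} \<Longrightarrow> cube_at i r \<notin> d"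
  shows "flip\<^sup>*\<^sup>* (X \<union> {{cube_at z p, cube_at z q}, {cube_at (z + 1) p, cube_at (z + 2) p}, {cube_at (z + 1) q, cube_at (z + 2) q}})
    (X \<union> {{cube_at (z + 2) p, cube_at (z + 2) q}, {cube_at z p, cube_at (z + 1) p}, {cube_at z q, cube_at (z + 1) q}})"
    (is "flip\<^sup>*\<^sup>* (X \<union> {?h0, ?v1, ?v1'}) (X \<union> {?h2, ?v0, ?v0'})")
proof -
  let ?h1 = "{cube_at (z + 1) p, cube_at (z + 1) q}"
  have zz: "z + 1 + 1 = z + 2" by simp
  have notin: "d \<notin> X" if "cube_at i r \<in> d" "i \<in> {z, z + 1, z + 2}" "r \<in> {p, q}" for d i r using X that by blast
  have ne: "{cube_at i r, cube_at j r} \<noteq> {cube_at l p, cube_at l q}" for i j l r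
    using pq(2) by (simp add: doubleton_eq_iff cube_at_eq_iff)
  have f1: "flip (insert ?h0 X \<union> {?v1, ?v1'}) (insert ?h0 X \<union> {?h1, ?h2})"
  proof (rule flipI)
    show "slab (?v1 \<union> ?v1')" using slab_columns[OF pq, of "z + 1"] unfolding zz by (simp add: insert_commute)
    have "?v1 \<notin> {?h1, ?h2}" using ne by auto
    then show "{?h1, ?h2} \<noteq> {?v1, ?v1'}" by (metis insertI1)
    show "?v1 \<notin> insert ?h0 X" "?v1' \<notin> insert ?h0 X"
      using ne notin[of "z + 1" p ?v1] notin[of "z + 1" q ?v1'] by auto
  qed (use dimer_level[OF pq] in \<open>auto\<close>)
  have f2: "flip (insert ?h2 X \<union> {?h0, ?h1}) (insert ?h2 X \<union> {?v0, ?v0'})"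
  proof (rule flipI)
    show "slab (?h0 \<union> ?h1)" using slab_columns[OF pq, of z] by (simp add: insert_commute)
    have "?v0 \<notin> {?h0, ?h1}" using ne by auto
    then show "{?v0, ?v0'} \<noteq> {?h0, ?h1}" by (metis insertI1)
    have "?h0 \<noteq> ?h2" "?h1 \<noteq> ?h2" by (simp_all add: doubleton_eq_iff cube_at_eq_iff)
    then show "?h0 \<notin> insert ?h2 X" "?h1 \<notin> insert ?h2 X"
      using notin[of z p ?h0] notin[of "z + 1" p ?h1] by auto
  qed (use dimer_column in \<open>auto\<close>)
  have sets: "insert ?h0 X \<union> {?v1, ?v1'} = X \<union> {?h0, ?v1, ?v1'}" "insert ?h2 X \<union> {?v0, ?v0'} = X \<union> {?h2, ?v0, ?v0'}"
    "insert ?h0 X \<union> {?h1, ?h2} = insert ?h2 X \<union> {?h0, ?h1}" by auto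
  show ?thesis using rtranclp_trans[OF r_into_rtranclp r_into_rtranclp, of flip, OF f1[unfolded sets] f2[unfolded sets(2)]] .
qed

lemma slide_dimers:
  assumes "finite V" "\<And>v. v \<in> V \<Longrightarrow> near v (\<rho> v)" "inj_on \<rho> V" "V \<inter> \<rho> ` V = {}"
    and "\<And>d i r. d \<in> X \<Longrightarrow> i \<in> {z, z + 1, z + 2} \<Longrightarrow> r \<in> V \<union> \<rho> ` V \<Longrightarrow> cube_at i r \<notin> d"
  shows "flip\<^sup>*\<^sup>* (X \<union> (\<lambda>v. {cube_at z v, cube_at z (\<rho> v)}) ` V \<union> (\<lambda>v. {cube_at (z + 1) v, cube_at (z + 2) v}) ` (V \<union> \<rho> ` V))
    (X \<union> (\<lambda>v. {cube_at (z + 2) v, cube_at (z + 2) (\<rho> v)}) ` V \<union> (\<lambda>v. {cube_at z v, cube_at (z + 1) v}) ` (V \<union> \<rho> ` V))"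
  using assms
proof (induction V arbitrary: X rule: finite_induct)
  case (insert p V)
  let ?h = "\<lambda>i v. {cube_at i v, cube_at i (\<rho> v)}" and ?v = "\<lambda>i v. {cube_at i v, cube_at (i + 1) v}"
  let ?v1 = "\<lambda>v. {cube_at (z + 1) v, cube_at (z + 2) v}"
  let ?q = "\<rho> p"
  let ?W = "V \<union> \<rho> ` V"
  have pq: "p \<noteq> ?q" "p \<notin> ?W" "?q \<notin> ?W" using insert.prems(2,3) insert.hyps(2) by auto
  have sep: "cube_at i r \<noteq> cube_at j s" if "r \<in> {p, ?q}" "s \<in> ?W" for i j r s
    using that pq by (auto simp: cube_at_eq_iff)
  let ?X1 = "X \<union> ?h z ` V \<union> ?v1 ` ?W"
  have f1: "flip\<^sup>*\<^sup>* (?X1 \<union> {?h z p, ?v1 p, ?v1 ?q}) (?X1 \<union> {?h (z + 2) p, ?v z p, ?v z ?q})"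
  proof (rule slide_dimer)
    show "near p ?q" using insert.prems(1) by simp
    show "p \<noteq> ?q" by (rule pq(1))
    fix d i r assume d: "d \<in> ?X1" "i \<in> {z, z + 1, z + 2}" "r \<in> {p, ?q}"
    show "cube_at i r \<notin> d"
    proof (cases "d \<in> X")
      case True
      then show ?thesis using insert.prems(4)[of d i r] d by auto
    next
      case False
      then obtain j s j' s' where d': "d = {cube_at j s, cube_at j' s'}" "s \<in> ?W" "s' \<in> ?W" using d(1) by blast
      then show ?thesis using sep[OF d(3) d'(2), of i j] sep[OF d(3) d'(3), of i j'] unfolding d'(1) by blast
    qed
  qed
  have f2: "flip\<^sup>*\<^sup>* ((X \<union> {?h (z + 2) p, ?v z p, ?v z ?q}) \<union> ?h z ` V \<union> ?v1 ` ?W)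
      ((X \<union> {?h (z + 2) p, ?v z p, ?v z ?q}) \<union> ?h (z + 2) ` V \<union> ?v z ` ?W)"
  proof (rule insert.IH)
    show "\<And>v. v \<in> V \<Longrightarrow> near v (\<rho> v)" using insert.prems(1) by simp
    show "inj_on \<rho> V" using insert.prems(2) by simp
    show "V \<inter> \<rho> ` V = {}" using insert.prems(3) by auto
    fix d i r assume d: "d \<in> X \<union> {?h (z + 2) p, ?v z p, ?v z ?q}" "i \<in> {z, z + 1, z + 2}" "r \<in> ?W"
    show "cube_at i r \<notin> d"
    proof (cases "d \<in> X")
      case True
      then show ?thesis using insert.prems(4)[of d i r] d by auto
    next
      case False
      then obtain j s j' s' where d': "d = {cube_at j s, cube_at j' s'}" "s \<in> {p, ?q}" "s' \<in> {p, ?q}" using d(1) by blast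
      then show ?thesis using sep[OF d'(2) d(3), of j i] sep[OF d'(3) d(3), of j' i] unfolding d'(1) by auto
    qed
  qed
  have sets: "?X1 \<union> {?h z p, ?v1 p, ?v1 ?q} = X \<union> ?h z ` insert p V \<union> ?v1 ` (insert p V \<union> \<rho> ` insert p V)"
    "?X1 \<union> {?h (z + 2) p, ?v z p, ?v z ?q} = (X \<union> {?h (z + 2) p, ?v z p, ?v z ?q}) \<union> ?h z ` V \<union> ?v1 ` ?W"
    "(X \<union> {?h (z + 2) p, ?v z p, ?v z ?q}) \<union> ?h (z + 2) ` V \<union> ?v z ` ?W =
      X \<union> ?h (z + 2) ` insert p V \<union> ?v z ` (insert p V \<union> \<rho> ` insert p V)"
    by (simp_all add: ac_simps Un_insert_left Un_insert_right insert_commute)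
  show ?case using rtranclp_trans[OF f1[unfolded sets(1,2)] f2[unfolded sets(3)]] .
qed simp

definition stack :: "square set \<Rightarrow> (square \<Rightarrow> square) \<Rightarrow> (square \<Rightarrow> square) \<Rightarrow> cube set set" where
  "stack A \<sigma> \<tau> = match_tiling 0 A \<sigma> \<union> match_tiling 1 A \<tau>"

lemma match_dimer_level:
  assumes "near v (\<rho> v)" "\<rho> v \<noteq> v"
  shows "match_dimer k \<rho> v = {cube_at (2 * k + (if white_square v then 0 else 1)) v,
    cube_at (2 * k + (if white_square v then 0 else 1)) (\<rho> v)}"
  using near_neq_colour[OF assms(1)] assms(2) by (auto simp: match_dimer_def white_over_cube_at black_over_cube_at)

lemma match_dimer_column: "\<rho> v = v \<Longrightarrow> match_dimer k \<rho> v = {cube_at (2 * k) v, cube_at (2 * k + 1) v}"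
  by (simp add: match_dimer_def column_pair)

text \<open>Moved white squares (\<open>E\<close>) have their horizontal dimers on floor 0, moved
  black squares (\<open>U\<close>) on floor 1. Those on floor 1 lie directly below the columns on
  floors 2 and 3, so they go first and end on floor 3; the columns are then on floors 1 and 2, and
  the dimers on floor 0 pass through them to floor 2. Since \<open>\<rho>\<close> exchanges the
  colours, it maps \<open>E\<close> onto \<open>U\<close> and \<open>U\<close> onto
  \<open>E\<close>, and both rounds use columns over the same squares.\<close>

lemma slide_stack:
  assumes s: "short_perm \<sigma>" and r: "short_perm \<rho>" and d: "\<And>v. \<sigma> v = v \<or> \<rho> v = v"
    and A: "{v. \<rho> v \<noteq> v} \<subseteq> A"
  shows "flip\<^sup>*\<^sup>* (stack A (\<sigma> \<circ> \<rho>) id) (stack A \<sigma> \<rho>)"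
proof -
  define V where "V = {v. \<rho> v \<noteq> v}"
  define E U where "E = {v \<in> V. white_square v}" and "U = {v \<in> V. \<not> white_square v}"
  have V: "V = E \<union> U" "E \<inter> U = {}" by (auto simp: E_def U_def)
  have fin: "finite V" "finite E" "finite U" using r by (auto simp: V_def E_def U_def short_perm_def)
  have near: "near v (\<rho> v)" for v using r by (rule short_perm_near)
  have inj: "inj_on \<rho> W" for W by (rule inj_onI) (rule inj_short_perm[OF r])
  have \<rho>V: "\<rho> v \<in> V \<longleftrightarrow> v \<in> V" for v
    using inj_short_perm[OF r, of "\<rho> v" v] by (auto simp: V_def)
  have \<rho>c: "white_square (\<rho> v) \<longleftrightarrow> \<not> white_square v" if "v \<in> V" for v
    using near_neq_colour[OF near[of v]] that by (auto simp: V_def)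
  have surj: "\<exists>u. \<rho> u = v" for v using r by (metis short_perm_def bij_pointE)
  have \<rho>E: "\<rho> ` E = U" and \<rho>U: "\<rho> ` U = E"
  proof -
    show "\<rho> ` E = U"
    proof (intro equalityI subsetI)
      fix v assume "v \<in> U"
      moreover obtain u where "\<rho> u = v" using surj by blast
      ultimately show "v \<in> \<rho> ` E" using \<rho>V[of u] \<rho>c[of u] by (auto simp: E_def U_def)
    qed (auto simp: E_def U_def \<rho>V \<rho>c)
    show "\<rho> ` U = E"
    proof (intro equalityI subsetI)
      fix v assume "v \<in> E"
      moreover obtain u where "\<rho> u = v" using surj by blast
      ultimately show "v \<in> \<rho> ` U" using \<rho>V[of u] \<rho>c[of u] by (auto simp: E_def U_def)
    qed (auto simp: E_def U_def \<rho>V \<rho>c)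
  qed
  have \<sigma>V: "\<sigma> v = v" if "v \<in> V" for v using d[of v] that by (auto simp: V_def)
  have \<sigma>out: "\<sigma> v \<notin> V" if "v \<notin> V" for v
    using inj_short_perm[OF s, of "\<sigma> v" v] \<sigma>V[of "\<sigma> v"] that by auto
  let ?base = "match_dimer 0 \<sigma> ` (A - V) \<union> match_dimer 1 id ` (A - V)"
  have AV: "A = (A - V) \<union> V" using A by (auto simp: V_def)
  have split: "match_dimer k \<tau> ` A = match_dimer k \<tau> ` (A - V) \<union> match_dimer k \<tau> ` V" for k \<tau>
    using AV by (metis image_Un)
  have comp: "match_dimer 0 (\<sigma> \<circ> \<rho>) ` (A - V) = match_dimer 0 \<sigma> ` (A - V)" "match_dimer 0 (\<sigma> \<circ> \<rho>) ` V = match_dimer 0 \<rho> ` V"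
    "match_dimer 1 \<rho> ` (A - V) = match_dimer 1 id ` (A - V)" "match_dimer 0 \<sigma> ` V = match_dimer 0 id ` V"
    using \<sigma>V \<rho>V by (auto intro!: image_cong simp: match_dimer_def V_def)
  have start: "stack A (\<sigma> \<circ> \<rho>) id = ?base \<union> match_dimer 0 \<rho> ` V \<union> match_dimer 1 id ` V"
    unfolding stack_def match_tiling_def split[of 0] split[of 1] comp by (simp add: ac_simps)
  have stop: "stack A \<sigma> \<rho> = ?base \<union> match_dimer 1 \<rho> ` V \<union> match_dimer 0 id ` V"
    unfolding stack_def match_tiling_def split[of 0] split[of 1] comp by (simp add: ac_simps)
  have level: "match_dimer k \<rho> ` E = (\<lambda>v. {cube_at (2 * k) v, cube_at (2 * k) (\<rho> v)}) ` E"
    "match_dimer k \<rho> ` U = (\<lambda>v. {cube_at (2 * k + 1) v, cube_at (2 * k + 1) (\<rho> v)}) ` U" for k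
    by (intro image_cong refl; simp add: match_dimer_level[of _ \<rho>, OF near] E_def U_def V_def)+
  have column: "match_dimer k id ` V = (\<lambda>v. {cube_at (2 * k) v, cube_at (2 * k + 1) v}) ` V" for k
    by (rule image_cong[OF refl], rule match_dimer_column) simp
  have base: "cube_at i r \<notin> d" if "d \<in> ?base" "r \<in> V" for d i r
    using that \<sigma>out by (auto simp: match_dimer_def white_over_cube_at black_over_cube_at cube_at_eq_iff)
  let ?X1 = "?base \<union> match_dimer 0 \<rho> ` E" and ?X2 = "?base \<union> match_dimer 1 \<rho> ` U"
  have 1: "flip\<^sup>*\<^sup>* (?X1 \<union> (\<lambda>v. {cube_at 1 v, cube_at 1 (\<rho> v)}) ` U \<union> (\<lambda>v. {cube_at (1 + 1) v, cube_at (1 + 2) v}) ` (U \<union> \<rho> ` U))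
    (?X1 \<union> (\<lambda>v. {cube_at (1 + 2) v, cube_at (1 + 2) (\<rho> v)}) ` U \<union> (\<lambda>v. {cube_at 1 v, cube_at (1 + 1) v}) ` (U \<union> \<rho> ` U))"
  proof (rule slide_dimers)
    fix d i r assume "d \<in> ?X1" "i \<in> {1, 1 + 1, 1 + 2 :: int}" "r \<in> U \<union> \<rho> ` U"
    then show "cube_at i r \<notin> d"
      using base[of d r i] unfolding level \<rho>U V(1) by (auto simp: cube_at_eq_iff)
  qed (use near inj fin V \<rho>U in auto)
  have 2: "flip\<^sup>*\<^sup>* (?X2 \<union> (\<lambda>v. {cube_at 0 v, cube_at 0 (\<rho> v)}) ` E \<union> (\<lambda>v. {cube_at (0 + 1) v, cube_at (0 + 2) v}) ` (E \<union> \<rho> ` E))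
    (?X2 \<union> (\<lambda>v. {cube_at (0 + 2) v, cube_at (0 + 2) (\<rho> v)}) ` E \<union> (\<lambda>v. {cube_at 0 v, cube_at (0 + 1) v}) ` (E \<union> \<rho> ` E))"
  proof (rule slide_dimers)
    fix d i r assume "d \<in> ?X2" "i \<in> {0, 0 + 1, 0 + 2 :: int}" "r \<in> E \<union> \<rho> ` E"
    then show "cube_at i r \<notin> d"
      using base[of d r i] unfolding level \<rho>E V(1) by (auto simp: cube_at_eq_iff)
  qed (use near inj fin V \<rho>E in auto)
  have VU: "U \<union> \<rho> ` U = V" "E \<union> \<rho> ` E = V" unfolding \<rho>E \<rho>U V(1) by auto
  have VE: "match_dimer k \<rho> ` V = match_dimer k \<rho> ` E \<union> match_dimer k \<rho> ` U" for k
    unfolding V(1) by (rule image_Un)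
  have a: "?X1 \<union> (\<lambda>v. {cube_at 1 v, cube_at 1 (\<rho> v)}) ` U \<union> (\<lambda>v. {cube_at (1 + 1) v, cube_at (1 + 2) v}) ` (U \<union> \<rho> ` U) = stack A (\<sigma> \<circ> \<rho>) id"
    unfolding start VU VE level column by (simp add: ac_simps)
  have b: "?X1 \<union> (\<lambda>v. {cube_at (1 + 2) v, cube_at (1 + 2) (\<rho> v)}) ` U \<union> (\<lambda>v. {cube_at 1 v, cube_at (1 + 1) v}) ` (U \<union> \<rho> ` U) =
    ?X2 \<union> (\<lambda>v. {cube_at 0 v, cube_at 0 (\<rho> v)}) ` E \<union> (\<lambda>v. {cube_at (0 + 1) v, cube_at (0 + 2) v}) ` (E \<union> \<rho> ` E)"
    unfolding VU level by (simp add: ac_simps)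
  have c: "?X2 \<union> (\<lambda>v. {cube_at (0 + 2) v, cube_at (0 + 2) (\<rho> v)}) ` E \<union> (\<lambda>v. {cube_at 0 v, cube_at (0 + 1) v}) ` (E \<union> \<rho> ` E) = stack A \<sigma> \<rho>"
    unfolding stop VU VE level column by (simp add: ac_simps)
  show ?thesis using rtranclp_trans[OF 1[unfolded a b] 2[unfolded c]] .
qed

subsection \<open>Families of curves that close up\<close>

text \<open>Split off the orbit of one point, listed up to its first return after \<open>n\<close>
  applications, and continue with the remaining points, which \<open>f\<close> permutes as
  well.\<close>

lemma cyclic_lists:
  assumes "finite A" "bij_betw f A A"
  shows "\<exists>cs. (\<forall>c\<in>set cs. c \<noteq> [] \<and> successively (\<lambda>p q. q = f p) c \<and> f (last c) = hd c) \<and>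
    distinct (concat cs) \<and> set (concat cs) = A"
  using assms
proof (induction A rule: finite_psubset_induct)
  case (psubset A)
  show ?case
  proof (cases "A = {}")
    case True
    then show ?thesis by (intro exI[of _ "[]"]) simp
  next
    case False
    then obtain p where p: "p \<in> A" by blast
    have fb: "bij_betw (f ^^ i) A A" for i by (rule bij_betw_funpow[OF psubset.prems])
    have fA: "(f ^^ i) p \<in> A" for i using bij_betwE[OF fb] p by blast
    have cancel: "(f ^^ (j - i)) p = p" if "(f ^^ i) p = (f ^^ j) p" "i < j" for i j
    proof -
      have "(f ^^ i) ((f ^^ (j - i)) p) = (f ^^ (i + (j - i))) p" by (simp only: funpow_add comp_apply)
      also have "i + (j - i) = j" using that(2) by simp
      finally have "(f ^^ i) ((f ^^ (j - i)) p) = (f ^^ i) p" using that(1) by simp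
      then show ?thesis by (rule inj_onD[OF bij_betw_imp_inj_on[OF fb] _ fA p])
    qed
    have "\<not> inj (\<lambda>i. (f ^^ i) p)"
      using finite_subset[of "range (\<lambda>i. (f ^^ i) p)" A] fA psubset.hyps(1) range_inj_infinite by blast
    then obtain i j where "(f ^^ i) p = (f ^^ j) p" "i < j" by (metis injI linorder_neqE_nat)
    then have ex: "\<exists>n>0. (f ^^ n) p = p" using cancel by (metis zero_less_diff)
    define n where "n = (LEAST n. n > 0 \<and> (f ^^ n) p = p)"
    have n: "n > 0" "(f ^^ n) p = p" using LeastI_ex[OF ex] by (simp_all only: n_def)
    have least: "k \<ge> n" if "k > 0" "(f ^^ k) p = p" for k
      unfolding n_def by (rule Least_le) (use that in simp)
    define c where "c = map (\<lambda>i. (f ^^ i) p) [0..<n]"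
    have set_c: "set c = (\<lambda>i. (f ^^ i) p) ` {0..<n}" by (simp add: c_def)
    have inj: "inj_on (\<lambda>i. (f ^^ i) p) {0..<n}"
    proof (rule linorder_inj_onI')
      fix i j assume "i \<in> {0..<n}" "j \<in> {0..<n}" "i < j"
      then show "(f ^^ i) p \<noteq> (f ^^ j) p" using cancel[of i j] least[of "j - i"] by auto
    qed
    have next_c: "f ((f ^^ i) p) = (f ^^ Suc i) p" for i by simp
    have "f ` set c = set c"
    proof (intro card_subset_eq card_image)
      show "f ` set c \<subseteq> set c"
      proof
        fix q assume "q \<in> f ` set c"
        then obtain i where i: "i < n" "q = (f ^^ Suc i) p" by (auto simp: set_c)
        show "q \<in> set c"
        proof (cases "Suc i = n")
          case True
          then have "q = (f ^^ 0) p" using i n(2) by simp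
          then show ?thesis using n(1) unfolding set_c by (intro image_eqI[of _ _ 0]) auto
        next
          case False
          then show ?thesis using i unfolding set_c by (intro image_eqI[of _ _ "Suc i"]) auto
        qed
      qed
      show "inj_on f (set c)"
        by (rule inj_on_subset[OF bij_betw_imp_inj_on[OF psubset.prems]]) (use fA in \<open>auto simp: set_c\<close>)
    qed simp
    moreover have cA: "set c \<subseteq> A" using fA by (auto simp: set_c)
    ultimately have "f ` (A - set c) = A - set c"
      using inj_on_image_set_diff[of f A A "set c"] psubset.prems by (simp add: bij_betw_def)
    then have "bij_betw f (A - set c) (A - set c)"
      using psubset.prems by (simp add: bij_betw_def inj_on_diff)
    moreover have "p \<in> set c" using n(1) unfolding set_c by (intro image_eqI[of _ _ 0]) auto
    then have "A - set c \<subset> A" using p by blast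
    ultimately obtain cs where cs: "\<forall>c\<in>set cs. c \<noteq> [] \<and> successively (\<lambda>p q. q = f p) c \<and> f (last c) = hd c"
      "distinct (concat cs)" "set (concat cs) = A - set c" using psubset.IH by blast
    have "c \<noteq> []" "hd c = p" "last c = (f ^^ (n - 1)) p"
      using n(1) by (simp_all add: c_def hd_map last_map)
    moreover have "f ((f ^^ (n - 1)) p) = p" using n by (metis Suc_pred' next_c)
    moreover have "successively (\<lambda>p q. q = f p) c"
      by (simp add: successively_conv_nth c_def)
    moreover have "distinct c" using inj by (simp add: c_def distinct_map atLeast_upt)
    ultimately show ?thesis using cs cA by (intro exI[of _ "c # cs"]) auto
  qed
qed

definition closed_family :: "(real \<Rightarrow> complex) set \<Rightarrow> bool" where
  "closed_family A \<longleftrightarrow> finite A \<and> (\<forall>p\<in>A. path p) \<and> inj_on pathstart A \<and> inj_on pathfinish A \<and>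
     pathstart ` A = pathfinish ` A"

lemma closed_curves_exist:
  assumes "closed_family A" shows "\<exists>cs. closed_curves A cs"
proof -
  define f where "f = inv_into A pathstart \<circ> pathfinish"
  have "bij_betw pathfinish A (pathstart ` A)" "bij_betw pathstart A (pathstart ` A)"
    using assms by (simp_all add: closed_family_def bij_betw_def)
  note this(1) bij_betw_inv_into[OF this(2)]
  then have "bij_betw f A A" unfolding f_def by (rule bij_betw_trans)
  moreover have fin: "finite A" using assms by (simp add: closed_family_def)
  ultimately obtain cs where cs: "\<And>c. c \<in> set cs \<Longrightarrow> c \<noteq> []" "\<And>c. c \<in> set cs \<Longrightarrow> successively (\<lambda>p q. q = f p) c"
    "\<And>c. c \<in> set cs \<Longrightarrow> f (last c) = hd c" "distinct (concat cs)" "set (concat cs) = A"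
    using cyclic_lists[of A f] by blast
  have link: "pathstart (f p) = pathfinish p" if "p \<in> A" for p
  proof -
    have "pathfinish p \<in> pathstart ` A" using assms that by (simp add: closed_family_def)
    then show ?thesis unfolding f_def comp_def by (rule f_inv_into_f)
  qed
  have "closed_chain c" if c: "c \<in> set cs" for c
  proof -
    have cA: "set c \<subseteq> A" using cs(5) c by auto
    have "pathfinish (c ! i) = pathstart (c ! Suc i)" if "Suc i < length c" for i
    proof -
      have "c ! i \<in> A" using cA that nth_mem[of i c] by auto
      then show ?thesis using successively_nth[OF cs(2)[OF c] that] link[of "c ! i"] by simp
    qed
    moreover have "pathfinish (last c) = pathstart (hd c)"
      using cs(3)[OF c] link[of "last c"] cA last_in_set[OF cs(1)[OF c]] by auto
    ultimately show ?thesis using cs(1)[OF c] unfolding closed_chain_def by blast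
  qed
  then show ?thesis unfolding closed_curves_def using cs(4,5) by blast
qed

lemma join_curves_chain:
  assumes "c \<noteq> []" "successively (\<lambda>p q. pathfinish p = pathstart q) c" "\<forall>p\<in>set c. path p"
  shows "path (join_curves c)" "pathstart (join_curves c) = pathstart (hd c)"
    "pathfinish (join_curves c) = pathfinish (last c)" "path_image (join_curves c) \<subseteq> (\<Union>p\<in>set c. path_image p)"
    "(\<forall>p\<in>set c. z \<notin> path_image p) \<Longrightarrow> winding_number (join_curves c) z = (\<Sum>p\<leftarrow>c. winding_number p z)"
proof -
  have "path (join_curves c) \<and> pathstart (join_curves c) = pathstart (hd c) \<and>
    pathfinish (join_curves c) = pathfinish (last c) \<and> path_image (join_curves c) \<subseteq> (\<Union>p\<in>set c. path_image p) \<and>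
    ((\<forall>p\<in>set c. z \<notin> path_image p) \<longrightarrow> winding_number (join_curves c) z = (\<Sum>p\<leftarrow>c. winding_number p z))"
    using assms
  proof (induction c rule: join_curves.induct)
    case (3 p q ps)
    have IH: "path (join_curves (q # ps))" "pathstart (join_curves (q # ps)) = pathstart q"
      "pathfinish (join_curves (q # ps)) = pathfinish (last (q # ps))"
      "path_image (join_curves (q # ps)) \<subseteq> (\<Union>p\<in>set (q # ps). path_image p)"
      "(\<forall>p\<in>set (q # ps). z \<notin> path_image p) \<Longrightarrow> winding_number (join_curves (q # ps)) z = (\<Sum>p\<leftarrow>q # ps. winding_number p z)"
    proof -
      have "q # ps \<noteq> []" "successively (\<lambda>p q. pathfinish p = pathstart q) (q # ps)" "\<forall>p\<in>set (q # ps). path p"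
        using 3(3,4) by auto
      note ih = 3(1)[OF this]
      show "path (join_curves (q # ps))" "pathstart (join_curves (q # ps)) = pathstart q"
        "pathfinish (join_curves (q # ps)) = pathfinish (last (q # ps))"
        "path_image (join_curves (q # ps)) \<subseteq> (\<Union>p\<in>set (q # ps). path_image p)"
        "(\<forall>p\<in>set (q # ps). z \<notin> path_image p) \<Longrightarrow> winding_number (join_curves (q # ps)) z = (\<Sum>p\<leftarrow>q # ps. winding_number p z)"
        using ih by (simp_all only: list.sel simp_thms)
    qed
    have link: "pathfinish p = pathstart (join_curves (q # ps))" "path p" using 3(3,4) IH(2) by simp_all
    have "winding_number (join_curves (p # q # ps)) z = (\<Sum>p\<leftarrow>p # q # ps. winding_number p z)"
      if z: "\<forall>p\<in>set (p # q # ps). z \<notin> path_image p"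
    proof -
      have "z \<notin> path_image (join_curves (q # ps))" using IH(4) z by auto
      then show ?thesis using winding_number_join[OF link(2) _ IH(1) _ link(1), of z] z IH(5) by simp
    qed
    moreover have "path_image (join_curves (p # q # ps)) \<subseteq> (\<Union>p\<in>set (p # q # ps). path_image p)"
      using path_image_join_subset[of p "join_curves (q # ps)"] IH(4) by auto
    ultimately show ?case using link IH(1,3) by simp
  qed simp_all
  then show "path (join_curves c)" "pathstart (join_curves c) = pathstart (hd c)"
    "pathfinish (join_curves c) = pathfinish (last c)" "path_image (join_curves c) \<subseteq> (\<Union>p\<in>set c. path_image p)"
    "(\<forall>p\<in>set c. z \<notin> path_image p) \<Longrightarrow> winding_number (join_curves c) z = (\<Sum>p\<leftarrow>c. winding_number p z)"
    by blast+
qed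

lemma closed_curves_loop:
  assumes A: "\<forall>p\<in>A. path p" and cs: "closed_curves A cs" and c: "c \<in> set cs"
  shows "path (join_curves c)" "pathfinish (join_curves c) = pathstart (join_curves c)"
    "path_image (join_curves c) \<subseteq> (\<Union>p\<in>A. path_image p)"
    "(\<forall>p\<in>A. z \<notin> path_image p) \<Longrightarrow> winding_number (join_curves c) z = (\<Sum>p\<leftarrow>c. winding_number p z)"
proof -
  have chain: "c \<noteq> []" "successively (\<lambda>p q. pathfinish p = pathstart q) c" "pathfinish (last c) = pathstart (hd c)"
    using cs c by (auto simp: closed_curves_def closed_chain_def successively_conv_nth)
  have sub: "set c \<subseteq> A" using cs c by (auto simp: closed_curves_def)
  have paths: "\<forall>p\<in>set c. path p" using sub A by blast
  note j = join_curves_chain[OF chain(1,2) paths]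
  show "path (join_curves c)" by (rule j(1))
  show "pathfinish (join_curves c) = pathstart (join_curves c)" unfolding j(2,3) by (rule chain(3))
  show "path_image (join_curves c) \<subseteq> (\<Union>p\<in>A. path_image p)" using j(4) sub by blast
  show "(\<forall>p\<in>A. z \<notin> path_image p) \<Longrightarrow> winding_number (join_curves c) z = (\<Sum>p\<leftarrow>c. winding_number p z)"
    using j(5)[of z] sub by blast
qed

text \<open>Winding numbers add up along joined pieces, so the arrangement into closed curves drops
  out. This makes the choice in \<open>winding\<close> harmless and lets the pieces be treated one
  by one.\<close>

lemma closed_curves_sum:
  assumes A: "\<forall>p\<in>A. path p" and cs: "closed_curves A cs" and z: "\<forall>p\<in>A. z \<notin> path_image p"
  shows "(\<Sum>c\<leftarrow>cs. winding_number (join_curves c) z) = (\<Sum>p\<in>A. winding_number p z)"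
proof -
  have "(\<Sum>c\<leftarrow>cs. winding_number (join_curves c) z) = (\<Sum>c\<leftarrow>cs. \<Sum>p\<leftarrow>c. winding_number p z)"
    using closed_curves_loop(4)[OF A cs _ z] by (intro arg_cong[of _ _ sum_list] map_cong) auto
  also have "\<dots> = (\<Sum>p\<leftarrow>concat cs. winding_number p z)"
    by (induction cs) auto
  also have "\<dots> = (\<Sum>p\<in>A. winding_number p z)"
    using cs unfolding closed_curves_def by (metis sum_list_distinct_conv_sum_set)
  finally show ?thesis .
qed

text \<open>The winding number of a single open piece need not be an integer; grouping the pieces
  into closed curves shows that the total is one.\<close>

lemma closed_family_Ints:
  assumes A: "closed_family A" and z: "\<forall>p\<in>A. z \<notin> path_image p"
  shows "(\<Sum>p\<in>A. winding_number p z) \<in> \<int>"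
proof -
  obtain cs where cs: "closed_curves A cs" using closed_curves_exist[OF A] by blast
  have P: "\<forall>p\<in>A. path p" using A by (simp add: closed_family_def)
  have "winding_number (join_curves c) z \<in> \<int>" if c: "c \<in> set cs" for c
  proof -
    note l = closed_curves_loop[OF P cs c]
    have "z \<notin> path_image (join_curves c)" using l(3) z by blast
    from integer_winding_number[OF l(1,2) this] show ?thesis .
  qed
  then have "(\<Sum>c\<leftarrow>cs. winding_number (join_curves c) z) \<in> \<int>"
    by (induction cs) auto
  then show ?thesis using closed_curves_sum[OF P cs z] by simp
qed

lemma closed_family_constant:
  assumes A: "closed_family A" and S: "connected S" "\<forall>p\<in>A. path_image p \<inter> S = {}" and z: "z1 \<in> S" "z2 \<in> S"
  shows "(\<Sum>p\<in>A. winding_number p z1) = (\<Sum>p\<in>A. winding_number p z2)"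
proof -
  obtain cs where cs: "closed_curves A cs" using closed_curves_exist[OF A] by blast
  have P: "\<forall>p\<in>A. path p" using A by (simp add: closed_family_def)
  have off: "\<forall>p\<in>A. z1 \<notin> path_image p" "\<forall>p\<in>A. z2 \<notin> path_image p" using S(2) z by blast+
  have "winding_number (join_curves c) z1 = winding_number (join_curves c) z2" if c: "c \<in> set cs" for c
  proof -
    note l = closed_curves_loop[OF P cs c]
    have "S \<inter> path_image (join_curves c) = {}" using l(3) S(2) by blast
    from winding_number_constant[OF l(1,2) S(1) this] show ?thesis using z by (auto simp: constant_on_def)
  qed
  then have "(\<Sum>c\<leftarrow>cs. winding_number (join_curves c) z1) = (\<Sum>c\<leftarrow>cs. winding_number (join_curves c) z2)"
    by (intro arg_cong[of _ _ sum_list] map_cong) auto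
  then show ?thesis using closed_curves_sum[OF P cs] off by simp
qed

lemma closed_family_zero:
  assumes A: "closed_family A" and S: "simply_connected S" "\<forall>p\<in>A. path_image p \<subseteq> S" and z: "z \<notin> S"
  shows "(\<Sum>p\<in>A. winding_number p z) = 0"
proof -
  obtain cs where cs: "closed_curves A cs" using closed_curves_exist[OF A] by blast
  have P: "\<forall>p\<in>A. path p" using A by (simp add: closed_family_def)
  have off: "\<forall>p\<in>A. z \<notin> path_image p" using S(2) z by blast
  have "winding_number (join_curves c) z = 0" if c: "c \<in> set cs" for c
  proof -
    note l = closed_curves_loop[OF P cs c]
    have "path_image (join_curves c) \<subseteq> S" using l(3) S(2) by blast
    from simply_connected_imp_winding_number_zero[OF S(1) l(1) this l(2) z] show ?thesis .
  qed
  then have "(\<Sum>c\<leftarrow>cs. winding_number (join_curves c) z) = 0" by (simp cong: map_cong)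
  then show ?thesis using closed_curves_sum[OF P cs off] by simp
qed

lemma winding_sum:
  assumes A: "closed_family (segments t \<union> G)" and z: "\<forall>p\<in>segments t \<union> G. center j \<notin> path_image p"
  shows "of_int (winding G t j) = (\<Sum>p\<in>segments t \<union> G. winding_number p (center j))"
proof -
  have cs: "closed_curves (segments t \<union> G) (SOME cs. closed_curves (segments t \<union> G) cs)"
    using someI_ex[OF closed_curves_exist[OF A]] .
  have "\<forall>p\<in>segments t \<union> G. path p" using A by (simp add: closed_family_def)
  note sum = closed_curves_sum[OF this cs z]
  obtain k where k: "(\<Sum>p\<in>segments t \<union> G. winding_number p (center j)) = of_int k"
    using closed_family_Ints[OF A z] by (elim Ints_cases)
  have "winding G t j = k"
    unfolding winding_def sum k by (rule the_equality) simp_all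
  then show ?thesis using k by simp
qed

subsection \<open>The drawing of a matching\<close>

lemma inj_center: "inj center"
  by (rule injI) (auto simp: center_def split: prod.splits)

lemma center_eq_iff: "center u = center v \<longleftrightarrow> u = v"
  using inj_center by (auto dest: injD)

lemma closed_segment_center:
  assumes "z \<in> closed_segment (center (x, y)) (center (x', y'))"
  obtains t where "0 \<le> t" "t \<le> 1" "Re z = of_int x + 1/2 + t * of_int (x' - x)" "Im z = of_int y + 1/2 + t * of_int (y' - y)"
proof -
  obtain t where t: "0 \<le> t" "t \<le> 1" "z = (1 - t) *\<^sub>R center (x, y) + t *\<^sub>R center (x', y')"
    using assms by (auto simp: closed_segment_def)
  have "Re z = of_int x + 1/2 + t * of_int (x' - x)" "Im z = of_int y + 1/2 + t * of_int (y' - y)"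
    unfolding t(3) by (simp_all add: center_def algebra_simps)
  then show ?thesis using that t(1,2) by blast
qed

lemma closed_segment_center_bounds:
  assumes "z \<in> closed_segment (center (x, y)) (center (x', y'))"
  shows "of_int (min x x') \<le> Re z - 1/2" "Re z - 1/2 \<le> of_int (max x x')"
    "of_int (min y y') \<le> Im z - 1/2" "Im z - 1/2 \<le> of_int (max y y')"
proof -
  obtain t where t: "0 \<le> t" "t \<le> 1" "Re z = of_int x + 1/2 + t * of_int (x' - x)" "Im z = of_int y + 1/2 + t * of_int (y' - y)"
    by (rule closed_segment_center[OF assms])
  have b: "min a b \<le> a + t * (b - a) \<and> a + t * (b - a) \<le> max a b" for a b :: real
  proof -
    have "a + t * (b - a) = (1 - t) * a + t * b" by (simp add: algebra_simps)
    then show ?thesis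
      using convex_bound_le[of a "max a b" b "1 - t" t] convex_bound_le[of "- a" "- min a b" "- b" "1 - t" t] t(1,2) by simp
  qed
  show "of_int (min x x') \<le> Re z - 1/2" "Re z - 1/2 \<le> of_int (max x x')"
    "of_int (min y y') \<le> Im z - 1/2" "Im z - 1/2 \<le> of_int (max y y')"
    using b[of "of_int x" "of_int x'"] b[of "of_int y" "of_int y'"] by (simp_all add: t(3,4) of_int_min of_int_max)
qed

lemma near_box:
  assumes "near (x, y) (x', y')" "min x x' \<le> p" "p \<le> max x x'" "min y y' \<le> q" "q \<le> max y y'"
  shows "(p, q) \<in> {(x, y), (x', y')}"
  using near_cases[OF assms(1)] assms(2-5) by (elim disjE) auto

text \<open>If the segments met, so would the rectangles that they span. After a shift by 1/2 these
  have integral corners, so their intersection has an integral corner \<open>(p, q)\<close>, and by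
  \<open>near_box\<close> this is an end of both segments.\<close>

lemma closed_segments_center_disjoint:
  assumes "near u v" "near s s'" "{u, v} \<inter> {s, s'} = {}"
  shows "closed_segment (center u) (center v) \<inter> closed_segment (center s) (center s') = {}"
proof (rule ccontr)
  assume "\<not> ?thesis"
  then obtain z where z: "z \<in> closed_segment (center u) (center v)" "z \<in> closed_segment (center s) (center s')" by blast
  obtain x y x' y' a b a' b' where c: "u = (x, y)" "v = (x', y')" "s = (a, b)" "s' = (a', b')" by fastforce
  note B = closed_segment_center_bounds[OF z(1)[unfolded c]] closed_segment_center_bounds[OF z(2)[unfolded c]]
  have i: "min x x' \<le> max a a'" "min a a' \<le> max x x'" "min y y' \<le> max b b'" "min b b' \<le> max y y'"
    using B by linarith+
  define p q where "p = max (min x x') (min a a')" and "q = max (min y y') (min b b')"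
  have "(p, q) \<in> {(x, y), (x', y')}"
    by (rule near_box[OF assms(1)[unfolded c]]) (use i in \<open>simp_all add: p_def q_def, linarith+\<close>)
  moreover have "(p, q) \<in> {(a, b), (a', b')}"
    by (rule near_box[OF assms(2)[unfolded c]]) (use i in \<open>simp_all add: p_def q_def, linarith+\<close>)
  ultimately show False using assms(3) unfolding c by blast
qed

lemma near_refl: "near v v"
  by (cases v) (simp add: near_def)

lemma center_notin_segment:
  "near s s' \<Longrightarrow> j \<notin> {s, s'} \<Longrightarrow> center j \<notin> closed_segment (center s) (center s')"
  using closed_segments_center_disjoint[OF near_refl[of j], of s s'] by auto

lemma closed_segment_center_subset:
  assumes "near u v"
  shows "closed_segment (center u) (center v) \<subseteq> plane_square u \<union> plane_square v"
proof
  fix z assume z: "z \<in> closed_segment (center u) (center v)"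
  obtain x y x' y' where c: "u = (x, y)" "v = (x', y')" by fastforce
  obtain t where t: "0 \<le> t" "t \<le> 1" "Re z = of_int x + 1/2 + t * of_int (x' - x)" "Im z = of_int y + 1/2 + t * of_int (y' - y)"
    by (rule closed_segment_center[OF z[unfolded c]])
  show "z \<in> plane_square u \<union> plane_square v"
    using near_cases[OF assms[unfolded c]] t unfolding c
    by (elim disjE) (cases "t \<le> 1/2", auto simp: plane_square_def in_cbox_complex_iff)
qed

lemma center_in_plane_square: "center v \<in> plane_square v"
  by (cases v) (simp add: center_def plane_square_def in_cbox_complex_iff)

definition arrow :: "square \<Rightarrow> square \<Rightarrow> real \<Rightarrow> complex" where
  "arrow u v = linepath (center u) (center v)"

lemma arrow_simps:
  "path (arrow u v)" "pathstart (arrow u v) = center u" "pathfinish (arrow u v) = center v"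
  "path_image (arrow u v) = closed_segment (center u) (center v)"
  by (simp_all add: arrow_def)

lemma winding_number_arrow_swap:
  "near u v \<Longrightarrow> j \<notin> {u, v} \<Longrightarrow> winding_number (arrow v u) (center j) = - winding_number (arrow u v) (center j)"
  using winding_number_reversepath[of "arrow u v" "center j"] center_notin_segment[of u v j]
  by (simp add: arrow_def)

lemma winding_number_quadrangle:
  assumes S: "convex S" "{a, b, c, d} \<subseteq> S" and z: "z \<notin> S"
  shows "winding_number (linepath a b) z + winding_number (linepath b c) z + winding_number (linepath c d) z +
    winding_number (linepath d a) z = 0"
proof -
  have sub: "closed_segment p q \<subseteq> S" if "p \<in> {a, b, c, d}" "q \<in> {a, b, c, d}" for p q
    using that S closed_segment_subset[of p S q] by blast
  let ?g = "linepath a b +++ linepath b c +++ linepath c d +++ linepath d a"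
  have "path_image ?g \<subseteq> S" using sub by (simp add: path_image_join)
  then have "winding_number ?g z = 0" by (intro winding_number_zero_outside[OF _ S(1)]) (use z in auto)
  moreover have "z \<notin> closed_segment p q" if "p \<in> {a, b, c, d}" "q \<in> {a, b, c, d}" for p q
    using sub[OF that] z by blast
  ultimately show ?thesis by (simp add: winding_number_join path_image_join add.assoc)
qed

text \<open>The closed square spanned by the four centres is convex and contains no further
  centre.\<close>

lemma winding_number_unit_square:
  assumes "s \<in> {1, -1}" "t \<in> {1, -1}" "j \<notin> {(x, y), (x + s, y), (x + s, y + t), (x, y + t)}"
  shows "winding_number (arrow (x, y) (x + s, y)) (center j) + winding_number (arrow (x + s, y) (x + s, y + t)) (center j) +
    winding_number (arrow (x + s, y + t) (x, y + t)) (center j) + winding_number (arrow (x, y + t) (x, y)) (center j) = 0"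
  unfolding arrow_def
proof (rule winding_number_quadrangle)
  let ?S = "cbox (center (min x (x + s), min y (y + t))) (center (max x (x + s), max y (y + t)))"
  show "{center (x, y), center (x + s, y), center (x + s, y + t), center (x, y + t)} \<subseteq> ?S"
    using assms(1,2) by (auto simp: center_def in_cbox_complex_iff)
  show "center j \<notin> ?S"
  proof
    assume j: "center j \<in> ?S"
    obtain a b where ab: "j = (a, b)" by fastforce
    have ineq: "min x (x + s) \<le> a" "a \<le> max x (x + s)" "min y (y + t) \<le> b" "b \<le> max y (y + t)"
      using j by (simp_all add: ab center_def in_cbox_complex_iff)
    have "a = x \<or> a = x + s" using assms(1) ineq(1,2) by (elim insertE emptyE) linarith+
    moreover have "b = y \<or> b = y + t" using assms(2) ineq(3,4) by (elim insertE emptyE) linarith+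
    ultimately show False using assms(3) unfolding ab by blast
  qed
qed (rule convex_box)

lemma white_over_projection: "cube_center (white_over k v) = center v" "cube_center (black_over k v) = center v"
  by (cases v, simp add: cube_center_def white_over_def black_over_def)+

lemma segments_match_tiling:
  "segments (match_tiling 0 A \<sigma>) = (\<lambda>v. arrow v (\<sigma> v)) ` {v \<in> A. \<sigma> v \<noteq> v}"
proof (intro equalityI subsetI)
  fix p assume "p \<in> segments (match_tiling 0 A \<sigma>)"
  then obtain w b where p: "p = linepath (cube_center w) (cube_center b)" "{w, b} \<in> match_tiling 0 A \<sigma>"
    "\<not> z_dimer {w, b}" "white_cube w" "\<not> white_cube b" unfolding segments_def by blast
  then obtain v where v: "v \<in> A" "{w, b} = {white_over 0 v, black_over 0 (\<sigma> v)}"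
    by (auto simp: match_tiling_def match_dimer_def)
  then have "w = white_over 0 v" "b = black_over 0 (\<sigma> v)"
    using p(4,5) white_cube_white_over white_cube_black_over by (metis doubleton_eq_iff)+
  then show "p \<in> (\<lambda>v. arrow v (\<sigma> v)) ` {v \<in> A. \<sigma> v \<noteq> v}"
    using p(1,3) v(1) by (auto simp: z_dimer_match white_over_projection arrow_def)
next
  fix p assume "p \<in> (\<lambda>v. arrow v (\<sigma> v)) ` {v \<in> A. \<sigma> v \<noteq> v}"
  then obtain v where v: "v \<in> A" "\<sigma> v \<noteq> v" "p = arrow v (\<sigma> v)" by blast
  then show "p \<in> segments (match_tiling 0 A \<sigma>)"
    unfolding segments_def
    by (intro CollectI exI[of _ "white_over 0 v"] exI[of _ "black_over 0 (\<sigma> v)"])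
      (auto simp: white_over_projection arrow_def match_tiling_def match_dimer_def z_dimer_match
        white_cube_white_over white_cube_black_over)
qed

lemma jewels_match_tiling: "jewels (match_tiling 0 A \<sigma>) = {v \<in> A. \<sigma> v = v}"
proof -
  have "{(x, y, 0), (x, y, 1)} = match_dimer 0 \<sigma> v \<longleftrightarrow> (x, y) = v \<and> (x, y) = \<sigma> v" for x y v
    using column_pair[of 0 "(x, y)"] white_black_pair_eq_iff[of 0 "(x, y)" 0 "(x, y)" v "\<sigma> v"]
    by (simp add: match_dimer_def cube_at_def)
  then have "(x, y) \<in> jewels (match_tiling 0 A \<sigma>) \<longleftrightarrow> (x, y) \<in> {v \<in> A. \<sigma> v = v}" for x y
    unfolding jewels_def match_tiling_def image_iff by auto
  then show ?thesis unfolding set_eq_iff split_paired_All by blast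
qed

text \<open>\<open>ghost_curves\<close> in terms of the squares \<open>A\<close> with a white cube
  and \<open>B\<close> with a black cube: \<open>B - A\<close> are the terminal holes and
  \<open>A - B\<close> the initial ones, see \<open>ghost_curves_iff\<close>.\<close>

definition ghosts :: "square set \<Rightarrow> square set \<Rightarrow> (real \<Rightarrow> complex) set \<Rightarrow> bool" where
  "ghosts A B G \<longleftrightarrow> (\<forall>g\<in>G. path g \<and> (\<forall>s\<in>A \<inter> B. path_image g \<inter> plane_square s = {})) \<and>
     bij_betw pathstart G (center ` (B - A)) \<and> bij_betw pathfinish G (center ` (A - B))"

definition curve_sum :: "(real \<Rightarrow> complex) set \<Rightarrow> square set \<Rightarrow> (square \<Rightarrow> square) \<Rightarrow> complex \<Rightarrow> complex" where
  "curve_sum G A \<sigma> z = (\<Sum>g\<in>G. winding_number g z) + (\<Sum>v | v \<in> A \<and> \<sigma> v \<noteq> v. winding_number (arrow v (\<sigma> v)) z)"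

lemma finite_ghosts:
  assumes "ghosts A B G" "finite A" "finite B" shows "finite G"
  using assms bij_betw_finite[of pathstart G] by (auto simp: ghosts_def)

text \<open>The pieces start at the moved squares and at the terminal holes; they end at the images
  of the moved squares and at the initial holes. Both sets consist of all squares of
  \<open>A\<close> and \<open>B\<close> that are not fixed, so the family closes up.\<close>

lemma matching_drawing:
  assumes fin: "finite A" "finite B" and m: "matching A B \<sigma>" and g: "ghosts A B G"
  defines "S \<equiv> segments (match_tiling 0 A \<sigma>)"
  shows "closed_family (S \<union> G)" "S \<inter> G = {}"
    "(\<Sum>p\<in>S \<union> G. winding_number p z) = curve_sum G A \<sigma> z"
proof -
  let ?M = "{v \<in> A. \<sigma> v \<noteq> v}"
  have S: "S = (\<lambda>v. arrow v (\<sigma> v)) ` ?M" unfolding S_def by (rule segments_match_tiling)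
  have \<sigma>: "inj_on \<sigma> A" "\<sigma> ` A = B" using m by (auto simp: matching_def bij_betw_def)
  have G: "inj_on pathstart G" "pathstart ` G = center ` (B - A)" "inj_on pathfinish G" "pathfinish ` G = center ` (A - B)"
    "\<forall>g\<in>G. path g" using g by (auto simp: ghosts_def bij_betw_def)
  have start: "inj_on pathstart S" "pathstart ` S = center ` ?M"
    unfolding S image_image arrow_simps by (auto simp: inj_on_def arrow_simps center_eq_iff)
  have finish: "inj_on pathfinish S" "pathfinish ` S = center ` \<sigma> ` ?M"
    unfolding S image_image arrow_simps using \<sigma>(1) by (auto simp: inj_on_def arrow_simps center_eq_iff)
  have disj: "pathstart ` S \<inter> pathstart ` G = {}" unfolding start G by (auto simp: center_eq_iff)
  then show SG: "S \<inter> G = {}" by blast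
  have im: "\<sigma> ` ?M = B - {v \<in> A. \<sigma> v = v}"
  proof (intro equalityI subsetI)
    fix b assume "b \<in> \<sigma> ` ?M"
    then obtain v where v: "v \<in> A" "\<sigma> v \<noteq> v" "b = \<sigma> v" by blast
    have "\<not> (b \<in> A \<and> \<sigma> b = b)" using v inj_onD[OF \<sigma>(1), of b v] by auto
    then show "b \<in> B - {v \<in> A. \<sigma> v = v}" using v \<sigma>(2) by auto
  next
    fix b assume "b \<in> B - {v \<in> A. \<sigma> v = v}"
    then obtain v where "v \<in> A" "b = \<sigma> v" "b \<notin> A \<or> \<sigma> b \<noteq> b" using \<sigma>(2) by auto
    then show "b \<in> \<sigma> ` ?M" by auto
  qed
  have disj': "pathfinish ` S \<inter> pathfinish ` G = {}" unfolding finish G im by (auto simp: center_eq_iff)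
  have fixB: "v \<in> B" if "v \<in> A" "\<sigma> v = v" for v using \<sigma>(2) that by (metis imageI)
  have "pathstart ` (S \<union> G) = center ` (?M \<union> (B - A))" "pathfinish ` (S \<union> G) = center ` (\<sigma> ` ?M \<union> (A - B))"
    unfolding image_Un start finish G by simp_all
  moreover have "?M \<union> (B - A) = \<sigma> ` ?M \<union> (A - B)" unfolding im using fixB by blast
  moreover have "inj_on pathstart (S \<union> G)" "inj_on pathfinish (S \<union> G)"
    unfolding inj_on_Un using start(1) G(1) disj finish(1) G(3) disj' by blast+
  moreover have finG: "finite G" by (rule finite_ghosts[OF g fin])
  moreover have finS: "finite S" unfolding S using fin by simp
  moreover have "\<forall>p\<in>S. path p" by (auto simp: S arrow_simps)
  then have "\<forall>p\<in>S \<union> G. path p" using G(5) by blast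
  ultimately show "closed_family (S \<union> G)" unfolding closed_family_def by simp
  have "inj_on (\<lambda>v. arrow v (\<sigma> v)) ?M"
    by (rule inj_onI) (metis arrow_simps(2) center_eq_iff)
  then have "(\<Sum>p\<in>S. winding_number p z) = (\<Sum>v\<in>?M. winding_number (arrow v (\<sigma> v)) z)"
    unfolding S by (simp add: sum.reindex)
  then show "(\<Sum>p\<in>S \<union> G. winding_number p z) = curve_sum G A \<sigma> z"
    unfolding curve_sum_def by (simp add: sum.union_disjoint[OF finS finG SG])
qed

lemma winding_matching:
  assumes fin: "finite A" "finite B" and m: "matching A B \<sigma>" and g: "ghosts A B G" and j: "j \<in> A" "\<sigma> j = j"
  shows "of_int (winding G (match_tiling 0 A \<sigma>) j) = curve_sum G A \<sigma> (center j)"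
proof -
  note d = matching_drawing[OF fin m g]
  have \<sigma>: "inj_on \<sigma> A" "\<sigma> ` A = B" "\<And>v. v \<in> A \<Longrightarrow> near v (\<sigma> v)" using m by (auto simp: matching_def bij_betw_def)
  have "j \<in> B" using j \<sigma>(2) by (metis imageI)
  then have "center j \<notin> path_image p" if "p \<in> G" for p
    using g j(1) that center_in_plane_square[of j] unfolding ghosts_def by blast
  moreover have "center j \<notin> path_image p" if p: "p \<in> segments (match_tiling 0 A \<sigma>)" for p
  proof -
    obtain v where v: "v \<in> A" "\<sigma> v \<noteq> v" "p = arrow v (\<sigma> v)" using p unfolding segments_match_tiling by blast
    have "j \<noteq> v" "j \<noteq> \<sigma> v" using v j inj_onD[OF \<sigma>(1), of j v] by auto
    then show ?thesis unfolding v(3) arrow_simps using center_notin_segment[OF \<sigma>(3)[OF v(1)], of j] by simp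
  qed
  ultimately have "\<forall>p\<in>segments (match_tiling 0 A \<sigma>) \<union> G. center j \<notin> path_image p" by blast
  from winding_sum[OF d(1) this] show ?thesis using d(3) by simp
qed

lemma P_match_tiling:
  assumes "finite A"
  shows "P G (match_tiling 0 A \<sigma>) =
    (\<Sum>j | j \<in> A \<and> \<sigma> j = j. Poly_Mapping.single (winding G (match_tiling 0 A \<sigma>) j) (square_sign j))"
proof -
  let ?F = "{j \<in> A. \<sigma> j = j}"
  let ?w = "winding G (match_tiling 0 A \<sigma>)"
  have sign: "square_sign j = (if white_square j then - 1 else 1)" for j
    by (cases j) (simp add: square_sign_def white_square_def)
  have F: "?F = {j \<in> ?F. \<not> white_square j} \<union> {j \<in> ?F. white_square j}" by blast
  have "(\<Sum>j\<in>?F. Poly_Mapping.single (?w j) (square_sign j)) =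
      (\<Sum>j\<in>{j \<in> ?F. \<not> white_square j}. Poly_Mapping.single (?w j) (square_sign j)) +
      (\<Sum>j\<in>{j \<in> ?F. white_square j}. Poly_Mapping.single (?w j) (square_sign j))"
    by (subst F, rule sum.union_disjoint) (use assms in auto)
  also have "\<dots> = (\<Sum>j\<in>{j \<in> ?F. \<not> white_square j}. q_pow (?w j)) - (\<Sum>j\<in>{j \<in> ?F. white_square j}. q_pow (?w j))"
    by (simp add: sign q_pow_def single_uminus sum_negf)
  finally show ?thesis unfolding P_def jewels_match_tiling by simp
qed

subsection \<open>Ghost curves and flips\<close>

lemma two_story_two_floors: "two_story R \<Longrightarrow> two_floors R"
  unfolding two_story_def two_floors_def floor_of_def by blast

lemma finite_region_squares:
  assumes "two_floors R" shows "finite (white_squares R)" "finite (black_squares R)"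
proof -
  have "inj (white_over 0)" "inj (black_over 0)"
    by (rule injI, simp add: white_over_eq_iff, rule injI, simp add: black_over_eq_iff)
  then show "finite (white_squares R)" "finite (black_squares R)"
    using assms finite_vimageI[of R "white_over 0"] finite_vimageI[of R "black_over 0"]
    by (simp_all add: two_floors_def white_squares_def black_squares_def vimage_def)
qed

lemma region_squares:
  assumes "two_floors R"
  shows "common R = white_squares R \<inter> black_squares R" "initial_holes R = white_squares R - black_squares R"
    "terminal_holes R = black_squares R - white_squares R"
proof -
  have z: "z = 0 \<or> z = 1" if "(x, y, z) \<in> R" for x y z using assms that by (auto simp: two_floors_def)
  have ex: "(\<exists>z. (x, y, z) \<in> R \<and> Q z) \<longleftrightarrow> (x, y, 0) \<in> R \<and> Q 0 \<or> (x, y, 1) \<in> R \<and> Q 1" for x y Q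
    using z by blast
  have w: "(x, y) \<in> white_squares R \<longleftrightarrow> (x, y, if even (x + y) then 0 else 1) \<in> R"
    and b: "(x, y) \<in> black_squares R \<longleftrightarrow> (x, y, if even (x + y) then 1 else 0) \<in> R" for x y
    by (simp_all add: white_squares_def black_squares_def white_over_def black_over_def)
  have "(x, y) \<in> common R \<longleftrightarrow> (x, y) \<in> white_squares R \<inter> black_squares R" for x y
    unfolding Int_iff w b by (auto simp: common_def shadow_def)
  then show "common R = white_squares R \<inter> black_squares R" unfolding set_eq_iff split_paired_All by blast
  have "(x, y) \<in> initial_holes R \<longleftrightarrow> (x, y) \<in> white_squares R - black_squares R" for x y
    unfolding Diff_iff w b by (cases "even (x + y)") (auto simp: initial_holes_def holes_def shadow_def white_cube_def ex)
  then show "initial_holes R = white_squares R - black_squares R" unfolding set_eq_iff split_paired_All by blast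
  have "(x, y) \<in> terminal_holes R \<longleftrightarrow> (x, y) \<in> black_squares R - white_squares R" for x y
    unfolding Diff_iff w b by (cases "even (x + y)") (auto simp: terminal_holes_def holes_def shadow_def white_cube_def ex)
  then show "terminal_holes R = black_squares R - white_squares R" unfolding set_eq_iff split_paired_All by blast
qed

lemma ghost_curves_iff:
  "two_floors R \<Longrightarrow> ghost_curves R G \<longleftrightarrow> ghosts (white_squares R) (black_squares R) G"
  by (simp add: ghost_curves_def ghosts_def region_squares)

text \<open>Two choices of ghost curves, one of them reversed, form closed curves that avoid the connected common part of the two floors.\<close>

lemma ghosts_difference:
  assumes fin: "finite A" "finite B" and g1: "ghosts A B G1" and g2: "ghosts A B G2"
    and conn: "connected (\<Union>s\<in>A \<inter> B. plane_square s)"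
  obtains k where "\<And>j. j \<in> A \<inter> B \<Longrightarrow>
    (\<Sum>g\<in>G1. winding_number g (center j)) = of_int k + (\<Sum>g\<in>G2. winding_number g (center j))"
proof (cases "A \<inter> B = {}")
  case False
  then obtain j0 where j0: "j0 \<in> A \<inter> B" by blast
  let ?S = "\<Union>s\<in>A \<inter> B. plane_square s"
  let ?H = "reversepath ` G2"
  have G: "inj_on pathstart G1" "pathstart ` G1 = center ` (B - A)" "inj_on pathfinish G1" "pathfinish ` G1 = center ` (A - B)"
    "inj_on pathstart G2" "pathstart ` G2 = center ` (B - A)" "inj_on pathfinish G2" "pathfinish ` G2 = center ` (A - B)"
    and p: "\<forall>g\<in>G1 \<union> G2. path g" and off: "\<forall>g\<in>G1 \<union> G2. path_image g \<inter> ?S = {}"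
    using g1 g2 by (auto simp: ghosts_def bij_betw_def)
  have H: "pathstart ` ?H = center ` (A - B)" "pathfinish ` ?H = center ` (B - A)"
    unfolding image_image pathstart_reversepath pathfinish_reversepath using G by simp_all
  have injr: "inj_on reversepath G2" by (metis inj_onI reversepath_reversepath)
  have injH: "inj_on pathstart ?H" "inj_on pathfinish ?H"
    using G(5,7) by (auto simp: inj_on_def)
  have dis: "pathstart ` G1 \<inter> pathstart ` ?H = {}" "pathfinish ` G1 \<inter> pathfinish ` ?H = {}"
    unfolding G H by (auto simp: center_eq_iff)
  have disj: "G1 \<inter> ?H = {}" using dis(1) by blast
  have finG: "finite G1" "finite ?H" using finite_ghosts[OF g1 fin] finite_ghosts[OF g2 fin] by simp_all
  have fam: "closed_family (G1 \<union> ?H)"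
    unfolding closed_family_def
  proof (intro conjI)
    show "finite (G1 \<union> ?H)" using finG by simp
    show "\<forall>g\<in>G1 \<union> ?H. path g" using p by auto
    show "inj_on pathstart (G1 \<union> ?H)" "inj_on pathfinish (G1 \<union> ?H)"
      unfolding inj_on_Un using G injH dis by blast+
    show "pathstart ` (G1 \<union> ?H) = pathfinish ` (G1 \<union> ?H)" unfolding image_Un G H by blast
  qed
  have offH: "\<forall>g\<in>G1 \<union> ?H. path_image g \<inter> ?S = {}" using off by (simp add: ball_Un del: Int_iff)
  define f where "f z = (\<Sum>g\<in>G1 \<union> ?H. winding_number g z)" for z
  have f: "f (center j) = (\<Sum>g\<in>G1. winding_number g (center j)) - (\<Sum>g\<in>G2. winding_number g (center j))"
    if j: "j \<in> A \<inter> B" for j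
  proof -
    have "center j \<in> ?S" using center_in_plane_square[of j] j by blast
    then have "winding_number (reversepath g) (center j) = - winding_number g (center j)" if "g \<in> G2" for g
      using that p off by (intro winding_number_reversepath) auto
    then have "(\<Sum>g\<in>?H. winding_number g (center j)) = (\<Sum>g\<in>G2. - winding_number g (center j))"
      unfolding sum.reindex[OF injr] by simp
    then show ?thesis unfolding f_def sum.union_disjoint[OF finG disj] by (simp add: sum_negf)
  qed
  have "\<forall>p\<in>G1 \<union> ?H. center j0 \<notin> path_image p" using offH j0 center_in_plane_square[of j0] by blast
  then have "f (center j0) \<in> \<int>" unfolding f_def by (rule closed_family_Ints[OF fam])
  then obtain k where k: "f (center j0) = of_int k" by (elim Ints_cases)
  have "(\<Sum>g\<in>G1. winding_number g (center j)) = of_int k + (\<Sum>g\<in>G2. winding_number g (center j))" if j: "j \<in> A \<inter> B" for j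
  proof -
    have "f (center j) = f (center j0)"
      unfolding f_def
      by (rule closed_family_constant[OF fam conn offH]) (use j j0 center_in_plane_square in blast)+
    then show ?thesis using k f[OF j] by (simp add: algebra_simps)
  qed
  then show ?thesis by (rule that)
next
  case True
  then show ?thesis using that by blast
qed

lemma matching_fixed: "matching A B \<sigma> \<Longrightarrow> j \<in> A \<Longrightarrow> \<sigma> j = j \<Longrightarrow> j \<in> A \<inter> B"
  unfolding matching_def bij_betw_def by (metis IntI imageI)

lemma P_ghosts:
  assumes R: "two_floors R" and conn: "connected (\<Union>s\<in>common R. plane_square s)"
    and g: "ghost_curves R G1" "ghost_curves R G2"
  shows "\<exists>k. \<forall>t. tiling R t \<longrightarrow> P G1 t = q_pow k * P G2 t"
proof -
  let ?A = "white_squares R" and ?B = "black_squares R"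
  note fin = finite_region_squares[OF R]
  have gs: "ghosts ?A ?B G1" "ghosts ?A ?B G2" using g by (simp_all add: ghost_curves_iff[OF R])
  obtain k where k: "\<And>j. j \<in> ?A \<inter> ?B \<Longrightarrow>
      (\<Sum>g\<in>G1. winding_number g (center j)) = of_int k + (\<Sum>g\<in>G2. winding_number g (center j))"
    using ghosts_difference[OF fin gs] conn by (auto simp: region_squares[OF R])
  have "P G1 t = q_pow k * P G2 t" if t: "tiling R t" for t
  proof -
    obtain \<sigma> where m: "matching ?A ?B \<sigma>" and t\<sigma>: "t = match_tiling 0 ?A \<sigma>" by (rule tiling_matching[OF R t])
    have "winding G1 t j = k + winding G2 t j" if j: "j \<in> ?A" "\<sigma> j = j" for j
    proof -
      have "complex_of_int (winding G1 t j) = of_int (k + winding G2 t j)"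
        using winding_matching[OF fin m gs(1) j] winding_matching[OF fin m gs(2) j] k[OF matching_fixed[OF m j]]
        unfolding t\<sigma> curve_sum_def by simp
      then show ?thesis by (simp only: of_int_eq_iff)
    qed
    then show ?thesis
      unfolding t\<sigma> P_match_tiling[OF fin(1)] sum_distrib_left
      by (intro sum.cong refl) (simp add: q_pow_def mult_single t\<sigma>)
  qed
  then show ?thesis by blast
qed

text \<open>The two drawings differ by a closed unit square, and a jewel is never inside it.\<close>

lemma curve_sum_diagonal:
  assumes fin: "finite A" and m: "matching A B \<sigma>" and uv: "(x, y) \<in> A" "(x + s, y + t) \<in> A" and st: "s \<in> {1, -1}" "t \<in> {1, -1}"
    and ab: "{\<sigma> (x, y), \<sigma> (x + s, y + t)} = {(x + s, y), (x, y + t)}" and j: "j \<in> A" "\<sigma> j = j"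
  shows "curve_sum G A (\<sigma> \<circ> Transposition.transpose (x, y) (x + s, y + t)) (center j) = curve_sum G A \<sigma> (center j)"
proof -
  let ?u = "(x, y)" and ?v = "(x + s, y + t)" and ?p = "(x + s, y)" and ?q = "(x, y + t)"
  let ?\<tau> = "\<sigma> \<circ> Transposition.transpose ?u ?v"
  let ?W = "\<lambda>u v. winding_number (arrow u v) (center j)"
  let ?M = "{v \<in> A. \<sigma> v \<noteq> v}"
  have ne: "?u \<noteq> ?v" "{?u, ?v} \<inter> {?p, ?q} = {}" using st by auto
  have inj: "inj_on \<sigma> A" using m by (simp add: matching_def bij_betw_def)
  have moved: "\<sigma> ?u \<in> {?p, ?q}" "\<sigma> ?v \<in> {?p, ?q}" using ab by blast+
  then have uM: "?u \<in> ?M" "?v \<in> ?M" using uv ne by auto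
  have jj: "j \<notin> {?u, ?p, ?v, ?q}"
  proof
    assume "j \<in> {?u, ?p, ?v, ?q}"
    then have "j \<in> {?u, ?v} \<or> j \<in> {\<sigma> ?u, \<sigma> ?v}" unfolding ab by blast
    then have "\<sigma> j \<noteq> j"
      using uM inj_onD[OF inj _ j(1) uv(1)] inj_onD[OF inj _ j(1) uv(2)] by auto
    then show False using j(2) by simp
  qed
  have \<tau>: "?\<tau> ?u = \<sigma> ?v" "?\<tau> ?v = \<sigma> ?u" "\<And>r. r \<noteq> ?u \<Longrightarrow> r \<noteq> ?v \<Longrightarrow> ?\<tau> r = \<sigma> r" by simp_all
  have M: "{v \<in> A. ?\<tau> v \<noteq> v} = ?M"
  proof (intro Collect_cong conj_cong refl)
    fix r show "?\<tau> r \<noteq> r \<longleftrightarrow> \<sigma> r \<noteq> r"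
      using moved ne \<tau> by (cases "r = ?u"; cases "r = ?v") auto
  qed
  have finM: "finite (?M - {?u} - {?v})" "finite ?M" using fin by auto
  have split: "(\<Sum>r\<in>?M. f r) = f ?u + (f ?v + (\<Sum>r\<in>?M - {?u} - {?v}. f r))" for f :: "square \<Rightarrow> complex"
    using sum.remove[OF finM(2) uM(1), of f] sum.remove[of "?M - {?u}" ?v f] finM uM(2) ne(1) by auto
  have rest: "(\<Sum>r\<in>?M - {?u} - {?v}. ?W r (?\<tau> r)) = (\<Sum>r\<in>?M - {?u} - {?v}. ?W r (\<sigma> r))"
    by (rule sum.cong[OF refl]) (use \<tau>(3) in simp)
  have square: "?W ?u ?p + ?W ?p ?v + ?W ?v ?q + ?W ?q ?u = 0"
    by (rule winding_number_unit_square[OF st jj])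
  have near: "near ?p ?v" "near ?q ?u" using st by (auto simp: near_def)
  have "?W ?v ?p = - ?W ?p ?v" "?W ?u ?q = - ?W ?q ?u"
    using winding_number_arrow_swap[OF near(1), of j] winding_number_arrow_swap[OF near(2), of j] jj by blast+
  then have sw: "?W ?u ?p + ?W ?v ?q = ?W ?u ?q + ?W ?v ?p" using square by algebra
  have "\<sigma> ?u = ?p \<and> \<sigma> ?v = ?q \<or> \<sigma> ?u = ?q \<and> \<sigma> ?v = ?p" using ab by (auto simp: doubleton_eq_iff)
  then have "?W ?u (\<sigma> ?v) + ?W ?v (\<sigma> ?u) = ?W ?u (\<sigma> ?u) + ?W ?v (\<sigma> ?v)" using sw by (elim disjE) simp_all
  then show ?thesis unfolding curve_sum_def M split rest \<tau>(1,2) by (simp add: algebra_simps)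
qed

lemma curve_sum_adjacent:
  assumes fin: "finite A" and uv: "u \<in> A" "v \<in> A" "u \<noteq> v" "near u v" "\<sigma> u = u" "\<sigma> v = v" and j: "j \<notin> {u, v}"
  shows "curve_sum G A (\<sigma> \<circ> Transposition.transpose u v) (center j) = curve_sum G A \<sigma> (center j)"
proof -
  let ?\<tau> = "\<sigma> \<circ> Transposition.transpose u v"
  let ?W = "\<lambda>u v. winding_number (arrow u v) (center j)"
  let ?M = "{v \<in> A. \<sigma> v \<noteq> v}"
  have \<tau>: "?\<tau> u = v" "?\<tau> v = u" "\<And>r. r \<noteq> u \<Longrightarrow> r \<noteq> v \<Longrightarrow> ?\<tau> r = \<sigma> r" using uv by simp_all
  have M: "{r \<in> A. ?\<tau> r \<noteq> r} = insert u (insert v ?M)"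
  proof (intro set_eqI)
    fix r show "r \<in> {r \<in> A. ?\<tau> r \<noteq> r} \<longleftrightarrow> r \<in> insert u (insert v ?M)"
      using uv \<tau> by (cases "r = u"; cases "r = v") auto
  qed
  have "u \<notin> insert v ?M" "v \<notin> ?M" "finite ?M" using uv fin by auto
  then have "(\<Sum>r\<in>insert u (insert v ?M). ?W r (?\<tau> r)) = ?W u v + (?W v u + (\<Sum>r\<in>?M. ?W r (?\<tau> r)))"
    using \<tau>(1,2) by simp
  also have "(\<Sum>r\<in>?M. ?W r (?\<tau> r)) = (\<Sum>r\<in>?M. ?W r (\<sigma> r))"
  proof (rule sum.cong[OF refl])
    fix r assume "r \<in> ?M"
    then have "r \<noteq> u" "r \<noteq> v" using uv by auto
    then show "?W r (?\<tau> r) = ?W r (\<sigma> r)" by simp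
  qed
  finally show ?thesis
    unfolding curve_sum_def M using winding_number_arrow_swap[OF uv(4) j] by simp
qed

text \<open>The segment between the two centres stays in the squares of the jewels, which no ghost
  curve enters, and it has no end in common with any arrow. So it avoids the whole drawing, whose
  winding number is constant along it.\<close>

lemma winding_adjacent_jewels:
  assumes fin: "finite A" "finite B" and m: "matching A B \<sigma>" and g: "ghosts A B G"
    and uv: "u \<in> A" "v \<in> A" "near u v" "\<sigma> u = u" "\<sigma> v = v"
  shows "curve_sum G A \<sigma> (center u) = curve_sum G A \<sigma> (center v)"
proof -
  note d = matching_drawing[OF fin m g]
  have inj: "inj_on \<sigma> A" and near: "\<And>v. v \<in> A \<Longrightarrow> near v (\<sigma> v)" using m by (auto simp: matching_def bij_betw_def)
  let ?S = "closed_segment (center u) (center v)"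
  have "path_image p \<inter> ?S = {}" if "p \<in> G" for p
    using g that matching_fixed[OF m uv(1,4)] matching_fixed[OF m uv(2,5)] closed_segment_center_subset[OF uv(3)]
    unfolding ghosts_def by blast
  moreover have "path_image p \<inter> ?S = {}" if p: "p \<in> segments (match_tiling 0 A \<sigma>)" for p
  proof -
    obtain r where r: "r \<in> A" "\<sigma> r \<noteq> r" "p = arrow r (\<sigma> r)" using p unfolding segments_match_tiling by blast
    have "{r, \<sigma> r} \<inter> {u, v} = {}"
      using r uv inj_onD[OF inj, of r u] inj_onD[OF inj, of r v] by auto
    from closed_segments_center_disjoint[OF near[OF r(1)] uv(3) this] show ?thesis by (simp add: r(3) arrow_simps)
  qed
  ultimately have "\<forall>p\<in>segments (match_tiling 0 A \<sigma>) \<union> G. path_image p \<inter> ?S = {}" by blast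
  from closed_family_constant[OF d(1) _ this, of "center u" "center v"] show ?thesis unfolding d(3) by simp
qed

lemma square_sign_adjacent: "near u v \<Longrightarrow> u \<noteq> v \<Longrightarrow> square_sign v = - square_sign u"
  using near_neq_colour[of u v] by (cases u, cases v) (auto simp: square_sign_def white_square_def)

lemma P_create_pair:
  assumes fin: "finite A" "finite B" and m: "matching A B \<sigma>" and m': "matching A B (\<sigma> \<circ> Transposition.transpose u v)"
    and g: "ghosts A B G" and uv: "u \<in> A" "v \<in> A" "u \<noteq> v" "near u v" "\<sigma> u = u" "\<sigma> v = v"
  shows "P G (match_tiling 0 A (\<sigma> \<circ> Transposition.transpose u v)) = P G (match_tiling 0 A \<sigma>)"
proof -
  let ?\<tau> = "\<sigma> \<circ> Transposition.transpose u v"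
  let ?w = "winding G (match_tiling 0 A \<sigma>)"
  have \<tau>: "?\<tau> u = v" "?\<tau> v = u" "\<And>r. r \<noteq> u \<Longrightarrow> r \<noteq> v \<Longrightarrow> ?\<tau> r = \<sigma> r" using uv by simp_all
  have J: "{j \<in> A. \<sigma> j = j} = insert u (insert v {j \<in> A. ?\<tau> j = j})"
  proof (intro set_eqI)
    fix r show "r \<in> {r \<in> A. \<sigma> r = r} \<longleftrightarrow> r \<in> insert u (insert v {j \<in> A. ?\<tau> j = j})"
      using uv \<tau> by (cases "r = u"; cases "r = v") auto
  qed
  have notin: "u \<notin> insert v {j \<in> A. ?\<tau> j = j}" "v \<notin> {j \<in> A. ?\<tau> j = j}" using \<tau>(1,2) uv(3) by auto
  have same: "winding G (match_tiling 0 A ?\<tau>) j = ?w j" if j: "j \<in> {j \<in> A. ?\<tau> j = j}" for j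
  proof -
    have "j \<notin> {u, v}" "j \<in> A" "?\<tau> j = j" using j \<tau> uv(3) by auto
    then have "complex_of_int (winding G (match_tiling 0 A ?\<tau>) j) = of_int (?w j)"
      using winding_matching[OF fin m' g, of j] winding_matching[OF fin m g, of j] \<tau>(3)[of j]
        curve_sum_adjacent[OF fin(1) uv, of j G] by simp
    then show ?thesis by (simp only: of_int_eq_iff)
  qed
  have "complex_of_int (?w u) = of_int (?w v)"
    using winding_matching[OF fin m g uv(1,5)] winding_matching[OF fin m g uv(2,6)]
      winding_adjacent_jewels[OF fin m g uv(1,2,4-6)] by simp
  then have w: "?w v = ?w u" by (simp only: of_int_eq_iff)
  have "Poly_Mapping.single (?w u) (square_sign u) + Poly_Mapping.single (?w v) (square_sign v) = 0"
    unfolding w square_sign_adjacent[OF uv(4,3)] single_add[symmetric] by simp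
  then show ?thesis
    unfolding P_match_tiling[OF fin(1)] J using fin(1) notin same by (simp add: add.assoc[symmetric])
qed

lemma P_transpose:
  assumes fin: "finite A" "finite B" and m: "matching A B \<sigma>" and g: "ghosts A B G"
    and uv: "u \<in> A" "v \<in> A" "u \<noteq> v" "near u (\<sigma> v)" "near v (\<sigma> u)"
  shows "matching A B (\<sigma> \<circ> Transposition.transpose u v)"
    "P G (match_tiling 0 A (\<sigma> \<circ> Transposition.transpose u v)) = P G (match_tiling 0 A \<sigma>)"
proof -
  let ?\<tau> = "\<sigma> \<circ> Transposition.transpose u v"
  have \<sigma>: "inj_on \<sigma> A" "\<And>v. v \<in> A \<Longrightarrow> near v (\<sigma> v)" using m by (auto simp: matching_def bij_betw_def)
  have "bij_betw (Transposition.transpose u v) A A" using uv(1,2) by simp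
  then have "bij_betw ?\<tau> A B" using m by (auto simp: matching_def intro: bij_betw_trans)
  moreover have "near r (?\<tau> r)" if "r \<in> A" for r
    using that \<sigma>(2) uv(4,5) by (simp add: Transposition.transpose_def)
  ultimately show m': "matching A B ?\<tau>" unfolding matching_def by blast
  have \<sigma>uv: "\<sigma> u \<noteq> \<sigma> v" using uv \<sigma>(1) by (auto dest: inj_onD)
  obtain x y where u: "u = (x, y)" by fastforce
  from near_square[of x y "\<sigma> u" "\<sigma> v" v] \<sigma>(2)[OF uv(1)] \<sigma>(2)[OF uv(2)] uv(3-5) \<sigma>uv
  consider "near u v" "{\<sigma> u, \<sigma> v} = {u, v}"
    | s t where "s \<in> {1, -1}" "t \<in> {1, -1}" "v = (x + s, y + t)" "{\<sigma> u, \<sigma> v} = {(x + s, y), (x, y + t)}"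
    unfolding u by blast
  then show "P G (match_tiling 0 A ?\<tau>) = P G (match_tiling 0 A \<sigma>)"
  proof cases
    case 1
    show ?thesis
    proof (cases "\<sigma> u = u")
      case True
      then have "\<sigma> v = v" using 1(2) \<sigma>uv by (auto simp: doubleton_eq_iff)
      then show ?thesis using P_create_pair[OF fin m m' g uv(1-3) 1(1) True] by simp
    next
      case False
      then have e: "\<sigma> u = v" "\<sigma> v = u" using 1(2) \<sigma>uv by (auto simp: doubleton_eq_iff)
      \<comment> \<open>Dissolving a two-cycle is the creation of one, read backwards.\<close>
      have undo: "?\<tau> \<circ> Transposition.transpose u v = \<sigma>" by (intro ext) simp
      show ?thesis
        using P_create_pair[OF fin m' _ g uv(1-3) 1(1)] m e unfolding undo by simp
    qed
  next
    case 2
    have "{\<sigma> u, \<sigma> v} \<inter> {u, v} = {}" unfolding 2(4) using 2(1,2) by (auto simp: u 2(3))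
    then have moved: "\<sigma> u \<noteq> u" "\<sigma> v \<noteq> v" "\<sigma> v \<noteq> u" "\<sigma> u \<noteq> v" by auto
    have J: "{j \<in> A. ?\<tau> j = j} = {j \<in> A. \<sigma> j = j}"
    proof (intro Collect_cong conj_cong refl)
      fix r show "?\<tau> r = r \<longleftrightarrow> \<sigma> r = r"
        using moved by (cases "r = u"; cases "r = v") (auto simp: Transposition.transpose_def)
    qed
    have "winding G (match_tiling 0 A ?\<tau>) j = winding G (match_tiling 0 A \<sigma>) j" if j: "j \<in> {j \<in> A. \<sigma> j = j}" for j
    proof -
      have j': "j \<in> A" "\<sigma> j = j" "?\<tau> j = j" using j J by blast+
      have "complex_of_int (winding G (match_tiling 0 A ?\<tau>) j) = of_int (winding G (match_tiling 0 A \<sigma>) j)"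
        unfolding winding_matching[OF fin m' g j'(1,3)] winding_matching[OF fin m g j'(1,2)]
        unfolding u 2(3)
        by (rule curve_sum_diagonal[OF fin(1) m _ _ 2(1,2) _ j'(1,2)]) (use uv(1,2) 2(3,4) u in auto)
      then show ?thesis by (simp only: of_int_eq_iff)
    qed
    then show ?thesis unfolding P_match_tiling[OF fin(1)] J by simp
  qed
qed

lemma P_flip:
  assumes R: "two_floors R" and t: "tiling R t" and f: "flip t t'" and g: "ghost_curves R G"
  shows "P G t' = P G t"
proof -
  obtain \<sigma> where m: "matching (white_squares R) (black_squares R) \<sigma>" and t\<sigma>: "t = match_tiling 0 (white_squares R) \<sigma>"
    by (rule tiling_matching[OF R t])
  obtain u v where uv: "u \<in> white_squares R" "v \<in> white_squares R" "u \<noteq> v" "near u (\<sigma> v)" "near v (\<sigma> u)"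
    "t' = match_tiling 0 (white_squares R) (\<sigma> \<circ> Transposition.transpose u v)"
    by (rule flip_matching[OF R t f m t\<sigma>])
  show ?thesis
    using P_transpose(2)[OF finite_region_squares[OF R] m _ uv(1-5)] g
    unfolding uv(6) t\<sigma> ghost_curves_iff[OF R] by blast
qed

lemma P_flips:
  assumes R: "two_floors R" and t: "tiling R t" and f: "flip\<^sup>*\<^sup>* t t'" and g: "ghost_curves R G"
  shows "P G t' = P G t"
  using f
proof (induction rule: rtranclp_induct)
  case (step y z)
  then show ?case using P_flip[OF R flips_tiling(1)[OF t step.hyps(1)] step.hyps(2) g] by simp
qed simp

subsection \<open>Winding numbers are heights\<close>

lemma winding_number_two_arrows:
  assumes "\<bar>a\<bar> + \<bar>b\<bar> = 1" "j \<notin> {(x - a, y - b), (x, y), (x + a, y + b)}"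
  shows "winding_number (linepath (center (x - a, y - b)) (center (x + a, y + b))) (center j) =
    winding_number (arrow (x - a, y - b) (x, y)) (center j) + winding_number (arrow (x, y) (x + a, y + b)) (center j)"
    "center j \<notin> closed_segment (center (x - a, y - b)) (center (x + a, y + b))"
proof -
  let ?S = "closed_segment (center (x - a, y - b)) (center (x + a, y + b))"
  have mid: "center (x, y) \<in> ?S"
    unfolding closed_segment_def by (intro CollectI exI[of _ "1/2"]) (simp add: center_def complex_eq_iff algebra_simps)
  have near: "near (x - a, y - b) (x, y)" "near (x, y) (x + a, y + b)" using assms(1) by (simp_all add: near_def)
  have "?S = closed_segment (center (x - a, y - b)) (center (x, y)) \<union> closed_segment (center (x, y)) (center (x + a, y + b))"
    using Un_closed_segment[OF mid] by simp
  moreover have "center j \<notin> closed_segment (center (x - a, y - b)) (center (x, y))"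
    by (rule center_notin_segment[OF near(1)]) (use assms(2) in blast)
  moreover have "center j \<notin> closed_segment (center (x, y)) (center (x + a, y + b))"
    by (rule center_notin_segment[OF near(2)]) (use assms(2) in blast)
  ultimately show off: "center j \<notin> ?S" by blast
  show "winding_number (linepath (center (x - a, y - b)) (center (x + a, y + b))) (center j) =
    winding_number (arrow (x - a, y - b) (x, y)) (center j) + winding_number (arrow (x, y) (x + a, y + b)) (center j)"
    unfolding arrow_def by (rule winding_number_split_linepath[OF mid off])
qed

text \<open>The eight arrows form the boundary of the square of side two centred at
  \<open>(x, y)\<close>, each side being split at its midpoint.\<close>

lemma winding_number_ring:
  fixes x y :: int
  defines "W \<equiv> \<lambda>u v. winding_number (arrow u v) (center (x, y))"
  shows "W (x - 1, y - 1) (x, y - 1) + W (x, y - 1) (x + 1, y - 1) + W (x + 1, y - 1) (x + 1, y) + W (x + 1, y) (x + 1, y + 1) +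
    W (x + 1, y + 1) (x, y + 1) + W (x, y + 1) (x - 1, y + 1) + W (x - 1, y + 1) (x - 1, y) + W (x - 1, y) (x - 1, y - 1) = 1"
proof -
  let ?z = "center (x, y)"
  let ?a = "center (x - 1, y - 1)" and ?b = "center (x + 1, y - 1)" and ?c = "center (x + 1, y + 1)" and ?d = "center (x - 1, y + 1)"
  have "winding_number (rectpath ?a ?c) ?z = 1"
    by (rule winding_number_rectpath) (simp add: center_def in_box_complex_iff)
  moreover have "rectpath ?a ?c = linepath ?a ?b +++ linepath ?b ?c +++ linepath ?c ?d +++ linepath ?d ?a"
    by (simp add: rectpath_def center_def Let_def)
  moreover
  note e = winding_number_two_arrows[of 1 0 "(x, y)" x "y - 1"] winding_number_two_arrows[of 0 1 "(x, y)" "x + 1" y]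
    winding_number_two_arrows[of "- 1" 0 "(x, y)" x "y + 1"] winding_number_two_arrows[of 0 "- 1" "(x, y)" "x - 1" y]
  have off: "?z \<notin> closed_segment ?a ?b" "?z \<notin> closed_segment ?b ?c" "?z \<notin> closed_segment ?c ?d" "?z \<notin> closed_segment ?d ?a"
    using e(2,4,6,8) by simp_all
  ultimately have "winding_number (linepath ?a ?b) ?z + winding_number (linepath ?b ?c) ?z + winding_number (linepath ?c ?d) ?z +
      winding_number (linepath ?d ?a) ?z = 1"
    by (simp add: winding_number_join path_image_join add.assoc)
  then show ?thesis unfolding W_def using e(1,3,5,7) by (simp add: add.assoc)
qed

lemma Sum_any_shift:
  fixes g :: "int \<times> int \<Rightarrow> complex"
  shows "Sum_any (\<lambda>s. g (fst s + a, snd s + b)) = Sum_any g"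
proof (rule Sum_any.reindex_cong[symmetric])
  show "bij (\<lambda>s. (fst s + a, snd s + b))"
    by (rule o_bij[of "\<lambda>s. (fst s - a, snd s - b)"]) (auto simp: fun_eq_iff)
qed auto

lemma finite_shift:
  assumes "finite {s. Q s}" shows "finite {s :: int \<times> int. Q (fst s + a, snd s + b)}"
proof -
  have "inj (\<lambda>s. (fst s + a, snd s + b) :: int \<times> int)" by (auto simp: inj_def prod_eq_iff)
  from finite_vimageI[OF assms this] show ?thesis by (simp add: vimage_def)
qed

text \<open>Summation by parts turns the sum over the arrows into a sum over the faces, weighted by the height;
  the boundary of a face winds around the center of \<open>v\<close> only if the face touches \<open>v\<close>.\<close>

lemma curve_sum_height:
  assumes h: "height_of \<sigma> w" and A: "finite A" "{v. \<sigma> v \<noteq> v} \<subseteq> A" and v: "\<sigma> v = v"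
  shows "curve_sum {} A \<sigma> (center v) = of_int (w v)"
proof -
  have s: "short_perm \<sigma>" and finw: "finite {f. w f \<noteq> 0}" using h by (auto simp: height_of_def)
  have fin\<sigma>: "finite {f. \<sigma> f \<noteq> f}" using s by (simp add: short_perm_def)
  \<comment> \<open>Edges at \<open>v\<close> get the value 0, because \<open>center v\<close> lies
    on them. The permutation does not use them, since \<open>v\<close> is fixed.\<close>
  define E where "E p q = (if p = v \<or> q = v then 0 else winding_number (arrow p q) (center v))" for p q
  have E_swap: "E q p = - E p q" if "near p q" for p q
    using winding_number_arrow_swap[OF that, of v] by (auto simp: E_def)
  define H V where "H = (\<lambda>s. E s (fst s + 1, snd s))" and "V = (\<lambda>s. E s (fst s, snd s + 1))"
  \<comment> \<open>The sum of \<open>E\<close> over the boundary of the face,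
    counterclockwise.\<close>
  define rim where "rim = (\<lambda>s. H s + V (fst s + 1, snd s) - H (fst s, snd s + 1) - V s)"
  \<comment> \<open>Moves to the right, left, up and down. Each is booked at the left or lower end
    of its edge, so that the two directions of an edge can be combined to the net flow.\<close>
  define r l u d where "r = (\<lambda>s. of_bool (\<sigma> s = (fst s + 1, snd s)) * H s)" and
    "l = (\<lambda>s. of_bool (\<sigma> (fst s + 1, snd s) = s) * H s)" and
    "u = (\<lambda>s. of_bool (\<sigma> s = (fst s, snd s + 1)) * V s)" and
    "d = (\<lambda>s. of_bool (\<sigma> (fst s, snd s + 1) = s) * V s)"
  have fin: "finite {s. r s \<noteq> 0}" "finite {s. l s \<noteq> 0}" "finite {s. u s \<noteq> 0}" "finite {s. d s \<noteq> 0}"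
  proof -
    show "finite {s. r s \<noteq> 0}" "finite {s. u s \<noteq> 0}"
      by (rule finite_subset[OF _ fin\<sigma>], auto simp: r_def u_def)+
    have "finite {s. \<sigma> (fst s + 1, snd s) \<noteq> (fst s + 1, snd s)}" using finite_shift[OF fin\<sigma>, of 1 0] by simp
    then show "finite {s. l s \<noteq> 0}" by (rule rev_finite_subset) (auto simp: l_def)
    have "finite {s. \<sigma> (fst s, snd s + 1) \<noteq> (fst s, snd s + 1)}" using finite_shift[OF fin\<sigma>, of 0 1] by simp
    then show "finite {s. d s \<noteq> 0}" by (rule rev_finite_subset) (auto simp: d_def)
  qed
  have l_back: "l (fst s - 1, snd s) = of_bool (\<sigma> s = (fst s - 1, snd s)) * H (fst s - 1, snd s)"
    and d_back: "d (fst s, snd s - 1) = of_bool (\<sigma> s = (fst s, snd s - 1)) * V (fst s, snd s - 1)" for s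
    by (simp_all add: l_def d_def)
  have "curve_sum {} A \<sigma> (center v) = (\<Sum>s | s \<in> A \<and> \<sigma> s \<noteq> s. E s (\<sigma> s))"
    unfolding curve_sum_def
  proof (simp, rule sum.cong[OF refl])
    fix s assume "s \<in> {s \<in> A. \<sigma> s \<noteq> s}"
    then have "s \<noteq> v" "\<sigma> s \<noteq> v" using v inj_short_perm[OF s, of s v] by auto
    then show "winding_number (arrow s (\<sigma> s)) (center v) = E s (\<sigma> s)" by (simp add: E_def)
  qed
  also have "\<dots> = Sum_any (\<lambda>s. if \<sigma> s \<noteq> s then E s (\<sigma> s) else 0)"
    by (subst Sum_any.expand_superset[of "{s \<in> A. \<sigma> s \<noteq> s}"]) (use A in \<open>auto split: if_splits intro!: sum.cong\<close>)
  also have "\<dots> = Sum_any (\<lambda>s. (r s - l (fst s - 1, snd s)) + (u s - d (fst s, snd s - 1)))"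
  proof (rule Sum_any.cong)
    fix s :: "int \<times> int"
    obtain x y where xy: "s = (x, y)" by fastforce
    have sw: "E (x, y) (x - 1, y) = - E (x - 1, y) (x, y)" "E (x, y) (x, y - 1) = - E (x, y - 1) (x, y)"
      by (rule E_swap, simp add: near_def)+
    show "(if \<sigma> s \<noteq> s then E s (\<sigma> s) else 0) = r s - l (fst s - 1, snd s) + (u s - d (fst s, snd s - 1))"
      using short_perm_out[OF s, of x y] unfolding l_back d_back r_def u_def H_def V_def xy
      by (elim disjE) (simp_all add: sw)
  qed
  also have "\<dots> = (Sum_any r - Sum_any l) + (Sum_any u - Sum_any d)"
  proof -
    have f: "finite {s. l (fst s - 1, snd s) \<noteq> 0}" "finite {s. d (fst s, snd s - 1) \<noteq> 0}"
      using finite_shift[OF fin(2), of "-1" 0] finite_shift[OF fin(4), of 0 "-1"] by simp_all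
    have n: "finite {s. - l (fst s - 1, snd s) \<noteq> 0}" "finite {s. - d (fst s, snd s - 1) \<noteq> 0}" using f by simp_all
    have sh: "Sum_any (\<lambda>s. l (fst s - 1, snd s)) = Sum_any l" "Sum_any (\<lambda>s. d (fst s, snd s - 1)) = Sum_any d"
      using Sum_any_shift[of l "-1" 0] Sum_any_shift[of d 0 "-1"] by simp_all
    have neg: "Sum_any (\<lambda>s. - g s) = - Sum_any g" if "finite {s. g s \<noteq> 0}" for g :: "int \<times> int \<Rightarrow> complex"
      using Sum_any_right_distrib[OF that, of "- 1"] by simp
    have "Sum_any (\<lambda>s. (r s + - l (fst s - 1, snd s)) + (u s + - d (fst s, snd s - 1))) =
        (Sum_any r + - Sum_any l) + (Sum_any u + - Sum_any d)"
    proof (subst Sum_any.distrib)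
      show "finite {s. r s + - l (fst s - 1, snd s) \<noteq> 0}"
        by (rule finite_subset[OF _ finite_UnI[OF fin(1) f(1)]]) auto
      show "finite {s. u s + - d (fst s, snd s - 1) \<noteq> 0}"
        by (rule finite_subset[OF _ finite_UnI[OF fin(3) f(2)]]) auto
    qed (simp only: Sum_any.distrib[OF fin(1) n(1)] Sum_any.distrib[OF fin(3) n(2)] neg[OF f(1)] neg[OF f(2)] sh)
    then show ?thesis by simp
  qed
  also have "\<dots> = Sum_any (\<lambda>s. of_int (w s) * rim s)"
  proof -
    have wd: "finite {s. w (fst s, snd s - 1) \<noteq> 0}" "finite {s. w (fst s - 1, snd s) \<noteq> 0}"
      using finite_shift[OF finw, of 0 "-1"] finite_shift[OF finw, of "-1" 0] by simp_all
    have sub: "Sum_any (\<lambda>s. f s - g s) = Sum_any f - Sum_any g" if "finite {s. f s \<noteq> 0}" "finite {s. g s \<noteq> 0}"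
      for f g :: "int \<times> int \<Rightarrow> complex"
    proof -
      have "finite {s. - g s \<noteq> 0}" using that(2) by simp
      from Sum_any.distrib[OF that(1) this] Sum_any_right_distrib[OF that(2), of "- 1"] show ?thesis by simp
    qed
    have flow: "perm_flow \<sigma> s (fst s + 1, snd s) = w s - w (fst s, snd s - 1)"
      "perm_flow \<sigma> s (fst s, snd s + 1) = w (fst s - 1, snd s) - w s" for s
      using h by (cases s, simp add: height_of_def)+
    have fs: "finite {s. of_int (w s) * g s \<noteq> 0}" "finite {s. of_int (w (fst s, snd s - 1)) * g s \<noteq> 0}"
        "finite {s. of_int (w (fst s - 1, snd s)) * g s \<noteq> 0}" for g :: "int \<times> int \<Rightarrow> complex"
      by (rule finite_subset[OF _ finw] finite_subset[OF _ wd(1)] finite_subset[OF _ wd(2)], auto)+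
    have "Sum_any r - Sum_any l = Sum_any (\<lambda>s. of_int (w s) * H s - of_int (w (fst s, snd s - 1)) * H s)"
      unfolding sub[OF fin(1,2), symmetric]
    proof (rule Sum_any.cong)
      fix s
      have "r s - l s = of_int (perm_flow \<sigma> s (fst s + 1, snd s)) * H s" by (simp add: r_def l_def perm_flow_def algebra_simps)
      then show "r s - l s = of_int (w s) * H s - of_int (w (fst s, snd s - 1)) * H s" by (simp only: flow of_int_diff left_diff_distrib)
    qed
    also have "\<dots> = Sum_any (\<lambda>s. of_int (w s) * H s) - Sum_any (\<lambda>s. of_int (w s) * H (fst s, snd s + 1))"
      unfolding sub[OF fs(1,2)] using Sum_any_shift[of "\<lambda>s. of_int (w (fst s, snd s - 1)) * H s" 0 1] by simp
    finally have 1: "Sum_any r - Sum_any l = Sum_any (\<lambda>s. of_int (w s) * H s) - Sum_any (\<lambda>s. of_int (w s) * H (fst s, snd s + 1))" .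
    have "Sum_any u - Sum_any d = Sum_any (\<lambda>s. of_int (w (fst s - 1, snd s)) * V s - of_int (w s) * V s)"
      unfolding sub[OF fin(3,4), symmetric]
    proof (rule Sum_any.cong)
      fix s
      have "u s - d s = of_int (perm_flow \<sigma> s (fst s, snd s + 1)) * V s" by (simp add: u_def d_def perm_flow_def algebra_simps)
      then show "u s - d s = of_int (w (fst s - 1, snd s)) * V s - of_int (w s) * V s" by (simp only: flow of_int_diff left_diff_distrib)
    qed
    also have "\<dots> = Sum_any (\<lambda>s. of_int (w s) * V (fst s + 1, snd s)) - Sum_any (\<lambda>s. of_int (w s) * V s)"
      unfolding sub[OF fs(3,1)] using Sum_any_shift[of "\<lambda>s. of_int (w (fst s - 1, snd s)) * V s" 1 0] by simp
    finally have 2: "Sum_any u - Sum_any d = Sum_any (\<lambda>s. of_int (w s) * V (fst s + 1, snd s)) - Sum_any (\<lambda>s. of_int (w s) * V s)" .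
    have "Sum_any (\<lambda>s. of_int (w s) * rim s) = Sum_any (\<lambda>s. (of_int (w s) * H s - of_int (w s) * H (fst s, snd s + 1)) +
        (of_int (w s) * V (fst s + 1, snd s) - of_int (w s) * V s))"
      by (rule Sum_any.cong) (simp add: rim_def algebra_simps)
    also have "\<dots> = Sum_any (\<lambda>s. of_int (w s) * H s - of_int (w s) * H (fst s, snd s + 1)) +
        Sum_any (\<lambda>s. of_int (w s) * V (fst s + 1, snd s) - of_int (w s) * V s)"
      by (rule Sum_any.distrib; rule finite_subset[OF _ finw]; auto)
    finally show ?thesis unfolding 1 2 sub[OF fs(1,1)] by simp
  qed
  finally have total: "curve_sum {} A \<sigma> (center v) = Sum_any (\<lambda>s. of_int (w s) * rim s)" .
  obtain x y where xy: "v = (x, y)" by fastforce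
  let ?F = "{(x, y), (x - 1, y), (x, y - 1), (x - 1, y - 1)}"
  \<comment> \<open>The boundary of a face that does not touch \<open>v\<close> is a unit square
    without \<open>center v\<close> inside or on it.\<close>
  have far: "rim s = 0" if "s \<notin> ?F" for s
  proof -
    obtain a b where ab: "s = (a, b)" by fastforce
    have v': "v \<notin> {(a, b), (a + 1, b), (a + 1, b + 1), (a, b + 1)}" using that by (auto simp: ab xy)
    have "winding_number (arrow (a, b) (a + 1, b)) (center v) + winding_number (arrow (a + 1, b) (a + 1, b + 1)) (center v) +
      winding_number (arrow (a + 1, b + 1) (a, b + 1)) (center v) + winding_number (arrow (a, b + 1) (a, b)) (center v) = 0"
      using winding_number_unit_square[of 1 1 v a b] v' by simp
    then have "E (a, b) (a + 1, b) + E (a + 1, b) (a + 1, b + 1) + E (a + 1, b + 1) (a, b + 1) + E (a, b + 1) (a, b) = 0"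
      using v' v'[unfolded insert_iff empty_iff eq_commute[of v]] by (simp add: E_def)
    moreover have "E (a + 1, b + 1) (a, b + 1) = - E (a, b + 1) (a + 1, b + 1)" "E (a, b + 1) (a, b) = - E (a, b) (a, b + 1)"
      by (rule E_swap, simp add: near_def)+
    ultimately show ?thesis by (simp add: rim_def H_def V_def ab)
  qed
  have flat: "w (x - 1, y) = w v" "w (x, y - 1) = w v" "w (x - 1, y - 1) = w v"
  proof -
    have "perm_flow \<sigma> v q = 0 \<and> perm_flow \<sigma> q v = 0" if "v \<noteq> q" for q by (rule perm_flow_fixed[OF s v that])
    then have "perm_flow \<sigma> (x, y) (x + 1, y) = 0" "perm_flow \<sigma> (x, y) (x, y + 1) = 0" "perm_flow \<sigma> (x, y - 1) (x, y) = 0"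
      by (auto simp: xy)
    moreover have "w (x, y) - w (x, y - 1) = perm_flow \<sigma> (x, y) (x + 1, y)" "w (x - 1, y) - w (x, y) = perm_flow \<sigma> (x, y) (x, y + 1)"
      "w (x - 1, y - 1) - w (x, y - 1) = perm_flow \<sigma> (x, y - 1) (x, y - 1 + 1)" using h unfolding height_of_def by blast+
    ultimately show "w (x - 1, y) = w v" "w (x, y - 1) = w v" "w (x - 1, y - 1) = w v" by (simp_all add: xy)
  qed
  \<comment> \<open>Around the four faces at \<open>v\<close> the inner edges have value 0, and the
    outer ones run once around \<open>center v\<close>.\<close>
  have ring: "rim (x, y) + rim (x - 1, y) + rim (x, y - 1) + rim (x - 1, y - 1) = 1"
  proof -
    have sw: "E (x + 1, y + 1) (x, y + 1) = - E (x, y + 1) (x + 1, y + 1)" "E (x, y + 1) (x - 1, y + 1) = - E (x - 1, y + 1) (x, y + 1)"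
      "E (x - 1, y + 1) (x - 1, y) = - E (x - 1, y) (x - 1, y + 1)" "E (x - 1, y) (x - 1, y - 1) = - E (x - 1, y - 1) (x - 1, y)"
      by (rule E_swap, simp add: near_def)+
    have "E (x - 1, y - 1) (x, y - 1) + E (x, y - 1) (x + 1, y - 1) + E (x + 1, y - 1) (x + 1, y) + E (x + 1, y) (x + 1, y + 1) +
      E (x + 1, y + 1) (x, y + 1) + E (x, y + 1) (x - 1, y + 1) + E (x - 1, y + 1) (x - 1, y) + E (x - 1, y) (x - 1, y - 1) = 1"
      using winding_number_ring[of x y] by (simp add: E_def xy)
    from this[unfolded sw] show ?thesis by (simp add: rim_def H_def V_def algebra_simps)
  qed
  have "Sum_any (\<lambda>s. of_int (w s) * rim s) = (\<Sum>s\<in>?F. of_int (w s) * rim s)"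
  proof (rule Sum_any.expand_superset)
    show "{s. of_int (w s) * rim s \<noteq> 0} \<subseteq> ?F" using far by force
  qed simp
  also have "\<dots> = of_int (w v) * (rim (x, y) + rim (x - 1, y) + rim (x, y - 1) + rim (x - 1, y - 1))"
    by (simp add: flat algebra_simps) (simp add: xy)
  finally show ?thesis unfolding total ring by simp
qed

subsection \<open>Duplex regions\<close>

lemma matching_short_perm: "short_perm \<sigma> \<Longrightarrow> {v. \<sigma> v \<noteq> v} \<subseteq> A \<Longrightarrow> matching A A \<sigma>"
proof -
  assume s: "short_perm \<sigma>" and A: "{v. \<sigma> v \<noteq> v} \<subseteq> A"
  have "\<sigma> permutes A"
  proof (rule bij_imp_permutes)
    show "\<And>x. x \<notin> A \<Longrightarrow> \<sigma> x = x" using A by blast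
    have out: "\<sigma> v \<in> A \<longleftrightarrow> v \<in> A" for v
      using A inj_short_perm[OF s, of "\<sigma> v" v] by (cases "\<sigma> v = v") auto
    have "\<sigma> ` A = A"
    proof (intro equalityI subsetI)
      fix v assume "v \<in> A"
      moreover obtain u where "\<sigma> u = v" using s by (metis short_perm_def bij_pointE)
      ultimately show "v \<in> \<sigma> ` A" using out by blast
    qed (use out in auto)
    then show "bij_betw \<sigma> A A" using inj_short_perm[OF s] by (auto simp: bij_betw_def inj_on_def)
  qed
  then show ?thesis using short_perm_near[OF s] by (simp add: matching_def permutes_imp_bij)
qed

lemma short_perm_extend:
  assumes "finite A" "matching A A \<sigma>"
  shows "short_perm (\<lambda>v. if v \<in> A then \<sigma> v else v)"
  unfolding short_perm_def
proof (intro conjI allI)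
  let ?\<tau> = "\<lambda>v. if v \<in> A then \<sigma> v else v"
  have "bij_betw ?\<tau> A A" using assms(2) by (simp add: matching_def cong: bij_betw_cong)
  then have "?\<tau> permutes A" by (rule bij_imp_permutes) simp
  then show "bij ?\<tau>" by (rule permutes_bij)
  show "finite {v. ?\<tau> v \<noteq> v}" by (rule finite_subset[OF _ assms(1)]) auto
  show "near v (?\<tau> v)" for v using assms(2) near_refl[of v] by (simp add: matching_def)
qed

lemma duplex_squares:
  assumes "duplex R"
  shows "two_floors R" "finite (shadow R 0)" "white_squares R = shadow R 0" "black_squares R = shadow R 0"
proof -
  show tf: "two_floors R" using assms two_story_two_floors by (simp add: duplex_def)
  have eq: "(x, y, 0) \<in> R \<longleftrightarrow> (x, y, 1) \<in> R" for x y
  proof -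
    have "(x, y) \<in> shadow R 0 \<longleftrightarrow> (x, y) \<in> shadow R 1" using assms by (simp add: duplex_def)
    then show ?thesis by (simp add: shadow_def)
  qed
  have "(x, y) \<in> white_squares R \<longleftrightarrow> (x, y) \<in> shadow R 0" "(x, y) \<in> black_squares R \<longleftrightarrow> (x, y) \<in> shadow R 0" for x y
    by (simp_all add: white_squares_def black_squares_def white_over_def black_over_def shadow_def eq)
  then show w: "white_squares R = shadow R 0" and "black_squares R = shadow R 0"
    unfolding set_eq_iff split_paired_All by blast+
  show "finite (shadow R 0)" using finite_region_squares(1)[OF tf] w by simp
qed

lemma duplex_tiling:
  assumes R: "duplex R" and t: "tiling R t"
  obtains \<sigma> where "short_perm \<sigma>" "{v. \<sigma> v \<noteq> v} \<subseteq> shadow R 0" "t = match_tiling 0 (shadow R 0) \<sigma>"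
proof -
  let ?D = "shadow R 0"
  note D = duplex_squares[OF R]
  obtain \<sigma> where m: "matching ?D ?D \<sigma>" and t\<sigma>: "t = match_tiling 0 ?D \<sigma>"
    using tiling_matching[OF D(1) t] unfolding D(3,4) by blast
  let ?\<tau> = "\<lambda>v. if v \<in> ?D then \<sigma> v else v"
  show ?thesis
  proof (rule that[of ?\<tau>])
    show "short_perm ?\<tau>" by (rule short_perm_extend[OF D(2) m])
    show "t = match_tiling 0 ?D ?\<tau>" unfolding t\<sigma> match_tiling_def by (rule image_cong) (simp_all add: match_dimer_def)
  qed auto
qed

lemma duplex_ghost_curves: "duplex R \<Longrightarrow> ghost_curves R G \<Longrightarrow> G = {}"
  by (auto simp: ghost_curves_def duplex_def terminal_holes_def holes_def bij_betw_def)

lemma ghosts_empty: "ghosts A A {}"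
  by (simp add: ghosts_def bij_betw_def)

lemma P_height:
  assumes h: "height_of \<sigma> w" and A: "finite A" "{v. \<sigma> v \<noteq> v} \<subseteq> A"
  shows "P {} (match_tiling 0 A \<sigma>) = (\<Sum>j | j \<in> A \<and> \<sigma> j = j. Poly_Mapping.single (w j) (square_sign j))"
proof -
  have m: "matching A A \<sigma>" by (rule matching_short_perm[OF _ A(2)]) (use h in \<open>simp add: height_of_def\<close>)
  have "winding {} (match_tiling 0 A \<sigma>) j = w j" if j: "j \<in> A" "\<sigma> j = j" for j
  proof -
    have "complex_of_int (winding {} (match_tiling 0 A \<sigma>) j) = of_int (w j)"
      using winding_matching[OF A(1) A(1) m ghosts_empty j] curve_sum_height[OF h A j(2)] by simp
    then show ?thesis by (simp only: of_int_eq_iff)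
  qed
  then show ?thesis unfolding P_match_tiling[OF A(1)] by simp
qed

text \<open>The floor, a solid of height one, projects onto its shadow, and the section at height
  1/2 makes the shadow a retract of it.\<close>

lemma simply_connected_floor:
  assumes "duplex R" shows "simply_connected (\<Union>s\<in>shadow R 0. plane_square s)"
proof (rule simply_connected_retraction_gen)
  let ?S = "solid (floor_of R 0)"
  let ?h = "\<lambda>(x, y, z :: real). Complex x y" and ?k = "\<lambda>c. (Re c, Im c, 1/2 :: real)"
  show "simply_connected ?S" using assms by (simp add: duplex_def two_story_def)
  show "continuous_on ?S ?h" unfolding case_prod_unfold Complex_eq by (intro continuous_intros)
  show "continuous_on T ?k" for T by (intro continuous_intros)
  have S: "?S = {(x, y, z). \<exists>a b. (a, b) \<in> shadow R 0 \<and> of_int a \<le> x \<and> x \<le> of_int a + 1 \<and>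
      of_int b \<le> y \<and> y \<le> of_int b + 1 \<and> 0 \<le> z \<and> z \<le> 1}"
    unfolding solid_def solid_cube_def floor_of_def shadow_def by force
  have T: "(\<Union>s\<in>shadow R 0. plane_square s) = {c. \<exists>a b. (a, b) \<in> shadow R 0 \<and> of_int a \<le> Re c \<and> Re c \<le> of_int a + 1 \<and>
      of_int b \<le> Im c \<and> Im c \<le> of_int b + 1}"
    unfolding plane_square_def by (force simp: in_cbox_complex_iff)
  show k: "?k \<in> (\<Union>s\<in>shadow R 0. plane_square s) \<rightarrow> ?S" unfolding S T by (auto simp: Pi_iff)
  show hk: "?h (?k c) = c" for c by simp
  show "?h ` ?S = (\<Union>s\<in>shadow R 0. plane_square s)"
  proof (intro equalityI subsetI)
    fix c assume "c \<in> ?h ` ?S"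
    then show "c \<in> (\<Union>s\<in>shadow R 0. plane_square s)" unfolding S T by clarsimp blast
  next
    fix c assume "c \<in> (\<Union>s\<in>shadow R 0. plane_square s)"
    then have "?k c \<in> ?S" using k by (rule funcset_mem[rotated])
    then show "c \<in> ?h ` ?S" using hk[of c] by (metis imageI)
  qed
qed

lemma center_in_plane_square_iff: "center j \<in> plane_square s \<longleftrightarrow> j = s"
proof
  assume c: "center j \<in> plane_square s"
  obtain a b x y where js: "j = (a, b)" "s = (x, y)" by fastforce
  have "of_int x \<le> of_int a + (1/2::real)" "of_int a + (1/2::real) \<le> of_int x + 1"
    "of_int y \<le> of_int b + (1/2::real)" "of_int b + (1/2::real) \<le> of_int y + 1"
    using c by (simp_all add: js center_def plane_square_def in_cbox_complex_iff)
  then have "x = a" "y = b" by linarith+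
  then show "j = s" by (simp add: js)
qed (simp add: center_in_plane_square)

text \<open>The drawing stays inside the shadow, and closed curves in a simply connected set do not
  wind around points outside it.\<close>

lemma height_outside_duplex:
  assumes R: "duplex R" and h: "height_of \<sigma> w" and A: "{v. \<sigma> v \<noteq> v} \<subseteq> shadow R 0" and j: "j \<notin> shadow R 0"
  shows "w j = 0"
proof -
  let ?D = "shadow R 0"
  have fin: "finite ?D" by (rule duplex_squares(2)[OF R])
  have s: "short_perm \<sigma>" using h by (simp add: height_of_def)
  have m: "matching ?D ?D \<sigma>" by (rule matching_short_perm[OF s A])
  note d = matching_drawing[OF fin fin m ghosts_empty]
  have "path_image p \<subseteq> (\<Union>s\<in>?D. plane_square s)" if p: "p \<in> segments (match_tiling 0 ?D \<sigma>)" for p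
  proof -
    obtain v where v: "v \<in> ?D" "p = arrow v (\<sigma> v)" using p unfolding segments_match_tiling by blast
    have "\<sigma> v \<in> ?D" using m v(1) by (auto simp: matching_def bij_betw_def)
    then show ?thesis
      using closed_segment_center_subset[OF short_perm_near[OF s, of v]] v by (auto simp: arrow_simps)
  qed
  moreover have "center j \<notin> (\<Union>s\<in>?D. plane_square s)" using j by (auto simp: center_in_plane_square_iff)
  ultimately have "curve_sum {} ?D \<sigma> (center j) = 0"
    using closed_family_zero[OF d(1) simply_connected_floor[OF R]] d(3) by simp
  moreover have "\<sigma> j = j" using A j by blast
  ultimately show ?thesis using curve_sum_height[OF h fin A] by simp
qed

lemma height_of_flat:
  assumes h: "height_of \<sigma> w" and z: "\<And>q. perm_flow \<sigma> v q = 0"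
  shows "v \<in> level_set (w v) w"
proof -
  obtain x y where v: "v = (x, y)" by fastforce
  have "perm_flow \<sigma> (x, y - 1) (x, y - 1 + 1) = 0" using z[of "(x, y - 1)"] by (simp add: v perm_flow_def)
  moreover have "w (x, y) - w (x, y - 1) = perm_flow \<sigma> (x, y) (x + 1, y)" "w (x - 1, y) - w (x, y) = perm_flow \<sigma> (x, y) (x, y + 1)"
    "w (x - 1, y - 1) - w (x, y - 1) = perm_flow \<sigma> (x, y - 1) (x, y - 1 + 1)" using h unfolding height_of_def by blast+
  ultimately show ?thesis using z by (simp add: level_set_def v)
qed

text \<open>A vertex between four faces of equal height carries no net flow, so it is fixed or in a
  two-cycle. The partner in the two-cycle carries none either, and it has the same level because the
  two vertices share faces.\<close>

lemma level_set_partner: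
  assumes h: "height_of \<sigma> w" and v: "v \<in> level_set m w"
  shows "\<sigma> (\<sigma> v) = v" "\<sigma> v \<in> level_set m w"
proof -
  have s: "short_perm \<sigma>" using h by (simp add: height_of_def)
  obtain x y where xy: "v = (x, y)" by fastforce
  have lev: "w (x, y) = m" "w (x - 1, y) = m" "w (x - 1, y - 1) = m" "w (x, y - 1) = m" using v by (simp_all add: level_set_def xy)
  have W: "w (a, b) - w (a, b - 1) = perm_flow \<sigma> (a, b) (a + 1, b)" "w (a - 1, b) - w (a, b) = perm_flow \<sigma> (a, b) (a, b + 1)" for a b
    using h unfolding height_of_def by blast+
  have anti: "perm_flow \<sigma> q p = 0" if "perm_flow \<sigma> p q = 0" for p q using that by (simp add: perm_flow_def)
  have zero: "perm_flow \<sigma> (x, y) (x + 1, y) = 0" "perm_flow \<sigma> (x, y) (x, y + 1) = 0"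
    "perm_flow \<sigma> (x, y) (x - 1, y) = 0" "perm_flow \<sigma> (x, y) (x, y - 1) = 0"
    using W(1)[of x y] W(2)[of x y] W(1)[of "x - 1" y] W(2)[of x "y - 1"] lev anti[of "(x - 1, y)" "(x, y)"] anti[of "(x, y - 1)" "(x, y)"]
    by simp_all
  have "perm_flow \<sigma> v (\<sigma> v) = 0" if "\<sigma> v \<noteq> v"
    using short_perm_out[OF s, of x y] zero that unfolding xy by (elim disjE) simp_all
  then show two: "\<sigma> (\<sigma> v) = v" by (cases "\<sigma> v = v") (auto simp: perm_flow_def split: if_splits)
  show "\<sigma> v \<in> level_set m w"
  proof (cases "\<sigma> v = v")
    case False
    have "perm_flow \<sigma> (\<sigma> v) q = 0" for q
      using two inj_short_perm[OF s, of q v] by (auto simp: perm_flow_def)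
    from height_of_flat[OF h this] have l: "\<sigma> v \<in> level_set (w (\<sigma> v)) w" .
    have "w (\<sigma> v) = m"
      using short_perm_out[OF s, of x y] l False lev unfolding xy
      by (elim disjE) (simp_all add: level_set_def)
    then show ?thesis using l by simp
  qed (use v in simp)
qed

text \<open>The vertices of level \<open>m\<close> that are not fixed are exchanged in pairs, which cancel in the count.\<close>

lemma level_count_fixed:
  assumes h: "height_of \<sigma> w" and m: "m \<noteq> 0"
  shows "level_count m w = (\<Sum>v | \<sigma> v = v \<and> w v = m. square_sign v)"
proof -
  have s: "short_perm \<sigma>" using h by (simp add: height_of_def)
  let ?N = "{v \<in> level_set m w. \<sigma> v \<noteq> v}" and ?F = "{v. \<sigma> v = v \<and> w v = m}"
  have fin: "finite (level_set m w)" by (rule finite_level_set[OF height_fun_height_of[OF h] m])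
  have "v \<in> level_set m w" if v: "\<sigma> v = v" "w v = m" for v
  proof -
    have "perm_flow \<sigma> v q = 0" for q
    proof (cases "v = q")
      case True
      show ?thesis unfolding True perm_flow_def by simp
    next
      case False
      show ?thesis using perm_flow_fixed[OF s v(1) False] by (rule conjunct1)
    qed
    from height_of_flat[OF h this] show ?thesis unfolding v(2) .
  qed
  moreover have "w v = m" if "v \<in> level_set m w" for v
    using that by (cases v) (simp add: level_set_def)
  ultimately have F: "v \<in> level_set m w \<and> \<sigma> v = v \<longleftrightarrow> \<sigma> v = v \<and> w v = m" for v by blast
  have split: "level_set m w = ?F \<union> ?N" using F by blast
  have "sum square_sign ?N = (\<Sum>v\<in>?N. - square_sign v)"
  proof (rule sum.reindex_bij_witness[of _ \<sigma> \<sigma>])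
    fix v assume v: "v \<in> ?N"
    note p = level_set_partner[OF h, of v m]
    show "\<sigma> (\<sigma> v) = v" "\<sigma> (\<sigma> v) = v" "\<sigma> v \<in> ?N" "\<sigma> v \<in> ?N" using p v by auto
    show "- square_sign (\<sigma> v) = square_sign v"
      using square_sign_adjacent[OF short_perm_near[OF s, of v]] v by auto
  qed
  then have "sum square_sign ?N = 0" by (simp add: sum_negf)
  moreover have "?F \<subseteq> level_set m w" using F by blast
  then have "finite ?F" "finite ?N" using fin by (auto intro: finite_subset)
  then have "sum square_sign (?F \<union> ?N) = sum square_sign ?F + sum square_sign ?N"
    by (intro sum.union_disjoint) auto
  then have "sum square_sign (level_set m w) = sum square_sign ?F + sum square_sign ?N"
    by (simp only: split[symmetric])
  ultimately show ?thesis using m by (simp add: level_count_def)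
qed

lemma lookup_sum_single:
  "finite J \<Longrightarrow> Poly_Mapping.lookup (\<Sum>j\<in>J. Poly_Mapping.single (f j) (g j)) m = (\<Sum>j | j \<in> J \<and> f j = m. g j)"
  by (simp add: lookup_sum lookup_single when_def sum.If_cases Int_def)

text \<open>Fixed squares of nonzero height all lie in the region, so the jewels with winding number
  \<open>m\<close> are all fixed vertices of that height, which \<open>level_count_fixed\<close>
  counts.\<close>

lemma lookup_P_duplex:
  assumes R: "duplex R" and h: "height_of \<sigma> w" and A: "{v. \<sigma> v \<noteq> v} \<subseteq> shadow R 0" and m: "m \<noteq> 0"
  shows "Poly_Mapping.lookup (P {} (match_tiling 0 (shadow R 0) \<sigma>)) m = level_count m w"
proof -
  let ?D = "shadow R 0"
  have fin: "finite ?D" by (rule duplex_squares(2)[OF R])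
  have "Poly_Mapping.lookup (P {} (match_tiling 0 ?D \<sigma>)) m = (\<Sum>j | j \<in> {j \<in> ?D. \<sigma> j = j} \<and> w j = m. square_sign j)"
    unfolding P_height[OF h fin A] using fin by (simp add: lookup_sum_single)
  also have "{j. j \<in> {j \<in> ?D. \<sigma> j = j} \<and> w j = m} = {v. \<sigma> v = v \<and> w v = m}"
    using height_outside_duplex[OF R h A] m by blast
  finally show ?thesis using level_count_fixed[OF h m] by simp
qed

lemma rectangle_covers:
  assumes "finite F" obtains a b L M where "F \<subseteq> rectangle a b L M"
proof -
  let ?K = "insert 0 ((\<lambda>(x, y). max \<bar>x\<bar> \<bar>y\<bar>) ` F)"
  define N where "N = Max ?K"
  have fin: "finite ?K" using assms by simp
  have "F \<subseteq> rectangle (- N) (- N) (2 * N + 1) (2 * N + 1)"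
  proof
    fix v assume "v \<in> F"
    moreover obtain x y where v: "v = (x, y)" by fastforce
    ultimately have "max \<bar>x\<bar> \<bar>y\<bar> \<in> ?K" by force
    then have "max \<bar>x\<bar> \<bar>y\<bar> \<le> N" unfolding N_def by (rule Max_ge[OF fin])
    then show "v \<in> rectangle (- N) (- N) (2 * N + 1) (2 * N + 1)" by (auto simp: v rectangle_def)
  qed
  then show ?thesis by (rule that)
qed

lemma box_contains_iff:
  assumes "two_floors R" "shadow R 0 = shadow R 1"
  shows "R \<subseteq> box_cubes a b L M 2 \<longleftrightarrow> shadow R 0 \<subseteq> rectangle a b L M"
proof -
  have z: "z = 0 \<or> z = 1" if "(x, y, z) \<in> R" for x y z using assms(1) that by (auto simp: two_floors_def)
  have e: "(x, y, 0) \<in> R \<longleftrightarrow> (x, y, 1) \<in> R" for x y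
    using assms(2) by (auto simp: shadow_def set_eq_iff)
  show ?thesis
  proof
    assume "R \<subseteq> box_cubes a b L M 2"
    then show "shadow R 0 \<subseteq> rectangle a b L M" by (auto simp: shadow_def rectangle_def box_cubes_def)
  next
    assume s: "shadow R 0 \<subseteq> rectangle a b L M"
    show "R \<subseteq> box_cubes a b L M 2"
    proof
      fix c assume c: "c \<in> R"
      obtain x y k where k: "c = (x, y, k)" by (metis prod_cases3)
      have "(x, y) \<in> shadow R 0" using z[of x y k] e[of x y] c k by (auto simp: shadow_def)
      then show "c \<in> box_cubes a b L M 2" using s z[of x y k] c k by (auto simp: rectangle_def box_cubes_def)
    qed
  qed
qed

lemma embed2_match_tiling:
  assumes "{v. \<sigma> v \<noteq> v} \<subseteq> shadow R 0" "shadow R 0 \<subseteq> rectangle a b L M"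
  shows "embed2 R a b L M (match_tiling 0 (shadow R 0) \<sigma>) = match_tiling 0 (rectangle a b L M) \<sigma>"
proof -
  let ?Q = "rectangle a b L M"
  have col: "match_dimer 0 \<sigma> (x, y) = {(x, y, 0), (x, y, 1)}" if "(x, y) \<notin> shadow R 0" for x y
  proof -
    have "\<sigma> (x, y) = (x, y)" using assms(1) that by blast
    then show ?thesis using match_dimer_column[of \<sigma> "(x, y)" 0] by (simp add: cube_at_def)
  qed
  have "{{(x, y, 0), (x, y, 1)} | x y. (x, y) \<in> ?Q - shadow R 0} = match_dimer 0 \<sigma> ` (?Q - shadow R 0)"
    unfolding image_def using col by (auto; metis)
  then have "embed2 R a b L M (match_tiling 0 (shadow R 0) \<sigma>) = match_dimer 0 \<sigma> ` (shadow R 0 \<union> (?Q - shadow R 0))"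
    unfolding embed2_def match_tiling_def image_Un by simp
  moreover have "shadow R 0 \<union> (?Q - shadow R 0) = ?Q" using assms(2) by blast
  ultimately show ?thesis by (simp add: match_tiling_def)
qed

lemma tiling_match_tiling:
  assumes m: "matching A B \<sigma>"
  shows "tiling (white_over k ` A \<union> black_over k ` B) (match_tiling k A \<sigma>)"
  unfolding tiling_def partition_on_def
proof (intro conjI ballI)
  have b: "inj_on \<sigma> A" "\<sigma> ` A = B" "\<And>v. v \<in> A \<Longrightarrow> near v (\<sigma> v)" using m by (auto simp: matching_def bij_betw_def)
  show "dimer d" if "d \<in> match_tiling k A \<sigma>" for d
  proof -
    obtain v where "v \<in> A" "d = {white_over k v, black_over k (\<sigma> v)}"
      using \<open>d \<in> match_tiling k A \<sigma>\<close> unfolding match_tiling_def match_dimer_def by blast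
    then show ?thesis using near_imp_dimer[OF b(3)] by simp
  qed
  show "\<Union> (match_tiling k A \<sigma>) = white_over k ` A \<union> black_over k ` B"
    unfolding b(2)[symmetric] by (auto simp: match_tiling_def match_dimer_def)
  show "{} \<notin> match_tiling k A \<sigma>" by (auto simp: match_tiling_def match_dimer_def)
  show "disjoint (match_tiling k A \<sigma>)"
  proof (rule disjointI)
    fix d e assume de: "d \<in> match_tiling k A \<sigma>" "e \<in> match_tiling k A \<sigma>" "d \<noteq> e"
    then obtain u v where uv: "u \<in> A" "v \<in> A" "d = match_dimer k \<sigma> u" "e = match_dimer k \<sigma> v" by (auto simp: match_tiling_def)
    then have ne: "u \<noteq> v" using de(3) by auto
    then have "\<sigma> u \<noteq> \<sigma> v" using inj_onD[OF b(1) _ uv(1,2)] by auto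
    then show "d \<inter> e = {}"
      using ne white_over_ne_black_over[of k u k "\<sigma> v"] white_over_ne_black_over[of k v k "\<sigma> u"]
      by (auto simp: uv match_dimer_def white_over_eq_iff black_over_eq_iff)
  qed
qed

text \<open>The two floors over \<open>A\<close> form a region without holes, for which the empty
  set is a choice of ghost curves; so \<open>P_flips\<close> applies to it.\<close>

lemma P_match_tiling_flips:
  assumes fin: "finite A" and m: "matching A A \<sigma>" and f: "flip\<^sup>*\<^sup>* (match_tiling 0 A \<sigma>) t"
  shows "P {} t = P {} (match_tiling 0 A \<sigma>)"
proof -
  let ?R = "white_over 0 ` A \<union> black_over 0 ` A"
  have R: "two_floors ?R" using fin by (auto simp: two_floors_def white_over_def black_over_def split: if_splits)
  have sq: "white_squares ?R = A" "black_squares ?R = A"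
    using white_over_ne_black_over
    by (auto simp: white_squares_def black_squares_def white_over_eq_iff black_over_eq_iff, metis)
  have "ghost_curves ?R {}" unfolding ghost_curves_iff[OF R] sq by (rule ghosts_empty)
  from P_flips[OF R tiling_match_tiling[OF m] f this] show ?thesis .
qed

theorem duplex_flip_equivalent:
  assumes R: "duplex R" and g: "ghost_curves R G" and t: "tiling R t0" "tiling R t1"
  shows "P G t0 = P G t1 \<longleftrightarrow> (\<exists>a b L M. R \<subseteq> box_cubes a b L M 2 \<and> embed2 R a b L M t1 \<in> flip_component (embed2 R a b L M t0))"
proof -
  let ?D = "shadow R 0"
  have G: "G = {}" by (rule duplex_ghost_curves[OF R g])
  note D = duplex_squares[OF R]
  have box: "R \<subseteq> box_cubes a b L M 2 \<longleftrightarrow> ?D \<subseteq> rectangle a b L M" for a b L M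
    by (rule box_contains_iff[OF D(1)]) (use R in \<open>simp add: duplex_def\<close>)
  obtain \<sigma> where s: "short_perm \<sigma>" "{v. \<sigma> v \<noteq> v} \<subseteq> ?D" "t0 = match_tiling 0 ?D \<sigma>" by (rule duplex_tiling[OF R t(1)])
  obtain \<tau> where t: "short_perm \<tau>" "{v. \<tau> v \<noteq> v} \<subseteq> ?D" "t1 = match_tiling 0 ?D \<tau>" by (rule duplex_tiling[OF R t(2)])
  obtain w where w: "height_of \<sigma> w" by (rule height_of_exists[OF s(1)])
  obtain u where u: "height_of \<tau> u" by (rule height_of_exists[OF t(1)])
  show ?thesis
  proof
    assume eq: "P G t0 = P G t1"
    \<comment> \<open>Comparing coefficients of \<open>P\<close> at nonzero exponents suffices,
      since the classes are determined by the counts at nonzero levels.\<close>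
    have "level_count m w = level_count m u" if "m \<noteq> 0" for m
      using lookup_P_duplex[OF R w s(2) that] lookup_P_duplex[OF R u t(2) that] eq by (simp add: G s(3) t(3))
    then have "w \<simeq> u" by (rule height_eq_if_counts[OF height_fun_height_of[OF w] height_fun_height_of[OF u]])
    then have "perm_step\<^sup>*\<^sup>* \<sigma> \<tau>" by (rule perm_steps_height_eq[OF _ w u])
    then obtain F where F: "finite F" "\<And>A X. F \<subseteq> A \<Longrightarrow> \<forall>\<tau> p. match_dimer 0 \<tau> p \<notin> X \<Longrightarrow>
       flip\<^sup>*\<^sup>* (match_tiling 0 A \<sigma> \<union> X) (match_tiling 0 A \<tau> \<union> X)" 
      using perm_steps_flips[of \<sigma> \<tau> 0] by blast
    have "finite (F \<union> ?D)" using F(1) D(2) by simp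
    then obtain a b L M where Q: "F \<union> ?D \<subseteq> rectangle a b L M" by (rule rectangle_covers)
    then have sub: "?D \<subseteq> rectangle a b L M" "F \<subseteq> rectangle a b L M" by auto
    have "flip\<^sup>*\<^sup>* (embed2 R a b L M t0) (embed2 R a b L M t1)"
      using F(2)[OF sub(2), of "{}"]
      unfolding s(3) t(3) embed2_match_tiling[OF s(2) sub(1)] embed2_match_tiling[OF t(2) sub(1)] by simp
    then show "\<exists>a b L M. R \<subseteq> box_cubes a b L M 2 \<and> embed2 R a b L M t1 \<in> flip_component (embed2 R a b L M t0)"
      using sub(1) unfolding box flip_component_def by blast
  next
    assume "\<exists>a b L M. R \<subseteq> box_cubes a b L M 2 \<and> embed2 R a b L M t1 \<in> flip_component (embed2 R a b L M t0)"
    then obtain a b L M where sub: "?D \<subseteq> rectangle a b L M"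
      and f: "flip\<^sup>*\<^sup>* (embed2 R a b L M t0) (embed2 R a b L M t1)" unfolding box flip_component_def by blast
    let ?Q = "rectangle a b L M"
    have fin: "finite ?Q" by (simp add: rectangle_def)
    \<comment> \<open>The embedding adds jewels of height 0 only, and the same ones for both
      tilings. Equality in the box therefore gives equality in the region.\<close>
    have split: "P {} (match_tiling 0 ?Q \<rho>) = P {} (match_tiling 0 ?D \<rho>) + (\<Sum>j\<in>?Q - ?D. Poly_Mapping.single 0 (square_sign j))"
      if r: "height_of \<rho> v" "{v. \<rho> v \<noteq> v} \<subseteq> ?D" for \<rho> v
    proof -
      have rQ: "{v. \<rho> v \<noteq> v} \<subseteq> ?Q" using r(2) sub by blast
      have J: "{j \<in> ?Q. \<rho> j = j} = {j \<in> ?D. \<rho> j = j} \<union> (?Q - ?D)" using r(2) sub by blast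
      have "(\<Sum>j\<in>?Q - ?D. Poly_Mapping.single (v j) (square_sign j)) = (\<Sum>j\<in>?Q - ?D. Poly_Mapping.single 0 (square_sign j))"
        by (rule sum.cong[OF refl]) (simp add: height_outside_duplex[OF R r])
      then show ?thesis
        unfolding P_height[OF r(1) fin rQ] P_height[OF r(1) D(2) r(2)] J
        by (subst sum.union_disjoint) (use fin D(2) in auto)
    qed
    have sQ: "{v. \<sigma> v \<noteq> v} \<subseteq> ?Q" using s(2) sub by blast
    have "P {} (match_tiling 0 ?Q \<tau>) = P {} (match_tiling 0 ?Q \<sigma>)"
      using P_match_tiling_flips[OF fin matching_short_perm[OF s(1) sQ]] f
      unfolding s(3) t(3) embed2_match_tiling[OF s(2) sub] embed2_match_tiling[OF t(2) sub] by blast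
    then show "P G t0 = P G t1"
      unfolding split[OF w s(2)] split[OF u t(2)] G s(3) t(3) by simp
  qed
qed

subsection \<open>Four floors\<close>

text \<open>Uniform in all large sets of squares, so that equivalences can be composed before a box
  is fixed.\<close>

definition four_floor_equivalent :: "(square \<Rightarrow> square) \<Rightarrow> (square \<Rightarrow> square) \<Rightarrow> bool" where
  "four_floor_equivalent \<sigma> \<tau> \<longleftrightarrow> (\<exists>F. finite F \<and> (\<forall>A. F \<subseteq> A \<longrightarrow> flip\<^sup>*\<^sup>* (stack A \<sigma> id) (stack A \<tau> id)))"

lemma match_dimer_floor: "match_dimer k \<sigma> u = match_dimer l \<tau> v \<Longrightarrow> k = l"
proof -
  assume "match_dimer k \<sigma> u = match_dimer l \<tau> v"
  then have "white_over k u = white_over l v"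
    using white_over_ne_black_over[of k u l "\<tau> v"] by (auto simp: match_dimer_def doubleton_eq_iff)
  then show "k = l" by (cases u, cases v) (auto simp: white_over_def split: if_splits)
qed

lemma tiling_stack:
  assumes "short_perm \<sigma>" "short_perm \<tau>" "{v. \<sigma> v \<noteq> v} \<subseteq> A" "{v. \<tau> v \<noteq> v} \<subseteq> A"
  shows "tiling ((white_over 0 ` A \<union> black_over 0 ` A) \<union> (white_over 1 ` A \<union> black_over 1 ` A)) (stack A \<sigma> \<tau>)"
proof -
  note t = tiling_match_tiling[OF matching_short_perm[OF assms(1,3)], of 0]
    tiling_match_tiling[OF matching_short_perm[OF assms(2,4)], of 1]
  have low: "z \<in> {0, 1}" if "(x, y, z) \<in> white_over 0 ` A \<union> black_over 0 ` A" for x y z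
    using that by (auto simp: white_over_def black_over_def split: if_splits)
  have high: "z \<in> {2, 3}" if "(x, y, z) \<in> white_over 1 ` A \<union> black_over 1 ` A" for x y z
    using that by (auto simp: white_over_def black_over_def split: if_splits)
  have "(white_over 0 ` A \<union> black_over 0 ` A) \<inter> (white_over 1 ` A \<union> black_over 1 ` A) = {}"
  proof (rule equals0I)
    fix c assume c: "c \<in> (white_over 0 ` A \<union> black_over 0 ` A) \<inter> (white_over 1 ` A \<union> black_over 1 ` A)"
    obtain x y z where "c = (x, y, z)" by (metis prod_cases3)
    then have "z \<in> {0, 1}" "z \<in> {2, 3}" using low[of x y z] high[of x y z] c by (simp_all only: Int_iff)
    then show False by auto
  qed
  moreover have "partition_on (white_over 0 ` A \<union> black_over 0 ` A) (match_tiling 0 A \<sigma>)"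
    "partition_on (white_over 1 ` A \<union> black_over 1 ` A) (match_tiling 1 A \<tau>)" using t by (simp_all add: tiling_def)
  ultimately have "partition_on ((white_over 0 ` A \<union> black_over 0 ` A) \<union> (white_over 1 ` A \<union> black_over 1 ` A)) (stack A \<sigma> \<tau>)"
    unfolding stack_def partition_on_def
    using disjoint_union[of "match_tiling 0 A \<sigma>" "match_tiling 1 A \<tau>"] by simp
  moreover have "\<forall>d\<in>stack A \<sigma> \<tau>. dimer d" using t by (auto simp: tiling_def stack_def)
  ultimately show ?thesis by (simp add: tiling_def)
qed

lemma four_floor_equivalent_sym:
  assumes "short_perm \<sigma>" "four_floor_equivalent \<sigma> \<tau>" shows "four_floor_equivalent \<tau> \<sigma>"
proof -
  obtain F where F: "finite F" "\<And>A. F \<subseteq> A \<Longrightarrow> flip\<^sup>*\<^sup>* (stack A \<sigma> id) (stack A \<tau> id)"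
    using assms(2) unfolding four_floor_equivalent_def by blast
  have "flip\<^sup>*\<^sup>* (stack A \<tau> id) (stack A \<sigma> id)" if "F \<union> {v. \<sigma> v \<noteq> v} \<subseteq> A" for A
  proof -
    have "F \<subseteq> A" "{v. \<sigma> v \<noteq> v} \<subseteq> A" "{v. id v \<noteq> v} \<subseteq> A" using that by auto
    then show ?thesis using flips_tiling(2)[OF tiling_stack[OF assms(1) short_perm_id] F(2)] by blast
  qed
  moreover have "finite (F \<union> {v. \<sigma> v \<noteq> v})" using F(1) assms(1) by (simp add: short_perm_def)
  ultimately show ?thesis unfolding four_floor_equivalent_def by blast
qed

lemma four_floor_equivalent_trans:
  assumes "four_floor_equivalent \<sigma> \<tau>" "four_floor_equivalent \<tau> \<rho>" shows "four_floor_equivalent \<sigma> \<rho>"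
proof -
  obtain F where F: "finite F" "\<And>A. F \<subseteq> A \<Longrightarrow> flip\<^sup>*\<^sup>* (stack A \<sigma> id) (stack A \<tau> id)"
    using assms(1) unfolding four_floor_equivalent_def by blast
  obtain F' where F': "finite F'" "\<And>A. F' \<subseteq> A \<Longrightarrow> flip\<^sup>*\<^sup>* (stack A \<tau> id) (stack A \<rho> id)"
    using assms(2) unfolding four_floor_equivalent_def by blast
  have "flip\<^sup>*\<^sup>* (stack A \<sigma> id) (stack A \<rho> id)" if "F \<union> F' \<subseteq> A" for A
    using rtranclp_trans[OF F(2)[of A] F'(2)[of A]] that by simp
  then show ?thesis unfolding four_floor_equivalent_def using F(1) F'(1) by (intro exI[of _ "F \<union> F'"]) blast
qed

lemma four_floor_equivalent_class:
  assumes "height_of \<sigma> w" "height_of \<tau> u" "height_class w = height_class u"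
  shows "four_floor_equivalent \<sigma> \<tau>"
proof -
  have "w \<simeq> u" using assms height_fun_height_of by (simp add: height_class_eq_iff)
  then have "perm_step\<^sup>*\<^sup>* \<sigma> \<tau>" by (rule perm_steps_height_eq[OF _ assms(1,2)])
  then obtain F where F: "finite F" "\<And>A X. F \<subseteq> A \<Longrightarrow> \<forall>\<tau> p. match_dimer 0 \<tau> p \<notin> X \<Longrightarrow>
       flip\<^sup>*\<^sup>* (match_tiling 0 A \<sigma> \<union> X) (match_tiling 0 A \<tau> \<union> X)" 
    using perm_steps_flips[of \<sigma> \<tau> 0] by blast
  have "\<forall>\<tau> p. match_dimer 0 \<tau> p \<notin> match_tiling 1 A id" for A
    using match_dimer_floor[of 0 _ _ 1] by (auto simp: match_tiling_def)
  then have "flip\<^sup>*\<^sup>* (stack A \<sigma> id) (stack A \<tau> id)" if "F \<subseteq> A" for A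
    using F(2)[OF that] unfolding stack_def by blast
  then show ?thesis unfolding four_floor_equivalent_def using F(1) by blast
qed

text \<open>Disjoint parts of a tiling can be moved one to the lower and one to the upper pair of floors;
  there the second part is deformed independently of the first.\<close>

lemma four_floor_equivalent_slide:
  assumes s: "height_of \<sigma> w" and r: "height_of \<rho> u" "height_of \<rho>' u'" and eq: "height_class u = height_class u'"
    and d: "\<And>v. \<sigma> v = v \<or> \<rho> v = v" "\<And>v. \<sigma> v = v \<or> \<rho>' v = v"
  shows "four_floor_equivalent (\<sigma> \<circ> \<rho>) (\<sigma> \<circ> \<rho>')"
proof -
  have sp: "short_perm \<sigma>" "short_perm \<rho>" "short_perm \<rho>'" using s r by (simp_all add: height_of_def)
  have "u \<simeq> u'" using r eq height_fun_height_of by (simp add: height_class_eq_iff)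
  then have "perm_step\<^sup>*\<^sup>* \<rho> \<rho>'" by (rule perm_steps_height_eq[OF _ r])
  then obtain F where F: "finite F" "\<And>A X. F \<subseteq> A \<Longrightarrow> \<forall>\<tau> p. match_dimer 1 \<tau> p \<notin> X \<Longrightarrow>
       flip\<^sup>*\<^sup>* (match_tiling 1 A \<rho> \<union> X) (match_tiling 1 A \<rho>' \<union> X)" 
    using perm_steps_flips[of \<rho> \<rho>' 1] by blast
  let ?F = "F \<union> {v. \<sigma> v \<noteq> v} \<union> {v. \<rho> v \<noteq> v} \<union> {v. \<rho>' v \<noteq> v}"
  have "flip\<^sup>*\<^sup>* (stack A (\<sigma> \<circ> \<rho>) id) (stack A (\<sigma> \<circ> \<rho>') id)" if A: "?F \<subseteq> A" for A
  proof -
    have sub: "F \<subseteq> A" "{v. \<sigma> v \<noteq> v} \<subseteq> A" "{v. \<rho> v \<noteq> v} \<subseteq> A" "{v. \<rho>' v \<noteq> v} \<subseteq> A" using A by auto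
    have 1: "flip\<^sup>*\<^sup>* (stack A (\<sigma> \<circ> \<rho>) id) (stack A \<sigma> \<rho>)" by (rule slide_stack[OF sp(1,2) d(1) sub(3)])
    have "\<forall>\<tau> p. match_dimer 1 \<tau> p \<notin> match_tiling 0 A \<sigma>"
      using match_dimer_floor[of 1 _ _ 0] by (auto simp: match_tiling_def)
    from F(2)[OF sub(1) this] have 2: "flip\<^sup>*\<^sup>* (stack A \<sigma> \<rho>) (stack A \<sigma> \<rho>')" unfolding stack_def by (simp add: Un_commute)
    have h': "height_of (\<sigma> \<circ> \<rho>') (\<lambda>f. w f + u' f)" by (rule height_of_add[OF s r(2) d(2)])
    have "{v. (\<sigma> \<circ> \<rho>') v \<noteq> v} \<subseteq> {v. \<sigma> v \<noteq> v} \<union> {v. \<rho>' v \<noteq> v}"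
      using comp_apply[of \<sigma> \<rho>'] by (smt (verit) UnCI mem_Collect_eq subsetI)
    then have "{v. (\<sigma> \<circ> \<rho>') v \<noteq> v} \<subseteq> A" using sub(2,4) by blast
    then have "tiling ((white_over 0 ` A \<union> black_over 0 ` A) \<union> (white_over 1 ` A \<union> black_over 1 ` A)) (stack A (\<sigma> \<circ> \<rho>') id)"
      by (intro tiling_stack short_perm_id) (use h' in \<open>auto simp: height_of_def\<close>)
    then have 3: "flip\<^sup>*\<^sup>* (stack A \<sigma> \<rho>') (stack A (\<sigma> \<circ> \<rho>') id)"
      by (rule flips_tiling(2)[OF _ slide_stack[OF sp(1,3) d(2) sub(4)]])
    show ?thesis by (rule rtranclp_trans[OF rtranclp_trans[OF 1 2] 3])
  qed
  moreover have "finite ?F" using F(1) sp by (simp add: short_perm_def)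
  ultimately show ?thesis unfolding four_floor_equivalent_def by (intro exI[of _ ?F]) blast
qed

text \<open>Stated for some representatives; by \<open>stackedD\<close> it holds for all of them,
  since permutations of the same class are already connected on the lower pair of floors.\<close>

definition stacked :: "height_class \<Rightarrow> height_class \<Rightarrow> bool" where
  "stacked g h \<longleftrightarrow> (\<exists>\<sigma> \<tau> w u. height_of \<sigma> w \<and> height_of \<tau> u \<and> height_class w = g \<and> height_class u = h \<and>
     four_floor_equivalent \<sigma> \<tau>)"

lemma stackedD:
  assumes "stacked g h" "height_of \<sigma> w" "height_class w = g" "height_of \<tau> u" "height_class u = h"
  shows "four_floor_equivalent \<sigma> \<tau>"
proof -
  obtain \<sigma>' \<tau>' w' u' where *: "height_of \<sigma>' w'" "height_of \<tau>' u'" "height_class w' = g" "height_class u' = h"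
    "four_floor_equivalent \<sigma>' \<tau>'" using assms(1) unfolding stacked_def by blast
  have "four_floor_equivalent \<sigma> \<sigma>'" by (rule four_floor_equivalent_class[OF assms(2) *(1)]) (simp add: assms(3) *(3))
  moreover have "four_floor_equivalent \<tau>' \<tau>" by (rule four_floor_equivalent_class[OF *(2) assms(4)]) (simp add: assms(5) *(4))
  ultimately show ?thesis using *(5) four_floor_equivalent_trans by blast
qed

lemma stacked_rep: obtains \<sigma> w where "height_of \<sigma> w" "height_class w = g"
  using height_class_cases[of g] height_of_flow_perm by metis

lemma stacked_refl: "stacked g g"
  unfolding stacked_def by (metis stacked_rep four_floor_equivalent_class)

lemma stacked_sym: "stacked g h \<Longrightarrow> stacked h g"
  unfolding stacked_def by (metis four_floor_equivalent_sym height_of_def)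

lemma stacked_trans: "stacked g h \<Longrightarrow> stacked h k \<Longrightarrow> stacked g k"
proof -
  assume gh: "stacked g h" and hk: "stacked h k"
  obtain \<sigma> w where s: "height_of \<sigma> w" "height_class w = g" by (rule stacked_rep)
  obtain \<tau> u where t: "height_of \<tau> u" "height_class u = h" by (rule stacked_rep)
  obtain \<rho> v where r: "height_of \<rho> v" "height_class v = k" by (rule stacked_rep)
  have "four_floor_equivalent \<sigma> \<rho>"
    using four_floor_equivalent_trans[OF stackedD[OF gh s t] stackedD[OF hk t r]] .
  then show ?thesis unfolding stacked_def using s r by blast
qed

text \<open>At every vertex one of the two functions is flat, so their flows move disjoint sets of
  vertices, although one may lie on a plateau of the other.\<close>

definition separate :: "(int \<times> int \<Rightarrow> int) \<Rightarrow> (int \<times> int \<Rightarrow> int) \<Rightarrow> bool" where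
  "separate w u \<longleftrightarrow> (\<forall>x y. (w (x, y) = w (x - 1, y) \<and> w (x - 1, y) = w (x - 1, y - 1) \<and> w (x - 1, y - 1) = w (x, y - 1)) \<or>
     (u (x, y) = u (x - 1, y) \<and> u (x - 1, y) = u (x - 1, y - 1) \<and> u (x - 1, y - 1) = u (x, y - 1)))"

lemma separate_flow_perm:
  assumes "height_fun w" "height_fun u" "separate w u"
  shows "flow_perm w v = v \<or> flow_perm u v = v"
proof -
  obtain x y where v: "v = (x, y)" by fastforce
  show ?thesis
    using assms(3) unfolding v flow_perm_iff(5)[OF assms(1)] flow_perm_iff(5)[OF assms(2)] separate_def by blast
qed

lemma height_of_separate:
  assumes "height_fun w" "height_fun u" "separate w u"
  shows "height_of (flow_perm w \<circ> flow_perm u) (height_add w u)"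
  using height_of_add[OF height_of_flow_perm[OF assms(1)] height_of_flow_perm[OF assms(2)] separate_flow_perm[OF assms]]
  by (simp add: height_add_def)

lemma separate_above: "zero_from c w \<Longrightarrow> zero_upto c u \<Longrightarrow> separate w u"
  unfolding separate_def zero_from_def zero_upto_def
proof (intro allI)
  fix x y assume "\<forall>x y. y \<ge> c \<longrightarrow> w (x, y) = 0" "\<forall>x y. y \<le> c \<longrightarrow> u (x, y) = 0"
  then show "(w (x, y) = w (x - 1, y) \<and> w (x - 1, y) = w (x - 1, y - 1) \<and> w (x - 1, y - 1) = w (x, y - 1)) \<or>
     (u (x, y) = u (x - 1, y) \<and> u (x - 1, y) = u (x - 1, y - 1) \<and> u (x - 1, y - 1) = u (x, y - 1))"
    by (cases "y \<le> c") simp_all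
qed

text \<open>The flow of \<open>u\<close> is moved to the upper floors, deformed there into that of a
  representative lying above \<open>w\<close>, and moved down again. The result represents the sum
  of the classes.\<close>

lemma stacked_separate:
  assumes w: "height_fun w" and u: "height_fun u" and d: "separate w u"
  shows "stacked (height_class (height_add w u)) (height_class w + height_class u)"
proof -
  obtain c where c: "zero_from c w" using height_fun_zero_from[OF w] by blast
  obtain u' where u': "height_fun u'" "height_class u = height_class u'" "zero_upto c u'" by (rule height_class_rep_above)
  have d': "separate w u'" by (rule separate_above[OF c u'(3)])
  have "four_floor_equivalent (flow_perm w \<circ> flow_perm u) (flow_perm w \<circ> flow_perm u')"
    by (rule four_floor_equivalent_slide[OF height_of_flow_perm[OF w] height_of_flow_perm[OF u] height_of_flow_perm[OF u'(1)] u'(2)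
      separate_flow_perm[OF w u d] separate_flow_perm[OF w u'(1) d']])
  moreover have "height_class (height_add w u') = height_class w + height_class u"
    using height_class_add[OF w u'(1) c u'(3)] u'(2) by simp
  ultimately show ?thesis
    unfolding stacked_def using height_of_separate[OF w u d] height_of_separate[OF w u'(1) d'] by blast
qed

text \<open>Equivalence in the presence of any further class \<open>k\<close>. The quantifier makes
  the relation compatible with addition, and so with cancellation; \<open>stacked\<close> itself is
  the case \<open>k = 0\<close>.\<close>

definition stacked_cong :: "height_class \<Rightarrow> height_class \<Rightarrow> bool" (infix "\<sim>" 50) where
  "g \<sim> h \<longleftrightarrow> (\<forall>k. stacked (g + k) (h + k))"

lemma stacked_cong_refl: "g \<sim> g"
  by (simp add: stacked_cong_def stacked_refl)

lemma stacked_cong_sym: "g \<sim> h \<Longrightarrow> h \<sim> g"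
  by (simp add: stacked_cong_def stacked_sym)

lemma stacked_cong_trans: "g \<sim> h \<Longrightarrow> h \<sim> k \<Longrightarrow> g \<sim> k"
  unfolding stacked_cong_def using stacked_trans by blast

lemma stacked_cong_add: "g \<sim> h \<Longrightarrow> g' \<sim> h' \<Longrightarrow> g + g' \<sim> h + h'"
proof -
  assume g: "g \<sim> h" and g': "g' \<sim> h'"
  have "g + g' \<sim> h + g'" using g by (simp add: stacked_cong_def add.assoc)
  moreover have "stacked (g' + (h + k)) (h' + (h + k))" for k using g' unfolding stacked_cong_def by blast
  then have "h + g' \<sim> h + h'" unfolding stacked_cong_def by (simp add: ac_simps)
  ultimately show ?thesis by (rule stacked_cong_trans)
qed

lemma stacked_cong_cancel: "g + k \<sim> h + k \<Longrightarrow> g \<sim> h"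
  using stacked_cong_add[OF _ stacked_cong_refl[of "- k"], of "g + k" "h + k"] by simp

text \<open>The further class is represented by a function \<open>v\<close> above both
  \<open>w\<close> and \<open>u\<close>. Adding it to \<open>w\<close> leaves a function separate
  from \<open>u\<close>, to which \<open>stacked_separate\<close> applies.\<close>

lemma stacked_cong_separate:
  assumes w: "height_fun w" and u: "height_fun u" and d: "separate w u"
  shows "height_class (height_add w u) \<sim> height_class w + height_class u"
  unfolding stacked_cong_def
proof
  fix k
  have wu: "height_fun (height_add w u)" by (rule height_fun_height_of[OF height_of_separate[OF w u d]])
  obtain a where a: "\<And>c. c \<ge> a \<Longrightarrow> zero_from c w" using height_fun_zero_from[OF w] by metis
  obtain b where b: "\<And>c. c \<ge> b \<Longrightarrow> zero_from c u" using height_fun_zero_from[OF u] by metis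
  define c where "c = max a b"
  have c: "zero_from c w" "zero_from c u" using a b by (simp_all add: c_def)
  then have cc: "zero_from c (height_add w u)" by (simp add: zero_from_def)
  obtain v where v: "height_fun v" "k = height_class v" "zero_upto c v" by (rule height_class_rep_above)
  have wv: "height_fun (height_add w v)" by (rule height_fun_add[OF w v(1) c(1) v(3)])
  have "separate (height_add w v) u"
    unfolding separate_def
  proof (intro allI)
    fix x y
    have "w (x, y) = w (x - 1, y) \<and> w (x - 1, y) = w (x - 1, y - 1) \<and> w (x - 1, y - 1) = w (x, y - 1) \<or>
     u (x, y) = u (x - 1, y) \<and> u (x - 1, y) = u (x - 1, y - 1) \<and> u (x - 1, y - 1) = u (x, y - 1)"
      using d unfolding separate_def by blast
    moreover have "y \<le> c \<Longrightarrow> v (x, y) = 0 \<and> v (x - 1, y) = 0 \<and> v (x - 1, y - 1) = 0 \<and> v (x, y - 1) = 0"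
      using v(3) by (simp add: zero_upto_def)
    moreover have "\<not> y \<le> c \<Longrightarrow> u (x, y) = 0 \<and> u (x - 1, y) = 0 \<and> u (x - 1, y - 1) = 0 \<and> u (x, y - 1) = 0"
      using c(2) by (simp add: zero_from_def)
    ultimately show "(height_add w v (x, y) = height_add w v (x - 1, y) \<and> height_add w v (x - 1, y) = height_add w v (x - 1, y - 1) \<and>
        height_add w v (x - 1, y - 1) = height_add w v (x, y - 1)) \<or>
     (u (x, y) = u (x - 1, y) \<and> u (x - 1, y) = u (x - 1, y - 1) \<and> u (x - 1, y - 1) = u (x, y - 1))"
      by (cases "y \<le> c") simp_all
  qed
  from stacked_separate[OF wv u this]
  have "stacked (height_class (height_add (height_add w v) u)) (height_class w + height_class v + height_class u)"
    unfolding height_class_add[OF w v(1) c(1) v(3)] .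
  moreover have "height_add (height_add w v) u = height_add (height_add w u) v" by (simp add: height_add_def fun_eq_iff)
  ultimately show "stacked (height_class (height_add w u) + k) (height_class w + height_class u + k)"
    using height_class_add[OF wu v(1) cc v(3)] v(2) by (simp add: ac_simps)
qed

subsection \<open>The twist\<close>

text \<open>The pyramid of height \<open>m + 1\<close> without its peak. For positive
  \<open>m\<close> its top is a block of four by four faces, just wide enough for
  \<open>pyramid 1 1 0\<close> to stand on it without touching the slope.\<close>

definition plateau :: "int \<Rightarrow> int \<times> int \<Rightarrow> int" where
  "plateau m = (\<lambda>f. min (pyramid (m + 1) 1 0 f) m)"

lemma pyramid_one: "pyramid 1 1 0 (x, y) = (if x \<in> {0, 1} \<and> y \<in> {-1, 0} then 1 else 0)"
  by (auto simp: pyramid_def ring_index_def)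

lemma plateau_top: "m \<ge> 0 \<Longrightarrow> plateau m (x, y) = m \<longleftrightarrow> m = 0 \<or> - 1 \<le> x \<and> x \<le> 2 \<and> - 2 \<le> y \<and> y \<le> 1"
  by (auto simp: plateau_def pyramid_def ring_index_def)

lemma plateau_range: "m \<ge> 0 \<Longrightarrow> 0 \<le> plateau m f \<and> plateau m f \<le> m"
  by (cases f) (auto simp: plateau_def pyramid_def)

lemma height_fun_plateau: assumes "m \<ge> 0" shows "height_fun (plateau m)"
proof -
  have p: "height_fun (pyramid (m + 1) 1 0)" by (rule height_fun_pyramid)
  then have "finite {f. pyramid (m + 1) 1 0 f \<noteq> 0}" by (simp add: height_fun_def)
  then have "finite {f. plateau m f \<noteq> 0}"
    by (rule rev_finite_subset) (use assms in \<open>auto simp: plateau_def min_def\<close>)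
  moreover have "valid (plateau m)"
    using p unfolding height_fun_def valid_def plateau_def
    by (intro allI vertex_ok_lipschitz[where g = "\<lambda>x. min x m"]) (auto simp: min_def)
  ultimately show ?thesis by (simp add: height_fun_def)
qed

lemma plateau_add_peak: "m \<ge> 0 \<Longrightarrow> height_add (plateau m) (pyramid 1 1 0) = pyramid (m + 1) 1 0"
  by (rule ext) (auto simp: plateau_def pyramid_def ring_index_def)

lemma separate_plateau: assumes "m \<ge> 0" shows "separate (plateau m) (pyramid 1 1 0)"
  unfolding separate_def
proof (intro allI)
  fix x y
  show "(plateau m (x, y) = plateau m (x - 1, y) \<and> plateau m (x - 1, y) = plateau m (x - 1, y - 1) \<and>
      plateau m (x - 1, y - 1) = plateau m (x, y - 1)) \<or>
    (pyramid 1 1 0 (x, y) = pyramid 1 1 0 (x - 1, y) \<and> pyramid 1 1 0 (x - 1, y) = pyramid 1 1 0 (x - 1, y - 1) \<and>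
      pyramid 1 1 0 (x - 1, y - 1) = pyramid 1 1 0 (x, y - 1))"
  proof (cases "0 \<le> x \<and> x \<le> 2 \<and> - 1 \<le> y \<and> y \<le> 1")
    case True
    then have "plateau m (x, y) = m" "plateau m (x - 1, y) = m" "plateau m (x - 1, y - 1) = m" "plateau m (x, y - 1) = m"
      using assms by (simp_all add: plateau_top)
    then show ?thesis by simp
  next
    case False
    then have "pyramid 1 1 0 (x, y) = 0" "pyramid 1 1 0 (x - 1, y) = 0" "pyramid 1 1 0 (x - 1, y - 1) = 0" "pyramid 1 1 0 (x, y - 1) = 0"
      by (auto simp: pyramid_one)
    then show ?thesis by simp
  qed
qed

lemma separate_uminus: "separate w u \<Longrightarrow> separate (\<lambda>f. - w f) u" "separate w u \<Longrightarrow> separate w (\<lambda>f. - u f)"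
  by (simp_all add: separate_def)

lemma level_set_plateau:
  assumes "m > 0" "j \<noteq> 0"
  shows "level_set j (plateau m) = (if j = m then {0..2} \<times> {-1..1} else {})"
proof -
  have "(x, y) \<in> level_set j (plateau m) \<longleftrightarrow> (x, y) \<in> (if j = m then {0..2} \<times> {-1..1} else {})" for x y
  proof (cases "j = m")
    case True
    show ?thesis unfolding True level_set_def using assms(1) by (auto simp: plateau_top)
  next
    case False
    have "(x, y) \<notin> level_set j (plateau m)"
    proof
      assume a: "(x, y) \<in> level_set j (plateau m)"
      then have "plateau m (x, y) = j" by (simp add: level_set_def)
      then have "j \<noteq> m + 1" using plateau_range[of m "(x, y)"] assms(1) by simp
      moreover have "(x, y) \<in> level_set j (pyramid (m + 1) 1 0)"
        using a False assms(1) by (auto simp: level_set_def plateau_def min_def split: if_splits)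
      ultimately show False using level_set_pyramid[OF assms(2), of "m + 1" 1 0] by simp
    qed
    then show ?thesis using False by simp
  qed
  then show ?thesis unfolding set_eq_iff split_paired_All by blast
qed

lemma height_class_plateau:
  assumes "m \<ge> 0" shows "height_class (plateau m) = gen m"
proof (cases "m = 0")
  case True
  have "plateau 0 = (\<lambda>_. 0)" using plateau_range[of 0] by (auto simp: fun_eq_iff order_antisym)
  then show ?thesis using True by (simp add: height_class_zero gen_zero)
next
  case False
  have "{0..2 :: int} = {0, 1, 2}" "{-1..1 :: int} = {-1, 0, 1}" by auto
  then have block: "{0..2 :: int} \<times> {-1..1 :: int} = {(0, -1), (0, 0), (0, 1), (1, -1), (1, 0), (1, 1), (2, -1), (2, 0), (2, 1)}"
    by auto
  \<comment> \<open>On top of the plateau the centre and the corners of a three by three block of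
    vertices are black, the other four are white. So the counts are those of the pyramid of height
    \<open>m\<close>, and with them the class.\<close>
  have "(\<Sum>v\<in>{0..2} \<times> {-1..1}. square_sign v) = 1" unfolding block by (simp add: square_sign_def)
  then have "class_count j (height_class (plateau m)) = class_count j (gen m)" if "j \<noteq> 0" for j
    using assms False that
    by (simp add: class_count_class height_fun_plateau class_count_gen level_count_def level_set_plateau)
  then show ?thesis by (rule height_class_eq_if_counts)
qed

lemma gen_step_up: assumes "m \<ge> 0" shows "gen (m + 1) \<sim> gen m + gen 1"
  using stacked_cong_separate[OF height_fun_plateau[OF assms] height_fun_pyramid separate_plateau[OF assms]]
  unfolding plateau_add_peak[OF assms] height_class_plateau[OF assms] gen_def[symmetric] .

lemma gen_step_down: assumes "m \<ge> 0" shows "gen (- m - 1) \<sim> gen (- m) + gen (- 1)"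
proof -
  have h: "height_fun (\<lambda>f. - plateau m f)" "height_fun (\<lambda>f. - pyramid 1 1 0 f)"
    using height_fun_plateau[OF assms] height_fun_pyramid[of 1 1 0] by (simp_all add: height_fun_uminus)
  have "separate (\<lambda>f. - plateau m f) (\<lambda>f. - pyramid 1 1 0 f)"
    by (rule separate_uminus(2)[OF separate_uminus(1)[OF separate_plateau[OF assms]]])
  from stacked_cong_separate[OF h this]
  have "height_class (height_add (\<lambda>f. - plateau m f) (\<lambda>f. - pyramid 1 1 0 f)) \<sim>
    height_class (\<lambda>f. - plateau m f) + height_class (\<lambda>f. - pyramid 1 1 0 f)" .
  moreover have "height_add (\<lambda>f. - plateau m f) (\<lambda>f. - pyramid 1 1 0 f) = (\<lambda>f. - pyramid (m + 1) 1 0 f)"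
    unfolding plateau_add_peak[OF assms, symmetric] by (simp add: fun_eq_iff)
  moreover have "height_class (\<lambda>f. - pyramid k 1 0 f) = gen (- k)" for k
    by (simp add: pyramid_uminus gen_def)
  moreover have "height_class (\<lambda>f. - plateau m f) = gen (- m)"
    using class_neg_class[OF height_fun_plateau[OF assms]] by (simp add: height_class_plateau[OF assms] class_neg_gen)
  ultimately show ?thesis by simp
qed

text \<open>A square annulus of width one around a fixed block has no jewels of nonzero level.\<close>

lemma gen_opposite: "gen (- 1) + gen 1 \<sim> 0"
proof -
  let ?w = "\<lambda>f. - plateau 1 f" and ?u = "pyramid 1 1 0"
  have h: "height_fun ?w" "height_fun ?u"
    using height_fun_plateau[of 1] height_fun_pyramid[of 1 1 0] by (simp_all add: height_fun_uminus)
  have d: "separate ?w ?u" by (rule separate_uminus(1)[OF separate_plateau]) simp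
  have wu: "height_fun (height_add ?w ?u)" by (rule height_fun_height_of[OF height_of_separate[OF h d]])
  have val: "height_add ?w ?u (x, y) = (if x \<in> {0, 1} \<and> y \<in> {-1, 0} then 0 else if - 1 \<le> x \<and> x \<le> 2 \<and> - 2 \<le> y \<and> y \<le> 1 then - 1 else 0)" for x y
  proof -
    have "plateau 1 (x, y) = (if - 1 \<le> x \<and> x \<le> 2 \<and> - 2 \<le> y \<and> y \<le> 1 then 1 else 0)"
      using plateau_top[of 1 x y] plateau_range[of 1 "(x, y)"] by auto
    then show ?thesis by (auto simp: pyramid_one)
  qed
  have "level_set j (height_add ?w ?u) = {}" if j: "j \<noteq> 0" for j
  proof (rule ccontr)
    assume "level_set j (height_add ?w ?u) \<noteq> {}"
    then obtain x y where "(x, y) \<in> level_set j (height_add ?w ?u)" by auto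
    then show False using j unfolding level_set_def by (auto simp: val simp del: height_add_apply split: if_splits)
  qed
  then have "class_count j (height_class (height_add ?w ?u)) = class_count j 0" if "j \<noteq> 0" for j
    using that wu by (simp add: class_count_class level_count_def class_count_zero)
  then have "height_class (height_add ?w ?u) = 0" by (rule height_class_eq_if_counts)
  moreover have "height_class ?w = gen (- 1)"
    using class_neg_class[OF height_fun_plateau[of 1]] by (simp add: height_class_plateau class_neg_gen)
  ultimately have "0 \<sim> gen (- 1) + gen 1"
    using stacked_cong_separate[OF h d] by (simp add: gen_def)
  then show ?thesis by (rule stacked_cong_sym)
qed

text \<open>For negative \<open>k\<close> the pit splits off a copy of \<open>gen (- 1)\<close> by
  \<open>gen_step_down\<close>, and \<open>gen 1\<close> cancels it by
  \<open>gen_opposite\<close>.\<close>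

lemma gen_Suc: "gen (k + 1) \<sim> gen k + gen 1"
proof (cases "k \<ge> 0")
  case True
  then show ?thesis by (rule gen_step_up)
next
  case False
  define m where "m = - k - 1"
  have m: "m \<ge> 0" "k = - m - 1" using False by (simp_all add: m_def)
  have "gen k + gen 1 \<sim> (gen (- m) + gen (- 1)) + gen 1"
    using stacked_cong_add[OF gen_step_down[OF m(1)] stacked_cong_refl] m(2) by simp
  moreover have "(gen (- m) + gen (- 1)) + gen 1 \<sim> gen (- m)"
    using stacked_cong_add[OF stacked_cong_refl gen_opposite, of "gen (- m)"] by (simp add: add.assoc)
  ultimately have "gen k + gen 1 \<sim> gen (- m)" by (rule stacked_cong_trans)
  then show ?thesis using m(2) by (simp add: stacked_cong_sym)
qed

lemma gen_add: "gen (a + b) \<sim> gen a + gen b"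
proof (induction b rule: int_induct[of _ 0])
  case base
  then show ?case by (simp add: gen_zero stacked_cong_refl)
next
  case (step1 b)
  have "gen (a + (b + 1)) \<sim> gen (a + b) + gen 1" using gen_Suc[of "a + b"] by (simp add: add.assoc)
  moreover have "gen (a + b) + gen 1 \<sim> (gen a + gen b) + gen 1" by (rule stacked_cong_add[OF step1.IH stacked_cong_refl])
  moreover have "(gen a + gen b) + gen 1 \<sim> gen a + gen (b + 1)"
    using stacked_cong_add[OF stacked_cong_refl stacked_cong_sym[OF gen_Suc[of b]], of "gen a"] by (simp add: add.assoc)
  ultimately show ?case using stacked_cong_trans by blast
next
  case (step2 b)
  have "gen (a + (b - 1)) + gen 1 \<sim> gen (a + b)" using stacked_cong_sym[OF gen_Suc[of "a + b - 1"]] by (simp add: algebra_simps)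
  moreover have "gen a + gen b \<sim> (gen a + gen (b - 1)) + gen 1"
    using stacked_cong_add[OF stacked_cong_refl gen_Suc[of "b - 1"], of "gen a"] by (simp add: add.assoc)
  ultimately have "gen (a + (b - 1)) + gen 1 \<sim> (gen a + gen (b - 1)) + gen 1"
    using step2.IH stacked_cong_trans by blast
  then show ?case by (rule stacked_cong_cancel)
qed

lemma gen_sum: "(\<Sum>k\<in>#A. gen k) \<sim> gen (\<Sum>\<^sub># A)"
proof (induction A)
  case empty
  then show ?case by (simp add: gen_zero stacked_cong_refl)
next
  case (add k A)
  have "gen k + (\<Sum>k\<in>#A. gen k) \<sim> gen k + gen (\<Sum>\<^sub># A)" by (rule stacked_cong_add[OF stacked_cong_refl add.IH])
  then show ?case using stacked_cong_trans[OF _ stacked_cong_sym[OF gen_add]] by simp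
qed

lemma sum_mset_count: "finite K \<Longrightarrow> set_mset A \<subseteq> K \<Longrightarrow> \<Sum>\<^sub># A = (\<Sum>k\<in>K. k * int (count A k))"
proof (induction A)
  case (add a A)
  have "(\<Sum>k\<in>K. k * int (count (add_mset a A) k)) = (\<Sum>k\<in>K. k * int (count A k) + (if k = a then a else 0))"
    by (rule sum.cong) (auto simp: algebra_simps)
  also have "\<dots> = (\<Sum>k\<in>K. k * int (count A k)) + a" using add.prems by (simp add: sum.distrib sum.delta')
  finally show ?case using add by simp
qed simp

text \<open>Up to \<open>\<sim>\<close> the generators add like their indices, so only the
  difference of the two index sums of \<open>g - h\<close> is left. It equals the sum of
  \<open>k\<close> times the count of \<open>g - h\<close> at level \<open>k\<close>, which
  vanishes. The set \<open>K\<close> has to contain the nonzero levels at which the counts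
  differ.\<close>

theorem stacked_if_twist:
  assumes K: "finite K" "\<And>m. m \<noteq> 0 \<Longrightarrow> m \<notin> K \<Longrightarrow> class_count m g = class_count m h"
    and eq: "(\<Sum>k\<in>K. k * class_count k g) = (\<Sum>k\<in>K. k * class_count k h)"
  shows "stacked g h"
proof -
  obtain w where "height_fun w" "g - h = height_class w" by (rule height_class_cases)
  then have "represented (g - h)" using represented_height_class by simp
  then obtain A B where AB: "g - h = (\<Sum>k\<in>#A. gen k) - (\<Sum>k\<in>#B. gen k)" unfolding represented_def by blast
  let ?K = "K \<union> set_mset A \<union> set_mset B"
  have fin: "finite ?K" using K(1) by simp
  have count: "class_count m (g - h) = int (count A m) - int (count B m)" if "m \<noteq> 0" for m
    unfolding AB class_count_diff class_count_sum[OF that] ..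
  have "\<Sum>\<^sub># A - \<Sum>\<^sub># B = (\<Sum>k\<in>?K. k * int (count A k)) - (\<Sum>k\<in>?K. k * int (count B k))"
    using sum_mset_count[OF fin, of A] sum_mset_count[OF fin, of B] by auto
  also have "\<dots> = (\<Sum>k\<in>?K. k * (int (count A k) - int (count B k)))" by (simp add: sum_subtractf right_diff_distrib)
  also have "\<dots> = (\<Sum>k\<in>?K. k * class_count k (g - h))"
  proof (rule sum.cong[OF refl])
    fix k show "k * (int (count A k) - int (count B k)) = k * class_count k (g - h)" using count[of k] by (cases "k = 0") simp_all
  qed
  also have "\<dots> = (\<Sum>k\<in>K. k * class_count k (g - h))"
  proof (rule sum.mono_neutral_right[OF fin])
    show "\<forall>k\<in>?K - K. k * class_count k (g - h) = 0"
    proof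
      fix k assume "k \<in> ?K - K"
      then show "k * class_count k (g - h) = 0" using K(2)[of k] by (cases "k = 0") (simp_all add: class_count_diff)
    qed
  qed auto
  also have "\<dots> = 0" using eq by (simp add: class_count_diff right_diff_distrib sum_subtractf)
  finally have AB0: "\<Sum>\<^sub># A = \<Sum>\<^sub># B" by simp
  have "(\<Sum>k\<in>#A. gen k) \<sim> (\<Sum>k\<in>#B. gen k)"
    using stacked_cong_trans[OF gen_sum[of A] stacked_cong_sym[OF gen_sum[of B, folded AB0]]] .
  \<comment> \<open>By \<open>AB\<close> the added term turns the two sides into \<open>g\<close>
    and \<open>h\<close>.\<close>
  then have "(\<Sum>k\<in>#A. gen k) + (- (\<Sum>k\<in>#B. gen k) + h) \<sim> (\<Sum>k\<in>#B. gen k) + (- (\<Sum>k\<in>#B. gen k) + h)"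
    by (rule stacked_cong_add[OF _ stacked_cong_refl])
  moreover have "(\<Sum>k\<in>#A. gen k) + (- (\<Sum>k\<in>#B. gen k) + h) = g"
    using arg_cong[OF AB, of "\<lambda>x. x + h"] by (simp add: add.assoc[symmetric])
  ultimately have "g \<sim> h" by (simp add: add.assoc[symmetric])
  then have "stacked (g + 0) (h + 0)" unfolding stacked_cong_def by blast
  then show ?thesis by simp
qed

lemma laurent_eval_deriv:
  assumes "finite K" "Poly_Mapping.keys p \<subseteq> K"
  shows "laurent_eval (laurent_deriv p) 1 = of_int (\<Sum>k\<in>K. k * Poly_Mapping.lookup p k)"
proof -
  let ?L = "(\<lambda>k. k - 1) ` K"
  have look: "Poly_Mapping.lookup (laurent_deriv p) j = (j + 1) * Poly_Mapping.lookup p (j + 1)" for j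
  proof -
    have "{k. k \<in> Poly_Mapping.keys p \<and> k - 1 = j} = (if j + 1 \<in> Poly_Mapping.keys p then {j + 1} else {})" by auto
    then show ?thesis
      unfolding laurent_deriv_def lookup_sum_single[OF finite_keys] by (auto simp: in_keys_iff)
  qed
  have sub: "Poly_Mapping.keys (laurent_deriv p) \<subseteq> ?L"
  proof
    fix j assume "j \<in> Poly_Mapping.keys (laurent_deriv p)"
    then have "j + 1 \<in> Poly_Mapping.keys p" by (auto simp: in_keys_iff look)
    then show "j \<in> ?L" using assms(2) by (intro image_eqI[of _ _ "j + 1"]) auto
  qed
  have "laurent_eval (laurent_deriv p) 1 = of_int (\<Sum>j\<in>Poly_Mapping.keys (laurent_deriv p). Poly_Mapping.lookup (laurent_deriv p) j)"
    by (simp add: laurent_eval_def)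
  also have "(\<Sum>j\<in>Poly_Mapping.keys (laurent_deriv p). Poly_Mapping.lookup (laurent_deriv p) j) = (\<Sum>j\<in>?L. Poly_Mapping.lookup (laurent_deriv p) j)"
    by (rule sum.mono_neutral_left[OF _ sub]) (use assms(1) in \<open>auto simp: in_keys_iff\<close>)
  also have "\<dots> = (\<Sum>k\<in>K. k * Poly_Mapping.lookup p k)"
    by (subst sum.reindex) (auto simp: inj_on_def look)
  finally show ?thesis .
qed

theorem duplex_twist:
  assumes R: "duplex R" and g: "ghost_curves R G" and t: "tiling R t0" "tiling R t1"
    and eq: "laurent_eval (laurent_deriv (P G t0)) 1 = laurent_eval (laurent_deriv (P G t1)) 1"
  shows "\<exists>a b L M. R \<subseteq> box_cubes a b L M 2 \<and> embed4 R a b L M t1 \<in> flip_component (embed4 R a b L M t0)"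
proof -
  let ?D = "shadow R 0"
  have G: "G = {}" by (rule duplex_ghost_curves[OF R g])
  note D = duplex_squares[OF R]
  obtain \<sigma> where s: "short_perm \<sigma>" "{v. \<sigma> v \<noteq> v} \<subseteq> ?D" "t0 = match_tiling 0 ?D \<sigma>" by (rule duplex_tiling[OF R t(1)])
  obtain \<tau> where t: "short_perm \<tau>" "{v. \<tau> v \<noteq> v} \<subseteq> ?D" "t1 = match_tiling 0 ?D \<tau>" by (rule duplex_tiling[OF R t(2)])
  obtain w where w: "height_of \<sigma> w" by (rule height_of_exists[OF s(1)])
  obtain u where u: "height_of \<tau> u" by (rule height_of_exists[OF t(1)])
  let ?g = "height_class w" and ?h = "height_class u"
  have look: "Poly_Mapping.lookup (P G t0) m = class_count m ?g" "Poly_Mapping.lookup (P G t1) m = class_count m ?h" if "m \<noteq> 0" for m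
    using lookup_P_duplex[OF R w s(2) that] lookup_P_duplex[OF R u t(2) that] height_fun_height_of[OF w] height_fun_height_of[OF u]
    by (simp_all add: G s(3) t(3) class_count_class)
  let ?K = "Poly_Mapping.keys (P G t0) \<union> Poly_Mapping.keys (P G t1)"
  have K: "finite ?K" by simp
  have "(\<Sum>k\<in>?K. k * Poly_Mapping.lookup (P G t0) k) = (\<Sum>k\<in>?K. k * Poly_Mapping.lookup (P G t1) k)"
    using eq laurent_eval_deriv[OF K, of "P G t0"] laurent_eval_deriv[OF K, of "P G t1"] by (simp only: Un_upper1 Un_upper2 of_int_eq_iff simp_thms)
  \<comment> \<open>The factor \<open>k\<close> removes the constant coefficient, about which the
    counts say nothing.\<close>
  moreover have "k * Poly_Mapping.lookup (P G t0) k = k * class_count k ?g" "k * Poly_Mapping.lookup (P G t1) k = k * class_count k ?h" for k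
    using look[of k] by (cases "k = 0"; simp)+
  ultimately have sums: "(\<Sum>k\<in>?K. k * class_count k ?g) = (\<Sum>k\<in>?K. k * class_count k ?h)" by simp
  have "stacked ?g ?h"
  proof (rule stacked_if_twist[OF K _ sums])
    fix m :: int assume "m \<noteq> 0" "m \<notin> ?K"
    then show "class_count m ?g = class_count m ?h" using look[of m] by (simp add: in_keys_iff)
  qed
  then have "four_floor_equivalent \<sigma> \<tau>" by (rule stackedD[OF _ w refl u refl])
  then obtain F where F: "finite F" "\<And>A. F \<subseteq> A \<Longrightarrow> flip\<^sup>*\<^sup>* (stack A \<sigma> id) (stack A \<tau> id)"
    unfolding four_floor_equivalent_def by blast
  have "finite (F \<union> ?D)" using F(1) D(2) by simp
  then obtain a b L M where Q: "F \<union> ?D \<subseteq> rectangle a b L M" by (rule rectangle_covers)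
  then have sub: "?D \<subseteq> rectangle a b L M" "F \<subseteq> rectangle a b L M" by auto
  have "R \<subseteq> box_cubes a b L M 2"
    using box_contains_iff[OF D(1), of a b L M] sub(1) R by (simp add: duplex_def)
  moreover have "embed4 R a b L M (match_tiling 0 ?D \<rho>) = stack (rectangle a b L M) \<rho> id" if "{v. \<rho> v \<noteq> v} \<subseteq> ?D" for \<rho>
  proof -
    have "match_dimer 1 id (x, y) = {(x, y, 2), (x, y, 3)}" for x y
      using match_dimer_column[of id "(x, y)" 1] by (simp add: cube_at_def)
    then have "{{(x, y, 2), (x, y, 3)} | x y. (x, y) \<in> rectangle a b L M} = match_tiling 1 (rectangle a b L M) id"
      unfolding match_tiling_def image_def by (auto; metis)
    then show ?thesis unfolding embed4_def stack_def embed2_match_tiling[OF that sub(1)] by simp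
  qed
  then have "flip\<^sup>*\<^sup>* (embed4 R a b L M t0) (embed4 R a b L M t1)"
    using F(2)[OF sub(2)] s(2) t(2) unfolding s(3) t(3) by simp
  ultimately show ?thesis unfolding flip_component_def by blast
qed

theorem theorem10p1:
  fixes R :: "cube set"
  assumes "two_story R"
  shows
    "(connected (\<Union>s \<in> common R. plane_square s) \<longrightarrow>
       (\<forall>G1 G2. ghost_curves R G1 \<and> ghost_curves R G2 \<longrightarrow>
          (\<exists>k. \<forall>t. tiling R t \<longrightarrow> P G1 t = q_pow k * P G2 t)))
     \<and>
     (\<forall>G t0 t1. ghost_curves R G \<and> tiling R t0 \<and> tiling R t1 \<and> t1 \<in> flip_component t0 \<longrightarrow>
          P G t0 = P G t1)
     \<and>
     (duplex R \<longrightarrow> (\<forall>G t0 t1. ghost_curves R G \<and> tiling R t0 \<and> tiling R t1 \<longrightarrow>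
          (P G t0 = P G t1 \<longleftrightarrow>
             (\<exists>a b L M. R \<subseteq> box_cubes a b L M 2 \<and>
                embed2 R a b L M t1 \<in> flip_component (embed2 R a b L M t0)))))
     \<and>
     (duplex R \<longrightarrow> (\<forall>G t0 t1. ghost_curves R G \<and> tiling R t0 \<and> tiling R t1 \<and>
          laurent_eval (laurent_deriv (P G t0)) 1 = laurent_eval (laurent_deriv (P G t1)) 1 \<longrightarrow>
             (\<exists>a b L M. R \<subseteq> box_cubes a b L M 2 \<and>
                embed4 R a b L M t1 \<in> flip_component (embed4 R a b L M t0))))"
proof -
  have R: "two_floors R" by (rule two_story_two_floors[OF assms])
  show ?thesis
  proof (intro conjI impI allI; (elim conjE)?)
    fix G1 G2
    assume "connected (\<Union>s\<in>common R. plane_square s)" "ghost_curves R G1" "ghost_curves R G2"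
    then show "\<exists>k. \<forall>t. tiling R t \<longrightarrow> P G1 t = q_pow k * P G2 t" by (rule P_ghosts[OF R])
  next
    fix G t0 t1
    assume "ghost_curves R G" "tiling R t0" "tiling R t1" "t1 \<in> flip_component t0"
    then show "P G t0 = P G t1" using P_flips[OF R, of t0 t1 G] by (simp add: flip_component_def)
  next
    fix G t0 t1
    assume "duplex R" "ghost_curves R G" "tiling R t0" "tiling R t1"
    then show "P G t0 = P G t1 \<longleftrightarrow>
        (\<exists>a b L M. R \<subseteq> box_cubes a b L M 2 \<and> embed2 R a b L M t1 \<in> flip_component (embed2 R a b L M t0))"
      by (rule duplex_flip_equivalent)
  next
    fix G t0 t1
    assume "duplex R" "ghost_curves R G" "tiling R t0" "tiling R t1"
      "laurent_eval (laurent_deriv (P G t0)) 1 = laurent_eval (laurent_deriv (P G t1)) 1"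
    then show "\<exists>a b L M. R \<subseteq> box_cubes a b L M 2 \<and> embed4 R a b L M t1 \<in> flip_component (embed4 R a b L M t0)"
      by (rule duplex_twist)
  qed
qed

end
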